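(* Let $d\ge 1$. For every $\psi_0\in L^2(\mathbb{R}^d)$ and every $T>0$: the attainable set $$\mathcal{A}=\bigcup_{p>1}\left\{\psi_V(t)\;:\; t\in\mathbb{R},\ V\in M^p_{\mathrm{loc}}(\mathbb{R})\right\}$$ is a countable union of compact subsets of $L^2(\mathbb{R}^d)$, and the set of $V$-representable densities $$\mathcal{R}_T=\bigcup_{p>1}\left\{\, t\mapsto|\psi_V(t)|^2 \;:\; V\in M^p([0,T])\right\}$$ is a countable union of compact subsets of $C^0\left([0,T],L^1(\mathbb{R}^d)\right)$. Here $\psi_V$ denotes the solution with initial condition $\psi_0$ and potential $V$ of the Schrödinger equation in integral form (see context), on $\mathbb{R}$ in the first case and on $[0,T]$ in the second.
   Context: For a compact interval $I\subset\mathbb{R}$, $1<p\le\infty$ and $p'=(1-1/p)^{-1}$, let $M^p(I):=\left(L^{p'}(I,L^1(\mathbb{R}^d,\mathbb{R}))\right)'$ (Banach space dual with dual norm). The pairing is extended complex-linearly to complex-valued elements of $L^{p'}(I,L^1(\mathbb{R}^d))$. An element $V\in M^p(I)$ is identified with the $L^\infty(\mathbb{R}^d,\mathbb{R})$-valued Borel measure on $I$, absolutely continuous with respect to Lebesgue measure, given by $\int_{\mathbb{R}^d} V(E)h\,\mathrm{d}x=\langle V,\chi_E h\rangle$ for $E\subset I$ Borel and $h\in L^1(\mathbb{R}^d,\mathbb{R})$. $M^p_{\mathrm{loc}}(\mathbb{R})$ is the set of $L^\infty(\mathbb{R}^d,\mathbb{R})$-valued Borel measures on $\mathbb{R}$ (defined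 on bounded Borel sets) whose restriction to every compact interval $I$ belongs to $M^p(I)$. Integrals: for $V\in M^p(I)$ and $f\in L^\infty(I,L^2(\mathbb{R}^d))$, $\int_I f(t)V(\mathrm{d}t)\in L^2(\mathbb{R}^d)$ is defined by $\int_{\mathbb{R}^d}\left(\int_I f(t)V(\mathrm{d}t)\right)g\,\mathrm{d}x=\langle V,f(t)g\rangle$ for all $g\in L^2(\mathbb{R}^d)$. The $L^2$-valued measure $f(t)V(\mathrm{d}t)$ has a density $\phi\in L^p(I,L^2(\mathbb{R}^d))$, i.e. $f(t)V(\mathrm{d}t)=\phi(t)\,\mathrm{d}t$, and one sets $\int_I \mathrm{e}^{\mathrm{i}\Delta(s-t)}f(t)V(\mathrm{d}t):=\int_I \mathrm{e}^{\mathrm{i}\Delta(s-t)}\phi(t)\,\mathrm{d}t$, where $\mathrm{e}^{\mathrm{i}\Delta t}$ is the free Schrödinger group on $L^2(\mathbb{R}^d)$. The same applies on subintervals, and $\int_0^t=-\int_t^0$ for $t<0$. Schrödinger equation in integral form: for fixed $\psi_0\in L^2(\mathbb{R}^d)$, $\psi_V$ is the unique continuous $L^2(\mathbb{R}^d)$-valued solution of $$\psi_V(t)=\mathrm{e}^{\mathrm{i}\Delta t}\psi_0-\mathrm{i}\int_0^t \mathrm{e}^{\mathrm{i}\Delta(t-s)}\psi_V(s)V(\mathrm{d}s),$$ for $t\in\mathbb{R}$ if $V\in M^p_{\mathrm{loc}}(\mathbb{R})$, and for $t\in[0,T]$ if $V\in M^p([0,T])$. *)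

theory Defs
  imports "HOL-Analysis.Analysis"
begin

section \<open>Lebesgue spaces on Euclidean space\<close>

text \<open>
  \<open>('a, 'b, 'p) lp\<close> is the space of \<open>'b\<close>-valued functions on \<open>'a\<close> whose norm to the power
  \<open>CARD('p)\<close> is Lebesgue integrable, modulo equality almost everywhere; only the numeral types
  \<open>1\<close> and \<open>2\<close> are used for \<open>'p\<close> below, giving \<open>L\<^sup>1\<close> and \<open>L\<^sup>2\<close>.
\<close>

definition lp_fun :: "nat \<Rightarrow> ('a::euclidean_space \<Rightarrow> 'b::{banach,second_countable_topology}) \<Rightarrow> bool" where
  "lp_fun n f \<longleftrightarrow> f \<in> borel_measurable lborel \<and> integrable lborel (\<lambda>x. norm (f x) ^ n)"

definition lp_eq :: "nat \<Rightarrow> ('a::euclidean_space \<Rightarrow> 'b::{banach,second_countable_topology}) \<Rightarrow> ('a \<Rightarrow> 'b) \<Rightarrow> bool" where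
  "lp_eq n f g \<longleftrightarrow> lp_fun n f \<and> lp_fun n g \<and> (AE x in lborel. f x = g x)"

lemma lp_fun_zero: "n > 0 \<Longrightarrow> lp_fun n (\<lambda>x. 0)"
  by (simp add: lp_fun_def zero_power)

lemma lp_fun_measurable: "lp_fun n f \<Longrightarrow> f \<in> borel_measurable lborel"
  by (simp add: lp_fun_def)

lemma lp_fun_integrable: "lp_fun n f \<Longrightarrow> integrable lborel (\<lambda>x. norm (f x) ^ n)"
  by (simp add: lp_fun_def)

lemma lp_fun_bound:
  assumes "f \<in> borel_measurable lborel" "integrable lborel (\<lambda>x. w x ^ n)"
    and "AE x in lborel. norm (f x) \<le> w x"
  shows "lp_fun n f"
  unfolding lp_fun_def
proof
  show "integrable lborel (\<lambda>x. norm (f x) ^ n)"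
  proof (rule Bochner_Integration.integrable_bound[OF assms(2)])
    show "(\<lambda>x. norm (f x) ^ n) \<in> borel_measurable lborel" using assms(1) by measurable
    show "AE x in lborel. norm (norm (f x) ^ n) \<le> norm (w x ^ n)"
      using assms(3)
    proof eventually_elim
      case (elim x)
      then have "norm (f x) ^ n \<le> w x ^ n" by (intro power_mono) auto
      then show ?case by auto
    qed
  qed
qed fact

lemma power_add_bound:
  fixes a b :: real assumes "a \<ge> 0" "b \<ge> 0"
  shows "(a + b) ^ n \<le> 2 ^ n * (a ^ n + b ^ n)"
proof -
  have "(a + b) ^ n \<le> (2 * max a b) ^ n" using assms by (intro power_mono) auto
  also have "\<dots> = 2 ^ n * max a b ^ n" by (simp add: power_mult_distrib)
  also have "max a b ^ n \<le> a ^ n + b ^ n" using assms by (auto simp: max_def)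
  finally show ?thesis by simp
qed

lemma lp_fun_add:
  assumes f: "lp_fun n f" and g: "lp_fun n g"
  shows "lp_fun n (\<lambda>x. f x + g x)"
  unfolding lp_fun_def
proof
  note [measurable] = lp_fun_measurable[OF f] lp_fun_measurable[OF g]
  show "(\<lambda>x. f x + g x) \<in> borel_measurable lborel" by measurable
  have "integrable lborel (\<lambda>x. 2 ^ n * (norm (f x) ^ n + norm (g x) ^ n))"
    using f g by (simp add: lp_fun_def)
  then show "integrable lborel (\<lambda>x. norm (f x + g x) ^ n)"
  proof (rule Bochner_Integration.integrable_bound)
    show "AE x in lborel. norm (norm (f x + g x) ^ n) \<le> norm (2 ^ n * (norm (f x) ^ n + norm (g x) ^ n))"
    proof (rule AE_I2)
      fix x
      have "norm (f x + g x) ^ n \<le> (norm (f x) + norm (g x)) ^ n"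
        by (intro power_mono norm_triangle_ineq) auto
      also have "\<dots> \<le> 2 ^ n * (norm (f x) ^ n + norm (g x) ^ n)"
        by (rule power_add_bound) auto
      finally show "norm (norm (f x + g x) ^ n) \<le> norm (2 ^ n * (norm (f x) ^ n + norm (g x) ^ n))"
        by simp
    qed
  qed measurable
qed

lemma lp_fun_scaleR: "lp_fun n f \<Longrightarrow> lp_fun n (\<lambda>x. c *\<^sub>R f x)"
  by (auto simp: lp_fun_def power_mult_distrib)

lemma lp_fun_uminus: "lp_fun n f \<Longrightarrow> lp_fun n (\<lambda>x. - f x)"
  using lp_fun_scaleR[of n f "-1"] by simp

lemma lp_fun_diff: "lp_fun n f \<Longrightarrow> lp_fun n g \<Longrightarrow> lp_fun n (\<lambda>x. f x - g x)"
  using lp_fun_add[of n f "\<lambda>x. - g x"] lp_fun_uminus[of n g] by simp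

lemma lp_eqI: "lp_fun n f \<Longrightarrow> lp_fun n g \<Longrightarrow> AE x in lborel. f x = g x \<Longrightarrow> lp_eq n f g"
  by (simp add: lp_eq_def)

lemma equiv_lp_eq: "equiv (Collect (lp_fun n)) {(f, g). lp_eq n f g}"
  by (rule equivI) (auto simp: lp_eq_def refl_on_def sym_def trans_def)

typedef (overloaded) ('a, 'b, 'p) lp =
  "Collect (lp_fun CARD('p::finite)) //
    {(f, g :: 'a::euclidean_space \<Rightarrow> 'b::{banach,second_countable_topology}). lp_eq CARD('p) f g}"
  using lp_fun_zero[of "CARD('p)"] by (auto simp: quotient_def)

definition abs_lp :: "('a::euclidean_space \<Rightarrow> 'b::{banach,second_countable_topology}) \<Rightarrow> ('a, 'b, 'p::finite) lp" where
  "abs_lp f = Abs_lp {g. lp_eq CARD('p) f g}"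

definition rep_lp :: "('a::euclidean_space, 'b::{banach,second_countable_topology}, 'p::finite) lp \<Rightarrow> 'a \<Rightarrow> 'b" where
  "rep_lp u = (SOME f. f \<in> Rep_lp u)"

lemma lp_fun_rep: "lp_fun CARD('p::finite) (rep_lp (u :: ('a::euclidean_space, 'b::{banach,second_countable_topology}, 'p) lp))"
  and abs_rep_lp: "abs_lp (rep_lp u) = u"
proof -
  let ?R = "{(f, g :: 'a \<Rightarrow> 'b). lp_eq CARD('p) f g}"
  have q: "Rep_lp u \<in> Collect (lp_fun CARD('p)) // ?R" by (rule Rep_lp)
  then have "Rep_lp u \<noteq> {}" by (rule in_quotient_imp_non_empty[OF equiv_lp_eq])
  then have m: "rep_lp u \<in> Rep_lp u" unfolding rep_lp_def by (simp add: some_in_eq)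
  then show f: "lp_fun CARD('p) (rep_lp u)"
    using in_quotient_imp_subset[OF equiv_lp_eq q] by auto
  obtain f where f: "Rep_lp u = ?R `` {f}" using q by (rule quotientE)
  with m have "(f, rep_lp u) \<in> ?R" by auto
  then have "Rep_lp u = ?R `` {rep_lp u}" unfolding f by (rule equiv_class_eq[OF equiv_lp_eq])
  then have "{g. lp_eq CARD('p) (rep_lp u) g} = Rep_lp u" by auto
  then show "abs_lp (rep_lp u) = u" by (simp add: abs_lp_def Rep_lp_inverse)
qed

lemma abs_lp_eq_iff:
  fixes f g :: "'a::euclidean_space \<Rightarrow> 'b::{banach,second_countable_topology}"
  assumes f: "lp_fun CARD('p::finite) f" and g: "lp_fun CARD('p) g"
  shows "(abs_lp f :: ('a, 'b, 'p) lp) = abs_lp g \<longleftrightarrow> (AE x in lborel. f x = g x)"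
proof -
  let ?C = "\<lambda>f. {g. lp_eq CARD('p) f g}"
  have "?C f \<in> Collect (lp_fun CARD('p)) // {(f, g). lp_eq CARD('p) f g}"
    if "lp_fun CARD('p) f" for f :: "'a \<Rightarrow> 'b"
    using that by (auto simp: quotient_def)
  then have "(abs_lp f :: ('a, 'b, 'p) lp) = abs_lp g \<longleftrightarrow> ?C f = ?C g"
    unfolding abs_lp_def using f g by (intro Abs_lp_inject) auto
  also have "\<dots> \<longleftrightarrow> lp_eq CARD('p) f g"
    using f g eq_equiv_class_iff[OF equiv_lp_eq, of f "CARD('p)" g] by (auto simp: Image_def)
  finally show ?thesis using f g by (simp add: lp_eq_def)
qed

lemma rep_abs_lp:
  fixes f :: "'a::euclidean_space \<Rightarrow> 'b::{banach,second_countable_topology}"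
  assumes "lp_fun CARD('p::finite) f"
  shows "AE x in lborel. rep_lp (abs_lp f :: ('a, 'b, 'p) lp) x = f x"
  using abs_lp_eq_iff[where 'p = 'p, OF lp_fun_rep[of "abs_lp f :: ('a, 'b, 'p) lp"] assms]
  by (simp add: abs_rep_lp)

lemma lp_cases:
  obtains f where "lp_fun CARD('p::finite) f" "(u :: ('a::euclidean_space, 'b::{banach,second_countable_topology}, 'p) lp) = abs_lp f"
  using lp_fun_rep[of u] abs_rep_lp[of u] by metis

subsection \<open>Vector space structure and norm\<close>

lemma minkowski_power:
  fixes f g :: "'a::euclidean_space \<Rightarrow> 'b::{banach,second_countable_topology}"
  assumes n: "n > 0" and f: "lp_fun n f" and g: "lp_fun n g"
  shows "root n (\<integral>x. norm (f x + g x) ^ n \<partial>lborel)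
    \<le> root n (\<integral>x. norm (f x) ^ n \<partial>lborel) + root n (\<integral>x. norm (g x) ^ n \<partial>lborel)"
    (is "?L \<le> ?a + ?b")
proof (rule field_le_epsilon)
  fix e :: real assume e: "e > 0"
  define a where "a = ?a + e / 2"
  define b where "b = ?b + e / 2"
  have a0: "?a \<ge> 0" and b0: "?b \<ge> 0" using n by (auto intro!: real_root_ge_zero integral_nonneg)
  have a: "a > 0" and b: "b > 0" using e a0 b0 by (auto simp: a_def b_def)
  have "?a ^ n = (\<integral>x. norm (f x) ^ n \<partial>lborel)" "?b ^ n = (\<integral>x. norm (g x) ^ n \<partial>lborel)"
    using n by (auto intro!: real_root_pow_pos2 integral_nonneg)
  moreover have "?a ^ n \<le> a ^ n" "?b ^ n \<le> b ^ n"
    using a0 b0 e by (auto simp: a_def b_def intro!: power_mono)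
  ultimately have F: "(\<integral>x. norm (f x) ^ n \<partial>lborel) \<le> a ^ n"
    and G: "(\<integral>x. norm (g x) ^ n \<partial>lborel) \<le> b ^ n" by auto
  define l where "l = a / (a + b)"
  have l: "0 \<le> l" "l \<le> 1" and l': "1 - l = b / (a + b)"
    using a b by (auto simp: l_def field_simps)
  have conv: "convex_on {0::real..} (\<lambda>x. x ^ n)"
    by (cases "even n") (auto intro: convex_power_odd convex_on_subset[OF convex_power_even])
  let ?R = "\<lambda>x. (a + b) ^ n * (l / a ^ n * norm (f x) ^ n + (1 - l) / b ^ n * norm (g x) ^ n)"
  have pt: "norm (f x + g x) ^ n \<le> ?R x" for x
  proof -
    have "norm (f x + g x) ^ n \<le> (norm (f x) + norm (g x)) ^ n"
      by (intro power_mono norm_triangle_ineq) auto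
    also have "norm (f x) + norm (g x) = ((a + b) * l) * (norm (f x) / a) + ((a + b) * (1 - l)) * (norm (g x) / b)"
      using a b unfolding l' by (simp add: l_def)
    also have "\<dots> = (a + b) * (l * (norm (f x) / a) + (1 - l) * (norm (g x) / b))"
      by (simp only: mult.assoc distrib_left)
    also have "\<dots> ^ n = (a + b) ^ n * (l * (norm (f x) / a) + (1 - l) * (norm (g x) / b)) ^ n"
      by (rule power_mult_distrib)
    also have "(l * (norm (f x) / a) + (1 - l) * (norm (g x) / b)) ^ n
        \<le> l * (norm (f x) / a) ^ n + (1 - l) * (norm (g x) / b) ^ n"
      using convex_onD[OF conv, of "1 - l" "norm (f x) / a" "norm (g x) / b"] l a b by simp
    finally show ?thesis using a b by (simp add: power_divide mult_left_mono)
  qed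
  have R: "integrable lborel ?R" using f g by (simp add: lp_fun_def)
  have "(\<integral>x. norm (f x + g x) ^ n \<partial>lborel) \<le> (\<integral>x. ?R x \<partial>lborel)"
    using lp_fun_integrable[OF lp_fun_add[OF f g]] R pt by (intro integral_mono) auto
  also have "\<dots> = (a + b) ^ n * (l / a ^ n * (\<integral>x. norm (f x) ^ n \<partial>lborel)
       + (1 - l) / b ^ n * (\<integral>x. norm (g x) ^ n \<partial>lborel))"
    using f g by (simp add: lp_fun_def)
  also have "\<dots> \<le> (a + b) ^ n * (l / a ^ n * a ^ n + (1 - l) / b ^ n * b ^ n)"
    using F G a b l by (intro mult_left_mono add_mono) auto
  also have "\<dots> = (a + b) ^ n" using a b by simp
  finally have "?L \<le> root n ((a + b) ^ n)" using n by simp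
  also have "\<dots> = a + b" using n a b by (simp add: real_root_power_cancel)
  finally show "?L \<le> ?a + ?b + e" by (simp add: a_def b_def)
qed

instantiation lp :: (euclidean_space, "{banach,second_countable_topology}", finite) real_normed_vector
begin

definition zero_lp :: "('a, 'b, 'c) lp" where
  "0 = abs_lp (\<lambda>x. 0)"

definition plus_lp :: "('a, 'b, 'c) lp \<Rightarrow> ('a, 'b, 'c) lp \<Rightarrow> ('a, 'b, 'c) lp" where
  "u + v = abs_lp (\<lambda>x. rep_lp u x + rep_lp v x)"

definition uminus_lp :: "('a, 'b, 'c) lp \<Rightarrow> ('a, 'b, 'c) lp" where
  "- u = abs_lp (\<lambda>x. - rep_lp u x)"

definition minus_lp :: "('a, 'b, 'c) lp \<Rightarrow> ('a, 'b, 'c) lp \<Rightarrow> ('a, 'b, 'c) lp" where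
  "u - v = abs_lp (\<lambda>x. rep_lp u x - rep_lp v x)"

definition scaleR_lp :: "real \<Rightarrow> ('a, 'b, 'c) lp \<Rightarrow> ('a, 'b, 'c) lp" where
  "c *\<^sub>R u = abs_lp (\<lambda>x. c *\<^sub>R rep_lp u x)"

definition norm_lp :: "('a, 'b, 'c) lp \<Rightarrow> real" where
  "norm u = root CARD('c) (\<integral>x. norm (rep_lp u x) ^ CARD('c) \<partial>lborel)"

definition sgn_lp :: "('a, 'b, 'c) lp \<Rightarrow> ('a, 'b, 'c) lp" where
  "sgn_lp u = inverse (norm u) *\<^sub>R u"

definition dist_lp :: "('a, 'b, 'c) lp \<Rightarrow> ('a, 'b, 'c) lp \<Rightarrow> real" where
  "dist_lp u v = norm (u - v)"

definition uniformity_lp :: "(('a, 'b, 'c) lp \<times> ('a, 'b, 'c) lp) filter" where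
  "uniformity_lp = (INF e\<in>{0<..}. principal {(u, v). dist u v < e})"

definition open_lp :: "('a, 'b, 'c) lp set \<Rightarrow> bool" where
  "open_lp U = (\<forall>u\<in>U. \<forall>\<^sub>F (u', v) in uniformity. u' = u \<longrightarrow> v \<in> U)"

lemma zero_lp_abs: "0 = abs_lp (\<lambda>x. 0)"
  by (rule zero_lp_def)

lemma plus_lp_abs:
  assumes f: "lp_fun CARD('c) f" and g: "lp_fun CARD('c) g"
  shows "(abs_lp f :: ('a, 'b, 'c) lp) + abs_lp g = abs_lp (\<lambda>x. f x + g x)"
  unfolding plus_lp_def using rep_abs_lp[OF f] rep_abs_lp[OF g]
  by (subst abs_lp_eq_iff) (auto intro!: lp_fun_add lp_fun_rep f g)

lemma minus_lp_abs:
  assumes f: "lp_fun CARD('c) f" and g: "lp_fun CARD('c) g"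
  shows "(abs_lp f :: ('a, 'b, 'c) lp) - abs_lp g = abs_lp (\<lambda>x. f x - g x)"
  unfolding minus_lp_def using rep_abs_lp[OF f] rep_abs_lp[OF g]
  by (subst abs_lp_eq_iff) (auto intro!: lp_fun_diff lp_fun_rep f g)

lemma uminus_lp_abs:
  assumes f: "lp_fun CARD('c) f"
  shows "- (abs_lp f :: ('a, 'b, 'c) lp) = abs_lp (\<lambda>x. - f x)"
  unfolding uminus_lp_def using rep_abs_lp[OF f]
  by (subst abs_lp_eq_iff) (auto intro!: lp_fun_uminus lp_fun_rep f)

lemma scaleR_lp_abs:
  assumes f: "lp_fun CARD('c) f"
  shows "c *\<^sub>R (abs_lp f :: ('a, 'b, 'c) lp) = abs_lp (\<lambda>x. c *\<^sub>R f x)"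
  unfolding scaleR_lp_def using rep_abs_lp[OF f]
  by (subst abs_lp_eq_iff) (auto intro!: lp_fun_scaleR lp_fun_rep f)

lemma norm_lp_abs:
  assumes f: "lp_fun CARD('c) f"
  shows "norm (abs_lp f :: ('a, 'b, 'c) lp) = root CARD('c) (\<integral>x. norm (f x) ^ CARD('c) \<partial>lborel)"
proof -
  note [measurable] = lp_fun_measurable[OF f] lp_fun_measurable[OF lp_fun_rep]
  have "(\<integral>x. norm (rep_lp (abs_lp f :: ('a, 'b, 'c) lp) x) ^ CARD('c) \<partial>lborel)
      = (\<integral>x. norm (f x) ^ CARD('c) \<partial>lborel)"
    using rep_abs_lp[OF f] by (intro integral_cong_AE) auto
  then show ?thesis by (simp add: norm_lp_def)
qed

instance
proof
  fix u v w :: "('a, 'b, 'c) lp" and c d :: real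
  obtain f g h where [simp]: "lp_fun CARD('c) f" "lp_fun CARD('c) g" "lp_fun CARD('c) h"
    and [simp]: "u = abs_lp f" "v = abs_lp g" "w = abs_lp h"
    by (metis lp_cases)
  note [simp] = lp_fun_add lp_fun_diff lp_fun_uminus lp_fun_scaleR lp_fun_zero
    plus_lp_abs minus_lp_abs uminus_lp_abs scaleR_lp_abs zero_lp_abs abs_lp_eq_iff norm_lp_abs
  show "u + v + w = u + (v + w)" by (simp add: algebra_simps)
  show "u + v = v + u" by (simp add: algebra_simps)
  show "0 + u = u" by simp
  show "- u + u = 0" by simp
  show "u - v = u + - v" by simp
  show "c *\<^sub>R (u + v) = c *\<^sub>R u + c *\<^sub>R v" by (simp add: algebra_simps)
  show "(c + d) *\<^sub>R u = c *\<^sub>R u + d *\<^sub>R u" by (simp add: algebra_simps)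
  show "c *\<^sub>R d *\<^sub>R u = (c * d) *\<^sub>R u" by simp
  show "1 *\<^sub>R u = u" by simp
  show "dist u v = norm (u - v)" by (rule dist_lp_def)
  show "sgn u = inverse (norm u) *\<^sub>R u" by (rule sgn_lp_def)
  show "uniformity = (INF e\<in>{0<..}. principal {(u :: ('a, 'b, 'c) lp, v). dist u v < e})"
    by (rule uniformity_lp_def)
  show "open U = (\<forall>u\<in>U. \<forall>\<^sub>F (u', v) in uniformity. u' = u \<longrightarrow> v \<in> U)" for U :: "('a, 'b, 'c) lp set"
    by (rule open_lp_def)
  show "norm (u + v) \<le> norm u + norm v"
    by (simp add: minkowski_power)
  show "norm (c *\<^sub>R u) = \<bar>c\<bar> * norm u"
    by (simp add: power_mult_distrib real_root_mult real_root_power_cancel)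
  have "norm u = 0 \<longleftrightarrow> (\<integral>x. norm (f x) ^ CARD('c) \<partial>lborel) = 0" by simp
  also have "\<dots> \<longleftrightarrow> (AE x in lborel. norm (f x) ^ CARD('c) = 0)"
    by (intro integral_nonneg_eq_0_iff_AE) (auto intro: lp_fun_integrable)
  also have "\<dots> \<longleftrightarrow> u = 0" by simp
  finally show "norm u = 0 \<longleftrightarrow> u = 0" .
qed

end

subsection \<open>Separability\<close>

lemma abs_lp_tendsto_dominated:
  fixes f :: "'a::euclidean_space \<Rightarrow> 'b::{banach,second_countable_topology}"
  assumes s: "\<And>i. s i \<in> borel_measurable lborel" and f: "f \<in> borel_measurable lborel"
    and w: "integrable lborel (\<lambda>x. w x ^ CARD('p::finite))"
    and bound: "\<And>i x. norm (s i x) \<le> w x"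
    and lim: "\<And>x. (\<lambda>i. s i x) \<longlonglongrightarrow> f x"
  shows "(\<lambda>i. abs_lp (s i) :: ('a, 'b, 'p) lp) \<longlonglongrightarrow> abs_lp f"
proof -
  let ?n = "CARD('p)"
  have fw: "norm (f x) \<le> w x" for x
    using lim[of x] bound by (intro LIMSEQ_le_const2[OF tendsto_norm[OF lim[of x]]]) auto
  have si: "lp_fun ?n (s i)" for i by (rule lp_fun_bound[OF s w]) (simp add: bound)
  have fi: "lp_fun ?n f" by (rule lp_fun_bound[OF f w]) (simp add: fw)
  note [measurable] = s f
  have "(\<lambda>i. \<integral>x. norm (s i x - f x) ^ ?n \<partial>lborel) \<longlonglongrightarrow> integral\<^sup>L lborel (\<lambda>x::'a. 0 :: real)"
  proof (rule integral_dominated_convergence[where w = "\<lambda>x. 2 ^ ?n * (w x ^ ?n + w x ^ ?n)"])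
    show "integrable lborel (\<lambda>x. 2 ^ ?n * (w x ^ ?n + w x ^ ?n))" using w by simp
    show "AE x in lborel. (\<lambda>i. norm (s i x - f x) ^ ?n) \<longlonglongrightarrow> 0"
    proof (rule AE_I2)
      fix x
      have "(\<lambda>i. norm (s i x - f x) ^ ?n) \<longlonglongrightarrow> norm (f x - f x) ^ ?n"
        by (intro tendsto_intros lim)
      then show "(\<lambda>i. norm (s i x - f x) ^ ?n) \<longlonglongrightarrow> 0" by (simp add: zero_power)
    qed
    show "AE x in lborel. norm (norm (s i x - f x) ^ ?n) \<le> 2 ^ ?n * (w x ^ ?n + w x ^ ?n)" for i
    proof (rule AE_I2)
      fix x
      have "norm (s i x - f x) \<le> w x + w x"
        using norm_triangle_ineq4[of "s i x" "f x"] bound[of i x] fw[of x] by linarith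
      then have "norm (s i x - f x) ^ ?n \<le> (w x + w x) ^ ?n" by (intro power_mono) auto
      also have "\<dots> \<le> 2 ^ ?n * (w x ^ ?n + w x ^ ?n)"
        using order_trans[OF norm_ge_zero fw[of x]] by (intro power_add_bound)
      finally show "norm (norm (s i x - f x) ^ ?n) \<le> 2 ^ ?n * (w x ^ ?n + w x ^ ?n)" by simp
    qed
  qed measurable
  then have "(\<lambda>i. root ?n (\<integral>x. norm (s i x - f x) ^ ?n \<partial>lborel)) \<longlonglongrightarrow> root ?n 0"
    by (intro tendsto_real_root) simp
  then have "(\<lambda>i. norm (abs_lp (s i) - abs_lp f :: ('a, 'b, 'p) lp)) \<longlonglongrightarrow> 0"
    using si fi by (simp add: minus_lp_abs norm_lp_abs lp_fun_diff)
  then show ?thesis by (subst LIM_zero_iff[symmetric]) (rule tendsto_norm_zero_cancel)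
qed

lemma abs_lp_sum:
  fixes h :: "'i \<Rightarrow> 'a::euclidean_space \<Rightarrow> 'b::{banach,second_countable_topology}"
  assumes "finite I" "\<And>i. lp_fun CARD('p::finite) (h i)"
  shows "(abs_lp (\<lambda>x. \<Sum>i\<in>I. h i x) :: ('a, 'b, 'p) lp) = (\<Sum>i\<in>I. abs_lp (h i))"
proof -
  have "(abs_lp (\<lambda>x. \<Sum>i\<in>I. h i x) :: ('a, 'b, 'p) lp) = (\<Sum>i\<in>I. abs_lp (h i))
      \<and> lp_fun CARD('p) (\<lambda>x. \<Sum>i\<in>I. h i x)"
    using assms(1)
  proof (induction I)
    case empty
    then show ?case by (simp add: zero_lp_def lp_fun_zero)
  next
    case (insert a I)
    then have "lp_fun CARD('p) (\<lambda>x. h a x + (\<Sum>i\<in>I. h i x))"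
      using assms(2) by (intro lp_fun_add) auto
    with insert assms(2)[of a] show ?case by (simp add: plus_lp_abs[symmetric])
  qed
  then show ?thesis by simp
qed

lemma separable_lp:
  "\<exists>R :: ('a::euclidean_space, 'b::{banach,second_countable_topology}, 'p::finite) lp set.
    countable R \<and> closure R = UNIV"
proof -
  obtain B :: "'a set set" where B: "countable B" "topological_basis B"
    using ex_countable_basis by blast
  obtain D :: "'b set" where D: "countable D" "\<And>U. open U \<Longrightarrow> U \<noteq> {} \<Longrightarrow> \<exists>d\<in>D. d \<in> U"
    using countable_dense_setE by blast
  define P where "P = (\<lambda>F. \<Inter>F) ` {F. finite F \<and> F \<subseteq> B}"
  have P: "countable P"
    unfolding P_def using B(1) by (intro countable_image countable_Collect_finite_subset)
  have opB: "open X" if "X \<in> B" for X using B(2) that by (rule topological_basis_open)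
  have opP: "open X" if "X \<in> P" for X using that opB by (auto simp: P_def)
  have PUN: "UNIV \<in> P" unfolding P_def by (rule image_eqI[of _ _ "{}"]) auto
  define ind :: "'a set \<Rightarrow> nat \<Rightarrow> 'b \<Rightarrow> ('a, 'b, 'p) lp"
    where "ind A k v = abs_lp (\<lambda>x. indicator (A \<inter> ball 0 (real k)) x *\<^sub>R v)" for A k v
  define K where "K = (\<lambda>(A, k, v). ind A k v) ` (P \<times> UNIV \<times> D)"
  define R where "R = sum_list ` lists K"
  have "countable K" unfolding K_def using P D(1) by auto
  then have cR: "countable R" unfolding R_def by auto
  have R_add: "a + b \<in> R" if "a \<in> R" "b \<in> R" for a b
  proof -
    obtain xs ys where "xs \<in> lists K" "a = sum_list xs" "ys \<in> lists K" "b = sum_list ys"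
      using \<open>a \<in> R\<close> \<open>b \<in> R\<close> by (auto simp: R_def)
    then show ?thesis unfolding R_def by (intro image_eqI[of _ _ "xs @ ys"]) auto
  qed
  have R0: "0 \<in> R" unfolding R_def by (rule image_eqI[of _ _ "[]"]) auto
  have KR: "K \<subseteq> R" 
  proof
    fix a assume "a \<in> K" then show "a \<in> R" unfolding R_def by (intro image_eqI[of _ _ "[a]"]) auto
  qed
  define C where "C = closure R"
  have C0: "0 \<in> C" using R0 closure_subset by (auto simp: C_def)
  have C_add: "a + b \<in> C" if "a \<in> C" "b \<in> C" for a b
  proof -
    obtain X Y where "\<And>i. X i \<in> R" "X \<longlonglongrightarrow> a" "\<And>i. Y i \<in> R" "Y \<longlonglongrightarrow> b"
      using \<open>a \<in> C\<close> \<open>b \<in> C\<close> unfolding C_def closure_sequential by metis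
    then show ?thesis unfolding C_def closure_sequential
      by (intro exI[of _ "\<lambda>i. X i + Y i"]) (auto intro: R_add tendsto_add)
  qed
  have C_lim: "a \<in> C" if "\<And>i::nat. X i \<in> C" "X \<longlonglongrightarrow> a" for X a
    using closed_sequentially[of C X a] that by (simp add: C_def)
  have C_sum: "finite I \<Longrightarrow> (\<And>i. i \<in> I \<Longrightarrow> h i \<in> C) \<Longrightarrow> sum h I \<in> C" for h and I :: "'i set"
    by (induction I rule: finite_induct) (auto intro: C0 C_add)
  have ball_int: "integrable lborel (\<lambda>x::'a. (indicator (ball 0 (real k)) x * c :: real) ^ CARD('p))" for k c
  proof -
    have "integrable lborel (indicator (ball (0::'a) (real k)) :: 'a \<Rightarrow> real)"
      using emeasure_bounded_finite[of "ball (0::'a) (real k)"] by (intro integrable_real_indicator) auto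
    moreover have "(indicator (ball 0 (real k)) x :: real) ^ CARD('p) = indicator (ball 0 (real k)) x" for x :: 'a
      by (auto simp: indicator_def zero_power)
    ultimately show ?thesis by (simp add: power_mult_distrib)
  qed
  have lpi: "lp_fun CARD('p) (\<lambda>x. indicator (A \<inter> ball 0 (real k)) x *\<^sub>R v)" if "A \<in> sets borel" for A :: "'a set" and k and v :: 'b
    using that by (intro lp_fun_bound[OF _ ball_int[of k "norm v"]]) (auto simp: indicator_def)
  have ind_P: "ind A k v \<in> C" if A: "A \<in> P" for A k v
  proof -
    have "\<exists>d\<in>D. d \<in> ball v (inverse (real (Suc i)))" for i by (rule D(2)) auto
    then obtain d where d: "\<And>i. d i \<in> D" "\<And>i. dist v (d i) < inverse (real (Suc i))"
      by (metis mem_ball)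
    have lim: "d \<longlonglongrightarrow> v"
    proof (rule metric_LIMSEQ_I)
      fix e :: real assume "0 < e"
      then obtain N where N: "N \<noteq> 0" "inverse (real N) < e" using real_arch_inverse[of e] by auto
      have "dist (d i) v < e" if "i \<ge> N" for i
      proof -
        have "inverse (real (Suc i)) \<le> inverse (real N)" using that N by (intro le_imp_inverse_le) auto
        also have "\<dots> < e" by (rule N(2))
        finally show ?thesis using order_less_trans[OF d(2)[of i]] by (simp only: dist_commute)
      qed
      then show "\<exists>N. \<forall>i\<ge>N. dist (d i) v < e" by blast
    qed
    have dn: "norm (d i) \<le> norm v + 1" for i
    proof -
      have "inverse (real (Suc i)) \<le> 1" by (simp add: inverse_le_1_iff)
      then have "dist v (d i) \<le> 1" using d(2)[of i] by linarith
      then show ?thesis using norm_triangle_ineq2[of "d i" v] by (simp add: dist_norm norm_minus_commute)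
    qed
    have "ind A k (d i) \<in> C" for i
      using d(1)[of i] A KR closure_subset[of R] by (force simp: K_def C_def)
    moreover have "(\<lambda>i. ind A k (d i)) \<longlonglongrightarrow> ind A k v"
      unfolding ind_def
    proof (rule abs_lp_tendsto_dominated[OF _ _ ball_int[of k "norm v + 1"]])
      have A': "A \<in> sets borel" using opP[OF A] by simp
      show "(\<lambda>x. indicator (A \<inter> ball 0 (real k)) x *\<^sub>R v) \<in> borel_measurable lborel"
        "(\<lambda>x. indicator (A \<inter> ball 0 (real k)) x *\<^sub>R d i) \<in> borel_measurable lborel" for i
        by (rule lp_fun_measurable[OF lpi[OF A']])+
      show "(\<lambda>i. indicator (A \<inter> ball 0 (real k)) x *\<^sub>R d i) \<longlonglongrightarrow> indicator (A \<inter> ball 0 (real k)) x *\<^sub>R v" for x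
        by (intro tendsto_intros lim)
    qed (use dn in \<open>auto simp: indicator_def\<close>)
    ultimately show ?thesis by (rule C_lim)
  qed
  have stP: "Int_stable P"
  proof (rule Int_stableI)
    fix a b assume "a \<in> P" "b \<in> P"
    then obtain F G where "finite F" "F \<subseteq> B" "a = \<Inter>F" "finite G" "G \<subseteq> B" "b = \<Inter>G" by (auto simp: P_def)
    then show "a \<inter> b \<in> P" unfolding P_def by (intro image_eqI[of _ _ "F \<union> G"]) auto
  qed
  have "sets (borel :: 'a measure) = sigma_sets UNIV B"
    by (subst borel_eq_countable_basis[OF B]) simp
  moreover have "sigma_sets UNIV B \<subseteq> sigma_sets UNIV P"
  proof (rule sigma_sets_mono')
    show "B \<subseteq> P"
    proof
      fix X assume "X \<in> B" then show "X \<in> P" unfolding P_def by (intro image_eqI[of _ _ "{X}"]) auto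
    qed
  qed
  ultimately have bor1: "sets borel \<subseteq> sigma_sets UNIV P" by simp
  have bor2: "sigma_sets UNIV P \<subseteq> sets borel"
    by (rule borel_sigma_sets_subset) (auto dest: opP)
  have ind_borel: "ind A k v \<in> C" if "A \<in> sets borel" for A k v
  proof -
    have "P \<subseteq> Pow UNIV" "A \<in> sigma_sets UNIV P" using bor1 that by auto
    with stP show ?thesis
    proof (induction A arbitrary: v rule: sigma_sets_induct_disjoint)
      case (basic A)
      then show ?case by (rule ind_P)
    next
      case empty
      then show ?case using C0 by (simp add: ind_def zero_lp_def)
    next
      case (compl A)
      then have A: "A \<in> sets borel" using bor2 by auto
      have "ind (UNIV - A) k v = ind UNIV k v + ind A k (- v)"
      proof -
        have "(\<lambda>x. indicator (UNIV \<inter> ball 0 (real k)) x *\<^sub>R v + indicator (A \<inter> ball 0 (real k)) x *\<^sub>R (- v))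
            = (\<lambda>x. indicator ((UNIV - A) \<inter> ball 0 (real k)) x *\<^sub>R v)"
          by (auto simp: indicator_def fun_eq_iff)
        then show ?thesis unfolding ind_def 
          by (subst plus_lp_abs) (rule lpi[OF A] lpi[of UNIV] | simp)+
      qed
      then show ?case using C_add[OF ind_P[OF PUN] compl.IH] by simp
    next
      case (union A)
      then have A: "A i \<in> sets borel" for i using bor2 by auto
      have fin: "ind (\<Union>i<m. A i) k v \<in> C" for m
      proof (induction m)
        case 0
        then show ?case using C0 by (simp add: ind_def zero_lp_def)
      next
        case (Suc m)
        have "ind (\<Union>i<Suc m. A i) k v = ind (\<Union>i<m. A i) k v + ind (A m) k v"
        proof -
          have "A m \<inter> A i = {}" if "i < m" for i
            using disjoint_family_onD[OF union.hyps(1), of m i] that by simp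
          then have disj: "A m \<inter> (\<Union>i<m. A i) = {}" by blast
          have Un: "(\<Union>i<Suc m. A i) = (\<Union>i<m. A i) \<union> A m" by (auto simp: less_Suc_eq)
          have "(\<lambda>x. indicator ((\<Union>i<m. A i) \<inter> ball 0 (real k)) x *\<^sub>R v + indicator (A m \<inter> ball 0 (real k)) x *\<^sub>R v)
            = (\<lambda>x. indicator ((\<Union>i<Suc m. A i) \<inter> ball 0 (real k)) x *\<^sub>R v)"
            unfolding Un using disj by (auto simp: indicator_def fun_eq_iff simp del: UN_iff)
          moreover have "(\<Union>i<m. A i) \<in> sets borel" using A by auto
          ultimately show ?thesis unfolding ind_def
            by (subst plus_lp_abs) (rule lpi[OF A] lpi | assumption | simp)+
        qed
        then show ?case using C_add[OF Suc.IH union.IH] by simp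
      qed
      have "(\<lambda>m. ind (\<Union>i<m. A i) k v) \<longlonglongrightarrow> ind (\<Union>i. A i) k v"
        unfolding ind_def
      proof (rule abs_lp_tendsto_dominated[OF _ _ ball_int[of k "norm v"]])
        show "(\<lambda>m. indicator ((\<Union>i<m. A i) \<inter> ball 0 (real k)) x *\<^sub>R v)
            \<longlonglongrightarrow> indicator ((\<Union>i. A i) \<inter> ball 0 (real k)) x *\<^sub>R v" for x
        proof (cases "\<exists>i. x \<in> A i")
          case True
          then obtain i where "x \<in> A i" by auto
          then have "\<forall>\<^sub>F m in sequentially. indicator ((\<Union>i<m. A i) \<inter> ball 0 (real k)) x *\<^sub>R v
              = indicator ((\<Union>i. A i) \<inter> ball 0 (real k)) x *\<^sub>R v"
            by (intro eventually_sequentiallyI[of "Suc i"]) (auto simp: indicator_def)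
          then show ?thesis by (rule tendsto_eventually)
        next
          case False
          then show ?thesis by (simp add: indicator_def)
        qed
        have A': "(\<Union>i. A i) \<in> sets borel" "(\<Union>i<m. A i) \<in> sets borel" for m using A by auto
        show "(\<lambda>x. indicator ((\<Union>i. A i) \<inter> ball 0 (real k)) x *\<^sub>R v) \<in> borel_measurable lborel"
          "(\<lambda>x. indicator ((\<Union>i<m. A i) \<inter> ball 0 (real k)) x *\<^sub>R v) \<in> borel_measurable lborel" for m
          by (rule lp_fun_measurable[OF lpi[OF A'(1)]], rule lp_fun_measurable[OF lpi[OF A'(2)]])
        show "norm (indicator ((\<Union>i<m. A i) \<inter> ball 0 (real k)) x *\<^sub>R v) \<le> indicator (ball 0 (real k)) x * norm v" for m x
          by (cases "x \<in> ball 0 (real k)"; cases "x \<in> (\<Union>i<m. A i)")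
             (simp_all del: UN_iff mem_ball)
      qed
      from fin this show ?case by (rule C_lim)
    qed
  qed
  have "u \<in> C" for u
  proof -
    obtain f where f: "lp_fun CARD('p) f" and u: "u = abs_lp f" by (rule lp_cases)
    have f': "f \<in> borel_measurable lborel" using f by (rule lp_fun_measurable)
    obtain s where s: "\<And>i. simple_function lborel (s i)"
      and lim: "\<And>x. (\<lambda>i. s i x) \<longlonglongrightarrow> f x" and bd: "\<And>i x. norm (s i x) \<le> 2 * norm (f x)"
      using borel_measurable_implies_sequence_metric[OF f', of 0] by (auto simp: dist_norm)
    have sm: "s i \<in> borel_measurable lborel" for i
      using s by (rule borel_measurable_simple_function)
    let ?s = "\<lambda>i x. indicator (ball 0 (real i)) x *\<^sub>R s i x"
    have s_lim: "(\<lambda>i. abs_lp (?s i)) \<longlonglongrightarrow> u" unfolding u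
    proof (rule abs_lp_tendsto_dominated)
      show "integrable lborel (\<lambda>x. (2 * norm (f x)) ^ CARD('p))"
        using f by (simp add: lp_fun_def power_mult_distrib)
      show "norm (?s i x) \<le> 2 * norm (f x)" for i x using bd[of i x] by (auto simp: indicator_def)
      show "(\<lambda>i. ?s i x) \<longlonglongrightarrow> f x" for x
      proof -
        obtain N :: nat where N: "norm x < real N" using reals_Archimedean2 by blast
        have "\<forall>\<^sub>F i in sequentially. s i x = ?s i x"
          using N by (intro eventually_sequentiallyI[of N]) (auto simp: indicator_def)
        then show ?thesis using lim by (rule Lim_transform_eventually[rotated])
      qed
      show "?s i \<in> borel_measurable lborel" for i
        using sm[of i] by (intro borel_measurable_scaleR borel_measurable_indicator) auto
    qed (rule f')
    have "abs_lp (?s i) \<in> C" for i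
    proof -
      let ?V = "range (s i)"
      have fV: "finite ?V" using simple_functionD(1)[OF s[of i]] by simp
      have mV: "s i -` {v} \<in> sets borel" for v
        using simple_functionD(2)[OF s[of i], of "{v}"] by simp
      have "abs_lp (\<lambda>x. \<Sum>v\<in>?V. indicator (s i -` {v} \<inter> ball 0 (real i)) x *\<^sub>R v) = (\<Sum>v\<in>?V. ind (s i -` {v}) i v)"
        unfolding ind_def by (rule abs_lp_sum[OF fV lpi[OF mV]])
      moreover have "(\<lambda>x. \<Sum>v\<in>?V. indicator (s i -` {v} \<inter> ball 0 (real i)) x *\<^sub>R v) = ?s i"
      proof
        fix x
        have "(\<Sum>v\<in>?V. indicator (s i -` {v} \<inter> ball 0 (real i)) x *\<^sub>R v)
            = (\<Sum>v\<in>?V. if v = s i x then indicator (ball 0 (real i)) x *\<^sub>R v else 0)"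
          by (intro sum.cong) (auto simp: indicator_def)
        also have "\<dots> = ?s i x" using fV by (simp add: sum.delta)
        finally show "(\<Sum>v\<in>?V. indicator (s i -` {v} \<inter> ball 0 (real i)) x *\<^sub>R v) = ?s i x" .
      qed
      ultimately have "abs_lp (?s i) = (\<Sum>v\<in>?V. ind (s i -` {v}) i v)" by simp
      then show ?thesis using C_sum[OF fV ind_borel[OF mV]] by simp
    qed
    from this s_lim show ?thesis by (rule C_lim)
  qed
  then show ?thesis using cR unfolding C_def by auto
qed

instance lp :: (euclidean_space, "{banach,second_countable_topology}", finite) second_countable_topology
proof
  obtain R :: "('a, 'b, 'c) lp set" where R: "countable R" "closure R = UNIV"
    using separable_lp by blast
  define \<B> where "\<B> = (\<lambda>(r, k::nat). ball r (inverse (real (Suc k)))) ` (R \<times> UNIV)"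
  have "topological_basis \<B>"
  proof (rule topological_basisI)
    show "open B'" if "B' \<in> \<B>" for B' using that by (auto simp: \<B>_def)
    fix U and u :: "('a, 'b, 'c) lp" assume "open U" "u \<in> U"
    then obtain e where e: "e > 0" "ball u e \<subseteq> U" using open_contains_ball by blast
    obtain k where k: "inverse (real (Suc k)) < e / 2" using reals_Archimedean[of "e / 2"] e by auto
    have "u \<in> closure R" using R by simp
    then obtain r where r: "r \<in> R" "dist r u < inverse (real (Suc k))"
      unfolding closure_approachable by (metis inverse_positive_iff_positive of_nat_0_less_iff zero_less_Suc)
    have "ball r (inverse (real (Suc k))) \<subseteq> U"
    proof
      fix y assume "y \<in> ball r (inverse (real (Suc k)))"
      then have "dist u y < e" using dist_triangle[of u y r] r k by (auto simp: dist_commute)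
      then show "y \<in> U" using e by auto
    qed
    then show "\<exists>B'\<in>\<B>. u \<in> B' \<and> B' \<subseteq> U" using r unfolding \<B>_def by force
  qed
  moreover have "countable \<B>" unfolding \<B>_def using R(1) by auto
  ultimately show "\<exists>B::('a, 'b, 'c) lp set set. countable B \<and> open = generate_topology B"
    using topological_basis_imp_subbasis by blast
qed

section \<open>Pointwise operations\<close>

type_synonym 'a L2 = "('a, complex, 2) lp"
type_synonym 'a L1 = "('a, complex, 1) lp"
type_synonym 'a L1_real = "('a, real, 1) lp"

definition cscale :: "complex \<Rightarrow> 'a::euclidean_space L2 \<Rightarrow> 'a L2" where
  "cscale c u = abs_lp (\<lambda>x. c * rep_lp u x)"

definition mult_L2 :: "'a::euclidean_space L2 \<Rightarrow> 'a L2 \<Rightarrow> 'a L1" where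
  "mult_L2 u v = abs_lp (\<lambda>x. rep_lp u x * rep_lp v x)"

definition Re_L1 :: "'a::euclidean_space L1 \<Rightarrow> 'a L1_real" where
  "Re_L1 u = abs_lp (\<lambda>x. Re (rep_lp u x))"

definition Im_L1 :: "'a::euclidean_space L1 \<Rightarrow> 'a L1_real" where
  "Im_L1 u = abs_lp (\<lambda>x. Im (rep_lp u x))"

definition abs_square :: "'a::euclidean_space L2 \<Rightarrow> 'a L1" where
  "abs_square u = abs_lp (\<lambda>x. complex_of_real ((cmod (rep_lp u x))\<^sup>2))"

lemma lp_fun_cscale: "lp_fun n f \<Longrightarrow> lp_fun n (\<lambda>x. c * f x :: complex)"
  by (auto simp: lp_fun_def norm_mult power_mult_distrib)

lemma lp_fun_mult:
  fixes f g :: "'a::euclidean_space \<Rightarrow> complex"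
  assumes f: "lp_fun 2 f" and g: "lp_fun 2 g"
  shows "lp_fun 1 (\<lambda>x. f x * g x)"
proof (rule lp_fun_bound)
  note [measurable] = lp_fun_measurable[OF f] lp_fun_measurable[OF g]
  show "(\<lambda>x. f x * g x) \<in> borel_measurable lborel" by measurable
  show "integrable lborel (\<lambda>x. (norm (f x) ^ 2 + norm (g x) ^ 2) ^ 1)"
    using f g by (simp add: lp_fun_def)
  show "AE x in lborel. norm (f x * g x) \<le> norm (f x) ^ 2 + norm (g x) ^ 2"
  proof (rule AE_I2)
    fix x
    have "2 * (norm (f x) * norm (g x)) \<le> norm (f x) ^ 2 + norm (g x) ^ 2"
      using sum_squares_bound[of "norm (f x)" "norm (g x)"] by simp
    moreover have "0 \<le> norm (f x) * norm (g x)" by simp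
    ultimately show "norm (f x * g x) \<le> norm (f x) ^ 2 + norm (g x) ^ 2"
      unfolding norm_mult by linarith
  qed
qed

lemma lp_fun_Re: "lp_fun 1 f \<Longrightarrow> lp_fun 1 (\<lambda>x. Re (f x))"
  and lp_fun_Im: "lp_fun 1 f \<Longrightarrow> lp_fun 1 (\<lambda>x. Im (f x))"
  by (rule lp_fun_bound[of _ "\<lambda>x. norm (f x)"];
      auto simp: lp_fun_def abs_Re_le_cmod abs_Im_le_cmod)+

lemma lp_fun_abs_square: "lp_fun 2 f \<Longrightarrow> lp_fun 1 (\<lambda>x. complex_of_real ((cmod (f x))\<^sup>2))"
  by (auto simp: lp_fun_def norm_power)

section \<open>The free Schroedinger group\<close>

text \<open>
  The Fourier--Plancherel transform, as the \<open>L\<^sup>2\<close>-limit of the Fourier integrals over growing balls;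
  \<open>\<sigma> = -1\<close> gives the unitary Fourier transform and \<open>\<sigma> = 1\<close> its inverse. Note that \<open>-|\<xi>|\<^sup>2\<close> is the
  symbol of the Laplacian.
\<close>

definition fourier_integral :: "real \<Rightarrow> nat \<Rightarrow> ('a::euclidean_space \<Rightarrow> complex) \<Rightarrow> 'a \<Rightarrow> complex" where
  "fourier_integral \<sigma> n f \<xi> =
    complex_of_real ((2 * pi) powr (- real DIM('a) / 2)) *
      (LINT x:cball 0 (real n)|lborel. exp (\<i> * complex_of_real (\<sigma> * (x \<bullet> \<xi>))) * f x)"

definition plancherel :: "real \<Rightarrow> 'a::euclidean_space L2 \<Rightarrow> 'a L2" where
  "plancherel \<sigma> u = lim (\<lambda>n. abs_lp (fourier_integral \<sigma> n (rep_lp u)))"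

definition schroedinger_group :: "real \<Rightarrow> 'a::euclidean_space L2 \<Rightarrow> 'a L2" where
  "schroedinger_group t u =
    plancherel 1 (abs_lp (\<lambda>\<xi>. exp (- \<i> * complex_of_real (t * (norm \<xi>)\<^sup>2)) * rep_lp (plancherel (-1) u) \<xi>))"

section \<open>Potentials\<close>

definition Lp_space :: "ereal \<Rightarrow> 'c measure \<Rightarrow> ('c \<Rightarrow> 'b::real_normed_vector) set" where
  "Lp_space p M = {f \<in> borel_measurable M.
    if p = \<infinity> then \<exists>C. AE x in M. norm (f x) \<le> C
    else integrable M (\<lambda>x. norm (f x) powr real_of_ereal p)}"

definition Lp_norm :: "real \<Rightarrow> 'c measure \<Rightarrow> ('c \<Rightarrow> 'b::real_normed_vector) \<Rightarrow> real" where
  "Lp_norm q M f = (\<integral>x. norm (f x) powr q \<partial>M) powr (1 / q)"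

definition conj_exponent :: "ereal \<Rightarrow> real" where
  "conj_exponent p = 1 / (1 - real_of_ereal (1 / p))"

text \<open>
  Elements of the time-dependent spaces are functions rather than equivalence classes. A bounded linear
  functional on \<open>L\<^sup>q(I, L\<^sup>1)\<close> automatically takes the same value on functions that agree almost
  everywhere on \<open>I\<close>; extensionality makes it unique as a function.
\<close>

definition M_space :: "ereal \<Rightarrow> real set \<Rightarrow> ((real \<Rightarrow> 'a::euclidean_space L1_real) \<Rightarrow> real) set" where
  "M_space p I =
    (let q = conj_exponent p; M = restrict_space lborel I; X = Lp_space (ereal q) M in
      {V \<in> extensional X.
        (\<forall>f\<in>X. \<forall>g\<in>X. \<forall>c d. V (\<lambda>t. c *\<^sub>R f t + d *\<^sub>R g t) = c * V f + d * V g) \<and>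
        (\<exists>C. \<forall>f\<in>X. \<bar>V f\<bar> \<le> C * Lp_norm q M f)})"

definition pairing :: "((real \<Rightarrow> 'a::euclidean_space L1_real) \<Rightarrow> real) \<Rightarrow> (real \<Rightarrow> 'a L1) \<Rightarrow> complex" where
  "pairing V F = Complex (V (\<lambda>t. Re_L1 (F t))) (V (\<lambda>t. Im_L1 (F t)))"

text \<open>
  The values \<open>V E \<in> L\<^sup>\<infinity>\<close> of a measure are given by representatives; only the values on bounded Borel
  sets are relevant.
\<close>

definition represents ::
  "real set \<Rightarrow> ((real \<Rightarrow> 'a::euclidean_space L1_real) \<Rightarrow> real) \<Rightarrow> (real set \<Rightarrow> 'a \<Rightarrow> real) \<Rightarrow> bool" where
  "represents I W V \<longleftrightarrow> (\<forall>E h. E \<in> sets borel \<and> E \<subseteq> I \<longrightarrow>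
    (\<integral>x. V E x * rep_lp h x \<partial>lborel) = W (\<lambda>t. indicator E t *\<^sub>R h))"

definition Linf_measure :: "(real set \<Rightarrow> 'a::euclidean_space \<Rightarrow> real) \<Rightarrow> bool" where
  "Linf_measure V \<longleftrightarrow>
    (\<forall>E. E \<in> sets borel \<and> bounded E \<longrightarrow> V E \<in> Lp_space \<infinity> lborel) \<and>
    (\<forall>E :: nat \<Rightarrow> real set. range E \<subseteq> sets borel \<and> disjoint_family E \<and> bounded (\<Union>i. E i) \<longrightarrow>
      (\<forall>e>0. \<forall>\<^sub>F n in sequentially. AE x in lborel. \<bar>V (\<Union>i. E i) x - (\<Sum>i<n. V (E i) x)\<bar> \<le> e))"

definition M_loc :: "ereal \<Rightarrow> (real set \<Rightarrow> 'a::euclidean_space \<Rightarrow> real) set" where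
  "M_loc p = {V. Linf_measure V \<and> (\<forall>a b. a \<le> b \<longrightarrow> (\<exists>W\<in>M_space p {a..b}. represents {a..b} W V))}"

definition local_functional ::
  "ereal \<Rightarrow> (real set \<Rightarrow> 'a::euclidean_space \<Rightarrow> real) \<Rightarrow> real \<Rightarrow> real \<Rightarrow> (real \<Rightarrow> 'a L1_real) \<Rightarrow> real" where
  "local_functional p V a b = (THE W. W \<in> M_space p {a..b} \<and> represents {a..b} W V)"

section \<open>Integrals and the Schroedinger equation\<close>

text \<open>\<open>V_integral V E f\<close> is the integral of \<open>f(t) V(dt)\<close> over \<open>E\<close>.\<close>

definition V_integral ::
  "((real \<Rightarrow> 'a::euclidean_space L1_real) \<Rightarrow> real) \<Rightarrow> real set \<Rightarrow> (real \<Rightarrow> 'a L2) \<Rightarrow> 'a L2" where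
  "V_integral V E f = (THE u. \<forall>g. (\<integral>x. rep_lp u x * rep_lp g x \<partial>lborel)
    = pairing V (\<lambda>t. indicator E t *\<^sub>R mult_L2 (f t) g))"

text \<open>\<open>V_density p V J f\<close> is the density \<open>\<phi>\<close> with \<open>f(t) V(dt) = \<phi>(t) dt\<close> on \<open>J\<close>, unique almost everywhere.\<close>

definition V_density ::
  "ereal \<Rightarrow> ((real \<Rightarrow> 'a::euclidean_space L1_real) \<Rightarrow> real) \<Rightarrow> real set \<Rightarrow> (real \<Rightarrow> 'a L2) \<Rightarrow> real \<Rightarrow> 'a L2" where
  "V_density p V J f = (SOME \<phi>. \<phi> \<in> Lp_space p (restrict_space lborel J) \<and>
    (\<forall>E. E \<in> sets borel \<and> E \<subseteq> J \<longrightarrow> V_integral V E f = (LINT t:E|lborel. \<phi> t)))"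

text \<open>\<open>duhamel p V a b s f\<close> is the integral of \<open>e\<^bsup>i\<Delta>(s-t)\<^esup> f(t) V(dt)\<close> over \<open>{a..b}\<close>.\<close>

definition duhamel ::
  "ereal \<Rightarrow> ((real \<Rightarrow> 'a::euclidean_space L1_real) \<Rightarrow> real) \<Rightarrow> real \<Rightarrow> real \<Rightarrow> real \<Rightarrow> (real \<Rightarrow> 'a L2) \<Rightarrow> 'a L2" where
  "duhamel p V a b s f = (LINT t:{a..b}|lborel. schroedinger_group (s - t) (V_density p V {a..b} f t))"

definition solution_on ::
  "ereal \<Rightarrow> real \<Rightarrow> ((real \<Rightarrow> 'a::euclidean_space L1_real) \<Rightarrow> real) \<Rightarrow> 'a L2 \<Rightarrow> (real \<Rightarrow> 'a L2) \<Rightarrow> bool" where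
  "solution_on p T V \<psi>0 \<psi> \<longleftrightarrow> continuous_on {0..T} \<psi> \<and>
    (\<forall>t\<in>{0..T}. \<psi> t = schroedinger_group t \<psi>0 - cscale \<i> (duhamel p V 0 t t \<psi>))"

definition global_solution ::
  "ereal \<Rightarrow> (real set \<Rightarrow> 'a::euclidean_space \<Rightarrow> real) \<Rightarrow> 'a L2 \<Rightarrow> (real \<Rightarrow> 'a L2) \<Rightarrow> bool" where
  "global_solution p V \<psi>0 \<psi> \<longleftrightarrow> continuous_on UNIV \<psi> \<and>
    (\<forall>t. \<psi> t = schroedinger_group t \<psi>0 - cscale \<i>
      (if 0 \<le> t then duhamel p (local_functional p V 0 t) 0 t t \<psi>
       else - duhamel p (local_functional p V t 0) t 0 t \<psi>))"

definition psi_on ::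
  "ereal \<Rightarrow> real \<Rightarrow> ((real \<Rightarrow> 'a::euclidean_space L1_real) \<Rightarrow> real) \<Rightarrow> 'a L2 \<Rightarrow> real \<Rightarrow> 'a L2" where
  "psi_on p T V \<psi>0 = (THE \<psi>. \<psi> \<in> extensional {0..T} \<and> solution_on p T V \<psi>0 \<psi>)"

definition psi_global ::
  "ereal \<Rightarrow> (real set \<Rightarrow> 'a::euclidean_space \<Rightarrow> real) \<Rightarrow> 'a L2 \<Rightarrow> real \<Rightarrow> 'a L2" where
  "psi_global p V \<psi>0 = (THE \<psi>. global_solution p V \<psi>0 \<psi>)"

definition attainable :: "'a::euclidean_space L2 \<Rightarrow> 'a L2 set" where
  "attainable \<psi>0 = (\<Union>p\<in>{1<..}. {psi_global p V \<psi>0 t | t V. V \<in> M_loc p})"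

definition representable_densities :: "'a::euclidean_space L2 \<Rightarrow> real \<Rightarrow> (real \<Rightarrow> 'a L1) set" where
  "representable_densities \<psi>0 T =
    (\<Union>p\<in>{1<..}. {(\<lambda>t\<in>{0..T}. abs_square (psi_on p T V \<psi>0 t)) | V. V \<in> M_space p {0..T}})"

text \<open>The space of continuous functions on \<open>{0..T}\<close> with the supremum metric.\<close>

definition C0_space :: "real \<Rightarrow> (real \<Rightarrow> 'b::metric_space) topology" where
  "C0_space T = mtopology_of (cfunspace (top_of_set {0..T}) euclidean_metric)"

end

theory Submission
  imports Defs "HOL-Probability.Characteristic_Functions" "HOL-Library.Diagonal_Subsequence"
begin

text \<open>
  Since the exponents \<open>p\<^sub>k = (k + 2) / (k + 1)\<close> decrease to 1 and \<open>M\<^sup>p\<close> is contained in \<open>M\<^sup>r\<close> for \<open>r \<le> p\<close> on compact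
  intervals, both sets are countable unions over \<open>k\<close>, a bound \<open>N\<close> of the norm of \<open>V\<close> and, for the attainable
  set, a time interval \<open>[-n, n]\<close>. The \<open>N\<close>-ball of \<open>M\<^sup>p\<close> is sequentially weak-* compact because
  \<open>L\<^sup>q(I, L\<^sup>1)\<close> is separable, so it suffices that the solution depends on \<open>V\<close> sequentially continuously from
  the weak-* topology to uniform convergence in \<open>L\<^sup>2\<close>. By a Gronwall argument this reduces to showing that
  the Duhamel integrals of a fixed continuous \<open>f\<close> tend to 0 in norm if \<open>V\<^sub>n\<close> tends to 0 weak-*. Test them with
  \<open>g\<close> in the unit ball: \<open>f\<close> may be cut off to a ball uniformly in time; there the
  high-frequency part of the free wave from \<open>g\<close> is small in \<open>L\<^sup>2\<close> of space-time by local smoothing, hence in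
  \<open>L\<^sup>q\<close> of time, as the conjugate exponent \<open>q = k + 2\<close> is at least 2; and up to a small error the low-frequency part
  ranges over a bounded set of a finite-dimensional space, where weak-* convergence is uniform.
\<close>

section \<open>Completeness and inner product of the Lebesgue spaces\<close>

text \<open>The obstacle is uniformity: weak-* convergence controls \<open>W n F\<close> for one
  fixed \<open>F\<close>, whereas norm convergence of the Duhamel integrals needs control for all
  test vectors of an infinite-dimensional unit ball at once. What rescues it is that the map from a
  vector \<open>g\<close> to its free wave, cut off to a ball, is compact from L^2 into L^q of time
  for finite q from 2 on; smallness at high frequencies and finite rank at low ones are the two
  halves of this fact. For high frequencies, the square of the wave weighted by a space-time
  Gaussian becomes a quadratic form in frequency whose kernel is a Gaussian of differences on the
  paraboloid, and the Schur test bounds it by row integrals. Potentials act on real L^1 functions,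
  so all testing uses the real inner product, and the complex structure enters through the isometry
  \<open>cscale \<i>\<close>. A weak-* limit is only a functional on one interval. To have the
  unions equal the two sets, it must come from a potential again: for the attainable set it is
  extended by zero to the line and turned into an L^infinity-valued measure by the duality of L^1
  and L^infinity.\<close>

lemma norm_integral_le:
  fixes f :: "'a \<Rightarrow> 'b::{banach,second_countable_topology}"
  assumes "integrable M f" "integrable M g" "\<And>x. norm (f x) \<le> g x"
  shows "norm (\<integral>x. f x \<partial>M) \<le> (\<integral>x. g x \<partial>M)"
  using assms by (intro order_trans[OF integral_norm_bound] integral_mono) auto

lemma rep_lp_measurable [measurable]: "rep_lp u \<in> borel_measurable borel"
  using lp_fun_measurable[OF lp_fun_rep[of u]] by simp

lemma lp_eq_AE:
  fixes u v :: "('a::euclidean_space, 'b::{banach,second_countable_topology}, 'p::finite) lp"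
  shows "u = v \<longleftrightarrow> (AE x in lborel. rep_lp u x = rep_lp v x)"
  using abs_lp_eq_iff[OF lp_fun_rep[of u] lp_fun_rep[of v]] by (simp add: abs_rep_lp)

lemma rep_plus_AE: "AE x in lborel. rep_lp (u + v) x = rep_lp u x + rep_lp v x"
  unfolding plus_lp_def by (intro rep_abs_lp lp_fun_add lp_fun_rep)

lemma rep_minus_AE: "AE x in lborel. rep_lp (u - v) x = rep_lp u x - rep_lp v x"
  unfolding minus_lp_def by (intro rep_abs_lp lp_fun_diff lp_fun_rep)

lemma rep_scaleR_AE: "AE x in lborel. rep_lp (c *\<^sub>R u) x = c *\<^sub>R rep_lp u x"
  unfolding scaleR_lp_def by (intro rep_abs_lp lp_fun_scaleR lp_fun_rep)

lemma rep_zero_AE: "AE x in lborel. rep_lp 0 x = 0"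
  unfolding zero_lp_def by (intro rep_abs_lp lp_fun_zero) simp

lemma norm_lp_power:
  fixes u :: "('a::euclidean_space, 'b::{banach,second_countable_topology}, 'p::finite) lp"
  shows "norm u ^ CARD('p) = (\<integral>x. norm (rep_lp u x) ^ CARD('p) \<partial>lborel)"
  unfolding norm_lp_def by (rule real_root_pow_pos2) (auto intro!: integral_nonneg_AE)

lemma nn_integral_lp:
  fixes u :: "('a::euclidean_space, 'b::{banach,second_countable_topology}, 'p::finite) lp"
  shows "(\<integral>\<^sup>+x. ennreal (norm (rep_lp u x) ^ CARD('p)) \<partial>lborel) = ennreal (norm u ^ CARD('p))"
  unfolding norm_lp_power
  by (rule nn_integral_eq_integral) (auto intro: lp_fun_integrable lp_fun_rep)

text \<open>Tailored to Fatou's lemma, which yields only a bound on a nonnegative integral: that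
  bound gives membership and the norm estimate together.\<close>

lemma norm_lp_le_nn:
  fixes f :: "'a::euclidean_space \<Rightarrow> 'b::{banach,second_countable_topology}"
  assumes [measurable]: "f \<in> borel_measurable borel" and c: "0 \<le> c"
    and le: "(\<integral>\<^sup>+x. ennreal (norm (f x) ^ CARD('p::finite)) \<partial>lborel) \<le> ennreal (c ^ CARD('p))"
  shows "lp_fun CARD('p) f" "norm (abs_lp f :: ('a, 'b, 'p) lp) \<le> c"
proof -
  show l: "lp_fun CARD('p) f"
    unfolding lp_fun_def
    by (auto intro!: integrableI_bounded order.strict_trans1[OF le])
  have "ennreal (norm (abs_lp f :: ('a, 'b, 'p) lp) ^ CARD('p)) = (\<integral>\<^sup>+x. ennreal (norm (f x) ^ CARD('p)) \<partial>lborel)"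
    unfolding nn_integral_lp[symmetric] using rep_abs_lp[OF l] by (intro nn_integral_cong_AE) auto
  with le have "ennreal (norm (abs_lp f :: ('a, 'b, 'p) lp) ^ CARD('p)) \<le> ennreal (c ^ CARD('p))" by simp
  then have "norm (abs_lp f :: ('a, 'b, 'p) lp) ^ CARD('p) \<le> c ^ CARD('p)"
    by (subst (asm) ennreal_le_iff) (simp_all add: c)
  then show "norm (abs_lp f :: ('a, 'b, 'p) lp) \<le> c"
    using c by (simp add: power_mono_iff)
qed

text \<open>Riesz-Fischer. A subsequence with gaps \<open>(1/4)^k\<close> converges almost
  everywhere, and Fatou's lemma transfers the gaps to the distance from the pointwise limit.\<close>

lemma lp_Cauchy_convergent:
  fixes X :: "nat \<Rightarrow> ('a::euclidean_space, 'b::{banach,second_countable_topology}, 'p::finite) lp"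
  assumes "Cauchy X" shows "convergent X"
proof -
  let ?n = "CARD('p)"
  have n1: "?n \<ge> 1" by (simp add: Suc_le_eq)
  have "\<exists>M. \<forall>m\<ge>M. \<forall>m'\<ge>M. norm (X m - X m') < (1/4)^k" for k :: nat
    using CauchyD[OF assms, of "(1/4)^k"] by auto
  then obtain N where N: "\<And>k m m'. m \<ge> N k \<Longrightarrow> m' \<ge> N k \<Longrightarrow> norm (X m - X m') < (1/4)^k"
    by metis
  \<comment> \<open>Partial sums give a monotone sequence that stays above \<open>N\<close>.\<close>
  define r where "r k = (\<Sum>j\<le>k. N j)" for k :: nat
  have rN: "N k \<le> r k" for k unfolding r_def by (rule member_le_sum) auto
  have rmono: "r k \<le> r j" if "k \<le> j" for k j unfolding r_def using that by (intro sum_mono2) auto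
  define f where "f k = rep_lp (X (r k))" for k
  have [measurable]: "f k \<in> borel_measurable borel" for k by (simp add: f_def)
  have fd: "(\<integral>\<^sup>+x. ennreal (norm (f k x - f j x) ^ ?n) \<partial>lborel) \<le> ennreal (((1/4)^k) ^ ?n)"
    if "k \<le> j" for k j
  proof -
    have "(\<integral>\<^sup>+x. ennreal (norm (f k x - f j x) ^ ?n) \<partial>lborel) =
        (\<integral>\<^sup>+x. ennreal (norm (rep_lp (X (r k) - X (r j)) x) ^ ?n) \<partial>lborel)"
      by (intro nn_integral_cong_AE eventually_mono[OF rep_minus_AE[of "X (r k)" "X (r j)"]]) (auto simp: f_def)
    also have "\<dots> = ennreal (norm (X (r k) - X (r j)) ^ ?n)" by (rule nn_integral_lp)
    also have "\<dots> \<le> ennreal (((1/4)^k) ^ ?n)"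
      using N[of k "r k" "r j"] rN[of k] rmono[OF that] by (intro ennreal_leI power_mono) auto
    finally show ?thesis .
  qed
  \<comment> \<open>Gaps of order 4^-k leave room for the weight 2^k: the integral of
    \<open>h\<close> is finite, and finiteness of \<open>h x\<close> forces the increments at
    \<open>x\<close> to decay like 2^-k.\<close>
  define h where "h x = (\<Sum>k. ennreal ((2^k * norm (f k x - f (Suc k) x)) ^ ?n))" for x
  have [measurable]: "h \<in> borel_measurable borel" unfolding h_def by measurable
  have "(\<integral>\<^sup>+x. h x \<partial>lborel) = (\<Sum>k. \<integral>\<^sup>+x. ennreal ((2^k * norm (f k x - f (Suc k) x)) ^ ?n) \<partial>lborel)"
    unfolding h_def by (intro nn_integral_suminf) simp
  also have "\<dots> \<le> (\<Sum>k. ennreal ((1/2)^k))"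
  proof (intro suminf_le summableI)
    fix k
    have "(\<integral>\<^sup>+x. ennreal ((2^k * norm (f k x - f (Suc k) x)) ^ ?n) \<partial>lborel)
      = ennreal ((2^k) ^ ?n) * (\<integral>\<^sup>+x. ennreal (norm (f k x - f (Suc k) x) ^ ?n) \<partial>lborel)"
      by (simp add: power_mult_distrib ennreal_mult nn_integral_cmult)
    also have "\<dots> \<le> ennreal ((2^k) ^ ?n) * ennreal (((1/4)^k) ^ ?n)"
      by (intro mult_left_mono fd) auto
    also have "\<dots> = ennreal (((1/2)^k) ^ ?n)"
      by (simp add: ennreal_mult[symmetric] power_mult_distrib[symmetric])
    also have "\<dots> \<le> ennreal ((1/2)^k)"
      using power_decreasing[OF n1, of "(1/2)^k::real"] by (intro ennreal_leI) (simp add: power_le_one)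
    finally show "(\<integral>\<^sup>+x. ennreal ((2^k * norm (f k x - f (Suc k) x)) ^ ?n) \<partial>lborel) \<le> ennreal ((1/2)^k)" .
  qed
  also have "\<dots> = ennreal (\<Sum>k. (1/2)^k)"
    by (intro suminf_ennreal2) (auto intro: summable_geometric)
  also have "\<dots> < \<infinity>" by simp
  finally have hfin: "(\<integral>\<^sup>+x. h x \<partial>lborel) \<noteq> \<infinity>" by simp
  have "AE x in lborel. h x \<noteq> \<infinity>"
    by (rule nn_integral_noteq_infinite[OF _ hfin]) simp
  then have conv: "AE x in lborel. convergent (\<lambda>k. f k x)"
  proof eventually_elim
    case (elim x)
    have le: "ennreal ((2^k * norm (f k x - f (Suc k) x)) ^ ?n) \<le> h x" for k
    proof -
      have "(\<Sum>k\<in>{k}. ennreal ((2^k * norm (f k x - f (Suc k) x)) ^ ?n)) \<le> h x"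
        unfolding h_def by (rule sum_le_suminf) (simp_all add: summableI)
      then show ?thesis by (simp only: sum.insert[OF finite.emptyI] sum.empty empty_iff not_False_eq_True add_0_right)
    qed
    obtain c where c: "h x = ennreal c" "0 \<le> c" using elim by (cases "h x") auto
    have b: "norm (f (Suc k) x - f k x) \<le> max 1 c * (1/2)^k" for k
    proof -
      let ?a = "2^k * norm (f k x - f (Suc k) x)"
      have "?a ^ ?n \<le> c" using le[of k] c by simp
      \<comment> \<open>No root is taken: a number above 1 is at most its own power.\<close>
      have "?a \<le> max 1 c"
      proof (cases "?a \<le> 1")
        case False
        then have "?a \<le> ?a ^ ?n" using power_increasing[OF n1, of ?a] by simp
        then show ?thesis using \<open>?a ^ ?n \<le> c\<close> by linarith
      qed simp
      then show ?thesis by (simp add: field_simps norm_minus_commute power_one_over)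
    qed
    have "summable (\<lambda>k. f (Suc k) x - f k x)"
      by (rule summable_comparison_test'[where N = 0, OF _ b]) (intro summable_mult summable_geometric; simp)
    then have "convergent (\<lambda>n. f n x - f 0 x)"
      using sum_lessThan_telescope[of "\<lambda>k. f k x"] by (simp add: summable_iff_convergent)
    then have "convergent (\<lambda>n. (f n x - f 0 x) + f 0 x)" by (intro convergent_add convergent_const)
    then show "convergent (\<lambda>k. f k x)" by simp
  qed
  define g where "g x = lim (\<lambda>k. f k x)" for x
  have [measurable]: "g \<in> borel_measurable borel"
    unfolding g_def by (rule borel_measurable_lim_metric) simp
  have fg: "(\<integral>\<^sup>+x. ennreal (norm (f k x - g x) ^ ?n) \<partial>lborel) \<le> ennreal (((1/4)^k) ^ ?n)" for k
  proof -
    have "(\<integral>\<^sup>+x. ennreal (norm (f k x - g x) ^ ?n) \<partial>lborel)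
      = (\<integral>\<^sup>+x. liminf (\<lambda>j. ennreal (norm (f k x - f j x) ^ ?n)) \<partial>lborel)"
      using conv
    proof (intro nn_integral_cong_AE, eventually_elim)
      case (elim x)
      then have "(\<lambda>j. f j x) \<longlonglongrightarrow> g x" unfolding g_def by (simp add: convergent_LIMSEQ_iff)
      then have "(\<lambda>j. ennreal (norm (f k x - f j x) ^ ?n)) \<longlonglongrightarrow> ennreal (norm (f k x - g x) ^ ?n)"
        by (intro tendsto_ennrealI tendsto_intros)
      then show ?case using lim_imp_Liminf[OF sequentially_bot] by metis
    qed
    also have "\<dots> \<le> liminf (\<lambda>j. \<integral>\<^sup>+x. ennreal (norm (f k x - f j x) ^ ?n) \<partial>lborel)"
      by (intro nn_integral_liminf) simp
    also have "\<dots> \<le> liminf (\<lambda>j. ennreal (((1/4)^k) ^ ?n))"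
      by (intro Liminf_mono eventually_sequentiallyI[of k] fd)
    also have "\<dots> = ennreal (((1/4)^k) ^ ?n)" by (simp add: Liminf_const)
    finally show ?thesis .
  qed
  have nfg: "lp_fun ?n (\<lambda>x. f k x - g x)" "norm (abs_lp (\<lambda>x. f k x - g x) :: ('a, 'b, 'p) lp) \<le> (1/4)^k" for k
    by (rule norm_lp_le_nn[OF _ _ fg[of k]]; simp)+
  have "lp_fun ?n g"
    using lp_fun_diff[OF lp_fun_rep[of "X (r 0)"] nfg(1)[of 0]] by (simp add: f_def)
  then have "norm (X (r k) - abs_lp g) \<le> (1/4)^k" for k
    using nfg(2)[of k] minus_lp_abs[OF lp_fun_rep[of "X (r k)"] \<open>lp_fun ?n g\<close>] by (simp add: abs_rep_lp f_def)
  have "X \<longlonglongrightarrow> abs_lp g"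
  proof (rule LIMSEQ_I)
    fix e :: real assume "e > 0"
    then obtain k where k: "(1/4)^k < e/2" using real_arch_pow_inv[of "e/2" "1/4"] by auto
    have "norm (X m - abs_lp g) < e" if "m \<ge> N k" for m
      using norm_triangle_ineq[of "X m - X (r k)" "X (r k) - abs_lp g"] N[of k m "r k"] that rN[of k] k
        \<open>norm (X (r k) - abs_lp g) \<le> (1/4)^k\<close> by simp
    then show "\<exists>no. \<forall>m\<ge>no. norm (X m - abs_lp g) < e" by blast
  qed
  then show ?thesis by (rule convergentI)
qed

instance lp :: (euclidean_space, "{banach,second_countable_topology}", finite) banach
  by standard (rule lp_Cauchy_convergent)

text \<open>An inner product is available exactly when the exponent is 2; the two classes below make this
  a condition on the index type.\<close>

class card_one = finite + assumes card_one: "CARD('a) = 1"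
class card_two = finite + assumes card_two: "CARD('a) = 2"

instance num1 :: card_one by standard simp
instance bit0 :: (card_one) card_two by standard (simp add: card_one)

lemma lp_fun_inner:
  fixes f g :: "'a::euclidean_space \<Rightarrow> 'b::{banach,second_countable_topology,real_inner}"
  assumes f: "lp_fun 2 f" and g: "lp_fun 2 g"
  shows "integrable lborel (\<lambda>x. inner (f x) (g x))"
    and "integrable lborel (\<lambda>x. norm (f x) * norm (g x))"
proof -
  note [measurable] = lp_fun_measurable[OF f] lp_fun_measurable[OF g]
  have i: "integrable lborel (\<lambda>x. norm (f x) ^ 2 + norm (g x) ^ 2)"
    using f g by (simp add: lp_fun_def)
  have b: "norm (f x) * norm (g x) \<le> norm (f x) ^ 2 + norm (g x) ^ 2" for x
  proof -
    have "0 \<le> norm (f x) * norm (g x)" by simp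
    then show ?thesis using sum_squares_bound[of "norm (f x)" "norm (g x)"] by linarith
  qed
  show "integrable lborel (\<lambda>x. norm (f x) * norm (g x))"
    by (rule Bochner_Integration.integrable_bound[OF i]) (use b in \<open>simp_all\<close>)
  show "integrable lborel (\<lambda>x. inner (f x) (g x))"
    by (rule Bochner_Integration.integrable_bound[OF i])
      (use order_trans[OF Cauchy_Schwarz_ineq2 b] in \<open>simp_all\<close>)
qed

instantiation lp :: (euclidean_space, "{banach,second_countable_topology,real_inner}", card_two) real_inner
begin

definition inner_lp :: "('a, 'b, 'c) lp \<Rightarrow> ('a, 'b, 'c) lp \<Rightarrow> real" where
  "inner u v = (\<integral>x. inner (rep_lp u x) (rep_lp v x) \<partial>lborel)"

lemma lp_fun_rep2: "lp_fun 2 (rep_lp (u :: ('a, 'b, 'c) lp))"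
  using lp_fun_rep[of u] by (simp add: card_two)

instance
proof
  fix u v w :: "('a, 'b, 'c) lp" and c :: real
  show "inner u v = inner v u" by (simp add: inner_lp_def inner_commute)
  have "inner (u + v) w = (\<integral>x. inner (rep_lp u x) (rep_lp w x) + inner (rep_lp v x) (rep_lp w x) \<partial>lborel)"
    unfolding inner_lp_def
    by (intro integral_cong_AE eventually_mono[OF rep_plus_AE[of u v]]) (auto simp: inner_add_left)
  then show "inner (u + v) w = inner u w + inner v w"
    by (simp add: inner_lp_def lp_fun_inner lp_fun_rep2)
  have "inner (c *\<^sub>R u) v = (\<integral>x. c * inner (rep_lp u x) (rep_lp v x) \<partial>lborel)"
    unfolding inner_lp_def
    by (intro integral_cong_AE eventually_mono[OF rep_scaleR_AE[of c u]]) auto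
  then show "inner (c *\<^sub>R u) v = c * inner u v"
    by (simp add: inner_lp_def)
  have n: "inner u u = norm u ^ 2"
    using norm_lp_power[of u] by (simp add: inner_lp_def card_two power2_norm_eq_inner)
  show "0 \<le> inner u u" "norm u = sqrt (inner u u)" "inner u u = 0 \<longleftrightarrow> u = 0" by (simp_all add: n)
qed

end

lemma inner_lp_abs:
  assumes f: "lp_fun 2 f" and g: "lp_fun 2 g"
  shows "inner (abs_lp f :: ('a::euclidean_space, 'b::{banach,second_countable_topology,real_inner}, 'c::card_two) lp) (abs_lp g)
    = (\<integral>x. inner (f x) (g x) \<partial>lborel)"
proof -
  note [measurable] = lp_fun_measurable[OF f] lp_fun_measurable[OF g]
  have f': "lp_fun CARD('c) f" and g': "lp_fun CARD('c) g" using f g by (simp_all add: card_two)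
  have "AE x in lborel. inner (rep_lp (abs_lp f :: ('a, 'b, 'c) lp) x) (rep_lp (abs_lp g :: ('a, 'b, 'c) lp) x) = inner (f x) (g x)"
    using rep_abs_lp[OF f'] rep_abs_lp[OF g'] by eventually_elim simp
  then show ?thesis
    unfolding inner_lp_def by (intro integral_cong_AE) auto
qed

section \<open>Multiplication operators\<close>

text \<open>Modulus at most 1 makes every multiplication operator \<open>mul h\<close> a contraction
  without tracking constants. Phases, indicators and the constant \<i> qualify, and the class is
  closed under products and conjugation.\<close>

definition unitb :: "('a::euclidean_space \<Rightarrow> complex) \<Rightarrow> bool" where
  "unitb h \<longleftrightarrow> h \<in> borel_measurable borel \<and> (\<forall>x. cmod (h x) \<le> 1)"

definition mul :: "('a::euclidean_space \<Rightarrow> complex) \<Rightarrow> 'a L2 \<Rightarrow> 'a L2" where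
  "mul h u = abs_lp (\<lambda>x. h x * rep_lp u x)"

definition conjL :: "'a::euclidean_space L2 \<Rightarrow> 'a L2" where
  "conjL u = abs_lp (\<lambda>x. cnj (rep_lp u x))"

text \<open>The real part of \<open>u\<close> times the conjugate of \<open>v\<close>, a real L^1
  function whose integral is \<open>inner u v\<close>. Potentials act on real L^1 functions, so this
  is the product through which they are tested.\<close>

definition rmul :: "'a::euclidean_space L2 \<Rightarrow> 'a L2 \<Rightarrow> 'a L1_real" where
  "rmul u v = abs_lp (\<lambda>x. inner (rep_lp u x) (rep_lp v x))"

lemma unitbD: "unitb h \<Longrightarrow> h \<in> borel_measurable borel" "unitb h \<Longrightarrow> cmod (h x) \<le> 1"
  by (auto simp: unitb_def)

lemma unitb_mult: "unitb h \<Longrightarrow> unitb k \<Longrightarrow> unitb (\<lambda>x. h x * k x)"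
  by (auto simp: unitb_def norm_mult intro: mult_le_one)

lemma borel_measurable_cnj [measurable]: "cnj \<in> borel_measurable borel"
  by (intro borel_measurable_continuous_onI continuous_intros)

lemma unitb_cnj: "unitb h \<Longrightarrow> unitb (\<lambda>x. cnj (h x))"
  unfolding unitb_def using measurable_compose[OF _ borel_measurable_cnj] by auto

lemma unitb_const: "cmod c \<le> 1 \<Longrightarrow> unitb (\<lambda>x. c)"
  by (simp add: unitb_def)

lemma unitb_indicator: "S \<in> sets borel \<Longrightarrow> unitb (indicator S)"
  by (auto simp: unitb_def indicator_def)

lemma lp2_L2: "lp_fun 2 (rep_lp (u :: 'a::euclidean_space L2))"
  using lp_fun_rep[of u] by simp

lemma abs_L2_eq_iff:
  fixes f g :: "'a::euclidean_space \<Rightarrow> complex"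
  assumes "lp_fun 2 f" "lp_fun 2 g"
  shows "(abs_lp f :: 'a L2) = abs_lp g \<longleftrightarrow> (AE x in lborel. f x = g x)"
  using assms by (intro abs_lp_eq_iff) auto

lemma rep_abs_L2: "lp_fun 2 f \<Longrightarrow> AE x in lborel. rep_lp (abs_lp f :: 'a::euclidean_space L2) x = f x"
  by (rule rep_abs_lp) simp

lemma rep_abs_L1: "lp_fun 1 f \<Longrightarrow> AE x in lborel. rep_lp (abs_lp f :: ('a::euclidean_space, 'b::{banach,second_countable_topology}, 1) lp) x = f x"
  by (rule rep_abs_lp) simp

lemma norm_L2_sq: "(norm (u :: 'a::euclidean_space L2))\<^sup>2 = (\<integral>x. (cmod (rep_lp u x))\<^sup>2 \<partial>lborel)"
  using norm_lp_power[of u] by simp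

lemma lp_fun1_integrable: "lp_fun 1 f \<Longrightarrow> integrable lborel f"
  using integrable_norm_iff[of f lborel] by (simp add: lp_fun_def)

lemma norm_L2_abs_sq: "lp_fun 2 f \<Longrightarrow> (norm (abs_lp f :: 'a::euclidean_space L2))\<^sup>2 = (\<integral>x. (cmod (f x))\<^sup>2 \<partial>lborel)"
  by (subst norm_lp_abs) (auto simp: real_root_pow_pos2 integral_nonneg_AE simp flip: sqrt_def)

lemma norm_L1_abs: "lp_fun 1 f \<Longrightarrow> norm (abs_lp f :: ('a::euclidean_space, 'b::{banach,second_countable_topology}, 1) lp) = (\<integral>x. norm (f x) \<partial>lborel)"
  by (subst norm_lp_abs) auto

lemma lp_fun_mul:
  assumes "unitb h" "lp_fun n (f :: 'a::euclidean_space \<Rightarrow> complex)"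
  shows "lp_fun n (\<lambda>x. h x * f x)"
proof (rule lp_fun_bound)
  note [measurable] = unitbD(1)[OF assms(1)] lp_fun_measurable[OF assms(2)]
  show "(\<lambda>x. h x * f x) \<in> borel_measurable lborel" by measurable
  show "integrable lborel (\<lambda>x. norm (f x) ^ n)" by (rule lp_fun_integrable[OF assms(2)])
  show "AE x in lborel. cmod (h x * f x) \<le> cmod (f x)"
    by (intro AE_I2) (simp add: norm_mult mult_left_le_one_le unitbD(2)[OF assms(1)])
qed

lemma mul_abs:
  assumes "unitb h" "lp_fun 2 f"
  shows "mul h (abs_lp f) = abs_lp (\<lambda>x. h x * f x)"
  unfolding mul_def using rep_abs_L2[OF assms(2)]
  by (subst abs_L2_eq_iff) (auto intro!: lp_fun_mul assms lp2_L2)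

lemma rep_mul_AE: "unitb h \<Longrightarrow> AE x in lborel. rep_lp (mul h u) x = h x * rep_lp u x"
  unfolding mul_def by (intro rep_abs_L2 lp_fun_mul lp2_L2)

lemma L2_eqI: "AE x in lborel. rep_lp u x = rep_lp v x \<Longrightarrow> u = v"
  by (simp add: lp_eq_AE)

lemma mul_add:
  assumes h: "unitb h" shows "mul h (u + v) = mul h u + mul h v"
proof (rule L2_eqI)
  show "AE x in lborel. rep_lp (mul h (u + v)) x = rep_lp (mul h u + mul h v) x"
    using rep_mul_AE[OF h, of "u + v"] rep_mul_AE[OF h, of u] rep_mul_AE[OF h, of v]
      rep_plus_AE[of u v] rep_plus_AE[of "mul h u" "mul h v"]
    by eventually_elim (simp add: algebra_simps)
qed

lemma mul_scaleR:
  assumes h: "unitb h" shows "mul h (c *\<^sub>R u) = c *\<^sub>R mul h u"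
proof (rule L2_eqI)
  show "AE x in lborel. rep_lp (mul h (c *\<^sub>R u)) x = rep_lp (c *\<^sub>R mul h u) x"
    using rep_mul_AE[OF h, of "c *\<^sub>R u"] rep_mul_AE[OF h, of u]
      rep_scaleR_AE[of c u] rep_scaleR_AE[of c "mul h u"]
    by eventually_elim simp
qed

lemma mul_mul:
  assumes h: "unitb h" and k: "unitb k" shows "mul h (mul k u) = mul (\<lambda>x. h x * k x) u"
proof (rule L2_eqI)
  show "AE x in lborel. rep_lp (mul h (mul k u)) x = rep_lp (mul (\<lambda>x. h x * k x) u) x"
    using rep_mul_AE[OF h, of "mul k u"] rep_mul_AE[OF k, of u] rep_mul_AE[OF unitb_mult[OF h k], of u]
    by eventually_elim simp
qed

lemma mul_one [simp]: "mul (\<lambda>x. 1) u = u"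
  by (simp add: mul_def abs_rep_lp)

lemma norm_mul_sq:
  assumes h: "unitb h"
  shows "(norm (mul h u))\<^sup>2 = (\<integral>x. (cmod (h x))\<^sup>2 * (cmod (rep_lp u x))\<^sup>2 \<partial>lborel)"
  unfolding mul_def
  by (subst norm_L2_abs_sq[OF lp_fun_mul[OF h lp2_L2]]) (simp add: norm_mult power_mult_distrib)

lemma norm_mul_le:
  assumes h: "unitb h" shows "norm (mul h u) \<le> norm u"
proof -
  have "(norm (mul h u))\<^sup>2 \<le> (norm u)\<^sup>2"
    unfolding norm_mul_sq[OF h] unfolding norm_L2_sq
  proof (rule integral_mono)
    show "integrable lborel (\<lambda>x. (cmod (rep_lp u x))\<^sup>2)" using lp2_L2[of u] by (simp add: lp_fun_def)
    show "integrable lborel (\<lambda>x. (cmod (h x))\<^sup>2 * (cmod (rep_lp u x))\<^sup>2)"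
      using lp_fun_integrable[OF lp_fun_mul[OF h lp2_L2[of u]]] by (simp add: norm_mult power_mult_distrib)
    show "(cmod (h x))\<^sup>2 * (cmod (rep_lp u x))\<^sup>2 \<le> (cmod (rep_lp u x))\<^sup>2" for x
      using unitbD(2)[OF h, of x] by (intro mult_left_le_one_le) (auto simp: power_le_one)
  qed
  then show ?thesis by simp
qed

lemma norm_mul_eq:
  assumes h: "unitb h" "\<And>x. cmod (h x) = 1" shows "norm (mul h u) = norm u"
proof -
  have "(norm (mul h u))\<^sup>2 = (norm u)\<^sup>2"
    unfolding norm_mul_sq[OF h(1)] unfolding norm_L2_sq by (simp add: h(2))
  then show ?thesis by simp
qed

lemma bounded_linear_mul: "unitb h \<Longrightarrow> bounded_linear (mul h)"
  by (rule bounded_linear_intro[where K = 1]) (auto simp: mul_add mul_scaleR norm_mul_le)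

lemma inner_mul:
  assumes h: "unitb h" shows "inner (mul h u) v = inner u (mul (\<lambda>x. cnj (h x)) v)"
  unfolding inner_lp_def
proof (rule integral_cong_AE)
  show "AE x in lborel. inner (rep_lp (mul h u) x) (rep_lp v x) = inner (rep_lp u x) (rep_lp (mul (\<lambda>x. cnj (h x)) v) x)"
    using rep_mul_AE[OF h, of u] rep_mul_AE[OF unitb_cnj[OF h], of v]
    by eventually_elim (simp add: inner_complex_def algebra_simps)
qed measurable

lemma mul_tendsto:
  assumes h: "\<And>n. unitb (h n)" "unitb k" and lim: "\<And>x. (\<lambda>n. h n x) \<longlonglongrightarrow> k x"
  shows "(\<lambda>n. mul (h n) u) \<longlonglongrightarrow> mul k u"
  unfolding mul_def
proof (rule abs_lp_tendsto_dominated[where w = "\<lambda>x. cmod (rep_lp u x)"])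
  show "integrable lborel (\<lambda>x. cmod (rep_lp u x) ^ CARD(2))" using lp2_L2[of u] by (simp add: lp_fun_def)
  show "cmod (h i x * rep_lp u x) \<le> cmod (rep_lp u x)" for i x
    using unitbD(2)[OF h(1)] by (auto simp: norm_mult intro: mult_left_le_one_le)
  show "(\<lambda>i. h i x * rep_lp u x) \<longlonglongrightarrow> k x * rep_lp u x" for x by (intro tendsto_intros lim)
qed (use unitbD(1)[OF h(1)] unitbD(1)[OF h(2)] in \<open>auto\<close>)

lemma lp_fun_cnj: "lp_fun n f \<Longrightarrow> lp_fun n (\<lambda>x. cnj (f x))"
  unfolding lp_fun_def using measurable_compose[OF _ borel_measurable_cnj] by auto

lemma rep_conjL_AE: "AE x in lborel. rep_lp (conjL u) x = cnj (rep_lp u x)"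
  unfolding conjL_def by (intro rep_abs_L2 lp_fun_cnj lp2_L2)

lemma conjL_conjL [simp]: "conjL (conjL u) = u"
proof (rule L2_eqI)
  show "AE x in lborel. rep_lp (conjL (conjL u)) x = rep_lp u x"
    using rep_conjL_AE[of u] rep_conjL_AE[of "conjL u"] by eventually_elim simp
qed

lemma lp_fun_inner1: "lp_fun 2 f \<Longrightarrow> lp_fun 2 g \<Longrightarrow> lp_fun 1 (\<lambda>x. inner (f x) (g x :: complex))"
  using lp_fun_inner[of f g] by (auto simp: lp_fun_def)

lemma rep_rmul_AE: "AE x in lborel. rep_lp (rmul u v) x = inner (rep_lp u x) (rep_lp v x)"
  unfolding rmul_def by (intro rep_abs_L1 lp_fun_inner1 lp2_L2)

text \<open>Cauchy-Schwarz for the inner product of the moduli, which are themselves elements of L^2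
  with the same norms.\<close>

lemma norm_inner_L2:
  fixes u v :: "'a::euclidean_space L2"
  shows "(\<integral>x. cmod (rep_lp u x) * cmod (rep_lp v x) \<partial>lborel) \<le> norm u * norm v"
proof -
  let ?f = "\<lambda>u::'a L2. (\<lambda>x. complex_of_real (cmod (rep_lp u x)))"
  have l: "lp_fun 2 (?f u)" for u
    using lp2_L2[of u] by (auto simp: lp_fun_def)
  have n: "norm (abs_lp (?f u) :: 'a L2) = norm u" for u
  proof -
    have "(norm (abs_lp (?f u) :: 'a L2))\<^sup>2 = (norm u)\<^sup>2"
      unfolding norm_L2_abs_sq[OF l] unfolding norm_L2_sq by simp
    then show ?thesis by simp
  qed
  have "(\<integral>x. cmod (rep_lp u x) * cmod (rep_lp v x) \<partial>lborel) = inner (abs_lp (?f u) :: 'a L2) (abs_lp (?f v))"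
    by (subst inner_lp_abs[OF l l]) (simp add: inner_complex_def)
  also have "\<dots> \<le> norm u * norm v" using norm_cauchy_schwarz[of "abs_lp (?f u) :: 'a L2" "abs_lp (?f v)"] by (simp add: n)
  finally show ?thesis .
qed

lemma norm_rmul_le: "norm (rmul u v) \<le> norm u * norm v"
proof -
  have "norm (rmul u v) = (\<integral>x. norm (inner (rep_lp u x) (rep_lp v x)) \<partial>lborel)"
    unfolding rmul_def by (intro norm_L1_abs lp_fun_inner1 lp2_L2)
  also have "\<dots> \<le> (\<integral>x. cmod (rep_lp u x) * cmod (rep_lp v x) \<partial>lborel)"
    by (intro integral_mono integrable_norm lp_fun_inner lp2_L2) (auto simp: Cauchy_Schwarz_ineq2)
  also have "\<dots> \<le> norm u * norm v" by (rule norm_inner_L2)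
  finally show ?thesis .
qed

lemma rmul_commute: "rmul u v = rmul v u"
  by (simp add: rmul_def inner_commute)

lemma rmul_add_left: "rmul (u + w) v = rmul u v + rmul w v"
proof (rule L2_eqI)
  show "AE x in lborel. rep_lp (rmul (u + w) v) x = rep_lp (rmul u v + rmul w v) x"
    using rep_rmul_AE[of "u + w" v] rep_rmul_AE[of u v] rep_rmul_AE[of w v]
      rep_plus_AE[of u w] rep_plus_AE[of "rmul u v" "rmul w v"]
    by eventually_elim (simp add: inner_add_left)
qed

lemma rmul_scaleR_left: "rmul (c *\<^sub>R u) v = c *\<^sub>R rmul u v"
proof (rule L2_eqI)
  show "AE x in lborel. rep_lp (rmul (c *\<^sub>R u) v) x = rep_lp (c *\<^sub>R rmul u v) x"
    using rep_rmul_AE[of "c *\<^sub>R u" v] rep_rmul_AE[of u v] rep_scaleR_AE[of c u] rep_scaleR_AE[of c "rmul u v"]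
    by eventually_elim simp
qed

lemma bounded_bilinear_rmul: "bounded_bilinear rmul"
proof
  show "\<exists>K. \<forall>a b. norm (rmul a b) \<le> norm a * norm b * K"
    by (intro exI[of _ 1]) (simp add: norm_rmul_le)
qed (metis rmul_add_left rmul_commute rmul_scaleR_left)+

text \<open>Lets a spatial cut-off pass from the wave function to the test function under a
  functional.\<close>

lemma rmul_mul:
  assumes h: "unitb h" shows "rmul (mul h u) v = rmul u (mul (\<lambda>x. cnj (h x)) v)"
proof (rule L2_eqI)
  show "AE x in lborel. rep_lp (rmul (mul h u) v) x = rep_lp (rmul u (mul (\<lambda>x. cnj (h x)) v)) x"
    using rep_rmul_AE[of "mul h u" v] rep_rmul_AE[of u "mul (\<lambda>x. cnj (h x)) v"]
      rep_mul_AE[OF h, of u] rep_mul_AE[OF unitb_cnj[OF h], of v]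
    by eventually_elim (simp add: inner_complex_def algebra_simps)
qed

lemma rep_mult_L2_AE: "AE x in lborel. rep_lp (mult_L2 u v) x = rep_lp u x * rep_lp v x"
  unfolding mult_L2_def by (intro rep_abs_L1 lp_fun_mult lp2_L2)

text \<open>These identities turn the complex pairing into two values of the real functional:
  conjugation accounts for the bilinear product in \<open>mult_L2\<close>, the factor \<i> for the
  imaginary part.\<close>

lemma Re_L1_mult_L2: "Re_L1 (c *\<^sub>R mult_L2 u v) = c *\<^sub>R rmul u (conjL v)"
  and Im_L1_mult_L2: "Im_L1 (c *\<^sub>R mult_L2 u v) = c *\<^sub>R rmul u (cscale \<i> (conjL v))"
proof -
  have l: "lp_fun 1 (rep_lp (w :: 'a L1))" for w using lp_fun_rep[of w] by simp
  have i: "unitb (\<lambda>x::'a. \<i>)" by (simp add: unitb_def)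
  have "AE x in lborel. rep_lp (Re_L1 (c *\<^sub>R mult_L2 u v)) x = rep_lp (c *\<^sub>R rmul u (conjL v)) x"
    using rep_abs_L1[OF lp_fun_Re[OF l[of "c *\<^sub>R mult_L2 u v"]]] rep_scaleR_AE[of c "mult_L2 u v"]
      rep_mult_L2_AE[of u v] rep_scaleR_AE[of c "rmul u (conjL v)"] rep_rmul_AE[of u "conjL v"] rep_conjL_AE[of v]
    unfolding Re_L1_def by eventually_elim (simp add: inner_complex_def algebra_simps)
  then show "Re_L1 (c *\<^sub>R mult_L2 u v) = c *\<^sub>R rmul u (conjL v)" by (rule L2_eqI)
  have "AE x in lborel. rep_lp (Im_L1 (c *\<^sub>R mult_L2 u v)) x = rep_lp (c *\<^sub>R rmul u (mul (\<lambda>x. \<i>) (conjL v))) x"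
    using rep_abs_L1[OF lp_fun_Im[OF l[of "c *\<^sub>R mult_L2 u v"]]] rep_scaleR_AE[of c "mult_L2 u v"]
      rep_mult_L2_AE[of u v] rep_scaleR_AE[of c "rmul u (mul (\<lambda>x. \<i>) (conjL v))"] rep_rmul_AE[of u "mul (\<lambda>x. \<i>) (conjL v)"] rep_conjL_AE[of v]
      rep_mul_AE[OF i, of "conjL v"]
    unfolding Im_L1_def by eventually_elim (simp add: inner_complex_def algebra_simps)
  then show "Im_L1 (c *\<^sub>R mult_L2 u v) = c *\<^sub>R rmul u (cscale \<i> (conjL v))"
    unfolding cscale_def mul_def by (rule L2_eqI)
qed

lemma cscale_mul: "cscale c = mul (\<lambda>x. c)"
  by (simp add: fun_eq_iff cscale_def mul_def)

text \<open>Rewrites the left-hand side in the definition of \<open>V_integral\<close> by the real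
  inner product, component by component as in \<open>pairing\<close>.\<close>

lemma integral_mult_inner:
  "(\<integral>x. rep_lp u x * rep_lp v x \<partial>lborel) = Complex (inner u (conjL v)) (inner u (cscale \<i> (conjL v)))"
proof -
  have i: "unitb (\<lambda>x::'a. \<i>)" by (simp add: unitb_def)
  have I: "integrable lborel (\<lambda>x. rep_lp u x * rep_lp v x)"
    using lp_fun_mult[OF lp2_L2[of u] lp2_L2[of v]] by (auto simp: lp_fun_def integrable_norm_iff)
  have "Re (\<integral>x. rep_lp u x * rep_lp v x \<partial>lborel) = (\<integral>x. Re (rep_lp u x * rep_lp v x) \<partial>lborel)"
    by (rule integral_Re[OF I, symmetric])
  also have "\<dots> = inner u (conjL v)"
    unfolding inner_lp_def using rep_conjL_AE[of v]
    by (intro integral_cong_AE) (auto elim!: eventually_mono simp: inner_complex_def)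
  finally have 1: "Re (\<integral>x. rep_lp u x * rep_lp v x \<partial>lborel) = inner u (conjL v)" .
  have "Im (\<integral>x. rep_lp u x * rep_lp v x \<partial>lborel) = (\<integral>x. Im (rep_lp u x * rep_lp v x) \<partial>lborel)"
    by (rule integral_Im[OF I, symmetric])
  also have "\<dots> = inner u (mul (\<lambda>x. \<i>) (conjL v))"
    unfolding inner_lp_def
  proof (rule integral_cong_AE)
    show "AE x in lborel. Im (rep_lp u x * rep_lp v x) = inner (rep_lp u x) (rep_lp (mul (\<lambda>x. \<i>) (conjL v)) x)"
      using rep_conjL_AE[of v] rep_mul_AE[OF i, of "conjL v"]
      by eventually_elim (simp add: inner_complex_def)
  qed measurable
  finally show ?thesis using 1 by (simp add: complex_eq_iff cscale_mul)
qed

section \<open>The Fourier transform of Gaussians\<close>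

definition gauss :: "real \<Rightarrow> 'a::euclidean_space \<Rightarrow> real" where
  "gauss s x = exp (- (s * norm x)\<^sup>2 / 2)"

lemma gauss_measurable [measurable]: "gauss s \<in> borel_measurable borel"
  unfolding gauss_def by measurable

lemma gauss_pos: "0 < gauss s x" by (simp add: gauss_def)
lemma gauss_le_1: "gauss s x \<le> 1" by (simp add: gauss_def)

text \<open>This is the characteristic function of the standard normal distribution, freed from the
  normalising factor of the density.\<close>

lemma gauss_integral_1:
  "(\<integral>x. complex_of_real (exp (- x\<^sup>2 / 2)) * cis (x * t) \<partial>lborel) = complex_of_real (sqrt (2 * pi) * exp (- t\<^sup>2 / 2))"
proof -
  have "complex_of_real (exp (- t\<^sup>2 / 2)) = char std_normal_distribution t"
    by (simp add: char_std_normal_distribution)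
  also have "\<dots> = (\<integral>x. std_normal_density x *\<^sub>R cis (t * x) \<partial>lborel)"
    unfolding char_def cis_conv_exp
    by (subst integral_density) (auto simp: normal_density_nonneg)
  also have "\<dots> = (\<integral>x. complex_of_real (1 / sqrt (2 * pi)) * (complex_of_real (exp (- x\<^sup>2 / 2)) * cis (x * t)) \<partial>lborel)"
    by (intro Bochner_Integration.integral_cong) (auto simp: std_normal_density_def scaleR_conv_of_real mult_ac)
  also have "\<dots> = complex_of_real (1 / sqrt (2 * pi)) * (\<integral>x. complex_of_real (exp (- x\<^sup>2 / 2)) * cis (x * t) \<partial>lborel)"
    by simp
  finally show ?thesis by (simp add: field_simps)
qed

lemma gauss_integral_real:
  assumes s: "s > 0"
  shows "(\<integral>x. complex_of_real (exp (- (s * x)\<^sup>2 / 2)) * cis (x * t) \<partial>lborel)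
    = complex_of_real (sqrt (2 * pi) / s * exp (- (t / s)\<^sup>2 / 2))"
proof -
  have "(\<integral>x. complex_of_real (exp (- x\<^sup>2 / 2)) * cis (x * (t / s)) \<partial>lborel)
     = s *\<^sub>R (\<integral>x. complex_of_real (exp (- (0 + s * x)\<^sup>2 / 2)) * cis ((0 + s * x) * (t / s)) \<partial>lborel)"
    using s by (subst lborel_integral_real_affine[where c = s and t = 0]) auto
  also have "\<dots> = s *\<^sub>R (\<integral>x. complex_of_real (exp (- (s * x)\<^sup>2 / 2)) * cis (x * t) \<partial>lborel)"
    using s by simp
  finally show ?thesis
    unfolding gauss_integral_1 using s by (simp add: scaleR_conv_of_real field_simps)
qed

text \<open>The Gaussian and the character both factor over an orthonormal basis, so the integral is
  a product of one-dimensional ones.\<close>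

lemma gauss_integral:
  fixes \<xi> :: "'a::euclidean_space"
  assumes s: "s > 0"
  shows "(\<integral>x. complex_of_real (gauss s x) * cis (x \<bullet> \<xi>) \<partial>lborel)
    = complex_of_real ((sqrt (2 * pi) / s) ^ DIM('a) * gauss (1 / s) \<xi>)"
proof -
  interpret product_sigma_finite "\<lambda>_::'a. lborel :: real measure" by standard
  let ?X = "\<lambda>f. \<Sum>b\<in>Basis. f b *\<^sub>R (b::'a)"
  let ?g = "\<lambda>b x. complex_of_real (exp (- (s * x)\<^sup>2 / 2)) * cis (x * (\<xi> \<bullet> b))"
  have Xb: "?X f \<bullet> b = f b" if "b \<in> Basis" for f b using that by simp
  have nsq: "(norm x)\<^sup>2 = (\<Sum>b\<in>Basis. (x \<bullet> b)\<^sup>2)" for x :: 'a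
    unfolding power2_norm_eq_inner by (subst euclidean_inner) (simp add: power2_eq_square)
  have cis_sum: "cis (\<Sum>b\<in>A. h b) = (\<Prod>b\<in>A. cis (h b))" if "finite A" for h and A :: "'a set"
    using that by (induction A) (auto simp flip: cis_mult)
  have split: "complex_of_real (gauss s x) * cis (x \<bullet> \<xi>) = (\<Prod>b\<in>Basis. ?g b (x \<bullet> b))" for x :: 'a
  proof -
    have "- (s * norm x)\<^sup>2 / 2 = (\<Sum>b\<in>Basis. - (s * (x \<bullet> b))\<^sup>2 / 2)"
      by (simp add: power_mult_distrib nsq sum_distrib_left sum_negf sum_divide_distrib)
    then have "gauss s x = (\<Prod>b\<in>Basis. exp (- (s * (x \<bullet> b))\<^sup>2 / 2))"
      by (simp add: gauss_def exp_sum)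
    moreover have "x \<bullet> \<xi> = (\<Sum>b\<in>Basis. (x \<bullet> b) * (\<xi> \<bullet> b))" by (rule euclidean_inner)
    ultimately show ?thesis by (simp add: cis_sum prod.distrib)
  qed
  \<comment> \<open>A function that is not integrable has integral 0 by convention, but the value
    computed above is nonzero.\<close>
  have "integrable lborel (?g b)" for b :: 'a
  proof (rule ccontr)
    assume n: "\<not> integrable lborel (?g b)"
    show False using not_integrable_integral_eq[OF n] s unfolding gauss_integral_real[OF s] by simp
  qed
  then have "(\<integral>f. (\<Prod>b\<in>Basis. ?g b (f b)) \<partial>(\<Pi>\<^sub>M b\<in>(Basis::'a set). lborel)) = (\<Prod>b\<in>Basis. \<integral>x. ?g b x \<partial>lborel)"
    by (intro product_integral_prod) auto
  also have "\<dots> = (\<Prod>b\<in>Basis. complex_of_real (sqrt (2 * pi) / s * exp (- ((\<xi> \<bullet> b) / s)\<^sup>2 / 2)))"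
    by (intro prod.cong refl gauss_integral_real s)
  also have "\<dots> = complex_of_real (\<Prod>b\<in>Basis. sqrt (2 * pi) / s * exp (- ((\<xi> \<bullet> b) / s)\<^sup>2 / 2))"
    by (rule of_real_prod[symmetric])
  also have "(\<Prod>b\<in>Basis. sqrt (2 * pi) / s * exp (- ((\<xi> \<bullet> b) / s)\<^sup>2 / 2)) = (sqrt (2 * pi) / s) ^ DIM('a) * gauss (1 / s) \<xi>"
  proof -
    have "- ((1 / s) * norm \<xi>)\<^sup>2 / 2 = (\<Sum>b\<in>Basis. - ((\<xi> \<bullet> b) / s)\<^sup>2 / 2)"
      by (simp add: power_mult_distrib nsq sum_distrib_left sum_negf sum_divide_distrib power_divide)
    then have "gauss (1 / s) \<xi> = (\<Prod>b\<in>Basis. exp (- ((\<xi> \<bullet> b) / s)\<^sup>2 / 2))"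
      by (simp only: gauss_def exp_sum[OF finite_Basis])
    then show ?thesis by (simp only: prod.distrib prod_constant)
  qed
  finally have "(\<integral>f. (\<Prod>b\<in>Basis. ?g b (?X f \<bullet> b)) \<partial>(\<Pi>\<^sub>M b\<in>(Basis::'a set). lborel))
    = complex_of_real ((sqrt (2 * pi) / s) ^ DIM('a) * gauss (1 / s) \<xi>)"
    by (simp add: Xb cong: prod.cong)
  then have "(\<integral>f. complex_of_real (gauss s (?X f)) * cis (?X f \<bullet> \<xi>) \<partial>(\<Pi>\<^sub>M b\<in>(Basis::'a set). lborel))
    = complex_of_real ((sqrt (2 * pi) / s) ^ DIM('a) * gauss (1 / s) \<xi>)"
    by (simp only: split)
  moreover have "(\<lambda>x::'a. complex_of_real (gauss s x) * cis (x \<bullet> \<xi>)) \<in> borel_measurable borel"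
    unfolding cis_conv_exp by measurable
  ultimately show ?thesis
    by (subst lborel_eq) (subst integral_distr; simp)
qed

lemma gauss_integrable:
  assumes s: "s > 0" shows "integrable lborel (gauss s :: 'a::euclidean_space \<Rightarrow> real)"
proof -
  have "integrable lborel (\<lambda>x::'a. complex_of_real (gauss s x))"
  proof (rule ccontr)
    assume n: "\<not> integrable lborel (\<lambda>x::'a. complex_of_real (gauss s x))"
    show False using not_integrable_integral_eq[OF n] gauss_integral[OF s, of "0::'a"] s by (simp add: gauss_def)
  qed
  then show ?thesis using integrable_Re by force
qed

lemma gauss_integral_0: "(\<integral>x. gauss 1 (x::'a::euclidean_space) \<partial>lborel) = sqrt (2 * pi) ^ DIM('a)"
proof -
  have "complex_of_real (\<integral>x. gauss 1 (x::'a) \<partial>lborel) = complex_of_real (sqrt (2 * pi) ^ DIM('a))"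
    using gauss_integral[of 1 "0::'a"] by (simp add: gauss_def)
  then show ?thesis by (simp only: of_real_eq_iff)
qed

section \<open>Two uses of Fubini's theorem\<close>

lemma integrable_prod_lborel:
  fixes g :: "'a::euclidean_space \<Rightarrow> complex" and h :: "'b::euclidean_space \<Rightarrow> complex"
  assumes g: "integrable lborel g" and h: "integrable lborel h"
  shows "integrable lborel (\<lambda>z. g (fst z) * h (snd z))"
    and "(\<integral>z. g (fst z) * h (snd z) \<partial>lborel) = (\<integral>x. g x \<partial>lborel) * (\<integral>x. h x \<partial>lborel)"
proof -
  have [measurable]: "g \<in> borel_measurable borel" "h \<in> borel_measurable borel"
    using g h by (auto dest: borel_measurable_integrable)
  have i: "integrable (lborel \<Otimes>\<^sub>M lborel) (\<lambda>z. g (fst z) * h (snd z))"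
  proof (rule lborel_pair.Fubini_integrable)
    show "integrable lborel (\<lambda>x. \<integral>y. norm (g (fst (x, y)) * h (snd (x, y))) \<partial>lborel)"
      using g by (simp add: norm_mult)
    show "AE x in lborel. integrable lborel (\<lambda>y. g (fst (x, y)) * h (snd (x, y)))" using h by simp
  qed simp
  then show "integrable lborel (\<lambda>z. g (fst z) * h (snd z))" by (simp add: lborel_prod)
  have "(\<integral>x. (\<integral>y. g (fst (x, y)) * h (snd (x, y)) \<partial>lborel) \<partial>lborel) = (\<integral>z. g (fst z) * h (snd z) \<partial>(lborel \<Otimes>\<^sub>M lborel))"
    by (rule lborel_pair.integral_fst'[OF i])
  then show "(\<integral>z. g (fst z) * h (snd z) \<partial>lborel) = (\<integral>x. g x \<partial>lborel) * (\<integral>x. h x \<partial>lborel)"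
    by (simp add: lborel_prod)
qed

lemma integral_swap_kernel:
  fixes G :: "'a::euclidean_space \<Rightarrow> complex" and W :: "'b::euclidean_space \<Rightarrow> complex"
  assumes G: "integrable lborel G" and W: "integrable lborel W"
    and k: "(\<lambda>(y, z). k y z) \<in> borel_measurable borel"
    and k1: "\<And>y z. cmod (k y z) \<le> 1"
  shows "(\<integral>y. W y * (\<integral>z. k y z * G z \<partial>lborel) \<partial>lborel) = (\<integral>z. (\<integral>y. W y * k y z \<partial>lborel) * G z \<partial>lborel)"
    and "integrable lborel (\<lambda>y. W y * (\<integral>z. k y z * G z \<partial>lborel))"
proof -
  have [measurable]: "G \<in> borel_measurable borel" "W \<in> borel_measurable borel"
    using G W by (auto dest: borel_measurable_integrable)
  have [measurable]: "(\<lambda>(y, z). k y z) \<in> borel_measurable (lborel \<Otimes>\<^sub>M lborel)"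
    using k by (simp add: lborel_prod)
  have i: "integrable (lborel \<Otimes>\<^sub>M lborel) (\<lambda>(y, z). W y * k y z * G z)"
  proof (rule Bochner_Integration.integrable_bound)
    show "integrable (lborel \<Otimes>\<^sub>M lborel) (\<lambda>p. W (fst p) * G (snd p))"
      using integrable_prod_lborel(1)[OF W G] by (simp add: lborel_prod)
    show "AE p in lborel \<Otimes>\<^sub>M lborel. norm (case p of (y, z) \<Rightarrow> W y * k y z * G z) \<le> norm (W (fst p) * G (snd p))"
    proof (intro AE_I2, clarify)
      fix y z
      have "norm (W y) * norm (k y z) * norm (G z) \<le> norm (W y) * 1 * norm (G z)"
        by (intro mult_right_mono mult_left_mono k1) auto
      then show "norm (W y * k y z * G z) \<le> norm (W (fst (y, z)) * G (snd (y, z)))" by (simp add: norm_mult)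
    qed
  qed measurable
  have "(\<integral>z. (\<integral>y. W y * k y z * G z \<partial>lborel) \<partial>lborel) = (\<integral>y. (\<integral>z. W y * k y z * G z \<partial>lborel) \<partial>lborel)"
    by (rule lborel_pair.Fubini_integral[OF i])
  moreover have "(\<integral>y. W y * k y z * G z \<partial>lborel) = (\<integral>y. W y * k y z \<partial>lborel) * G z" for z
    by (rule integral_mult_left_zero)
  moreover have "(\<integral>z. W y * k y z * G z \<partial>lborel) = W y * (\<integral>z. k y z * G z \<partial>lborel)" for y
    by (simp add: mult.assoc)
  ultimately show "(\<integral>y. W y * (\<integral>z. k y z * G z \<partial>lborel) \<partial>lborel) = (\<integral>z. (\<integral>y. W y * k y z \<partial>lborel) * G z \<partial>lborel)"
    by simp
  show "integrable lborel (\<lambda>y. W y * (\<integral>z. k y z * G z \<partial>lborel))"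
    using lborel_pair.integrable_fst'[OF i] by (simp add: mult.assoc)
qed

text \<open>Expanding the square and integrating the weight \<open>w\<close> against the two kernels
  before anything else is the device behind both Plancherel's theorem and local smoothing: in both,
  that inner integral is an explicit Gaussian.\<close>

lemma integral_square_kernel:
  fixes f :: "'a::euclidean_space \<Rightarrow> complex" and w :: "'b::euclidean_space \<Rightarrow> real"
  assumes f: "integrable lborel f" and w: "integrable lborel w"
    and k: "(\<lambda>(y, x). k y x) \<in> borel_measurable borel"
    and k1: "\<And>y x. cmod (k y x) \<le> 1"
  shows "complex_of_real (\<integral>y. w y * (cmod (\<integral>x. k y x * f x \<partial>lborel))\<^sup>2 \<partial>lborel)
    = (\<integral>z. (\<integral>y. w y * (k y (fst z) * cnj (k y (snd z))) \<partial>lborel) * (f (fst z) * cnj (f (snd z))) \<partial>lborel)"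
    and "integrable lborel (\<lambda>y. w y * (cmod (\<integral>x. k y x * f x \<partial>lborel))\<^sup>2)"
proof -
  have [measurable]: "f \<in> borel_measurable borel" "w \<in> borel_measurable borel"
    using f w by (auto dest: borel_measurable_integrable)
  have fi: "integrable lborel (\<lambda>x. k y x * f x)" for y
  proof (rule Bochner_Integration.integrable_bound[OF f])
    have "(\<lambda>x. k y x) \<in> borel_measurable borel"
      using measurable_compose[OF borel_measurable_continuous_onI k, of "\<lambda>x. (y, x)"]
      by (simp add: continuous_on_Pair)
    then show "(\<lambda>x. k y x * f x) \<in> borel_measurable lborel" by simp
    show "AE x in lborel. norm (k y x * f x) \<le> norm (f x)"
      by (intro AE_I2) (simp add: norm_mult mult_left_le_one_le k1)
  qed
  have ci: "integrable lborel (\<lambda>x. cnj (k y x * f x))" for y by (rule integrable_cnj[OF fi])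
  have G: "integrable lborel (\<lambda>z. f (fst z) * cnj (f (snd z)))"
    using integrable_prod_lborel(1)[OF f, of "\<lambda>x. cnj (f x)"] f by simp
  have W: "integrable lborel (\<lambda>y. complex_of_real (w y))" using w by simp
  have K: "(\<lambda>(y, z). k y (fst z) * cnj (k y (snd z))) \<in> borel_measurable borel"
  proof -
    have "(\<lambda>p. (fst p, fst (snd p))) \<in> borel \<rightarrow>\<^sub>M (borel :: ('b \<times> 'a) measure)"
      "(\<lambda>p. (fst p, snd (snd p))) \<in> borel \<rightarrow>\<^sub>M (borel :: ('b \<times> 'a) measure)"
      by (intro borel_measurable_continuous_onI continuous_intros)+
    from measurable_compose[OF this(1) k] measurable_compose[OF measurable_compose[OF this(2) k] borel_measurable_cnj]
    show ?thesis unfolding case_prod_beta fst_conv snd_conv by (rule borel_measurable_times)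
  qed
  have K1: "cmod (k y (fst z) * cnj (k y (snd z))) \<le> 1" for y z
    by (simp add: norm_mult mult_le_one k1)
  have eq: "(\<integral>z. k y (fst z) * cnj (k y (snd z)) * (f (fst z) * cnj (f (snd z))) \<partial>lborel)
      = complex_of_real ((cmod (\<integral>x. k y x * f x \<partial>lborel))\<^sup>2)" for y
  proof -
    have "(\<integral>z. k y (fst z) * cnj (k y (snd z)) * (f (fst z) * cnj (f (snd z))) \<partial>lborel)
      = (\<integral>z. (k y (fst z) * f (fst z)) * cnj (k y (snd z) * f (snd z)) \<partial>lborel)"
      by (intro Bochner_Integration.integral_cong) auto
    also have "\<dots> = (\<integral>x. k y x * f x \<partial>lborel) * (\<integral>x. cnj (k y x * f x) \<partial>lborel)"
      by (rule integrable_prod_lborel(2)[OF fi ci])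
    also have "(\<integral>x. cnj (k y x * f x) \<partial>lborel) = cnj (\<integral>x. k y x * f x \<partial>lborel)"
      by (rule integral_bounded_linear[OF bounded_linear_cnj fi])
    finally show ?thesis by (simp only: complex_norm_square)
  qed
  note * = integral_swap_kernel[OF G W K K1, unfolded eq of_real_mult[symmetric] integral_complex_of_real]
  show "complex_of_real (\<integral>y. w y * (cmod (\<integral>x. k y x * f x \<partial>lborel))\<^sup>2 \<partial>lborel)
    = (\<integral>z. (\<integral>y. w y * (k y (fst z) * cnj (k y (snd z))) \<partial>lborel) * (f (fst z) * cnj (f (snd z))) \<partial>lborel)"
    using *(1) by simp
  have "integrable lborel (\<lambda>y. complex_of_real (w y * (cmod (\<integral>x. k y x * f x \<partial>lborel))\<^sup>2))"
    using *(2) by simp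
  then show "integrable lborel (\<lambda>y. w y * (cmod (\<integral>x. k y x * f x \<partial>lborel))\<^sup>2)"
    using integrable_Re by force
qed

section \<open>Continuity of translations in the mean\<close>

lemma integral_translate:
  fixes f :: "'a::euclidean_space \<Rightarrow> 'b::{banach,second_countable_topology}"
  assumes [measurable]: "f \<in> borel_measurable borel"
  shows "(\<integral>x. f (x + h) \<partial>lborel) = (\<integral>x. f x \<partial>lborel)"
    and "integrable lborel (\<lambda>x. f (x + h)) \<longleftrightarrow> integrable lborel f"
proof -
  have "(\<integral>x. f x \<partial>distr lborel borel ((+) h)) = (\<integral>x. f (h + x) \<partial>lborel)"
    by (intro integral_distr) auto
  then show "(\<integral>x. f (x + h) \<partial>lborel) = (\<integral>x. f x \<partial>lborel)" by (simp add: lborel_distr_plus add.commute)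
  have "integrable (distr lborel borel ((+) h)) f \<longleftrightarrow> integrable lborel (\<lambda>x. f (h + x))"
    by (intro integrable_distr_eq) auto
  then show "integrable lborel (\<lambda>x. f (x + h)) \<longleftrightarrow> integrable lborel f"
    by (simp add: lborel_distr_plus add.commute)
qed

lemma integrable_translate:
  fixes f :: "'a::euclidean_space \<Rightarrow> 'b::{banach,second_countable_topology}"
  assumes "integrable lborel f" shows "integrable lborel (\<lambda>x. f (x + h))"
  using integral_translate(2)[of f h] borel_measurable_integrable[OF assms] assms by simp

text \<open>For an indicator u the modulus of the difference is u(x+h) + u(x) - 2 u(x+h) u(x), and
  openness of \<open>U\<close> makes the product converge pointwise.\<close>

lemma translate_open:
  fixes U :: "'a::euclidean_space set"
  assumes U: "open U" "emeasure lborel U < \<infinity>" and h: "h \<longlonglongrightarrow> (0::'a)"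
  shows "(\<lambda>n. \<integral>x. \<bar>indicator U (x + h n) - indicator U x :: real\<bar> \<partial>lborel) \<longlonglongrightarrow> 0"
proof -
  let ?u = "indicator U :: 'a \<Rightarrow> real"
  have [measurable]: "U \<in> sets borel" using U by simp
  have i: "integrable lborel ?u" using U by (intro integrable_real_indicator) auto
  have p: "integrable lborel (\<lambda>x. ?u (x + h n) * ?u x)" for n
    by (rule Bochner_Integration.integrable_bound[OF i]) (auto simp: indicator_def)
  have "(\<integral>x. \<bar>?u (x + h n) - ?u x\<bar> \<partial>lborel) = (\<integral>x. ?u (x + h n) + ?u x - 2 * (?u (x + h n) * ?u x) \<partial>lborel)" for n
    by (intro Bochner_Integration.integral_cong) (auto simp: indicator_def)
  also have "\<dots> n = 2 * (\<integral>x. ?u x \<partial>lborel) - 2 * (\<integral>x. ?u (x + h n) * ?u x \<partial>lborel)" for n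
    using i p[of n] integrable_translate[OF i, of "h n"] integral_translate(1)[of ?u "h n"] by simp
  finally have eq: "(\<integral>x. \<bar>?u (x + h n) - ?u x\<bar> \<partial>lborel) = 2 * (\<integral>x. ?u x \<partial>lborel) - 2 * (\<integral>x. ?u (x + h n) * ?u x \<partial>lborel)" for n .
  have "(\<lambda>n. \<integral>x. ?u (x + h n) * ?u x \<partial>lborel) \<longlonglongrightarrow> (\<integral>x. ?u x \<partial>lborel)"
  proof (rule integral_dominated_convergence[where w = ?u])
    show "AE x in lborel. (\<lambda>n. ?u (x + h n) * ?u x) \<longlonglongrightarrow> ?u x"
    proof (intro AE_I2)
      fix x show "(\<lambda>n. ?u (x + h n) * ?u x) \<longlonglongrightarrow> ?u x"
      proof (cases "x \<in> U")
        case True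
        have "(\<lambda>n. x + h n) \<longlonglongrightarrow> x + 0" by (intro tendsto_intros h)
        then have "\<forall>\<^sub>F n in sequentially. x + h n \<in> U" using True U(1) by (simp add: topological_tendstoD)
        then have "\<forall>\<^sub>F n in sequentially. ?u (x + h n) * ?u x = ?u x"
          by eventually_elim (simp add: True)
        then show ?thesis by (rule tendsto_eventually)
      qed simp
    qed
  qed (use i in \<open>auto simp: indicator_def\<close>)
  then have "(\<lambda>n. 2 * (\<integral>x. ?u x \<partial>lborel) - 2 * (\<integral>x. ?u (x + h n) * ?u x \<partial>lborel)) \<longlonglongrightarrow> 2 * (\<integral>x. ?u x \<partial>lborel) - 2 * (\<integral>x. ?u x \<partial>lborel)"
    by (intro tendsto_intros)
  then show ?thesis unfolding eq by simp
qed

lemma tendsto_0_by_approx: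
  fixes a :: "nat \<Rightarrow> real"
  assumes "\<And>n. 0 \<le> a n" "\<And>e. e > 0 \<Longrightarrow> \<exists>b. b \<longlonglongrightarrow> 0 \<and> (\<forall>n. a n \<le> b n + e)"
  shows "a \<longlonglongrightarrow> 0"
proof (rule LIMSEQ_I)
  fix e :: real assume e: "e > 0"
  then have "e / 2 > 0" by simp
  from assms(2)[OF this] obtain b where b: "b \<longlonglongrightarrow> 0" "\<forall>n. a n \<le> b n + e/2" by blast
  obtain N where N: "\<forall>n\<ge>N. norm (b n - 0) < e/2" using LIMSEQ_D[OF b(1) \<open>e / 2 > 0\<close>] by blast
  have "norm (a n - 0) < e" if "n \<ge> N" for n
  proof -
    have "\<bar>b n\<bar> < e/2" using N that by auto
    then show ?thesis using b(2)[rule_format, of n] assms(1)[of n] by simp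
  qed
  then show "\<exists>N. \<forall>n\<ge>N. norm (a n - 0) < e" by blast
qed

text \<open>Induction over integrable functions; outer regularity reduces a measurable set to an
  open one at the cost of the small set \<open>U - A\<close>.\<close>

lemma translate_continuous:
  fixes f :: "'a::euclidean_space \<Rightarrow> 'b::{banach,second_countable_topology}"
  assumes f: "integrable lborel f" and h: "h \<longlonglongrightarrow> (0::'a)"
  shows "(\<lambda>n. \<integral>x. norm (f (x + h n) - f x) \<partial>lborel) \<longlonglongrightarrow> 0"
  using f
proof (induction rule: integrable_induct)
  case (base A c)
  then have [measurable]: "A \<in> sets borel" by simp
  have "(\<lambda>n. \<integral>x. \<bar>indicator A (x + h n) - indicator A x :: real\<bar> \<partial>lborel) \<longlonglongrightarrow> 0"
  proof (rule tendsto_0_by_approx)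
    fix e :: real assume e: "e > 0"
    obtain U where U: "open U" "A \<subseteq> U" "emeasure lborel (U - A) < e/2"
      using outer_regular_lborel[of A "e/2"] e by auto
    have [measurable]: "U \<in> sets borel" using U by simp
    have "emeasure lborel U \<le> emeasure lborel A + emeasure lborel (U - A)"
      using emeasure_subadditive[of A lborel "U - A"] U(2) by (simp add: Un_absorb1)
    also have "\<dots> < \<infinity>" using base order.strict_trans[OF U(3), of \<infinity>] by (simp add: ennreal_add_less_top)
    finally have Uf: "emeasure lborel U < \<infinity>" .
    have UA: "integrable lborel (indicator (U - A) :: 'a \<Rightarrow> real)"
      using U(3) by (intro integrable_real_indicator) (auto intro: order.strict_trans)
    have iU: "integrable lborel (indicator U :: 'a \<Rightarrow> real)" and iA: "integrable lborel (indicator A :: 'a \<Rightarrow> real)"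
      using Uf base by (auto intro!: integrable_real_indicator)
    have m: "(\<integral>x. indicator (U - A) x \<partial>lborel) \<le> e/2"
    proof -
      have "measure lborel (U - A) \<le> e/2"
        unfolding measure_def using U(3) e by (intro enn2real_leI) (auto intro: less_imp_le)
      then show ?thesis by simp
    qed
    let ?b = "\<lambda>n. \<integral>x. \<bar>indicator U (x + h n) - indicator U x :: real\<bar> \<partial>lborel"
    have "(\<integral>x. \<bar>indicator A (x + h n) - indicator A x :: real\<bar> \<partial>lborel) \<le> ?b n + e" for n
    proof -
      have "(\<integral>x. \<bar>indicator A (x + h n) - indicator A x :: real\<bar> \<partial>lborel) \<le>
        (\<integral>x. \<bar>indicator U (x + h n) - indicator U x\<bar> + (indicator (U - A) (x + h n) + indicator (U - A) x) \<partial>lborel)"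
        using U(2) by (intro integral_mono Bochner_Integration.integrable_add integrable_abs Bochner_Integration.integrable_diff
          integrable_translate UA iU iA) (auto simp: indicator_def)
      also have "\<dots> = ?b n + ((\<integral>x. indicator (U - A) x \<partial>lborel) + (\<integral>x. indicator (U - A) x \<partial>lborel))"
        using UA iU integrable_translate[OF UA, of "h n"] integrable_translate[OF iU, of "h n"]
          integral_translate(1)[of "indicator (U - A) :: 'a \<Rightarrow> real" "h n"] by simp
      finally show ?thesis using m by simp
    qed
    then show "\<exists>b. b \<longlonglongrightarrow> 0 \<and> (\<forall>n. (\<integral>x. \<bar>indicator A (x + h n) - indicator A x :: real\<bar> \<partial>lborel) \<le> b n + e)"
      using translate_open[OF U(1) Uf h] by blast
  qed (rule integral_nonneg_AE, simp)
  from tendsto_mult_right[OF this, of "norm c"]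
  have "(\<lambda>n. (\<integral>x. \<bar>indicator A (x + h n) - indicator A x :: real\<bar> \<partial>lborel) * norm c) \<longlonglongrightarrow> 0" by simp
  moreover have "(\<integral>x. \<bar>indicator A (x + h n) - indicator A x :: real\<bar> \<partial>lborel) * norm c
    = (\<integral>x. norm (indicator A (x + h n) *\<^sub>R c - indicator A x *\<^sub>R c) \<partial>lborel)" for n
    by (subst integral_mult_left_zero[symmetric]) (simp add: scaleR_left_diff_distrib[symmetric])
  ultimately show ?case by simp
next
  case (add f g)
  have "(\<lambda>n. (\<integral>x. norm (f (x + h n) - f x) \<partial>lborel) + (\<integral>x. norm (g (x + h n) - g x) \<partial>lborel)) \<longlonglongrightarrow> 0 + 0"
    by (intro tendsto_add add)
  then have lim0: "(\<lambda>n. (\<integral>x. norm (f (x + h n) - f x) \<partial>lborel) + (\<integral>x. norm (g (x + h n) - g x) \<partial>lborel)) \<longlonglongrightarrow> 0" by simp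
  show ?case
  proof (rule Lim_null_comparison[OF _ lim0])
    have "(\<integral>x. norm (f (x + h n) + g (x + h n) - (f x + g x)) \<partial>lborel)
      \<le> (\<integral>x. norm (f (x + h n) - f x) + norm (g (x + h n) - g x) \<partial>lborel)" for n
      using add by (intro integral_mono Bochner_Integration.integrable_add integrable_norm Bochner_Integration.integrable_diff integrable_translate)
        (auto intro: norm_diff_triangle_ineq)
    also have "\<dots> n = (\<integral>x. norm (f (x + h n) - f x) \<partial>lborel) + (\<integral>x. norm (g (x + h n) - g x) \<partial>lborel)" for n
      using add by (intro Bochner_Integration.integral_add integrable_norm Bochner_Integration.integrable_diff integrable_translate)
    finally show "\<forall>\<^sub>F n in sequentially. norm (\<integral>x. norm (f (x + h n) + g (x + h n) - (f x + g x)) \<partial>lborel)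
      \<le> (\<integral>x. norm (f (x + h n) - f x) \<partial>lborel) + (\<integral>x. norm (g (x + h n) - g x) \<partial>lborel)" by simp
  qed
next
  case (lim f s)
  have sf: "(\<lambda>i. \<integral>x. norm (s i x - f x) \<partial>lborel) \<longlonglongrightarrow> (\<integral>x. norm (0::'b) \<partial>(lborel :: 'a measure))"
  proof (rule integral_dominated_convergence[where w = "\<lambda>x. 3 * norm (f x)"])
    show "AE x in lborel. (\<lambda>i. norm (s i x - f x)) \<longlonglongrightarrow> norm (0::'b)"
      using tendsto_norm[OF tendsto_diff[OF lim.hyps(2) tendsto_const]] by (intro AE_I2) (metis diff_self space_lborel UNIV_I)
    show "AE x in lborel. norm (norm (s i x - f x)) \<le> 3 * norm (f x)" for i
    proof (intro AE_I2)
      fix x show "norm (norm (s i x - f x)) \<le> 3 * norm (f x)"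
        using norm_triangle_ineq4[of "s i x" "f x"] lim.hyps(3)[of x i] by simp
    qed
    show "(\<lambda>x. norm (s i x - f x)) \<in> borel_measurable lborel" for i using lim by (auto dest: borel_measurable_integrable)
  qed (use lim in auto)
  show ?case
  proof (rule tendsto_0_by_approx)
    fix e :: real assume e: "e > 0"
    obtain i where i: "(\<integral>x. norm (s i x - f x) \<partial>lborel) < e/2"
      using LIMSEQ_D[OF sf, of "e/2"] e by (auto simp: abs_less_iff)
    let ?d = "\<lambda>x. s i x - f x"
    have d: "integrable lborel ?d" using lim by auto
    let ?b = "\<lambda>n. \<integral>x. norm (s i (x + h n) - s i x) \<partial>lborel"
    have "(\<integral>x. norm (f (x + h n) - f x) \<partial>lborel) \<le> ?b n + e" for n
    proof -
      have "(\<integral>x. norm (f (x + h n) - f x) \<partial>lborel) \<le>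
        (\<integral>x. norm (s i (x + h n) - s i x) + (norm (?d (x + h n)) + norm (?d x)) \<partial>lborel)"
      proof (intro integral_mono Bochner_Integration.integrable_add integrable_norm Bochner_Integration.integrable_diff integrable_translate[of ?d, simplified] integrable_translate[of f] integrable_translate[of "s i"])
        show "norm (f (x + h n) - f x) \<le> norm (s i (x + h n) - s i x) + (norm (?d (x + h n)) + norm (?d x))" for x
          using norm_triangle_ineq4[of "s i (x + h n) - s i x" "?d (x + h n) - ?d x"]
            norm_triangle_ineq4[of "?d (x + h n)" "?d x"] by (simp add: algebra_simps)
      qed (use lim d in auto)
      also have "\<dots> = ?b n + ((\<integral>x. norm (?d (x + h n)) \<partial>lborel) + (\<integral>x. norm (?d x) \<partial>lborel))"
        using d lim integrable_translate[OF d, of "h n"] integrable_translate[OF lim.hyps(1)[of i], of "h n"] by simp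
      also have "(\<integral>x. norm (?d (x + h n)) \<partial>lborel) = (\<integral>x. norm (?d x) \<partial>lborel)"
        using d integral_translate(1)[of "\<lambda>x. norm (?d x)" "h n"] by (auto dest: borel_measurable_integrable)
      finally show ?thesis using i by simp
    qed
    then show "\<exists>b. b \<longlonglongrightarrow> 0 \<and> (\<forall>n. (\<integral>x. norm (f (x + h n) - f x) \<partial>lborel) \<le> b n + e)"
      using lim.IH[of i] by blast
  qed (rule integral_nonneg_AE, simp)
qed

section \<open>Plancherel's theorem\<close>

text \<open>No normalising constant is included, to keep the Gaussian computations free of it;
  \<open>cft\<close> carries the unitary one.\<close>

definition ft :: "real \<Rightarrow> ('a::euclidean_space \<Rightarrow> complex) \<Rightarrow> 'a \<Rightarrow> complex" where
  "ft \<sigma> f \<xi> = (\<integral>x. cis (\<sigma> * (x \<bullet> \<xi>)) * f x \<partial>lborel)"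

lemma four_const: "(2 * pi) powr (- real n / 2) * sqrt (2 * pi) ^ n = 1"
proof -
  have "(2 * pi) powr (real n / 2) = ((2 * pi) powr (1/2)) powr real n" by (simp add: powr_powr)
  also have "\<dots> = sqrt (2 * pi) ^ n" by (simp add: powr_half_sqrt powr_realpow)
  finally show ?thesis by (simp add: powr_minus field_simps)
qed

lemma cis_measurable [measurable]: "cis \<in> borel_measurable borel"
  unfolding cis_conv_exp by measurable

lemma fourier_kernel_measurable: "(\<lambda>(y, x). cis (\<sigma> * (x \<bullet> y))) \<in> borel_measurable borel"
  unfolding case_prod_beta cis_conv_exp
  by (intro borel_measurable_continuous_onI continuous_intros)

lemma ft_measurable:
  fixes f :: "'a::euclidean_space \<Rightarrow> complex"
  assumes [measurable]: "f \<in> borel_measurable borel"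
  shows "ft \<sigma> f \<in> borel_measurable borel"
proof -
  have "(\<lambda>\<xi>. \<integral>x. cis (\<sigma> * (x \<bullet> \<xi>)) * f x \<partial>lborel) \<in> borel_measurable lborel" by measurable
  then show ?thesis by (simp add: ft_def[abs_def])
qed

lemma ft_integrable:
  fixes f :: "'a::euclidean_space \<Rightarrow> complex"
  assumes f: "integrable lborel f"
  shows "integrable lborel (\<lambda>x. cis (\<sigma> * (x \<bullet> \<xi>)) * f x)"
proof (rule Bochner_Integration.integrable_bound[OF f])
  show "(\<lambda>x. cis (\<sigma> * (x \<bullet> \<xi>)) * f x) \<in> borel_measurable lborel"
    using borel_measurable_integrable[OF f] by measurable
qed (simp add: norm_mult)

lemma integral_affine:
  fixes f :: "'a::euclidean_space \<Rightarrow> complex"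
  assumes [measurable]: "f \<in> borel_measurable borel" and s: "s > 0"
  shows "(\<integral>x. f x \<partial>lborel) = complex_of_real (s ^ DIM('a)) * (\<integral>h. f (a + s *\<^sub>R h) \<partial>lborel)"
  using s by (subst lborel_affine[of s a])
    (simp_all add: integral_density integral_distr scaleR_conv_of_real)

text \<open>Square integrability of the transform is not known beforehand, so its square is weighted
  by a wide Gaussian. The transform of that weight is a narrow Gaussian, which acts as an
  approximate identity on the autocorrelation \<open>A\<close> of \<open>f\<close>, and the limit
  picks out \<open>A 0\<close>. Boundedness of \<open>f\<close> makes \<open>A\<close> bounded and
  continuous at 0.\<close>

lemma ft_isometry_bounded:
  fixes f :: "'a::euclidean_space \<Rightarrow> complex"
  assumes f: "integrable lborel f" and B: "\<And>x. cmod (f x) \<le> B" and \<sigma>: "\<bar>\<sigma>\<bar> = 1"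
  shows "(\<integral>\<^sup>+\<xi>. ennreal ((cmod (ft \<sigma> f \<xi>))\<^sup>2) \<partial>lborel)
    = ennreal ((sqrt (2 * pi) ^ DIM('a))\<^sup>2 * (\<integral>x. (cmod (f x))\<^sup>2 \<partial>lborel))"
proof -
  have [measurable]: "f \<in> borel_measurable borel" using f by (auto dest: borel_measurable_integrable)
  let ?\<kappa> = "sqrt (2 * pi) ^ DIM('a)"
  have B0: "0 \<le> B" using B[of 0] norm_ge_zero order_trans by blast
  define A where "A v = (\<integral>a. f a * cnj (f (a + v)) \<partial>lborel)" for v
  define I where "I n = (\<integral>\<xi>. gauss (1 / real (Suc n)) \<xi> * (cmod (ft \<sigma> f \<xi>))\<^sup>2 \<partial>lborel)" for n
  have Ai: "integrable lborel (\<lambda>a. f a * cnj (f (a + v)))" for v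
  proof (rule Bochner_Integration.integrable_bound)
    show "integrable lborel (\<lambda>a. B * cmod (f a))" using f by simp
    show "AE a in lborel. norm (f a * cnj (f (a + v))) \<le> norm (B * cmod (f a))"
      using B0 mult_right_mono[OF B norm_ge_zero] by (intro AE_I2) (simp add: norm_mult mult.commute)
  qed measurable
  have A_le: "cmod (A v) \<le> B * (\<integral>a. cmod (f a) \<partial>lborel)" for v
  proof -
    have "cmod (A v) \<le> (\<integral>a. B * cmod (f a) \<partial>lborel)" unfolding A_def
      using f mult_right_mono[OF B norm_ge_zero] by (intro norm_integral_le Ai) (simp_all add: norm_mult mult.commute)
    then show ?thesis by simp
  qed
  have A0: "A 0 = complex_of_real (\<integral>x. (cmod (f x))\<^sup>2 \<partial>lborel)"
  proof -
    have "f a * cnj (f (a + 0)) = complex_of_real ((cmod (f a))\<^sup>2)" for a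
      by (simp only: complex_norm_square add_0_right)
    then show ?thesis unfolding A_def by (simp only: integral_complex_of_real)
  qed
  have Alim: "(\<lambda>n. A (v n)) \<longlonglongrightarrow> A 0" if v: "v \<longlonglongrightarrow> 0" for v
  proof -
    have "cmod (A (v n) - A 0) \<le> B * (\<integral>a. cmod (f (a + v n) - f a) \<partial>lborel)" for n
    proof -
      have "A (v n) - A 0 = (\<integral>a. f a * cnj (f (a + v n)) - f a * cnj (f (a + 0)) \<partial>lborel)"
        unfolding A_def by (intro Bochner_Integration.integral_diff[symmetric] Ai)
      also have "cmod \<dots> \<le> (\<integral>a. B * cmod (f (a + v n) - f a) \<partial>lborel)"
      proof (intro norm_integral_le Bochner_Integration.integrable_diff Ai)
        show "integrable lborel (\<lambda>a. B * cmod (f (a + v n) - f a))"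
          using f integrable_translate[OF f, of "v n"] by simp
        show "cmod (f a * cnj (f (a + v n)) - f a * cnj (f (a + 0))) \<le> B * cmod (f (a + v n) - f a)" for a
        proof -
          have "f a * cnj (f (a + v n)) - f a * cnj (f (a + 0)) = f a * cnj (f (a + v n) - f a)"
            by (simp add: algebra_simps)
          then show ?thesis using B by (simp add: norm_mult mult_right_mono del: complex_cnj_diff)
        qed
      qed
      finally show ?thesis by simp
    qed
    then have le: "\<forall>\<^sub>F n in sequentially. cmod (A (v n) - A 0) \<le> B * (\<integral>a. cmod (f (a + v n) - f a) \<partial>lborel)"
      by (intro always_eventually allI)
    have "(\<lambda>n. B * (\<integral>a. cmod (f (a + v n) - f a) \<partial>lborel)) \<longlonglongrightarrow> B * 0"
      by (intro tendsto_mult_left translate_continuous f v)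
    then have "(\<lambda>n. A (v n) - A 0) \<longlonglongrightarrow> 0"
      by (intro Lim_null_comparison[OF le]) simp
    then show ?thesis by (rule LIM_zero_cancel)
  qed
  have I_eq: "complex_of_real (I n) = complex_of_real ?\<kappa> * (\<integral>h. complex_of_real (gauss 1 h) * A ((1 / real (Suc n)) *\<^sub>R h) \<partial>lborel)" for n
  proof -
    define s where "s = 1 / real (Suc n)"
    have s: "s > 0" by (simp add: s_def)
    \<comment> \<open>\<open>K\<close> is the constant in the transform of \<open>gauss s\<close>.
      The substitution x' = a + s h contributes \<open>s ^ DIM('a)\<close>, which cancels the power
      of \<open>s\<close> in \<open>K\<close> and leaves \<open>?\<kappa>\<close>.\<close>
    define K where "K = (sqrt (2 * pi) / s) ^ DIM('a)"
    have inner: "(\<integral>y. complex_of_real (gauss s y) * (cis (\<sigma> * (x \<bullet> y)) * cnj (cis (\<sigma> * (x' \<bullet> y)))) \<partial>lborel)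
      = complex_of_real (K * gauss (1 / s) (x - x'))" for x x' :: 'a
    proof -
      have "(\<integral>y. complex_of_real (gauss s y) * (cis (\<sigma> * (x \<bullet> y)) * cnj (cis (\<sigma> * (x' \<bullet> y)))) \<partial>lborel)
        = (\<integral>y. complex_of_real (gauss s y) * cis (y \<bullet> (\<sigma> *\<^sub>R (x - x'))) \<partial>lborel)"
        by (intro Bochner_Integration.integral_cong) (auto simp: cis_cnj cis_mult algebra_simps inner_commute)
      also have "\<dots> = complex_of_real (K * gauss (1 / s) (\<sigma> *\<^sub>R (x - x')))"
        unfolding K_def by (rule gauss_integral[OF s])
      also have "gauss (1 / s) (\<sigma> *\<^sub>R (x - x')) = gauss (1 / s) (x - x')" by (simp add: gauss_def \<sigma>)
      finally show ?thesis .
    qed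
    let ?G = "\<lambda>z. complex_of_real (K * gauss (1 / s) (fst z - snd z)) * (f (fst z) * cnj (f (snd z)))"
    let ?H = "\<lambda>a h. complex_of_real (gauss 1 h) * (f a * cnj (f (a + s *\<^sub>R h)))"
    have Gi: "integrable (lborel \<Otimes>\<^sub>M lborel) ?G"
    proof (rule Bochner_Integration.integrable_bound)
      show "integrable (lborel \<Otimes>\<^sub>M lborel) (\<lambda>z. complex_of_real K * (f (fst z) * cnj (f (snd z))))"
        using integrable_prod_lborel(1)[OF f integrable_cnj[OF f]] by (simp add: lborel_prod)
      show "AE z in lborel \<Otimes>\<^sub>M lborel. norm (?G z) \<le> norm (complex_of_real K * (f (fst z) * cnj (f (snd z))))"
      proof (intro AE_I2)
        fix z :: "'a \<times> 'a"
        let ?C = "\<bar>K\<bar> * (cmod (f (fst z)) * cmod (f (snd z)))"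
        have "norm (?G z) = ?C * gauss (1 / s) (fst z - snd z)"
          by (simp add: norm_mult abs_mult abs_of_pos[OF gauss_pos])
        also have "\<dots> \<le> ?C * 1" by (intro mult_left_mono gauss_le_1) auto
        finally show "norm (?G z) \<le> norm (complex_of_real K * (f (fst z) * cnj (f (snd z))))"
          by (simp add: norm_mult)
      qed
    qed (simp, measurable)
    have Hi: "integrable (lborel \<Otimes>\<^sub>M lborel) (\<lambda>(a, h). ?H a h)"
    proof (rule Bochner_Integration.integrable_bound)
      have "integrable lborel (\<lambda>z. f (fst z) * complex_of_real (gauss 1 (snd z :: 'a)))"
        using gauss_integrable[of 1, where 'a = 'a] by (intro integrable_prod_lborel(1)[OF f]) simp
      then show "integrable (lborel \<Otimes>\<^sub>M lborel) (\<lambda>z. complex_of_real B * (f (fst z) * complex_of_real (gauss 1 (snd z :: 'a))))"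
        by (simp add: lborel_prod)
      show "AE z in lborel \<Otimes>\<^sub>M lborel. norm (case z of (a, h) \<Rightarrow> ?H a h) \<le> norm (complex_of_real B * (f (fst z) * complex_of_real (gauss 1 (snd z))))"
      proof (intro AE_I2, clarify)
        fix a h :: 'a
        have "norm (?H a h) = (gauss 1 h * cmod (f a)) * cmod (f (a + s *\<^sub>R h))"
          using gauss_pos[of 1 h] by (simp add: norm_mult)
        also have "\<dots> \<le> (gauss 1 h * cmod (f a)) * B"
          using gauss_pos[of 1 h] by (intro mult_left_mono B) auto
        finally show "norm (?H a h) \<le> norm (complex_of_real B * (f (fst (a, h)) * complex_of_real (gauss 1 (snd (a, h)))))"
          using gauss_pos[of 1 h] B0 by (simp add: norm_mult mult_ac)
      qed
    qed measurable
    have "complex_of_real (I n) = (\<integral>z. ?G z \<partial>lborel)"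
      unfolding I_def s_def[symmetric] ft_def
      by (subst integral_square_kernel(1)[OF f gauss_integrable[OF s] fourier_kernel_measurable])
        (simp_all add: inner)
    also have "\<dots> = (\<integral>z. ?G z \<partial>(lborel \<Otimes>\<^sub>M lborel))" by (simp add: lborel_prod)
    also have "\<dots> = (\<integral>a. (\<integral>b. ?G (a, b) \<partial>lborel) \<partial>lborel)"
      by (rule lborel_pair.integral_fst'[OF Gi, symmetric])
    also have "\<dots> = (\<integral>a. complex_of_real ?\<kappa> * (\<integral>h. ?H a h \<partial>lborel) \<partial>lborel)"
    proof (intro Bochner_Integration.integral_cong refl)
      fix a :: 'a
      have g: "gauss (1 / s) (s *\<^sub>R h) = gauss 1 h" for h :: 'a using s by (simp add: gauss_def power_mult_distrib)
      have gm: "gauss (1 / s) (- v) = gauss (1 / s) v" for v :: 'a by (simp add: gauss_def)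
      have "(\<integral>b. ?G (a, b) \<partial>lborel) = complex_of_real (s ^ DIM('a)) * (\<integral>h. ?G (a, a + s *\<^sub>R h) \<partial>lborel)"
        by (rule integral_affine[OF _ s]) (simp only: fst_conv snd_conv, measurable)
      also have "(\<integral>h. ?G (a, a + s *\<^sub>R h) \<partial>lborel) = (\<integral>h. complex_of_real K * ?H a h \<partial>lborel)"
        by (intro Bochner_Integration.integral_cong) (auto simp: g gm)
      also have "\<dots> = complex_of_real K * (\<integral>h. ?H a h \<partial>lborel)" by simp
      finally show "(\<integral>b. ?G (a, b) \<partial>lborel) = complex_of_real ?\<kappa> * (\<integral>h. ?H a h \<partial>lborel)"
        using s by (simp add: K_def power_divide)
    qed
    also have "\<dots> = complex_of_real ?\<kappa> * (\<integral>a. (\<integral>h. ?H a h \<partial>lborel) \<partial>lborel)" by simp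
    also have "(\<integral>a. (\<integral>h. ?H a h \<partial>lborel) \<partial>lborel) = (\<integral>h. (\<integral>a. ?H a h \<partial>lborel) \<partial>lborel)"
      by (rule lborel_pair.Fubini_integral[OF Hi, symmetric])
    also have "\<dots> = (\<integral>h. complex_of_real (gauss 1 h) * A (s *\<^sub>R h) \<partial>lborel)" by (simp add: A_def)
    finally show ?thesis by (simp add: s_def)
  qed
  have "(\<lambda>n. \<integral>h. complex_of_real (gauss 1 h) * A ((1 / real (Suc n)) *\<^sub>R h) \<partial>lborel) \<longlonglongrightarrow> (\<integral>h. complex_of_real (gauss 1 (h::'a)) * A 0 \<partial>lborel)"
  proof (rule integral_dominated_convergence)
    show "integrable lborel (\<lambda>h::'a. gauss 1 h * (B * (\<integral>a. cmod (f a) \<partial>lborel)))"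
      by (intro integrable_mult_left gauss_integrable) simp
    have "(\<lambda>h. A ((1 / real (Suc n)) *\<^sub>R h)) \<in> borel_measurable lborel" for n unfolding A_def by measurable
    then show "(\<lambda>h. complex_of_real (gauss 1 h) * A ((1 / real (Suc n)) *\<^sub>R h)) \<in> borel_measurable lborel" for n by measurable
    show "AE h in lborel. (\<lambda>n. complex_of_real (gauss 1 h) * A ((1 / real (Suc n)) *\<^sub>R h)) \<longlonglongrightarrow> complex_of_real (gauss 1 h) * A 0"
    proof (intro AE_I2 tendsto_mult_left Alim)
      fix h :: 'a
      have "(\<lambda>n. (1 / real (Suc n)) *\<^sub>R h) \<longlonglongrightarrow> 0 *\<^sub>R h"
        using LIMSEQ_inverse_real_of_nat by (intro tendsto_intros) (simp add: inverse_eq_divide)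
      then show "(\<lambda>n. (1 / real (Suc n)) *\<^sub>R h) \<longlonglongrightarrow> 0" by simp
    qed
    show "AE h in lborel. norm (complex_of_real (gauss 1 h) * A ((1 / real (Suc n)) *\<^sub>R h)) \<le> gauss 1 h * (B * (\<integral>a. cmod (f a) \<partial>lborel))" for n
      using A_le by (intro AE_I2) (simp add: norm_mult mult_left_mono abs_of_pos[OF gauss_pos] less_imp_le[OF gauss_pos])
  qed measurable
  from tendsto_mult_left[OF this, of "complex_of_real ?\<kappa>"]
  have "(\<lambda>n. complex_of_real (I n)) \<longlonglongrightarrow> complex_of_real ?\<kappa> * (\<integral>h. complex_of_real (gauss 1 (h::'a)) * A 0 \<partial>lborel)"
    unfolding I_eq .
  also have "complex_of_real ?\<kappa> * (\<integral>h. complex_of_real (gauss 1 (h::'a)) * A 0 \<partial>lborel) = complex_of_real (?\<kappa>\<^sup>2 * (\<integral>x. (cmod (f x))\<^sup>2 \<partial>lborel))"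
    unfolding A0 by (simp add: gauss_integral_0 power2_eq_square)
  finally have "(\<lambda>n. I n) \<longlonglongrightarrow> ?\<kappa>\<^sup>2 * (\<integral>x. (cmod (f x))\<^sup>2 \<partial>lborel)"
    by (simp only: tendsto_of_real_iff)
  then have L1: "(\<lambda>n. ennreal (I n)) \<longlonglongrightarrow> ennreal (?\<kappa>\<^sup>2 * (\<integral>x. (cmod (f x))\<^sup>2 \<partial>lborel))"
    by (rule tendsto_ennrealI)
  have [measurable]: "ft \<sigma> f \<in> borel_measurable borel" by (rule ft_measurable) measurable
  \<comment> \<open>The weights increase to 1 with \<open>n\<close>, so monotone convergence
    identifies the limit of the same integrals with the unweighted one, which might still be
    infinite at this point.\<close>
  have "(\<lambda>n. \<integral>\<^sup>+\<xi>. ennreal (gauss (1 / real (Suc n)) \<xi> * (cmod (ft \<sigma> f \<xi>))\<^sup>2) \<partial>lborel) \<longlonglongrightarrow> (\<integral>\<^sup>+\<xi>. ennreal ((cmod (ft \<sigma> f \<xi>))\<^sup>2) \<partial>lborel)"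
  proof (rule nn_integral_LIMSEQ)
    show "incseq (\<lambda>n \<xi>. ennreal (gauss (1 / real (Suc n)) \<xi> * (cmod (ft \<sigma> f \<xi>))\<^sup>2))"
    proof (intro incseq_SucI le_funI ennreal_leI mult_right_mono)
      fix n and \<xi> :: 'a
      have "(1 / real (Suc (Suc n)) * norm \<xi>)\<^sup>2 \<le> (1 / real (Suc n) * norm \<xi>)\<^sup>2"
        by (intro power_mono mult_right_mono) (auto simp: field_simps)
      then show "gauss (1 / real (Suc n)) \<xi> \<le> gauss (1 / real (Suc (Suc n))) \<xi>" by (simp add: gauss_def)
    qed simp
    show "(\<lambda>n. ennreal (gauss (1 / real (Suc n)) \<xi> * (cmod (ft \<sigma> f \<xi>))\<^sup>2)) \<longlonglongrightarrow> ennreal ((cmod (ft \<sigma> f \<xi>))\<^sup>2)" for \<xi>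
    proof -
      have "(\<lambda>n. gauss (1 / real (Suc n)) \<xi>) \<longlonglongrightarrow> exp (- (0 * norm \<xi>)\<^sup>2 / 2)"
        unfolding gauss_def using LIMSEQ_inverse_real_of_nat by (intro tendsto_intros) (simp_all add: inverse_eq_divide)
      then have "(\<lambda>n. ennreal (gauss (1 / real (Suc n)) \<xi> * (cmod (ft \<sigma> f \<xi>))\<^sup>2)) \<longlonglongrightarrow> ennreal (exp (- (0 * norm \<xi>)\<^sup>2 / 2) * (cmod (ft \<sigma> f \<xi>))\<^sup>2)"
        by (intro tendsto_ennrealI tendsto_mult_right)
      then show ?thesis by simp
    qed
  qed measurable
  moreover have "(\<integral>\<^sup>+\<xi>. ennreal (gauss (1 / real (Suc n)) \<xi> * (cmod (ft \<sigma> f \<xi>))\<^sup>2) \<partial>lborel) = ennreal (I n)" for n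
    unfolding I_def ft_def
    using integral_square_kernel(2)[OF f gauss_integrable[of "1 / real (Suc n)"] fourier_kernel_measurable[of \<sigma>]] gauss_pos[of "1 / real (Suc n)"]
    by (intro nn_integral_eq_integral) (auto intro!: AE_I2 mult_nonneg_nonneg less_imp_le[OF gauss_pos])
  ultimately have "(\<lambda>n. ennreal (I n)) \<longlonglongrightarrow> (\<integral>\<^sup>+\<xi>. ennreal ((cmod (ft \<sigma> f \<xi>))\<^sup>2) \<partial>lborel)" by simp
  from LIMSEQ_unique[OF this L1] show ?thesis .
qed

definition cft :: "real \<Rightarrow> ('a::euclidean_space \<Rightarrow> complex) \<Rightarrow> 'a \<Rightarrow> complex" where
  "cft \<sigma> f \<xi> = complex_of_real ((2 * pi) powr (- real DIM('a) / 2)) * ft \<sigma> f \<xi>"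

lemma cft_measurable: "f \<in> borel_measurable borel \<Longrightarrow> cft \<sigma> f \<in> borel_measurable borel"
  unfolding cft_def[abs_def] by (intro borel_measurable_times borel_measurable_const ft_measurable)

lemma cft_diff: "integrable lborel f \<Longrightarrow> integrable lborel g \<Longrightarrow> cft \<sigma> (\<lambda>x. f x - g x) \<xi> = cft \<sigma> f \<xi> - cft \<sigma> g \<xi>"
  using ft_integrable[of f \<sigma> \<xi>] ft_integrable[of g \<sigma> \<xi>] by (simp add: cft_def ft_def distrib_left right_diff_distrib)

lemma cft_add: "integrable lborel f \<Longrightarrow> integrable lborel g \<Longrightarrow> cft \<sigma> (\<lambda>x. f x + g x) \<xi> = cft \<sigma> f \<xi> + cft \<sigma> g \<xi>"
  using ft_integrable[of f \<sigma> \<xi>] ft_integrable[of g \<sigma> \<xi>] by (simp add: cft_def ft_def distrib_left right_diff_distrib)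

lemma cft_scaleR: "cft \<sigma> (\<lambda>x. c *\<^sub>R f x) \<xi> = c *\<^sub>R cft \<sigma> f \<xi>"
  by (simp add: cft_def ft_def)

lemma ft_dominated:
  fixes f :: "'a::euclidean_space \<Rightarrow> complex"
  assumes w: "integrable lborel w" "\<And>n x. cmod (s n x) \<le> w x" and m: "\<And>n. s n \<in> borel_measurable borel" "f \<in> borel_measurable borel"
    and lim: "\<And>x. (\<lambda>n. s n x) \<longlonglongrightarrow> f x"
  shows "(\<lambda>n. cft \<sigma> (s n) \<xi>) \<longlonglongrightarrow> cft \<sigma> f \<xi>"
proof -
  note [measurable] = m
  have "(\<lambda>n. ft \<sigma> (s n) \<xi>) \<longlonglongrightarrow> ft \<sigma> f \<xi>" unfolding ft_def
  proof (rule integral_dominated_convergence[where w = w])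
    show "AE x in lborel. (\<lambda>n. cis (\<sigma> * (x \<bullet> \<xi>)) * s n x) \<longlonglongrightarrow> cis (\<sigma> * (x \<bullet> \<xi>)) * f x"
      by (intro AE_I2 tendsto_mult_left lim)
    show "AE x in lborel. norm (cis (\<sigma> * (x \<bullet> \<xi>)) * s n x) \<le> w x" for n
      using w(2) by (simp add: norm_mult)
    show "integrable lborel w" by (rule w(1))
  qed measurable
  then show ?thesis unfolding cft_def by (rule tendsto_mult_left)
qed

text \<open>Truncation in height gives bounded functions. Fatou's lemma yields contraction only, but
  applied to the differences \<open>f - s k\<close> this makes the transforms of the truncations
  converge in L^2, and equality of norms passes to the limit.\<close>

lemma cft_isometry:
  fixes f :: "'a::euclidean_space \<Rightarrow> complex"
  assumes f1: "integrable lborel f" and f2: "lp_fun 2 f" and \<sigma>: "\<bar>\<sigma>\<bar> = 1"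
  shows "lp_fun 2 (cft \<sigma> f)" "norm (abs_lp (cft \<sigma> f) :: 'a L2) = norm (abs_lp f :: 'a L2)"
proof -
  have [measurable]: "f \<in> borel_measurable borel" using f1 by (auto dest: borel_measurable_integrable)
  let ?c = "(2 * pi) powr (- real DIM('a) / 2)"
  have nn: "(\<integral>\<^sup>+x. ennreal (cmod (g x) ^ CARD(2)) \<partial>lborel) = ennreal ((norm (abs_lp g :: 'a L2)) ^ CARD(2))" if "lp_fun 2 g" for g :: "'a \<Rightarrow> complex"
    using that by (simp add: norm_L2_abs_sq) (intro nn_integral_eq_integral, auto simp: lp_fun_def)
  have bd: "lp_fun 2 (cft \<sigma> g) \<and> norm (abs_lp (cft \<sigma> g) :: 'a L2) = norm (abs_lp g :: 'a L2)"
    if g: "integrable lborel g" "lp_fun 2 g" "\<And>x. cmod (g x) \<le> B" for g B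
  proof -
    have [measurable]: "g \<in> borel_measurable borel" using g(1) by (auto dest: borel_measurable_integrable)
    have [measurable]: "cft \<sigma> g \<in> borel_measurable borel" "ft \<sigma> g \<in> borel_measurable borel" by (auto intro: cft_measurable ft_measurable)
    have "(\<integral>\<^sup>+\<xi>. ennreal (cmod (cft \<sigma> g \<xi>) ^ CARD(2)) \<partial>lborel) = ennreal (?c\<^sup>2) * (\<integral>\<^sup>+\<xi>. ennreal ((cmod (ft \<sigma> g \<xi>))\<^sup>2) \<partial>lborel)"
      by (subst nn_integral_cmult[symmetric]) (auto simp: cft_def norm_mult power_mult_distrib ennreal_mult)
    also have "\<dots> = ennreal (?c\<^sup>2 * ((sqrt (2 * pi) ^ DIM('a))\<^sup>2 * (\<integral>x. (cmod (g x))\<^sup>2 \<partial>lborel)))"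
      unfolding ft_isometry_bounded[OF g(1) g(3) \<sigma>] by (simp add: ennreal_mult integral_nonneg_AE)
    also have "?c\<^sup>2 * ((sqrt (2 * pi) ^ DIM('a))\<^sup>2 * (\<integral>x. (cmod (g x))\<^sup>2 \<partial>lborel)) = (?c * sqrt (2 * pi) ^ DIM('a))\<^sup>2 * (\<integral>x. (cmod (g x))\<^sup>2 \<partial>lborel)"
      by (simp add: power_mult_distrib)
    also have "\<dots> = (norm (abs_lp g :: 'a L2)) ^ CARD(2)" unfolding four_const using g(2) by (simp add: norm_L2_abs_sq)
    finally have e: "(\<integral>\<^sup>+\<xi>. ennreal (cmod (cft \<sigma> g \<xi>) ^ CARD(2)) \<partial>lborel) = ennreal ((norm (abs_lp g :: 'a L2)) ^ CARD(2))" .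
    have l: "lp_fun CARD(2) (cft \<sigma> g)" by (rule norm_lp_le_nn(1)[of _ "norm (abs_lp g :: 'a L2)"]) (use e in \<open>auto\<close>)
    have "ennreal ((norm (abs_lp (cft \<sigma> g) :: 'a L2))\<^sup>2) = ennreal ((norm (abs_lp g :: 'a L2))\<^sup>2)"
      using nn[of "cft \<sigma> g"] l e by simp
    then show ?thesis using l by simp
  qed
  define s where "s k x = (if cmod (f x) \<le> real k then f x else 0)" for k x
  have [measurable]: "s k \<in> borel_measurable borel" for k unfolding s_def[abs_def] by measurable
  have sle: "cmod (s k x) \<le> cmod (f x)" for k x by (simp add: s_def)
  have s1: "integrable lborel (s k)" for k
    by (rule Bochner_Integration.integrable_bound[OF f1]) (use sle in auto)
  have s2: "lp_fun 2 (s k)" for k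
    by (rule lp_fun_bound[OF _ lp_fun_integrable[OF f2]]) (use sle in auto)
  have slim: "(\<lambda>k. s k x) \<longlonglongrightarrow> f x" for x
  proof -
    obtain K where "cmod (f x) \<le> real K" using real_arch_simple by blast
    then have "\<forall>\<^sub>F k in sequentially. s k x = f x"
      by (intro eventually_sequentiallyI[of K]) (simp add: s_def)
    then show ?thesis by (rule tendsto_eventually)
  qed
  \<comment> \<open>Stated for \<open>f\<close> and for the tails \<open>f - s j\<close> together,
    since one Fatou argument proves both.\<close>
  have contr: "lp_fun 2 (cft \<sigma> g) \<and> norm (abs_lp (cft \<sigma> g) :: 'a L2) \<le> norm (abs_lp g :: 'a L2)"
    if g: "g = (\<lambda>x. f x - s j x) \<or> g = f" for g j
  proof -
    \<comment> \<open>Truncations of \<open>g\<close> at height k. For a tail this is the part of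
      \<open>f\<close> with modulus above j and at most k, which vanishes as long as k is at most
      j.\<close>
    define sg where "sg k x = (if g = f then s k x else s k x - s (min j k) x)" for k x
    have [measurable]: "g \<in> borel_measurable borel" using g by auto
    have g1: "integrable lborel g" using g f1 s1 by auto
    have g2: "lp_fun 2 g" using g f2 s2 by (auto intro: lp_fun_diff)
    have sg1: "integrable lborel (sg k)" for k using s1 by (cases "g = f") (auto simp: sg_def[abs_def])
    have sg2: "lp_fun 2 (sg k)" for k using s2 by (cases "g = f") (auto simp: sg_def[abs_def] intro: lp_fun_diff)
    have sgf: "cmod (sg k x) \<le> cmod (g x)" for k x
      using g by (auto simp: sg_def s_def)
    have sgb: "cmod (sg k x) \<le> real k" for k x
      by (auto simp: sg_def s_def)
    have sgl: "(\<lambda>k. sg k x) \<longlonglongrightarrow> g x" for x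
    proof (cases "g = f")
      case False
      then have gj: "g = (\<lambda>x. f x - s j x)" using g by simp
      have "\<forall>\<^sub>F k in sequentially. s k x - s j x = sg k x"
        using False by (intro eventually_sequentiallyI[of j]) (simp add: sg_def)
      then show ?thesis unfolding gj
        by (rule Lim_transform_eventually[rotated]) (intro tendsto_diff slim tendsto_const)
    qed (simp add: sg_def slim)
    have lim: "(\<lambda>k. cft \<sigma> (sg k) \<xi>) \<longlonglongrightarrow> cft \<sigma> g \<xi>" for \<xi>
      by (rule ft_dominated[OF integrable_norm[OF g1]]) (use sgf sgl sg1 in \<open>auto dest: borel_measurable_integrable\<close>)
    have [measurable]: "cft \<sigma> (sg k) \<in> borel_measurable borel" for k
      using sg1[of k] by (intro cft_measurable) (auto dest: borel_measurable_integrable)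
    have "(\<integral>\<^sup>+\<xi>. ennreal (cmod (cft \<sigma> g \<xi>) ^ CARD(2)) \<partial>lborel) = (\<integral>\<^sup>+\<xi>. liminf (\<lambda>k. ennreal (cmod (cft \<sigma> (sg k) \<xi>) ^ CARD(2))) \<partial>lborel)"
      by (intro nn_integral_cong lim_imp_Liminf[OF sequentially_bot, symmetric] tendsto_ennrealI tendsto_power tendsto_norm lim)
    also have "\<dots> \<le> liminf (\<lambda>k. \<integral>\<^sup>+\<xi>. ennreal (cmod (cft \<sigma> (sg k) \<xi>) ^ CARD(2)) \<partial>lborel)"
      by (intro nn_integral_liminf) measurable
    also have "\<dots> \<le> liminf (\<lambda>k::nat. ennreal ((norm (abs_lp g :: 'a L2)) ^ CARD(2)))"
    proof (intro Liminf_mono always_eventually allI)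
      fix k
      have b: "lp_fun 2 (cft \<sigma> (sg k))" "norm (abs_lp (cft \<sigma> (sg k)) :: 'a L2) = norm (abs_lp (sg k) :: 'a L2)"
        using bd[OF sg1 sg2 sgb, of k] by auto
      have "(norm (abs_lp (sg k) :: 'a L2))\<^sup>2 \<le> (norm (abs_lp g :: 'a L2))\<^sup>2"
        unfolding norm_L2_abs_sq[OF sg2] norm_L2_abs_sq[OF g2]
        using g2 sg2[of k] sgf by (intro integral_mono power_mono) (auto simp: lp_fun_def)
      then show "(\<integral>\<^sup>+\<xi>. ennreal (cmod (cft \<sigma> (sg k) \<xi>) ^ CARD(2)) \<partial>lborel) \<le> ennreal ((norm (abs_lp g :: 'a L2)) ^ CARD(2))"
        unfolding nn[OF b(1)] b(2) by (intro ennreal_leI) simp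
    qed
    also have "\<dots> = ennreal ((norm (abs_lp g :: 'a L2)) ^ CARD(2))" by (simp add: Liminf_const)
    finally have le: "(\<integral>\<^sup>+\<xi>. ennreal (cmod (cft \<sigma> g \<xi>) ^ CARD(2)) \<partial>lborel) \<le> ennreal ((norm (abs_lp g :: 'a L2)) ^ CARD(2))" .
    have "cft \<sigma> g \<in> borel_measurable borel" by (rule cft_measurable) measurable
    from norm_lp_le_nn[OF this norm_ge_zero le] show ?thesis by simp
  qed
  show l: "lp_fun 2 (cft \<sigma> f)" using contr[of f] by simp
  have "(\<lambda>k. abs_lp (s k) :: 'a L2) \<longlonglongrightarrow> abs_lp f"
    by (rule abs_lp_tendsto_dominated[where w = "\<lambda>x. cmod (f x)"]) (use f2 sle slim in \<open>auto simp: lp_fun_def\<close>)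
  then have n1: "(\<lambda>k. norm (abs_lp (s k) :: 'a L2)) \<longlonglongrightarrow> norm (abs_lp f :: 'a L2)"
    and d0: "(\<lambda>k. norm (abs_lp f - abs_lp (s k) :: 'a L2)) \<longlonglongrightarrow> 0"
    by (rule tendsto_norm, intro tendsto_norm_zero) (use tendsto_diff[OF tendsto_const[of "abs_lp f :: 'a L2"] \<open>(\<lambda>k. abs_lp (s k) :: 'a L2) \<longlonglongrightarrow> abs_lp f\<close>] in simp)
  have ls: "lp_fun 2 (cft \<sigma> (s k))" "norm (abs_lp (cft \<sigma> (s k)) :: 'a L2) = norm (abs_lp (s k) :: 'a L2)" for k
    using bd[OF s1 s2, of k "real k"] by (auto simp: s_def)
  have "norm (abs_lp (cft \<sigma> f) - abs_lp (cft \<sigma> (s k)) :: 'a L2) \<le> norm (abs_lp f - abs_lp (s k) :: 'a L2)" for k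
  proof -
    have "(abs_lp (cft \<sigma> f) - abs_lp (cft \<sigma> (s k)) :: 'a L2) = abs_lp (\<lambda>\<xi>. cft \<sigma> f \<xi> - cft \<sigma> (s k) \<xi>)"
      using l ls by (intro minus_lp_abs) auto
    also have "\<dots> = abs_lp (cft \<sigma> (\<lambda>x. f x - s k x))"
      by (rule arg_cong[where f = abs_lp]) (simp add: fun_eq_iff cft_diff[OF f1 s1])
    finally show ?thesis using contr[of "\<lambda>x. f x - s k x" k] minus_lp_abs[of f "s k", where 'c = 2] f2 s2[of k] by simp
  qed
  then have "(\<lambda>k. abs_lp (cft \<sigma> f) - abs_lp (cft \<sigma> (s k)) :: 'a L2) \<longlonglongrightarrow> 0"
    by (intro Lim_null_comparison[OF _ d0] always_eventually) auto
  then have "(\<lambda>k. abs_lp (cft \<sigma> (s k)) :: 'a L2) \<longlonglongrightarrow> abs_lp (cft \<sigma> f)"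
    using tendsto_diff[OF tendsto_const[of "abs_lp (cft \<sigma> f) :: 'a L2"]] by force
  from tendsto_norm[OF this] have "(\<lambda>k. norm (abs_lp (s k) :: 'a L2)) \<longlonglongrightarrow> norm (abs_lp (cft \<sigma> f) :: 'a L2)"
    by (simp add: ls)
  from LIMSEQ_unique[OF this n1] show "norm (abs_lp (cft \<sigma> f) :: 'a L2) = norm (abs_lp f :: 'a L2)" .
qed

text \<open>Serves as a cut-off in space and, applied after \<open>plancherel (-1)\<close>, as a
  cut-off in frequency; it is complex-valued so as to be a multiplier for
  \<open>mul\<close>.\<close>

definition cb :: "nat \<Rightarrow> 'a::euclidean_space \<Rightarrow> complex" where
  "cb n = indicator (cball 0 (real n))"

lemma unitb_cb: "unitb (cb n)"
  unfolding cb_def by (rule unitb_indicator) simp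

lemma cb_tendsto: "(\<lambda>n. cb n x) \<longlonglongrightarrow> 1"
proof -
  obtain N where "norm x \<le> real N" using real_arch_simple by blast
  then have "\<forall>\<^sub>F n in sequentially. cb n x = 1"
    by (intro eventually_sequentiallyI[of N]) (auto simp: cb_def indicator_def)
  then show ?thesis by (rule tendsto_eventually)
qed

lemma mul_cb_tendsto: "(\<lambda>n. mul (cb n) u) \<longlonglongrightarrow> u"
  using mul_tendsto[of cb "\<lambda>x. 1", OF unitb_cb unitb_const cb_tendsto] by simp

lemma cb_lp_fun2: "lp_fun 2 (\<lambda>x. cb n x * rep_lp (u :: 'a::euclidean_space L2) x)"
  by (intro lp_fun_mul unitb_cb lp2_L2)

lemma cb_integrable: "integrable lborel (\<lambda>x. cb n x * rep_lp (u :: 'a::euclidean_space L2) x)"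
proof (rule Bochner_Integration.integrable_bound)
  have "integrable lborel (indicator (cball (0::'a) (real n)) :: 'a \<Rightarrow> real)"
    using emeasure_bounded_finite[of "cball (0::'a) (real n)"] by (intro integrable_real_indicator) auto
  then show "integrable lborel (\<lambda>x. indicator (cball 0 (real n)) x + (cmod (rep_lp u x))\<^sup>2)"
    using lp_fun_integrable[OF lp2_L2[of u]] by (intro Bochner_Integration.integrable_add) auto
  show "(\<lambda>x. cb n x * rep_lp u x) \<in> borel_measurable lborel"
    using lp_fun_measurable[OF cb_lp_fun2] by simp
  have "y \<le> 1 + y\<^sup>2" for y :: real
    using sum_squares_bound[of 1 y] zero_le_power2[of y] by (cases "y \<ge> 0") (auto simp: add_nonneg_nonneg intro: order_trans[of y 0])
  then show "AE x in lborel. cmod (cb n x * rep_lp u x) \<le> norm (indicator (cball 0 (real n)) x + (cmod (rep_lp u x))\<^sup>2)"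
    by (intro AE_I2) (auto simp: cb_def indicator_def)
qed

lemma mul_cb_abs: "mul (cb n) u = abs_lp (\<lambda>x. cb n x * rep_lp u x)"
  by (simp add: mul_def)

lemma fourier_integral_cft: "fourier_integral \<sigma> n f = cft \<sigma> (\<lambda>x. cb n x * f x)"
  unfolding fourier_integral_def cft_def ft_def fun_eq_iff set_lebesgue_integral_def cb_def cis_conv_exp
  by (intro allI arg_cong2[where f = "(*)"] refl Bochner_Integration.integral_cong) (auto simp: indicator_def)

definition FI :: "real \<Rightarrow> nat \<Rightarrow> 'a::euclidean_space L2 \<Rightarrow> 'a L2" where
  "FI \<sigma> n u = abs_lp (cft \<sigma> (\<lambda>x. cb n x * rep_lp u x))"

lemma plancherel_FI: "plancherel \<sigma> u = lim (\<lambda>n. FI \<sigma> n u)"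
  by (simp add: plancherel_def FI_def fourier_integral_cft)

section \<open>The Fourier integrals over balls as operators on L^2\<close>

lemma cft_cong_AE:
  assumes [measurable]: "f \<in> borel_measurable borel" "g \<in> borel_measurable borel" and "AE x in lborel. f x = g x"
  shows "cft \<sigma> f = cft \<sigma> g"
proof
  fix \<xi>
  have "ft \<sigma> f \<xi> = ft \<sigma> g \<xi>"
    unfolding ft_def
  proof (rule integral_cong_AE)
    show "AE x in lborel. cis (\<sigma> * (x \<bullet> \<xi>)) * f x = cis (\<sigma> * (x \<bullet> \<xi>)) * g x"
      using assms(3) by eventually_elim simp
  qed measurable
  then show "cft \<sigma> f \<xi> = cft \<sigma> g \<xi>" by (simp add: cft_def)
qed

lemma cb_measurable [measurable]: "cb n \<in> borel_measurable borel"
  by (rule unitbD(1)[OF unitb_cb])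

lemma FI_lp: "\<bar>\<sigma>\<bar> = 1 \<Longrightarrow> lp_fun 2 (cft \<sigma> (\<lambda>x. cb n x * rep_lp (u :: 'a::euclidean_space L2) x))"
  by (rule cft_isometry(1)[OF cb_integrable cb_lp_fun2])

lemma norm_FI: "\<bar>\<sigma>\<bar> = 1 \<Longrightarrow> norm (FI \<sigma> n u) = norm (mul (cb n) u)"
  unfolding FI_def mul_cb_abs by (rule cft_isometry(2)[OF cb_integrable cb_lp_fun2])

lemma FI_add:
  assumes s: "\<bar>\<sigma>\<bar> = 1" shows "FI \<sigma> n (u + v) = FI \<sigma> n u + FI \<sigma> n v"
proof -
  have "cft \<sigma> (\<lambda>x. cb n x * rep_lp (u + v) x) = cft \<sigma> (\<lambda>x. cb n x * rep_lp u x + cb n x * rep_lp v x)"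
  proof (rule cft_cong_AE)
    show "AE x in lborel. cb n x * rep_lp (u + v) x = cb n x * rep_lp u x + cb n x * rep_lp v x"
      using rep_plus_AE[of u v] by eventually_elim (simp add: algebra_simps)
  qed measurable
  also have "\<dots> = (\<lambda>\<xi>. cft \<sigma> (\<lambda>x. cb n x * rep_lp u x) \<xi> + cft \<sigma> (\<lambda>x. cb n x * rep_lp v x) \<xi>)"
    by (intro ext cft_add cb_integrable)
  finally show ?thesis unfolding FI_def by (simp add: plus_lp_abs FI_lp[OF s])
qed

lemma FI_scaleR:
  assumes s: "\<bar>\<sigma>\<bar> = 1" shows "FI \<sigma> n (c *\<^sub>R u) = c *\<^sub>R FI \<sigma> n u"
proof -
  have "cft \<sigma> (\<lambda>x. cb n x * rep_lp (c *\<^sub>R u) x) = cft \<sigma> (\<lambda>x. c *\<^sub>R (cb n x * rep_lp u x))"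
  proof (rule cft_cong_AE)
    show "AE x in lborel. cb n x * rep_lp (c *\<^sub>R u) x = c *\<^sub>R (cb n x * rep_lp u x)"
      using rep_scaleR_AE[of c u] by eventually_elim simp
  qed measurable
  also have "\<dots> = (\<lambda>\<xi>. c *\<^sub>R cft \<sigma> (\<lambda>x. cb n x * rep_lp u x) \<xi>)"
    by (intro ext cft_scaleR)
  finally show ?thesis unfolding FI_def by (simp add: scaleR_lp_abs FI_lp[OF s])
qed

lemma FI_diff:
  assumes s: "\<bar>\<sigma>\<bar> = 1" shows "FI \<sigma> n (u - v) = FI \<sigma> n u - FI \<sigma> n v"
  using FI_add[OF s, of n u "(-1) *\<^sub>R v"] FI_scaleR[OF s, of n "-1" v] by simp

lemma FI_mul_cb: "FI \<sigma> n (mul (cb m) u) = FI \<sigma> (min m n) u"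
proof -
  have "cft \<sigma> (\<lambda>x. cb n x * rep_lp (mul (cb m) u) x) = cft \<sigma> (\<lambda>x. cb (min m n) x * rep_lp u x)"
  proof (rule cft_cong_AE)
    show "AE x in lborel. cb n x * rep_lp (mul (cb m) u) x = cb (min m n) x * rep_lp u x"
      using rep_mul_AE[OF unitb_cb, of m u] by eventually_elim (auto simp: cb_def indicator_def)
  qed measurable
  then show ?thesis by (simp add: FI_def)
qed

text \<open>For m below n the difference is the transform of a truncation error, which the isometry
  controls by the tail of \<open>u\<close>.\<close>

lemma FI_Cauchy:
  assumes s: "\<bar>\<sigma>\<bar> = 1" shows "Cauchy (\<lambda>n. FI \<sigma> n u)"
proof (rule CauchyI')
  fix e :: real assume "e > 0"
  then obtain M where M: "\<And>m. m \<ge> M \<Longrightarrow> norm (mul (cb m) u - u) < e"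
    using LIMSEQ_D[OF mul_cb_tendsto[of u]] by blast
  have "norm (FI \<sigma> m u - FI \<sigma> n u) < e" if "m \<ge> M" "n > m" for m n
  proof -
    have "FI \<sigma> m u - FI \<sigma> n u = FI \<sigma> n (mul (cb m) u - u)"
      using that by (simp add: FI_diff[OF s] FI_mul_cb)
    then have "norm (FI \<sigma> m u - FI \<sigma> n u) \<le> norm (mul (cb m) u - u)"
      by (simp add: norm_FI[OF s] norm_mul_le[OF unitb_cb])
    then show ?thesis using M that(1) by force
  qed
  then show "\<exists>M. \<forall>m\<ge>M. \<forall>n>m. dist (FI \<sigma> m u) (FI \<sigma> n u) < e" unfolding dist_norm by blast
qed

lemma FI_tendsto: "\<bar>\<sigma>\<bar> = 1 \<Longrightarrow> (\<lambda>n. FI \<sigma> n u) \<longlonglongrightarrow> plancherel \<sigma> u"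
  unfolding plancherel_FI using Cauchy_convergent[OF FI_Cauchy] by (simp add: convergent_LIMSEQ_iff)

lemma norm_plancherel:
  assumes s: "\<bar>\<sigma>\<bar> = 1" shows "norm (plancherel \<sigma> u) = norm u"
  using tendsto_norm[OF FI_tendsto[OF s, of u]] tendsto_norm[OF mul_cb_tendsto[of u]]
  unfolding norm_FI[OF s] by (rule LIMSEQ_unique)

lemma bounded_linear_plancherel:
  assumes s: "\<bar>\<sigma>\<bar> = 1" shows "bounded_linear (plancherel \<sigma>)"
proof (rule bounded_linear_intro[where K = 1])
  show "plancherel \<sigma> (u + v) = plancherel \<sigma> u + plancherel \<sigma> v" for u v
    using FI_tendsto[OF s, of "u + v"] tendsto_add[OF FI_tendsto[OF s, of u] FI_tendsto[OF s, of v]]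
    unfolding FI_add[OF s] by (rule LIMSEQ_unique)
  show "plancherel \<sigma> (c *\<^sub>R u) = c *\<^sub>R plancherel \<sigma> u" for u c
    using FI_tendsto[OF s, of "c *\<^sub>R u"] tendsto_scaleR[OF tendsto_const FI_tendsto[OF s, of u]]
    unfolding FI_scaleR[OF s] by (rule LIMSEQ_unique)
qed (simp add: norm_plancherel[OF s])

lemma plancherel_mul_cb:
  assumes s: "\<bar>\<sigma>\<bar> = 1" shows "plancherel \<sigma> (mul (cb m) u) = FI \<sigma> m u"
proof -
  have "\<forall>\<^sub>F n in sequentially. FI \<sigma> n (mul (cb m) u) = FI \<sigma> m u"
    by (intro eventually_sequentiallyI[of m]) (simp add: FI_mul_cb min_absorb1)
  then have "(\<lambda>n. FI \<sigma> n (mul (cb m) u)) \<longlonglongrightarrow> FI \<sigma> m u" by (rule tendsto_eventually)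
  with FI_tendsto[OF s] show ?thesis by (rule LIMSEQ_unique)
qed

text \<open>Multiplication formula: Fubini moves the kernel to the other factor, with the opposite
  sign after conjugation. The cut-offs on both sides make the two factors integrable.\<close>

lemma inner_FI:
  assumes s: "\<bar>\<sigma>\<bar> = 1"
  shows "inner (FI \<sigma> n a) (mul (cb m) b) = inner (mul (cb n) a) (FI (-\<sigma>) m b)"
proof -
  have s': "\<bar>- \<sigma>\<bar> = 1" using s by simp
  let ?a = "\<lambda>x. cb n x * rep_lp a x" and ?b = "\<lambda>x. cb m x * rep_lp b x"
  let ?c = "complex_of_real ((2 * pi) powr (- real DIM('a) / 2))"
  have km: "(\<lambda>(y, z). cis (\<sigma> * (z \<bullet> y))) \<in> borel_measurable borel" by (rule fourier_kernel_measurable)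
  have k1: "cmod (cis (\<sigma> * (z \<bullet> y))) \<le> 1" for y z :: 'a by simp
  note sw = integral_swap_kernel[OF cb_integrable[of n a] integrable_cnj[OF cb_integrable[of m b]] km k1]
  have in_eq: "inner z w = Re (cnj w * z)" for z w :: complex by (simp add: inner_complex_def)
  have "inner (FI \<sigma> n a) (mul (cb m) b) = (\<integral>y. Re (cnj (?b y) * cft \<sigma> ?a y) \<partial>lborel)"
    unfolding FI_def mul_cb_abs by (subst inner_lp_abs[OF FI_lp[OF s] cb_lp_fun2]) (simp only: in_eq)
  also have "\<dots> = Re (\<integral>y. cnj (?b y) * cft \<sigma> ?a y \<partial>lborel)"
  proof (rule integral_Re)
    have "integrable lborel (\<lambda>y. ?c * (cnj (?b y) * (\<integral>z. cis (\<sigma> * (z \<bullet> y)) * ?a z \<partial>lborel)))"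
      by (intro integrable_mult_right sw(2))
    then show "integrable lborel (\<lambda>y. cnj (?b y) * cft \<sigma> ?a y)"
      unfolding cft_def ft_def by (simp only: mult.left_commute)
  qed
  also have "(\<integral>y. cnj (?b y) * cft \<sigma> ?a y \<partial>lborel) = ?c * (\<integral>y. cnj (?b y) * (\<integral>z. cis (\<sigma> * (z \<bullet> y)) * ?a z \<partial>lborel) \<partial>lborel)"
    unfolding cft_def ft_def by (subst integral_mult_right_zero[symmetric]) (simp only: mult.left_commute)
  also have "\<dots> = ?c * (\<integral>z. (\<integral>y. cnj (?b y) * cis (\<sigma> * (z \<bullet> y)) \<partial>lborel) * ?a z \<partial>lborel)"
    by (simp only: sw(1))
  also have "\<dots> = (\<integral>z. cnj (cft (-\<sigma>) ?b z) * ?a z \<partial>lborel)"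
  proof -
    have "(\<integral>y. cnj (?b y) * cis (\<sigma> * (z \<bullet> y)) \<partial>lborel) = cnj (ft (-\<sigma>) ?b z)" for z
    proof -
      have "cnj (ft (-\<sigma>) ?b z) = (\<integral>y. cnj (cis (- \<sigma> * (y \<bullet> z)) * ?b y) \<partial>lborel)"
        unfolding ft_def by (rule integral_bounded_linear[OF bounded_linear_cnj ft_integrable[OF cb_integrable], symmetric])
      also have "\<dots> = (\<integral>y. cnj (?b y) * cis (\<sigma> * (z \<bullet> y)) \<partial>lborel)"
        by (intro Bochner_Integration.integral_cong refl) (simp add: cis_cnj inner_commute)
      finally show ?thesis by simp
    qed
    then show ?thesis unfolding cft_def by (simp add: mult.assoc)
  qed
  also have "Re \<dots> = (\<integral>z. Re (cnj (cft (-\<sigma>) ?b z) * ?a z) \<partial>lborel)"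
  proof (rule integral_Re[symmetric])
    have "lp_fun 1 (\<lambda>z. cnj (cft (-\<sigma>) ?b z) * ?a z)"
      by (intro lp_fun_mult lp_fun_cnj FI_lp[OF s'] cb_lp_fun2)
    then show "integrable lborel (\<lambda>z. cnj (cft (-\<sigma>) ?b z) * ?a z)"
      by (rule lp_fun1_integrable)
  qed
  also have "\<dots> = inner (mul (cb n) a) (FI (-\<sigma>) m b)"
    unfolding FI_def mul_cb_abs by (subst inner_lp_abs[OF cb_lp_fun2 FI_lp[OF s']]) (simp only: in_eq)
  finally show ?thesis .
qed

lemma inner_plancherel:
  assumes s: "\<bar>\<sigma>\<bar> = 1" shows "inner (plancherel \<sigma> a) b = inner a (plancherel (-\<sigma>) b)"
proof -
  have s': "\<bar>- \<sigma>\<bar> = 1" using s by simp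
  have "(\<lambda>n. inner (FI \<sigma> n a) (mul (cb n) b)) \<longlonglongrightarrow> inner (plancherel \<sigma> a) b"
    by (intro tendsto_inner FI_tendsto s mul_cb_tendsto)
  moreover have "(\<lambda>n. inner (mul (cb n) a) (FI (-\<sigma>) n b)) \<longlonglongrightarrow> inner a (plancherel (-\<sigma>) b)"
    by (intro tendsto_inner FI_tendsto s' mul_cb_tendsto)
  ultimately show ?thesis unfolding inner_FI[OF s] by (rule LIMSEQ_unique)
qed

text \<open>Polarisation of the squared norm of a sum.\<close>

lemma isometry_inner:
  fixes f :: "'a::real_inner \<Rightarrow> 'b::real_inner"
  assumes "bounded_linear f" "\<And>x. norm (f x) = norm x"
  shows "inner (f x) (f y) = inner x y"
proof -
  interpret bounded_linear f by fact
  have "(norm (f (x + y)))\<^sup>2 = (norm (x + y))\<^sup>2" by (simp add: assms(2))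
  then have "(norm (f x))\<^sup>2 + 2 * inner (f x) (f y) + (norm (f y))\<^sup>2 = (norm x)\<^sup>2 + 2 * inner x y + (norm y)\<^sup>2"
    unfolding add power2_norm_eq_inner by (simp add: inner_add_left inner_add_right inner_commute)
  then show ?thesis by (simp add: assms(2))
qed

text \<open>The adjoint of an isometry is its left inverse, and by \<open>inner_plancherel\<close>
  the adjoint is the transform of opposite sign. Taking both signs gives unitarity.\<close>

lemma plancherel_inverse:
  assumes s: "\<bar>\<sigma>\<bar> = 1" shows "plancherel (-\<sigma>) (plancherel \<sigma> u) = u"
proof -
  have s': "\<bar>- \<sigma>\<bar> = 1" using s by simp
  have "inner (plancherel (-\<sigma>) (plancherel \<sigma> u)) v = inner u v" for v
    using inner_plancherel[OF s', of "plancherel \<sigma> u" v]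
      isometry_inner[OF bounded_linear_plancherel[OF s] norm_plancherel[OF s], of u v] by simp
  then show ?thesis by (metis inner_eq_zero_iff inner_diff_left right_minus_eq)
qed

section \<open>The free Schroedinger group\<close>

definition phase :: "real \<Rightarrow> 'a::euclidean_space \<Rightarrow> complex" where
  "phase t \<xi> = cis (- (t * (norm \<xi>)\<^sup>2))"

lemma unitb_phase: "unitb (phase t)"
  unfolding unitb_def phase_def[abs_def] by simp

lemma norm_phase: "cmod (phase t \<xi>) = 1" by (simp add: phase_def)

lemma phase_tendsto: "t \<longlonglongrightarrow> t0 \<Longrightarrow> (\<lambda>n. phase (t n) \<xi>) \<longlonglongrightarrow> phase t0 \<xi>"
  unfolding phase_def cis_conv_exp by (intro tendsto_intros)

lemma schroedinger_group_eq: "schroedinger_group t u = plancherel 1 (mul (phase t) (plancherel (-1) u))"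
proof -
  have "exp (- \<i> * complex_of_real (t * (norm \<xi>)\<^sup>2)) = phase t \<xi>" for \<xi> :: 'a
    by (simp add: phase_def cis_conv_exp)
  then show ?thesis unfolding schroedinger_group_def mul_def by simp
qed

abbreviation U :: "real \<Rightarrow> 'a::euclidean_space L2 \<Rightarrow> 'a L2" where
  "U \<equiv> schroedinger_group"

lemma norm_U [simp]: "norm (U t u) = norm u"
  by (simp add: schroedinger_group_eq norm_plancherel norm_mul_eq[OF unitb_phase norm_phase])

lemma bounded_linear_U: "bounded_linear (U t)"
proof -
  have eq: "U t = (\<lambda>u. plancherel 1 (mul (phase t) (plancherel (-1) u)))"
    by (simp add: fun_eq_iff schroedinger_group_eq)
  show ?thesis unfolding eq
    by (intro bounded_linear_compose[OF bounded_linear_plancherel] bounded_linear_compose[OF bounded_linear_mul]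
      bounded_linear_plancherel unitb_phase) auto
qed

lemma plancherel_inverse1: "plancherel 1 (plancherel (-1) u) = u"
  and plancherel_inverse2: "plancherel (-1) (plancherel 1 u) = u"
  using plancherel_inverse[of "-1" u] plancherel_inverse[of 1 u] by simp_all

lemma U_U: "U s (U t u) = U (s + t) u"
proof -
  have "(\<lambda>x::'a. phase s x * phase t x) = phase (s + t)" by (simp add: phase_def fun_eq_iff cis_mult algebra_simps)
  then show ?thesis
    by (simp add: schroedinger_group_eq plancherel_inverse2 mul_mul[OF unitb_phase unitb_phase])
qed

lemma inner_U: "inner (U t u) v = inner u (U (- t) v)"
proof -
  have "(\<lambda>x::'a. cnj (phase t x)) = phase (- t)" by (simp add: phase_def fun_eq_iff cis_cnj)
  then show ?thesis
    by (simp add: schroedinger_group_eq inner_plancherel inner_mul[OF unitb_phase])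
qed

text \<open>Strong continuity in time for a fixed vector upgrades to joint continuity because every
  \<open>U t\<close> is an isometry.\<close>

lemma U_tendsto:
  assumes t: "t \<longlonglongrightarrow> t0" and u: "u \<longlonglongrightarrow> u0"
  shows "(\<lambda>n. U (t n) (u n)) \<longlonglongrightarrow> U t0 u0"
proof -
  have 1: "(\<lambda>n. U (t n) u0) \<longlonglongrightarrow> U t0 u0"
    unfolding schroedinger_group_eq
    by (intro bounded_linear.tendsto[OF bounded_linear_plancherel] mul_tendsto unitb_phase phase_tendsto t) simp
  have "(\<lambda>n. norm (U (t n) (u n) - U (t n) u0)) \<longlonglongrightarrow> 0"
    using LIM_zero[OF u] by (simp add: linear_diff[OF bounded_linear.linear[OF bounded_linear_U], symmetric] tendsto_norm_zero_iff)
  then have "(\<lambda>n. (U (t n) (u n) - U (t n) u0) + U (t n) u0) \<longlonglongrightarrow> 0 + U t0 u0"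
    using 1 by (intro tendsto_add) (auto simp: tendsto_norm_zero_iff)
  then show ?thesis by simp
qed

lemma continuous_on_U:
  assumes "continuous_on S f" "continuous_on S g"
  shows "continuous_on S (\<lambda>x. U (f x) (g x))"
proof -
  have "continuous_on UNIV (\<lambda>p. U (fst p) (snd p))"
    unfolding continuous_on_sequentially comp_def by (auto intro!: U_tendsto dest: tendsto_fst tendsto_snd)
  then have "continuous_on S ((\<lambda>p. U (fst p) (snd p)) \<circ> (\<lambda>x. (f x, g x)))"
    by (intro continuous_on_compose continuous_on_Pair assms) (auto intro: continuous_on_subset)
  then show ?thesis by (simp add: comp_def)
qed

section \<open>Orthonormal bases of separable Hilbert spaces\<close>

text \<open>\<open>sgn\<close> normalises and maps 0 to 0, so a vector that depends linearly on its
  predecessors simply produces 0.\<close>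

function gram_schmidt :: "(nat \<Rightarrow> 'a::real_inner) \<Rightarrow> nat \<Rightarrow> 'a" where
  "gram_schmidt d n = sgn (d n - (\<Sum>k<n. inner (gram_schmidt d k) (d n) *\<^sub>R gram_schmidt d k))"
  by auto
termination by (relation "Wellfounded.measure snd") auto

declare gram_schmidt.simps [simp del]

definition onb_proj :: "(nat \<Rightarrow> 'a::real_inner) \<Rightarrow> nat \<Rightarrow> 'a \<Rightarrow> 'a" where
  "onb_proj e n y = (\<Sum>k<n. inner (e k) y *\<^sub>R e k)"

text \<open>Vectors of an orthonormal system may also vanish, so that no distinction is needed for finite-dimensional spaces.\<close>

definition orthosys :: "(nat \<Rightarrow> 'a::real_inner) \<Rightarrow> bool" where
  "orthosys e \<longleftrightarrow> (\<forall>j k. inner (e j) (e k) = (if j = k \<and> e k \<noteq> 0 then 1 else 0))"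

lemma bounded_linear_onb_proj: "bounded_linear (onb_proj e n)"
  unfolding onb_proj_def[abs_def]
  by (intro bounded_linear_sum bounded_linear_scaleR_const bounded_linear_inner_right)

lemma onb_proj_self:
  assumes e: "orthosys e" "k < n" shows "onb_proj e n (e k) = e k"
proof -
  have "onb_proj e n (e k) = (\<Sum>j<n. if j = k then e k else 0)"
    unfolding onb_proj_def using e(1) by (intro sum.cong) (auto simp: orthosys_def)
  then show ?thesis using e(2) by simp
qed

lemma onb_proj_sum:
  assumes e: "orthosys e" shows "onb_proj e n (\<Sum>k<n. a k *\<^sub>R e k) = (\<Sum>k<n. a k *\<^sub>R e k)"
proof -
  interpret bounded_linear "onb_proj e n" by (rule bounded_linear_onb_proj)
  show ?thesis by (simp add: sum scaleR onb_proj_self[OF e])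
qed

lemma orthosys_norm_sum:
  assumes e: "orthosys e" and F: "finite F"
  shows "(norm (\<Sum>k\<in>F. a k *\<^sub>R e k))\<^sup>2 = (\<Sum>k\<in>F. (a k)\<^sup>2 * (norm (e k))\<^sup>2)"
proof -
  have "inner (\<Sum>k\<in>F. a k *\<^sub>R e k) (\<Sum>k\<in>F. a k *\<^sub>R e k) = (\<Sum>k\<in>F. \<Sum>j\<in>F. a k * (a j * inner (e j) (e k)))"
    by (simp only: inner_sum_left inner_sum_right inner_scaleR_left inner_scaleR_right sum_distrib_left)
  also have "\<dots> = (\<Sum>k\<in>F. \<Sum>j\<in>F. if j = k then (a k)\<^sup>2 * inner (e k) (e k) else 0)"
    using e by (intro sum.cong refl) (auto simp: orthosys_def power2_eq_square)
  also have "\<dots> = (\<Sum>k\<in>F. (a k)\<^sup>2 * (norm (e k))\<^sup>2)"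
    using F by (simp add: power2_norm_eq_inner)
  finally show ?thesis by (simp add: power2_norm_eq_inner)
qed

lemma norm_onb_proj_le:
  assumes e: "orthosys e" shows "norm (onb_proj e n y) \<le> norm y"
proof -
  have t: "(inner (e k) y)\<^sup>2 * (norm (e k))\<^sup>2 = inner (e k) y * inner (e k) y" for k
  proof (cases "e k = 0")
    case False
    then have 1: "(norm (e k))\<^sup>2 = 1" using e by (simp add: orthosys_def power2_norm_eq_inner)
    show ?thesis unfolding 1 by (simp add: power2_eq_square)
  qed simp
  have "(norm (onb_proj e n y))\<^sup>2 = (\<Sum>k<n. inner (e k) y * inner (e k) y)"
    unfolding onb_proj_def orthosys_norm_sum[OF e finite_lessThan] by (simp only: t)
  also have "\<dots> = inner (onb_proj e n y) y"
    by (simp add: onb_proj_def inner_sum_left)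
  also have "\<dots> \<le> norm (onb_proj e n y) * norm y" by (rule norm_cauchy_schwarz)
  finally show ?thesis
    by (cases "onb_proj e n y = 0") (auto simp: power2_eq_square)
qed

lemma inner_onb_proj: "inner (onb_proj e n x) y = inner x (onb_proj e n y)"
  by (simp add: onb_proj_def inner_sum_left inner_sum_right inner_commute mult.commute)

text \<open>Gram-Schmidt on a dense sequence \<open>d\<close>: the n-th projection fixes every
  \<open>d i\<close> with i below n, and contractivity carries convergence over to the
  closure.\<close>

lemma ex_onb:
  "\<exists>e :: nat \<Rightarrow> 'a::{real_inner,second_countable_topology}. orthosys e \<and> (\<forall>y. (\<lambda>n. onb_proj e n y) \<longlonglongrightarrow> y)"
proof -
  obtain D :: "'a set" where D: "countable D" "\<And>X. open X \<Longrightarrow> X \<noteq> {} \<Longrightarrow> \<exists>d\<in>D. d \<in> X"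
    using countable_dense_setE by blast
  have "D \<noteq> {}" using D(2)[of UNIV] by auto
  define d where "d = from_nat_into D"
  have rd: "range d = D" unfolding d_def using D(1) \<open>D \<noteq> {}\<close> by (rule range_from_nat_into[rotated])
  define e where "e = gram_schmidt d"
  define r where "r n = d n - (\<Sum>k<n. inner (e k) (d n) *\<^sub>R e k)" for n
  have e_r: "e n = sgn (r n)" for n unfolding e_def r_def by (rule gram_schmidt.simps)
  have en: "inner (e k) (e k) = (if e k \<noteq> 0 then 1 else 0)" for k
    using norm_sgn[of "r k"] by (auto simp: e_r norm_eq_1[symmetric] sgn_zero_iff)
  have orth: "j < n \<Longrightarrow> inner (e j) (e n) = 0" for j n
  proof (induction n arbitrary: j rule: less_induct)
    case (less n)
    have z: "inner (e j) (e k) = 0" if "k < n" "k \<noteq> j" for k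
      using less.IH[of k j] less.IH[of j k] that less.prems by (cases "j < k") (auto simp: inner_commute)
    have "inner (e j) (r n) = inner (e j) (d n) - (\<Sum>k<n. inner (e k) (d n) * inner (e j) (e k))"
      by (simp add: r_def inner_diff_right inner_sum_right)
    also have "(\<Sum>k<n. inner (e k) (d n) * inner (e j) (e k)) = (\<Sum>k<n. if k = j then inner (e j) (d n) * inner (e j) (e j) else 0)"
      using z by (intro sum.cong) auto
    also have "\<dots> = inner (e j) (d n)" using less.prems en[of j] by auto
    finally show ?case by (simp add: e_r sgn_div_norm)
  qed
  have os: "orthosys e"
    unfolding orthosys_def
  proof (intro allI)
    fix j k show "inner (e j) (e k) = (if j = k \<and> e k \<noteq> 0 then 1 else 0)"
      using orth[of j k] orth[of k j] en[of k] by (cases j k rule: linorder_cases) (auto simp: inner_commute)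
  qed
  have Pd: "onb_proj e N (d n) = d n" if "n < N" for n N
  proof -
    interpret bounded_linear "onb_proj e N" by (rule bounded_linear_onb_proj)
    have dn: "d n = norm (r n) *\<^sub>R e n + (\<Sum>k<n. inner (e k) (d n) *\<^sub>R e k)"
    proof -
      have "norm (r n) *\<^sub>R e n = r n" by (cases "r n = 0") (simp_all add: e_r sgn_div_norm)
      then show ?thesis by (simp add: r_def)
    qed
    have "onb_proj e N (norm (r n) *\<^sub>R e n + (\<Sum>k<n. inner (e k) (d n) *\<^sub>R e k)) = norm (r n) *\<^sub>R e n + (\<Sum>k<n. inner (e k) (d n) *\<^sub>R e k)"
      using that onb_proj_self[OF os, of _ N] by (simp add: add sum scaleR)
    then show ?thesis using dn by simp
  qed
  have "(\<lambda>n. onb_proj e n y) \<longlonglongrightarrow> y" for y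
  proof (rule LIMSEQ_I)
    fix \<epsilon> :: real assume "\<epsilon> > 0"
    then obtain x where "x \<in> D" "x \<in> ball y (\<epsilon>/2)" using D(2)[of "ball y (\<epsilon>/2)"] by auto
    then obtain i where i: "norm (y - d i) < \<epsilon>/2" using rd by (auto simp: dist_norm)
    have "norm (onb_proj e n y - y) < \<epsilon>" if "n \<ge> Suc i" for n
    proof -
      have eq: "onb_proj e n y - y = onb_proj e n (y - d i) - (y - d i)"
        using Pd[of i n] that linear_diff[OF bounded_linear.linear[OF bounded_linear_onb_proj[of e n]], of y "d i"] by simp
      show ?thesis unfolding eq
        using norm_triangle_ineq4[of "onb_proj e n (y - d i)" "y - d i"] norm_onb_proj_le[OF os, of n "y - d i"] i by simp
    qed
    then show "\<exists>no. \<forall>n\<ge>no. norm (onb_proj e n y - y) < \<epsilon>" by blast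
  qed
  with os show ?thesis by blast
qed

text \<open>By Pythagoras the squared norms of the terms are summable, and their tails are the
  squared norms of blocks of the series.\<close>

lemma orthosys_convergent:
  fixes e :: "nat \<Rightarrow> 'a::{real_inner,banach}"
  assumes e: "orthosys e" and b: "\<And>n. norm (\<Sum>k<n. a k *\<^sub>R e k) \<le> B"
  shows "convergent (\<lambda>n. \<Sum>k<n. a k *\<^sub>R e k)"
proof -
  let ?f = "\<lambda>k. (a k)\<^sup>2 * (norm (e k))\<^sup>2"
  have "sum ?f {..<n} \<le> B\<^sup>2" for n
  proof -
    have "sum ?f {..<n} = (norm (\<Sum>k<n. a k *\<^sub>R e k))\<^sup>2" by (rule orthosys_norm_sum[OF e finite_lessThan, symmetric])
    also have "\<dots> \<le> B\<^sup>2" using b[of n] by (intro power_mono) auto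
    finally show ?thesis .
  qed
  then have "summable ?f" by (intro summableI_nonneg_bounded) auto
  then have C: "\<exists>N. \<forall>m\<ge>N. \<forall>n. norm (sum ?f {m..<n}) < \<epsilon>" if "\<epsilon> > 0" for \<epsilon>
    using that by (simp only: summable_Cauchy)
  have "summable (\<lambda>k. a k *\<^sub>R e k)"
    unfolding summable_Cauchy
  proof (intro allI impI)
    fix \<epsilon> :: real assume "\<epsilon> > 0"
    then have "\<epsilon>\<^sup>2 > 0" by simp
    from C[OF this] obtain N where N: "\<forall>m\<ge>N. \<forall>n. norm (sum ?f {m..<n}) < \<epsilon>\<^sup>2" by blast
    have "norm (\<Sum>k=m..<n. a k *\<^sub>R e k) < \<epsilon>" if "m \<ge> N" for m n
    proof (rule power2_less_imp_less)
      show "(norm (\<Sum>k=m..<n. a k *\<^sub>R e k))\<^sup>2 < \<epsilon>\<^sup>2"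
        unfolding orthosys_norm_sum[OF e finite_atLeastLessThan] using N[rule_format, OF that, of n]
        by (simp add: sum_nonneg)
    qed (use \<open>\<epsilon> > 0\<close> in simp)
    then show "\<exists>N. \<forall>m\<ge>N. \<forall>n. norm (\<Sum>k=m..<n. a k *\<^sub>R e k) < \<epsilon>" by blast
  qed
  then show ?thesis by (simp add: summable_iff_convergent)
qed

section \<open>The dual of a Bochner space with values in a Hilbert space\<close>

text \<open>The power bound does double duty: it gives continuity at the empty set, hence countable
  additivity of a merely additive set function, and it gives absolute continuity. Set functions that
  come from functionals on L^q satisfy it with exponent 1/q.\<close>

lemma Radon_Nikodym_real:
  assumes "finite_measure M" and nn: "\<And>E. E \<in> sets M \<Longrightarrow> 0 \<le> \<nu> E"
    and add: "\<And>E F. E \<in> sets M \<Longrightarrow> F \<in> sets M \<Longrightarrow> E \<inter> F = {} \<Longrightarrow> \<nu> (E \<union> F) = \<nu> E + \<nu> F"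
    and r: "r > 0" and le: "\<And>E. E \<in> sets M \<Longrightarrow> \<nu> E \<le> C * measure M E powr r"
  obtains m :: "'a \<Rightarrow> real" where "m \<in> borel_measurable M" "\<And>x. 0 \<le> m x" "integrable M m"
    "\<And>E. E \<in> sets M \<Longrightarrow> \<nu> E = (\<integral>x. indicator E x * m x \<partial>M)"
proof -
  interpret finite_measure M by fact
  have e0: "\<nu> {} = 0" using add[of "{}" "{}"] by simp
  define N where "N = measure_of (space M) (sets M) (\<lambda>E. ennreal (\<nu> E))"
  have sN [measurable_cong]: "sets N = sets M" by (simp add: N_def)
  have ca: "countably_additive (sets M) (\<lambda>E. ennreal (\<nu> E))"
  proof (rule sets.empty_continuous_imp_countably_additive)
    show "positive (sets M) (\<lambda>E. ennreal (\<nu> E))" by (simp add: positive_def e0)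
    show "additive (sets M) (\<lambda>E. ennreal (\<nu> E))" by (auto simp: additive_def add nn)
    fix A :: "nat \<Rightarrow> 'a set" assume A: "range A \<subseteq> sets M" "decseq A" "(\<Inter>i. A i) = {}"
    have "(\<lambda>i. measure M (A i)) \<longlonglongrightarrow> measure M (\<Inter>i. A i)"
      by (rule finite_Lim_measure_decseq) (use A in auto)
    then have "(\<lambda>i. measure M (A i) powr r) \<longlonglongrightarrow> 0 powr r"
      using A(3) r by (intro tendsto_powr2) auto
    then have "(\<lambda>i. C * measure M (A i) powr r) \<longlonglongrightarrow> C * 0"
      by (intro tendsto_mult_left) simp
    then have lim: "(\<lambda>i. C * measure M (A i) powr r) \<longlonglongrightarrow> 0" by simp
    have "A i \<in> sets M" for i using A(1) by auto
    then have "\<forall>\<^sub>F i in sequentially. norm (\<nu> (A i)) \<le> C * measure M (A i) powr r"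
      using le nn by (intro always_eventually allI) simp
    from tendsto_ennrealI[OF Lim_null_comparison[OF this lim]]
    show "(\<lambda>i. ennreal (\<nu> (A i))) \<longlonglongrightarrow> 0" by simp
  qed simp
  have eN: "emeasure N E = ennreal (\<nu> E)" if "E \<in> sets M" for E
    unfolding N_def using that ca sets.space_closed by (intro emeasure_measure_of_sigma) (auto simp: positive_def e0 sets.sigma_algebra_axioms)
  have "absolutely_continuous M N"
    unfolding absolutely_continuous_def
  proof
    fix E assume E: "E \<in> null_sets M"
    then have "measure M E = 0" by (simp add: measure_def null_setsD1)
    then show "E \<in> null_sets N" using le[of E] nn[of E] E eN[of E] by (auto simp: null_sets_def sN)
  qed
  then obtain f where f [measurable]: "f \<in> borel_measurable M" and fN: "density M f = N"
    using Radon_Nikodym[OF _ sN] by blast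
  have ef: "ennreal (\<nu> E) = (\<integral>\<^sup>+x. f x * indicator E x \<partial>M)" if "E \<in> sets M" for E
    using eN[OF that] emeasure_density[OF f that] fN by simp
  have fin: "(\<integral>\<^sup>+x. f x \<partial>M) \<noteq> \<infinity>"
  proof -
    have "(\<integral>\<^sup>+x. f x \<partial>M) = (\<integral>\<^sup>+x. f x * indicator (space M) x \<partial>M)" by (intro nn_integral_cong) auto
    then have "(\<integral>\<^sup>+x. f x \<partial>M) = ennreal (\<nu> (space M))" using ef[of "space M"] by simp
    then show ?thesis by simp
  qed
  then have ffin: "AE x in M. f x \<noteq> \<infinity>" by (intro nn_integral_noteq_infinite) auto
  define m where "m x = enn2real (f x)" for x
  have [measurable]: "m \<in> borel_measurable M" unfolding m_def by measurable
  have mf: "AE x in M. ennreal (m x) = f x" using ffin by eventually_elim (simp add: m_def less_top)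
  have "(\<integral>\<^sup>+x. ennreal (m x) \<partial>M) = (\<integral>\<^sup>+x. f x \<partial>M)" using mf by (rule nn_integral_cong_AE)
  then have mi: "integrable M m" using fin by (intro integrableI_nonneg) (auto simp: m_def less_top)
  have "\<nu> E = (\<integral>x. indicator E x * m x \<partial>M)" if E: "E \<in> sets M" for E
  proof -
    have "ennreal (\<nu> E) = (\<integral>\<^sup>+x. ennreal (indicator E x * m x) \<partial>M)"
      unfolding ef[OF E] using mf
      by (intro nn_integral_cong_AE, eventually_elim) (auto simp: indicator_def)
    also have "\<dots> = ennreal (\<integral>x. indicator E x * m x \<partial>M)"
      using integrable_mult_indicator[OF E mi] by (intro nn_integral_eq_integral) (auto simp: m_def)
    finally show ?thesis using nn[OF E] by (simp add: integral_nonneg_AE m_def)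
  qed
  then show ?thesis using mi by (intro that[of m]) (auto simp: m_def)
qed

text \<open>Test functions bounded everywhere rather than almost everywhere: they lie in every L^q
  of a finite measure, and products and pointwise bounded operators keep them in the class.\<close>

definition bm :: "'a measure \<Rightarrow> ('a \<Rightarrow> 'b::real_normed_vector) set" where
  "bm M = {g \<in> borel_measurable M. \<exists>B. \<forall>t\<in>space M. norm (g t) \<le> B}"

lemma bmI: "g \<in> borel_measurable M \<Longrightarrow> (\<And>t. t \<in> space M \<Longrightarrow> norm (g t) \<le> B) \<Longrightarrow> g \<in> bm M"
  by (auto simp: bm_def)

lemma bmE:
  assumes "g \<in> bm M" obtains B where "g \<in> borel_measurable M" "0 \<le> B" "\<And>t. t \<in> space M \<Longrightarrow> norm (g t) \<le> B"
proof -
  from assms obtain B where "g \<in> borel_measurable M" "\<forall>t\<in>space M. norm (g t) \<le> B" by (auto simp: bm_def)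
  then show thesis by (intro that[of "max B 0"]) (auto simp: le_max_iff_disj)
qed

lemma bm_measurable: "g \<in> bm M \<Longrightarrow> g \<in> borel_measurable M"
  by (simp add: bm_def)

lemma bm_add:
  fixes g h :: "'a \<Rightarrow> 'b::{real_normed_vector,second_countable_topology}"
  assumes "g \<in> bm M" "h \<in> bm M" shows "(\<lambda>t. g t + h t) \<in> bm M"
proof -
  obtain A B where "g \<in> borel_measurable M" "\<And>t. t \<in> space M \<Longrightarrow> norm (g t) \<le> A"
    "h \<in> borel_measurable M" "\<And>t. t \<in> space M \<Longrightarrow> norm (h t) \<le> B" using bmE[OF assms(1)] bmE[OF assms(2)] by metis
  then show ?thesis by (intro bmI[of _ _ "A + B"]) (auto intro: order_trans[OF norm_triangle_ineq] add_mono)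
qed

lemma bm_scaleR:
  fixes g :: "'a \<Rightarrow> 'b::{real_normed_vector,second_countable_topology}"
  assumes "g \<in> bm M" "c \<in> bm M" shows "(\<lambda>t. c t *\<^sub>R g t) \<in> bm M"
proof -
  obtain A B where "g \<in> borel_measurable M" "0 \<le> A" "\<And>t. t \<in> space M \<Longrightarrow> norm (g t) \<le> A"
    "c \<in> borel_measurable M" "0 \<le> B" "\<And>t. t \<in> space M \<Longrightarrow> norm (c t) \<le> B" using bmE[OF assms(1)] bmE[OF assms(2)] by metis
  then show ?thesis by (intro bmI[of _ _ "B * A"]) (auto intro: mult_mono)
qed

lemma bm_const: "(\<lambda>t. c) \<in> bm M" by (intro bmI[of _ _ "norm c"]) auto

lemma bm_indicator: "E \<in> sets M \<Longrightarrow> (indicator E :: 'a \<Rightarrow> real) \<in> bm M"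
  by (intro bmI[of _ _ 1]) (auto simp: indicator_def)

lemma bm_indicator_scaleR:
  fixes g :: "'a \<Rightarrow> 'b::{real_normed_vector,second_countable_topology}"
  shows "E \<in> sets M \<Longrightarrow> g \<in> bm M \<Longrightarrow> (\<lambda>t. indicator E t *\<^sub>R g t) \<in> bm M"
  by (intro bm_scaleR bm_indicator)

lemma bm_linear:
  fixes T :: "'b::{real_normed_vector,second_countable_topology} \<Rightarrow> 'c::{real_normed_vector,second_countable_topology}"
  assumes T: "bounded_linear T" and g: "g \<in> bm M" shows "(\<lambda>t. T (g t)) \<in> bm M"
proof -
  obtain B where "g \<in> borel_measurable M" "\<And>t. t \<in> space M \<Longrightarrow> norm (g t) \<le> B" using bmE[OF g] by metis
  moreover obtain K where "0 \<le> K" "\<And>x. norm (T x) \<le> norm x * K" using bounded_linear.nonneg_bounded[OF T] by blast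
  moreover have "T \<in> borel_measurable borel"
    by (intro borel_measurable_continuous_onI linear_continuous_on T)
  ultimately show ?thesis
    by (intro bmI[of _ _ "B * K"]) (auto intro: measurable_compose order_trans[OF _ mult_right_mono])
qed

lemma bm_integrable:
  fixes g :: "'a \<Rightarrow> 'b::{banach,second_countable_topology}"
  assumes "finite_measure M" "g \<in> bm M" shows "integrable M g"
proof -
  interpret finite_measure M by fact
  obtain B where "g \<in> borel_measurable M" "\<And>t. t \<in> space M \<Longrightarrow> norm (g t) \<le> B" using bmE[OF assms(2)] by metis
  then show ?thesis by (intro integrable_const_bound[of g B]) auto
qed

lemma Lp_norm_le:
  assumes "finite_measure M" "q \<ge> 1" "b \<ge> 0" "E \<in> sets M" "f \<in> borel_measurable M"
    and le: "\<And>t. t \<in> space M \<Longrightarrow> norm (f t) \<le> b * indicator E t"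
  shows "Lp_norm q M f \<le> b * measure M E powr (1 / q)"
proof -
  interpret finite_measure M by fact
  have i: "integrable M (\<lambda>t. b powr q * indicator E t)"
    using assms(4) by (intro integrable_mult_right integrable_real_indicator) (auto simp: less_top[symmetric])
  have "(\<integral>t. norm (f t) powr q \<partial>M) \<le> (\<integral>t. b powr q * indicator E t \<partial>M)"
  proof (rule integral_mono')
    show "norm (f t) powr q \<le> b powr q * indicator E t" if "t \<in> space M" for t
      using le[OF that] assms(2,3) by (cases "t \<in> E") (auto intro: powr_mono2)
  qed (use i in auto)
  also have "\<dots> = b powr q * measure M E" using assms(4) by (simp add: sets.Int_space_eq2)
  finally have "Lp_norm q M f \<le> (b powr q * measure M E) powr (1 / q)"
    unfolding Lp_norm_def using assms(2) by (intro powr_mono2) (auto intro: integral_nonneg_AE)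
  also have "\<dots> = b * measure M E powr (1 / q)"
    using assms(2,3) by (simp add: powr_mult powr_powr)
  finally show ?thesis .
qed

lemma Lp_norm_tendsto_0:
  fixes f :: "nat \<Rightarrow> 'a \<Rightarrow> 'b::{real_normed_vector,second_countable_topology}"
  assumes q: "q \<ge> 1" and m: "\<And>n. f n \<in> borel_measurable M"
    and lim: "AE t in M. (\<lambda>n. f n t) \<longlonglongrightarrow> 0" and w: "integrable M (\<lambda>t. w t powr q)"
    and b: "\<And>n. AE t in M. norm (f n t) \<le> w t"
  shows "(\<lambda>n. Lp_norm q M (f n)) \<longlonglongrightarrow> 0"
proof -
  have "(\<lambda>n. \<integral>t. norm (f n t) powr q \<partial>M) \<longlonglongrightarrow> (\<integral>t. 0 \<partial>M)"
  proof (rule integral_dominated_convergence[where w = "\<lambda>t. w t powr q"])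
    show "AE t in M. (\<lambda>n. norm (f n t) powr q) \<longlonglongrightarrow> 0"
      using lim
    proof eventually_elim
      case (elim t)
      have "(\<lambda>n. norm (f n t) powr q) \<longlonglongrightarrow> 0 powr q"
        by (rule tendsto_powr2[OF tendsto_norm_zero[OF elim] tendsto_const]) (use q in auto)
      then show ?case by simp
    qed
    show "AE t in M. norm (norm (f n t) powr q) \<le> w t powr q" for n
      using b[of n] by eventually_elim (use q in \<open>auto intro: powr_mono2\<close>)
    show "(\<lambda>t. norm (f n t) powr q) \<in> borel_measurable M" for n using m[of n] by measurable
  qed (use w in auto)
  then have "(\<lambda>n. (\<integral>t. norm (f n t) powr q \<partial>M) powr (1 / q)) \<longlonglongrightarrow> 0 powr (1 / q)"
    using q by (intro tendsto_powr2) (auto intro!: always_eventually integral_nonneg_AE)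
  then show ?thesis by (simp add: Lp_norm_def)
qed

lemma bm_diff:
  fixes g h :: "'a \<Rightarrow> 'b::{real_normed_vector,second_countable_topology}"
  assumes "g \<in> bm M" "h \<in> bm M" shows "(\<lambda>t. g t - h t) \<in> bm M"
  using bm_add[OF assms(1) bm_scaleR[OF assms(2) bm_const[of "-1"]]] by simp

lemma bm_sum:
  fixes g :: "'i \<Rightarrow> 'a \<Rightarrow> 'b::{real_normed_vector,second_countable_topology}"
  assumes "finite A" "\<And>i. i \<in> A \<Longrightarrow> g i \<in> bm M" shows "(\<lambda>t. \<Sum>i\<in>A. g i t) \<in> bm M"
  using assms by (induction A) (auto intro: bm_const bm_add)

lemma inner_sgn: "inner x (sgn x) = norm (x :: 'a::real_inner)"
  by (cases "x = 0") (simp_all add: sgn_div_norm dot_square_norm power2_eq_square)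

text \<open>A functional on functions with values in a separable Hilbert space. It is bounded in the
  L^q norm, but linearity and the bound are demanded only on bounded functions, which is enough to
  construct a density.\<close>

locale lq_functional = finite_measure M for M :: "'a measure" +
  fixes \<Lambda> :: "('a \<Rightarrow> 'b::{real_inner,banach,second_countable_topology}) \<Rightarrow> real" and q C :: real
  assumes q: "q \<ge> 1" and C: "C \<ge> 0"
    and add: "\<And>g h. g \<in> bm M \<Longrightarrow> h \<in> bm M \<Longrightarrow> \<Lambda> (\<lambda>t. g t + h t) = \<Lambda> g + \<Lambda> h"
    and scale: "\<And>g c. g \<in> bm M \<Longrightarrow> \<Lambda> (\<lambda>t. c *\<^sub>R g t) = c * \<Lambda> g"
    and bound: "\<And>g. g \<in> bm M \<Longrightarrow> \<bar>\<Lambda> g\<bar> \<le> C * Lp_norm q M g"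
begin

lemma diff: "g \<in> bm M \<Longrightarrow> h \<in> bm M \<Longrightarrow> \<Lambda> (\<lambda>t. g t - h t) = \<Lambda> g - \<Lambda> h"
  using add[of g "\<lambda>t. -1 *\<^sub>R h t"] scale[of h "-1"] bm_scaleR[OF _ bm_const[of "-1"], of h M] by simp

lemma sum: "finite A \<Longrightarrow> (\<And>i. i \<in> A \<Longrightarrow> g i \<in> bm M) \<Longrightarrow> \<Lambda> (\<lambda>t. \<Sum>i\<in>A. g i t) = (\<Sum>i\<in>A. \<Lambda> (g i))"
proof (induction A rule: finite_induct)
  case empty
  then show ?case using scale[OF bm_const[of 0], of 0] by simp
next
  case (insert i A)
  then show ?case using add[OF _ bm_sum, of "g i" A g] by simp
qed

lemma cong_AE:
  assumes "g \<in> bm M" "h \<in> bm M" "AE t in M. g t = h t" shows "\<Lambda> g = \<Lambda> h"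
proof -
  have "(\<integral>t. norm (g t - h t) powr q \<partial>M) = (\<integral>t. 0 \<partial>M)"
  proof (rule integral_cong_AE)
    show "AE t in M. norm (g t - h t) powr q = 0" using assms(3) by eventually_elim simp
  qed (use bm_measurable[OF bm_diff[OF assms(1,2)]] in auto)
  then have "Lp_norm q M (\<lambda>t. g t - h t) = 0" by (simp add: Lp_norm_def)
  then show ?thesis using bound[OF bm_diff[OF assms(1,2)]] diff[OF assms(1,2)] by simp
qed

lemma cong: "g \<in> bm M \<Longrightarrow> h \<in> bm M \<Longrightarrow> (\<And>t. t \<in> space M \<Longrightarrow> g t = h t) \<Longrightarrow> \<Lambda> g = \<Lambda> h"
  by (rule cong_AE) auto

lemma tendsto:
  assumes "\<And>n. g n \<in> bm M" "h \<in> bm M" "\<And>t. t \<in> space M \<Longrightarrow> (\<lambda>n. g n t) \<longlonglongrightarrow> h t"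
    and B: "\<And>n t. t \<in> space M \<Longrightarrow> norm (g n t) \<le> B"
  shows "(\<lambda>n. \<Lambda> (g n)) \<longlonglongrightarrow> \<Lambda> h"
proof -
  obtain B' where B': "0 \<le> B'" "\<And>t. t \<in> space M \<Longrightarrow> norm (h t) \<le> B'" using bmE[OF assms(2)] by metis
  have "(\<lambda>n. Lp_norm q M (\<lambda>t. g n t - h t)) \<longlonglongrightarrow> 0"
  proof (rule Lp_norm_tendsto_0[OF q, where w = "\<lambda>t. B + B'"])
    show "(\<lambda>t. g n t - h t) \<in> borel_measurable M" for n by (intro bm_measurable bm_diff assms)
    show "AE t in M. (\<lambda>n. g n t - h t) \<longlonglongrightarrow> 0" using assms(3) by (intro AE_I2 LIM_zero)
    show "AE t in M. norm (g n t - h t) \<le> B + B'" for n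
      using B B'(2) by (intro AE_I2 order_trans[OF norm_triangle_ineq4] add_mono)
  qed simp
  then have "(\<lambda>n. C * Lp_norm q M (\<lambda>t. g n t - h t)) \<longlonglongrightarrow> C * 0" by (intro tendsto_mult_left)
  then have lim: "(\<lambda>n. C * Lp_norm q M (\<lambda>t. g n t - h t)) \<longlonglongrightarrow> 0" by simp
  have "norm (\<Lambda> (g n) - \<Lambda> h) \<le> C * Lp_norm q M (\<lambda>t. g n t - h t)" for n
    using bound[OF bm_diff[OF assms(1)[of n] assms(2)]] diff[OF assms(1)[of n] assms(2)] by simp
  then have "(\<lambda>n. \<Lambda> (g n) - \<Lambda> h) \<longlonglongrightarrow> 0" by (intro Lim_null_comparison[OF always_eventually lim] allI)
  then show ?thesis by (rule LIM_zero_cancel)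
qed

text \<open>Passes from indicators to all bounded \<open>g\<close> by simple functions. The operator
  \<open>T\<close> is a finite-rank projection when a density is constructed and the identity when a
  given density is identified.\<close>

lemma represent_bounded:
  fixes T :: "'b \<Rightarrow> 'b"
  assumes \<phi>: "integrable M \<phi>" and T: "bounded_linear T"
    and rep: "\<And>E y. E \<in> sets M \<Longrightarrow> \<Lambda> (\<lambda>t. indicator E t *\<^sub>R T y) = (\<integral>t. indicator E t * inner (\<phi> t) y \<partial>M)"
    and g: "g \<in> bm M"
  shows "\<Lambda> (\<lambda>t. T (g t)) = (\<integral>t. inner (\<phi> t) (g t) \<partial>M)"
proof -
  interpret T: bounded_linear T by (rule T)
  obtain B where gm: "g \<in> borel_measurable M" and B: "0 \<le> B" "\<And>t. t \<in> space M \<Longrightarrow> norm (g t) \<le> B" using bmE[OF g] by metis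
  obtain s where "\<forall>i. simple_function M (s i)" "\<forall>t\<in>space M. (\<lambda>i. s i t) \<longlonglongrightarrow> g t"
    "\<forall>i. \<forall>t\<in>space M. dist (s i t) 0 \<le> 2 * dist (g t) 0"
    using borel_measurable_implies_sequence_metric[OF gm, of 0] by blast
  then have s: "\<And>i. simple_function M (s i)" and lim: "\<And>t. t \<in> space M \<Longrightarrow> (\<lambda>i. s i t) \<longlonglongrightarrow> g t"
    and sb: "\<And>i t. t \<in> space M \<Longrightarrow> norm (s i t) \<le> 2 * norm (g t)" by auto
  have [measurable]: "\<phi> \<in> borel_measurable M" using \<phi> by auto
  have sm [measurable]: "s i \<in> borel_measurable M" for i using s by (rule borel_measurable_simple_function)
  have sB: "norm (s i t) \<le> 2 * B" if "t \<in> space M" for i t using sb[OF that, of i] B(2)[OF that] by linarith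
  have sbm: "s i \<in> bm M" for i by (rule bmI[OF sm sB])
  obtain K where K: "0 \<le> K" "\<And>x. norm (T x) \<le> norm x * K" using T.nonneg_bounded by blast
  have in_i: "integrable M (\<lambda>t. inner (\<phi> t) (h t))" if hb: "h \<in> bm M" for h
  proof -
    obtain A where h: "h \<in> borel_measurable M" "0 \<le> A" "\<And>t. t \<in> space M \<Longrightarrow> norm (h t) \<le> A" using bmE[OF hb] by metis
    show ?thesis
    proof (rule Bochner_Integration.integrable_bound)
      show "integrable M (\<lambda>t. norm (\<phi> t) * A)" using \<phi> by (intro integrable_mult_left integrable_norm[OF \<phi>])
      show "AE t in M. norm (inner (\<phi> t) (h t)) \<le> norm (norm (\<phi> t) * A)"
      proof (rule AE_I2)
        fix t assume "t \<in> space M"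
        from order_trans[OF Cauchy_Schwarz_ineq2 mult_left_mono[OF h(3)[OF this] norm_ge_zero]]
        show "norm (inner (\<phi> t) (h t)) \<le> norm (norm (\<phi> t) * A)" using h(2) by simp
      qed
      show "(\<lambda>t. inner (\<phi> t) (h t)) \<in> borel_measurable M" using h(1) by simp
    qed
  qed
  have simple: "\<Lambda> (\<lambda>t. T (s i t)) = (\<integral>t. inner (\<phi> t) (s i t) \<partial>M)" for i
  proof -
    let ?V = "s i ` space M" and ?E = "\<lambda>v. s i -` {v} \<inter> space M"
    have fV: "finite ?V" and mE: "?E v \<in> sets M" for v using s[of i] by (auto intro: simple_functionD)
    have dec: "(\<Sum>v\<in>?V. indicator (?E v) t *\<^sub>R f v) = f (s i t)" if "t \<in> space M" for t and f :: "_ \<Rightarrow> 'z::real_vector"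
    proof -
      have "(\<Sum>v\<in>?V. indicator (?E v) t *\<^sub>R f v) = (\<Sum>v\<in>?V. if v = s i t then f v else 0)"
        using that by (intro sum.cong) (auto simp: indicator_def)
      then show ?thesis using fV that by simp
    qed
    have "\<Lambda> (\<lambda>t. T (s i t)) = \<Lambda> (\<lambda>t. \<Sum>v\<in>?V. indicator (?E v) t *\<^sub>R T v)"
      using dec[of _ T] fV mE
      by (intro cong bm_linear[OF T] sbm bm_sum bm_indicator_scaleR bm_const) auto
    also have "\<dots> = (\<Sum>v\<in>?V. \<Lambda> (\<lambda>t. indicator (?E v) t *\<^sub>R T v))"
      using fV mE by (intro sum bm_indicator_scaleR bm_const) auto
    also have "\<dots> = (\<Sum>v\<in>?V. \<integral>t. indicator (?E v) t * inner (\<phi> t) v \<partial>M)"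
      using mE by (intro sum.cong refl rep) auto
    also have "\<dots> = (\<integral>t. (\<Sum>v\<in>?V. indicator (?E v) t * inner (\<phi> t) v) \<partial>M)"
    proof (rule Bochner_Integration.integral_sum[symmetric])
      fix v
      have "integrable M (\<lambda>t. inner (\<phi> t) (indicator (?E v) t *\<^sub>R v))"
        by (intro in_i bm_indicator_scaleR mE bm_const)
      then show "integrable M (\<lambda>t. indicator (?E v) t * inner (\<phi> t) v)" by simp
    qed
    also have "\<dots> = (\<integral>t. inner (\<phi> t) (s i t) \<partial>M)"
    proof (intro Bochner_Integration.integral_cong refl)
      fix t assume "t \<in> space M"
      from dec[OF this, of "\<lambda>v. inner (\<phi> t) v"]
      show "(\<Sum>v\<in>?V. indicator (?E v) t * inner (\<phi> t) v) = inner (\<phi> t) (s i t)" by simp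
    qed
    finally show ?thesis .
  qed
  have "(\<lambda>i. \<Lambda> (\<lambda>t. T (s i t))) \<longlonglongrightarrow> \<Lambda> (\<lambda>t. T (g t))"
  proof (rule tendsto)
    show "norm (T (s i t)) \<le> 2 * B * K" if "t \<in> space M" for i t
      using K(2)[of "s i t"] mult_right_mono[OF sB[OF that] K(1)] by (rule order_trans)
  qed (auto intro: bm_linear[OF T] sbm g T.tendsto lim)
  moreover have "(\<lambda>i. \<integral>t. inner (\<phi> t) (s i t) \<partial>M) \<longlonglongrightarrow> (\<integral>t. inner (\<phi> t) (g t) \<partial>M)"
  proof (rule integral_dominated_convergence[where w = "\<lambda>t. norm (\<phi> t) * (2 * B)"])
    show "AE t in M. (\<lambda>i. inner (\<phi> t) (s i t)) \<longlonglongrightarrow> inner (\<phi> t) (g t)"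
      by (intro AE_I2 tendsto_inner tendsto_const lim)
    show "AE t in M. norm (inner (\<phi> t) (s i t)) \<le> norm (\<phi> t) * (2 * B)" for i
    proof (rule AE_I2)
      fix t assume "t \<in> space M"
      from order_trans[OF Cauchy_Schwarz_ineq2 mult_left_mono[OF sB[OF this] norm_ge_zero]]
      show "norm (inner (\<phi> t) (s i t)) \<le> norm (\<phi> t) * (2 * B)" by simp
    qed
    show "integrable M (\<lambda>t. norm (\<phi> t) * (2 * B))" using \<phi> by (intro integrable_mult_left integrable_norm[OF \<phi>])
    show "(\<lambda>t. inner (\<phi> t) (g t)) \<in> borel_measurable M" using gm by simp
  qed measurable
  ultimately show ?thesis unfolding simple by (rule LIMSEQ_unique)
qed

definition ub :: "('a \<Rightarrow> 'b) set" where
  "ub = {g \<in> borel_measurable M. \<forall>t. norm (g t) \<le> 1}"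

text \<open>Total variation on \<open>E\<close> of the vector measure induced by the functional,
  with unit-ball-valued functions in place of partitions.\<close>

definition var :: "'a set \<Rightarrow> real" where
  "var E = (SUP g\<in>ub. \<Lambda> (\<lambda>t. indicator E t *\<^sub>R g t))"

lemma ub_bm: "g \<in> ub \<Longrightarrow> g \<in> bm M" by (auto simp: ub_def intro: bmI)

lemma indicator_le:
  assumes "E \<in> sets M" "g \<in> ub"
  shows "\<bar>\<Lambda> (\<lambda>t. indicator E t *\<^sub>R g t)\<bar> \<le> C * measure M E powr (1 / q)"
proof -
  have bm: "(\<lambda>t. indicator E t *\<^sub>R g t) \<in> bm M" by (intro bm_indicator_scaleR assms ub_bm)
  have "Lp_norm q M (\<lambda>t. indicator E t *\<^sub>R g t) \<le> 1 * measure M E powr (1 / q)"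
    using assms by (intro Lp_norm_le q bm_measurable[OF bm]) (auto simp: finite_measure_axioms ub_def indicator_def)
  then show ?thesis using bound[OF bm] mult_left_mono[of _ _ C] C by force
qed

lemma var_bdd: "E \<in> sets M \<Longrightarrow> bdd_above ((\<lambda>g. \<Lambda> (\<lambda>t. indicator E t *\<^sub>R g t)) ` ub)"
  using indicator_le by (intro bdd_aboveI[of _ "C * measure M E powr (1 / q)"]) (force simp: abs_le_iff)

lemma ub_0: "(\<lambda>t. 0) \<in> ub" by (simp add: ub_def)

lemma var_upper: "E \<in> sets M \<Longrightarrow> g \<in> ub \<Longrightarrow> \<Lambda> (\<lambda>t. indicator E t *\<^sub>R g t) \<le> var E"
  unfolding var_def by (intro cSUP_upper var_bdd)

lemma var_nonneg: "E \<in> sets M \<Longrightarrow> 0 \<le> var E"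
  using var_upper[OF _ ub_0] scale[OF bm_const[of 0], of 0] by simp

lemma var_le: "E \<in> sets M \<Longrightarrow> var E \<le> C * measure M E powr (1 / q)"
  unfolding var_def using ub_0 indicator_le by (intro cSUP_least) (auto simp: abs_le_iff)

lemma var_add:
  assumes E: "E \<in> sets M" and F: "F \<in> sets M" and d: "E \<inter> F = {}"
  shows "var (E \<union> F) = var E + var F"
proof (rule antisym)
  have sp: "\<Lambda> (\<lambda>t. indicator (E \<union> F) t *\<^sub>R g t) = \<Lambda> (\<lambda>t. indicator E t *\<^sub>R g t) + \<Lambda> (\<lambda>t. indicator F t *\<^sub>R g t)"
    if "g \<in> bm M" for g
  proof -
    have "(\<lambda>t. indicator (E \<union> F) t *\<^sub>R g t) = (\<lambda>t. indicator E t *\<^sub>R g t + indicator F t *\<^sub>R g t)"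
      using d by (auto simp: fun_eq_iff indicator_def)
    then show ?thesis using add[OF bm_indicator_scaleR[OF E that] bm_indicator_scaleR[OF F that]] by simp
  qed
  show "var (E \<union> F) \<le> var E + var F"
    unfolding var_def[of "E \<union> F"]
  proof (rule cSUP_least)
    show "ub \<noteq> {}" using ub_0 by blast
    show "\<Lambda> (\<lambda>t. indicator (E \<union> F) t *\<^sub>R g t) \<le> var E + var F" if "g \<in> ub" for g
      unfolding sp[OF ub_bm[OF that]] by (intro add_mono var_upper E F that)
  qed
  have "var E \<le> var (E \<union> F) - \<Lambda> (\<lambda>t. indicator F t *\<^sub>R h t)" if h: "h \<in> ub" for h
    unfolding var_def[of E]
  proof (rule cSUP_least)
    fix g assume g: "g \<in> ub"
    \<comment> \<open>Gluing \<open>g\<close> on \<open>E\<close> with \<open>h\<close> elsewhere is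
      again admissible, so both suprema can be approached at the same time.\<close>
    let ?k = "\<lambda>t. if t \<in> E then g t else h t"
    have k: "?k \<in> ub" using g h E by (auto simp: ub_def intro!: measurable_If_set)
    have "(\<lambda>t. indicator E t *\<^sub>R ?k t) = (\<lambda>t. indicator E t *\<^sub>R g t)" "(\<lambda>t. indicator F t *\<^sub>R ?k t) = (\<lambda>t. indicator F t *\<^sub>R h t)"
      using d by (auto simp: fun_eq_iff indicator_def)
    then show "\<Lambda> (\<lambda>t. indicator E t *\<^sub>R g t) \<le> var (E \<union> F) - \<Lambda> (\<lambda>t. indicator F t *\<^sub>R h t)"
      using var_upper[OF sets.Un[OF E F] k] sp[OF ub_bm[OF k]] by simp
  qed (use ub_0 in auto)
  note * = this
  have "var F \<le> var (E \<union> F) - var E"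
    unfolding var_def[of F]
  proof (rule cSUP_least)
    show "ub \<noteq> {}" using ub_0 by blast
    show "\<Lambda> (\<lambda>t. indicator F t *\<^sub>R h t) \<le> var (E \<union> F) - var E" if "h \<in> ub" for h
      using *[OF that] by linarith
  qed
  then show "var E + var F \<le> var (E \<union> F)" by simp
qed

text \<open>The coordinates of the density along an orthonormal system are scalar Radon-Nikodym
  derivatives. Their partial sums are bounded almost everywhere by the density \<open>m\<close> of
  the variation, so the orthogonal series converges pointwise: a concrete form of the Radon-Nikodym
  property of Hilbert spaces.\<close>

lemma dual_density:
  obtains \<phi> where "\<phi> \<in> borel_measurable M" "integrable M \<phi>" "\<And>g. g \<in> bm M \<Longrightarrow> \<Lambda> g = (\<integral>t. inner (\<phi> t) (g t) \<partial>M)"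
proof -
  have q0: "1 / q > 0" using q by simp
  obtain m where m [measurable]: "m \<in> borel_measurable M" and m0: "\<And>x. 0 \<le> m x" and mi: "integrable M m"
    and vm: "\<And>E. E \<in> sets M \<Longrightarrow> var E = (\<integral>x. indicator E x * m x \<partial>M)"
    by (rule Radon_Nikodym_real[OF finite_measure_axioms var_nonneg var_add q0 var_le]) (assumption+, blast intro: that)
  obtain e :: "nat \<Rightarrow> 'b" where os: "orthosys e" and elim: "\<And>y. (\<lambda>n. onb_proj e n y) \<longlonglongrightarrow> y" using ex_onb by metis
  have en: "norm (e k) \<le> 1" for k
  proof (rule power2_le_imp_le)
    show "(norm (e k))\<^sup>2 \<le> 1\<^sup>2" using os unfolding orthosys_def power2_norm_eq_inner by simp
  qed simp
  have eub: "(\<lambda>t. e k) \<in> ub" for k using en by (simp add: ub_def)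
  have "\<exists>f. integrable M f \<and> (\<forall>E\<in>sets M. \<Lambda> (\<lambda>t. indicator E t *\<^sub>R e k) = (\<integral>t. indicator E t * f t \<partial>M))" for k
  proof -
    \<comment> \<open>The coordinate set function is signed. Adding the variation makes it
      nonnegative, and \<open>m\<close> is subtracted from the resulting density afterwards.\<close>
    let ?\<nu> = "\<lambda>E. \<Lambda> (\<lambda>t. indicator E t *\<^sub>R e k) + var E"
    have low: "- \<Lambda> (\<lambda>t. indicator E t *\<^sub>R e k) \<le> var E" if "E \<in> sets M" for E
    proof -
      have "(\<lambda>t. - e k) \<in> ub" using en by (simp add: ub_def)
      from var_upper[OF that this] scale[OF bm_indicator_scaleR[OF that bm_const[of "e k"]], of "-1"] show ?thesis by simp
    qed
    obtain f where f: "integrable M f" "\<And>E. E \<in> sets M \<Longrightarrow> ?\<nu> E = (\<integral>x. indicator E x * f x \<partial>M)"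
    proof (rule Radon_Nikodym_real[OF finite_measure_axioms, of ?\<nu> "1/q" "2 * C"])
      show "0 \<le> ?\<nu> E" if "E \<in> sets M" for E using low[OF that] by simp
      show "?\<nu> (E \<union> F) = ?\<nu> E + ?\<nu> F" if "E \<in> sets M" "F \<in> sets M" "E \<inter> F = {}" for E F
      proof -
        have "(\<lambda>t. indicator (E \<union> F) t *\<^sub>R e k) = (\<lambda>t. indicator E t *\<^sub>R e k + indicator F t *\<^sub>R e k)"
          using that(3) by (auto simp: fun_eq_iff indicator_def)
        then show ?thesis
          using add[OF bm_indicator_scaleR[OF that(1) bm_const[of "e k"]] bm_indicator_scaleR[OF that(2) bm_const[of "e k"]]] var_add[OF that] by simp
      qed
      show "?\<nu> E \<le> 2 * C * measure M E powr (1 / q)" if "E \<in> sets M" for E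
        using var_upper[OF that eub, of k] var_le[OF that] by simp
    qed (use q0 that in auto)
    have "\<Lambda> (\<lambda>t. indicator E t *\<^sub>R e k) = (\<integral>t. indicator E t * (f t - m t) \<partial>M)" if E: "E \<in> sets M" for E
      using f(2)[OF E] vm[OF E] integrable_mult_indicator[OF E f(1)] integrable_mult_indicator[OF E mi]
      by (simp add: right_diff_distrib)
    then show ?thesis using f(1) mi by (intro exI[of _ "\<lambda>t. f t - m t"]) auto
  qed
  then obtain f where fi: "\<And>k. integrable M (f k)"
    and f: "\<And>k E. E \<in> sets M \<Longrightarrow> \<Lambda> (\<lambda>t. indicator E t *\<^sub>R e k) = (\<integral>t. indicator E t * f k t \<partial>M)" by metis
  have [measurable]: "f k \<in> borel_measurable M" for k using fi by auto
  define \<phi> where "\<phi> n t = (\<Sum>k<n. f k t *\<^sub>R e k)" for n t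
  have \<phi>m [measurable]: "\<phi> n \<in> borel_measurable M" for n unfolding \<phi>_def[abs_def] by measurable
  have \<phi>i: "integrable M (\<phi> n)" for n
    unfolding \<phi>_def[abs_def] using fi by (intro Bochner_Integration.integrable_sum integrable_scaleR_left)
  have rep: "\<Lambda> (\<lambda>t. onb_proj e n (g t)) = (\<integral>t. inner (\<phi> n t) (g t) \<partial>M)" if "g \<in> bm M" for g n
  proof (rule represent_bounded[OF \<phi>i bounded_linear_onb_proj _ that])
    fix E y assume E: "E \<in> sets M"
    have fE: "integrable M (\<lambda>t. indicator E t * f k t)" for k using integrable_mult_indicator[OF E fi[of k]] by simp
    have "\<Lambda> (\<lambda>t. indicator E t *\<^sub>R onb_proj e n y) = \<Lambda> (\<lambda>t. \<Sum>k<n. inner (e k) y *\<^sub>R (indicator E t *\<^sub>R e k))"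
      by (rule arg_cong[where f = \<Lambda>]) (simp add: onb_proj_def scaleR_sum_right mult.commute)
    also have "\<dots> = (\<Sum>k<n. \<Lambda> (\<lambda>t. inner (e k) y *\<^sub>R (indicator E t *\<^sub>R e k)))"
      by (intro sum bm_scaleR[OF _ bm_const] bm_indicator_scaleR E bm_const) auto
    also have "\<dots> = (\<Sum>k<n. inner (e k) y * (\<integral>t. indicator E t * f k t \<partial>M))"
      by (simp only: scale[OF bm_indicator_scaleR[OF E bm_const]] f[OF E])
    also have "\<dots> = (\<integral>t. (\<Sum>k<n. inner (e k) y * (indicator E t * f k t)) \<partial>M)"
      using fE by simp
    also have "\<dots> = (\<integral>t. indicator E t * inner (\<phi> n t) y \<partial>M)"
      by (intro Bochner_Integration.integral_cong refl) (simp add: \<phi>_def inner_sum_left sum_distrib_left mult_ac)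
    finally show "\<Lambda> (\<lambda>t. indicator E t *\<^sub>R onb_proj e n y) = (\<integral>t. indicator E t * inner (\<phi> n t) y \<partial>M)" .
  qed
  have "AE t in M. norm (\<phi> n t) \<le> m t" for n
  proof -
    \<comment> \<open>On the set where the bound fails, the functional is tested with the direction
      of \<open>\<phi> n\<close> itself. This lies in the span of the first n vectors, so the
      projection in \<open>rep\<close> leaves it unchanged.\<close>
    define E where "E = {t \<in> space M. m t < norm (\<phi> n t)}"
    have E [measurable]: "E \<in> sets M" unfolding E_def by measurable
    let ?g = "\<lambda>t. indicator E t *\<^sub>R sgn (\<phi> n t)"
    have sg: "(\<lambda>t. sgn (\<phi> n t)) \<in> ub" by (auto simp: ub_def norm_sgn)
    have P: "onb_proj e n (?g t) = ?g t" for t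
    proof -
      interpret P: bounded_linear "onb_proj e n" by (rule bounded_linear_onb_proj)
      show ?thesis by (simp add: P.scaleR sgn_div_norm) (simp add: \<phi>_def onb_proj_sum[OF os])
    qed
    have "(\<integral>t. indicator E t * norm (\<phi> n t) \<partial>M) = (\<integral>t. inner (\<phi> n t) (?g t) \<partial>M)"
    proof (intro Bochner_Integration.integral_cong refl)
      fix t show "indicator E t * norm (\<phi> n t) = inner (\<phi> n t) (?g t)"
        by (simp add: inner_sgn)
    qed
    also have "\<dots> = \<Lambda> ?g" using rep[OF bm_indicator_scaleR[OF E ub_bm[OF sg]], of n] unfolding P by simp
    also have "\<dots> \<le> (\<integral>t. indicator E t * m t \<partial>M)" using var_upper[OF E sg] vm[OF E] by simp
    finally have le: "(\<integral>t. indicator E t * norm (\<phi> n t) \<partial>M) \<le> (\<integral>t. indicator E t * m t \<partial>M)" .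
    have i1: "integrable M (\<lambda>t. indicator E t * norm (\<phi> n t))" using integrable_mult_indicator[OF E integrable_norm[OF \<phi>i]] by simp
    have i2: "integrable M (\<lambda>t. indicator E t * m t)" using integrable_mult_indicator[OF E mi] by simp
    have i: "integrable M (\<lambda>t. indicator E t * (norm (\<phi> n t) - m t))" using i1 i2 by (simp add: right_diff_distrib)
    have nn: "AE t in M. 0 \<le> indicator E t * (norm (\<phi> n t) - m t)"
      by (intro AE_I2) (auto simp: E_def indicator_def)
    have "(\<integral>t. indicator E t * (norm (\<phi> n t) - m t) \<partial>M) \<le> 0" using le i1 i2 by (simp add: right_diff_distrib)
    then have "(\<integral>t. indicator E t * (norm (\<phi> n t) - m t) \<partial>M) = 0" using integral_nonneg_AE[OF nn] by simp
    then have "AE t in M. indicator E t * (norm (\<phi> n t) - m t) = 0" using integral_nonneg_eq_0_iff_AE[OF i nn] by simp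
    then show ?thesis
      by (rule AE_mp) (intro AE_I2, auto simp: E_def indicator_def split: if_splits)
  qed
  then have bd: "AE t in M. \<forall>n. norm (\<phi> n t) \<le> m t" by (simp add: AE_all_countable)
  then have cv: "AE t in M. convergent (\<lambda>n. \<phi> n t)"
    by eventually_elim (auto simp: \<phi>_def intro: orthosys_convergent[OF os])
  define \<psi> where "\<psi> t = lim (\<lambda>n. \<phi> n t)" for t
  have \<psi>m [measurable]: "\<psi> \<in> borel_measurable M" unfolding \<psi>_def by (rule borel_measurable_lim_metric) measurable
  have l\<psi>: "AE t in M. (\<lambda>n. \<phi> n t) \<longlonglongrightarrow> \<psi> t" using cv by eventually_elim (simp add: \<psi>_def convergent_LIMSEQ_iff)
  have \<psi>b: "AE t in M. norm (\<psi> t) \<le> m t"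
    using l\<psi> bd by eventually_elim (auto intro: LIMSEQ_le_const2[OF tendsto_norm])
  have \<psi>i: "integrable M \<psi>"
    by (rule Bochner_Integration.integrable_bound[OF mi \<psi>m]) (use \<psi>b m0 in \<open>auto elim!: eventually_mono\<close>)
  have "\<Lambda> g = (\<integral>t. inner (\<psi> t) (g t) \<partial>M)" if g: "g \<in> bm M" for g
  proof -
    obtain B where gm [measurable]: "g \<in> borel_measurable M" and B: "0 \<le> B" "\<And>t. t \<in> space M \<Longrightarrow> norm (g t) \<le> B" using bmE[OF g] by metis
    have "(\<lambda>n. \<Lambda> (\<lambda>t. onb_proj e n (g t))) \<longlonglongrightarrow> \<Lambda> g"
      by (rule tendsto[where B = B]) (auto intro: bm_linear[OF bounded_linear_onb_proj] g elim order_trans[OF norm_onb_proj_le[OF os]] B)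
    moreover have "(\<lambda>n. \<integral>t. inner (\<phi> n t) (g t) \<partial>M) \<longlonglongrightarrow> (\<integral>t. inner (\<psi> t) (g t) \<partial>M)"
    proof (rule integral_dominated_convergence[where w = "\<lambda>t. m t * B"])
      show "AE t in M. (\<lambda>n. inner (\<phi> n t) (g t)) \<longlonglongrightarrow> inner (\<psi> t) (g t)"
        using l\<psi> by eventually_elim (intro tendsto_inner tendsto_const)
      show "AE t in M. norm (inner (\<phi> n t) (g t)) \<le> m t * B" for n
        using bd AE_space
      proof eventually_elim
        case (elim t)
        have "norm (inner (\<phi> n t) (g t)) \<le> norm (\<phi> n t) * norm (g t)" using Cauchy_Schwarz_ineq2 by simp
        also have "\<dots> \<le> m t * B" using elim B m0 by (intro mult_mono) auto
        finally show ?case .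
      qed
      show "integrable M (\<lambda>t. m t * B)" using mi by simp
    qed measurable
    ultimately show ?thesis unfolding rep[OF g] by (rule LIMSEQ_unique)
  qed
  then show thesis using \<psi>m \<psi>i by (rule that[rotated 2])
qed

text \<open>Converse of Hoelder's inequality. For p = \<infinity> the test function is the direction
  of the density where its norm exceeds \<open>C\<close>; for finite p it is the extremal function
  of Hoelder's inequality, truncated so that everything is finite before dividing.\<close>

lemma density_in_Lp:
  assumes \<phi>: "\<phi> \<in> borel_measurable M" "integrable M \<phi>" and rep: "\<And>g. g \<in> bm M \<Longrightarrow> \<Lambda> g = (\<integral>t. inner (\<phi> t) (g t) \<partial>M)"
    and p: "1 < p" "q = conj_exponent p"
  shows "\<phi> \<in> Lp_space p M"
proof (cases "p = \<infinity>")
  case True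
  then have q1: "q = 1" using p(2) by (simp add: conj_exponent_def)
  note [measurable] = \<phi>(1)
  define E where "E = {t \<in> space M. C < norm (\<phi> t)}"
  have E [measurable]: "E \<in> sets M" unfolding E_def by measurable
  let ?g = "\<lambda>t. indicator E t *\<^sub>R sgn (\<phi> t)"
  have sg: "(\<lambda>t. sgn (\<phi> t)) \<in> ub" by (auto simp: ub_def norm_sgn)
  have "(\<integral>t. indicator E t * norm (\<phi> t) \<partial>M) = (\<integral>t. inner (\<phi> t) (?g t) \<partial>M)"
  proof (intro Bochner_Integration.integral_cong refl)
    fix t show "indicator E t * norm (\<phi> t) = inner (\<phi> t) (?g t)"
      by (simp add: inner_sgn)
  qed
  also have "\<dots> = \<Lambda> ?g" using rep[OF bm_indicator_scaleR[OF E ub_bm[OF sg]]] by simp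
  also have "\<dots> \<le> C * measure M E" using indicator_le[OF E sg] by (simp add: q1)
  also have "\<dots> = (\<integral>t. indicator E t * C \<partial>M)" by (simp add: sets.Int_space_eq2)
  finally have le: "(\<integral>t. indicator E t * norm (\<phi> t) \<partial>M) \<le> (\<integral>t. indicator E t * C \<partial>M)" .
  have i1: "integrable M (\<lambda>t. indicator E t * norm (\<phi> t))" using integrable_mult_indicator[OF E integrable_norm[OF \<phi>(2)]] by simp
  have i2: "integrable M (\<lambda>t. indicator E t * C)" using integrable_mult_indicator[OF E integrable_const[of C]] by simp
  have i: "integrable M (\<lambda>t. indicator E t * (norm (\<phi> t) - C))" using i1 i2 by (simp only: right_diff_distrib Bochner_Integration.integrable_diff)
  have nn: "AE t in M. 0 \<le> indicator E t * (norm (\<phi> t) - C)"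
    by (intro AE_I2) (auto simp: E_def indicator_def)
  have "(\<integral>t. indicator E t * (norm (\<phi> t) - C) \<partial>M) = (\<integral>t. indicator E t * norm (\<phi> t) \<partial>M) - (\<integral>t. indicator E t * C \<partial>M)"
    by (simp only: right_diff_distrib Bochner_Integration.integral_diff[OF i1 i2])
  then have "(\<integral>t. indicator E t * (norm (\<phi> t) - C) \<partial>M) = 0" using integral_nonneg_AE[OF nn] le by simp
  then have "AE t in M. indicator E t * (norm (\<phi> t) - C) = 0" using integral_nonneg_eq_0_iff_AE[OF i nn] by simp
  then have "AE t in M. norm (\<phi> t) \<le> C"
    by (rule AE_mp) (intro AE_I2, auto simp: E_def indicator_def split: if_splits)
  then show ?thesis using True \<phi>(1) by (auto simp: Lp_space_def)
next
  case False
  then obtain r where r: "p = ereal r" "1 < r" using p(1) by (cases p) auto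
  have qr: "1 / q = 1 - 1 / r" using p(2) r by (simp add: conj_exponent_def one_ereal_def)
  have rq: "(r - 1) * q = r" using qr q r(2) by (simp add: field_simps)
  note [measurable] = \<phi>(1)
  let ?E = "\<lambda>K. {t \<in> space M. norm (\<phi> t) \<le> real K}"
  let ?a = "\<lambda>K. \<integral>t. indicator (?E K) t * norm (\<phi> t) powr r \<partial>M"
  have ai: "integrable M (\<lambda>t. indicator (?E K) t * norm (\<phi> t) powr r)" for K
    using r(2) by (intro integrable_const_bound[of _ "real K powr r"] AE_I2) (auto simp: indicator_def intro: powr_mono2)
  have a_le: "?a K \<le> C powr r" for K
  proof -
    have E [measurable]: "?E K \<in> sets M" by measurable
    \<comment> \<open>Since \<open>(r - 1) * q = r\<close>, the q-th power of the norm of this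
      function is again the truncated integral \<open>?a K\<close>.\<close>
    let ?g = "\<lambda>t. indicator (?E K) t *\<^sub>R (norm (\<phi> t) powr (r - 1) *\<^sub>R sgn (\<phi> t))"
    have gn: "norm (?g t) = indicator (?E K) t * norm (\<phi> t) powr (r - 1)" for t
      by (cases "\<phi> t = 0") (auto simp: norm_sgn)
    have gb: "?g \<in> bm M"
    proof (rule bmI)
      show "?g \<in> borel_measurable M" unfolding sgn_div_norm by measurable
      show "norm (?g t) \<le> real K powr (r - 1)" for t
        unfolding gn using r(2) by (auto simp: indicator_def intro: powr_mono2)
    qed
    have "?a K = (\<integral>t. inner (\<phi> t) (?g t) \<partial>M)"
    proof (intro Bochner_Integration.integral_cong refl)
      fix t
      have x: "x powr r = x powr (r - 1) * x" if "x \<ge> 0" for x :: real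
        using powr_add[of x "r - 1" 1] that by (cases "x = 0") auto
      show "indicator (?E K) t * norm (\<phi> t) powr r = inner (\<phi> t) (?g t)"
        by (simp only: inner_scaleR_right inner_sgn x[OF norm_ge_zero])
    qed
    also have "\<dots> \<le> C * Lp_norm q M ?g" using rep[OF gb] bound[OF gb] by simp
    also have "Lp_norm q M ?g = ?a K powr (1 / q)"
    proof -
      have "norm (?g t) powr q = indicator (?E K) t * norm (\<phi> t) powr r" for t
        unfolding gn using q by (auto simp: indicator_def powr_powr rq)
      then show ?thesis by (simp only: Lp_norm_def)
    qed
    finally have le: "?a K \<le> C * ?a K powr (1 / q)" .
    have a0: "0 \<le> ?a K" by (intro integral_nonneg_AE AE_I2) auto
    show ?thesis
    proof (cases "?a K = 0")
      case False
      then have pos: "?a K > 0" using a0 by linarith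
      have "?a K powr (1 / r) * ?a K powr (1 / q) = ?a K"
        using pos by (simp only: powr_add[symmetric] qr) simp
      with le have "?a K powr (1 / r) * ?a K powr (1 / q) \<le> C * ?a K powr (1 / q)" by simp
      then have "?a K powr (1 / r) \<le> C" using pos by simp
      then have "(?a K powr (1 / r)) powr r \<le> C powr r" using r(2) by (intro powr_mono2) auto
      then show ?thesis using r(2) pos by (simp add: powr_powr)
    qed simp
  qed
  have "integrable M (\<lambda>t. norm (\<phi> t) powr r)"
  proof (rule integrableI_nonneg)
    have "(\<integral>\<^sup>+t. ennreal (norm (\<phi> t) powr r) \<partial>M) \<le> ennreal (C powr r)"
    proof -
      have "(\<integral>\<^sup>+t. ennreal (norm (\<phi> t) powr r) \<partial>M)
        = (\<integral>\<^sup>+t. liminf (\<lambda>K. ennreal (indicator (?E K) t * norm (\<phi> t) powr r)) \<partial>M)"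
      proof (intro nn_integral_cong lim_imp_Liminf[OF sequentially_bot, symmetric])
        fix t assume t: "t \<in> space M"
        obtain K0 where "norm (\<phi> t) \<le> real K0" using real_arch_simple by blast
        then have "\<forall>\<^sub>F K in sequentially. ennreal (indicator (?E K) t * norm (\<phi> t) powr r) = ennreal (norm (\<phi> t) powr r)"
          using t by (intro eventually_sequentiallyI[of K0]) (auto simp: indicator_def)
        then show "(\<lambda>K. ennreal (indicator (?E K) t * norm (\<phi> t) powr r)) \<longlonglongrightarrow> ennreal (norm (\<phi> t) powr r)"
          by (rule tendsto_eventually)
      qed
      also have "\<dots> \<le> liminf (\<lambda>K. \<integral>\<^sup>+t. ennreal (indicator (?E K) t * norm (\<phi> t) powr r) \<partial>M)"
        by (intro nn_integral_liminf) measurable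
      also have "\<dots> \<le> liminf (\<lambda>K::nat. ennreal (C powr r))"
      proof (intro Liminf_mono always_eventually allI)
        fix K
        have "(\<integral>\<^sup>+t. ennreal (indicator (?E K) t * norm (\<phi> t) powr r) \<partial>M) = ennreal (?a K)"
          using ai[of K] by (intro nn_integral_eq_integral AE_I2) auto
        then show "(\<integral>\<^sup>+t. ennreal (indicator (?E K) t * norm (\<phi> t) powr r) \<partial>M) \<le> ennreal (C powr r)"
          using a_le[of K] by (simp add: ennreal_leI)
      qed
      finally show ?thesis by (simp add: Liminf_const)
    qed
    then show "(\<integral>\<^sup>+t. ennreal (norm (\<phi> t) powr r) \<partial>M) < \<infinity>" by (rule order.strict_trans1) simp
  qed (auto intro: AE_I2)
  then show ?thesis using r \<phi>(1) by (auto simp: Lp_space_def)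
qed

end

lemma inner_eqI:
  assumes "\<And>g. inner u g = inner v g" shows "u = (v :: 'a::real_inner)"
proof -
  have "inner (u - v) (u - v) = 0" using assms by (simp add: inner_diff_left)
  then show ?thesis by simp
qed

section \<open>Functionals on time-dependent integrable functions\<close>

abbreviation MI :: "real \<Rightarrow> real \<Rightarrow> real measure" where
  "MI a b \<equiv> restrict_space lborel {a..b}"

section \<open>Lebesgue measure restricted to a compact interval\<close>

lemma space_MI: "space (MI a b) = {a..b}" by (simp add: space_restrict_space)

lemma finite_measure_MI: "finite_measure (MI a b)"
  by (rule finite_measureI) (simp add: emeasure_restrict_space space_restrict_space emeasure_lborel_Icc_eq)

lemma sets_MI: "E \<in> sets borel \<Longrightarrow> E \<subseteq> {a..b} \<Longrightarrow> E \<in> sets (MI a b)"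
  by (auto simp: sets_restrict_space_iff)

lemma sets_MI_D: "E \<in> sets (MI a b) \<Longrightarrow> E \<in> sets borel \<and> E \<subseteq> {a..b}"
  by (auto simp: sets_restrict_space_iff)

lemma borel_measurable_MI: "f \<in> borel_measurable borel \<Longrightarrow> f \<in> borel_measurable (MI a b)"
  by (rule measurable_restrict_space1) simp

lemma measurable_MI_iff:
  fixes f :: "real \<Rightarrow> 'b::{real_normed_vector,second_countable_topology}"
  shows "f \<in> borel_measurable (MI a b) \<longleftrightarrow> (\<lambda>t. indicator {a..b} t *\<^sub>R f t) \<in> borel_measurable borel"
  by (subst borel_measurable_restrict_space_iff) auto

lemma MI_subset:
  fixes f :: "real \<Rightarrow> 'b::{real_normed_vector,second_countable_topology}"
  assumes J: "{c..d} \<subseteq> {a..b}" and f: "f \<in> borel_measurable (MI c d)"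
  shows "(\<lambda>t. indicator {c..d} t *\<^sub>R f t) \<in> borel_measurable (MI a b)"
  using f unfolding measurable_MI_iff[of f] by (rule borel_measurable_MI)

lemma continuous_bm:
  fixes f :: "real \<Rightarrow> 'b::{real_normed_vector,second_countable_topology}"
  assumes f: "continuous_on {a..b} f" shows "f \<in> bm (MI a b)"
proof -
  have "f \<in> borel_measurable (restrict_space borel {a..b})" using f by (rule borel_measurable_continuous_on_restrict)
  then have m: "f \<in> borel_measurable (MI a b)" by (simp cong: measurable_cong_sets sets_restrict_space_cong)
  have "bounded (f ` {a..b})" by (intro compact_imp_bounded compact_continuous_image f) simp
  then obtain B where "\<forall>t\<in>{a..b}. norm (f t) \<le> B" by (auto simp: bounded_iff)
  with m show ?thesis by (intro bmI[of f _ B]) (auto simp: space_MI)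
qed

section \<open>Elementary facts on the spaces L^q of functions\<close>

lemma Lp_space_real: "f \<in> Lp_space (ereal q) M \<longleftrightarrow> f \<in> borel_measurable M \<and> integrable M (\<lambda>x. norm (f x) powr q)"
  by (simp add: Lp_space_def)

lemma Lp_norm_nonneg: "0 \<le> Lp_norm q M f" by (simp add: Lp_norm_def)

lemma powr_add_le:
  fixes x y :: real assumes "0 \<le> x" "0 \<le> y" "0 \<le> q"
  shows "(x + y) powr q \<le> 2 powr q * (x powr q + y powr q)"
proof -
  have "(x + y) powr q \<le> (2 * max x y) powr q" using assms by (intro powr_mono2) auto
  also have "\<dots> = 2 powr q * max x y powr q" using assms by (simp add: powr_mult)
  also have "max x y powr q \<le> x powr q + y powr q" by (auto simp: max_def)
  finally show ?thesis by simp
qed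

lemma Lp_space_add:
  fixes f g :: "'c \<Rightarrow> 'b::{real_normed_vector,second_countable_topology}"
  assumes q: "q \<ge> 1" and f: "f \<in> Lp_space (ereal q) M" and g: "g \<in> Lp_space (ereal q) M"
  shows "(\<lambda>t. f t + g t) \<in> Lp_space (ereal q) M"
  unfolding Lp_space_real
proof
  have [measurable]: "f \<in> borel_measurable M" "g \<in> borel_measurable M" using f g by (auto simp: Lp_space_real)
  show "(\<lambda>t. f t + g t) \<in> borel_measurable M" by measurable
  show "integrable M (\<lambda>x. norm (f x + g x) powr q)"
  proof (rule Bochner_Integration.integrable_bound)
    show "integrable M (\<lambda>x. 2 powr q * (norm (f x) powr q + norm (g x) powr q))"
      using f g by (auto simp: Lp_space_real)
    show "AE x in M. norm (norm (f x + g x) powr q) \<le> norm (2 powr q * (norm (f x) powr q + norm (g x) powr q))"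
    proof (rule AE_I2)
      fix x
      have "norm (f x + g x) powr q \<le> (norm (f x) + norm (g x)) powr q"
        using q by (intro powr_mono2 norm_triangle_ineq) auto
      also have "\<dots> \<le> 2 powr q * (norm (f x) powr q + norm (g x) powr q)" using q by (intro powr_add_le) auto
      finally show "norm (norm (f x + g x) powr q) \<le> norm (2 powr q * (norm (f x) powr q + norm (g x) powr q))" by simp
    qed
  qed measurable
qed

lemma Lp_space_mono:
  fixes f :: "'c \<Rightarrow> 'b::{real_normed_vector,second_countable_topology}" and g :: "'c \<Rightarrow> 'd::{real_normed_vector,second_countable_topology}"
  assumes q: "q \<ge> 1" and f: "f \<in> borel_measurable M" and g: "g \<in> Lp_space (ereal q) M"
    and c: "0 \<le> c" and le: "\<And>t. t \<in> space M \<Longrightarrow> norm (f t) \<le> c * norm (g t)"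
  shows "f \<in> Lp_space (ereal q) M" "Lp_norm q M f \<le> c * Lp_norm q M g"
proof -
  have le': "norm (f t) powr q \<le> c powr q * norm (g t) powr q" if "t \<in> space M" for t
    using le[OF that] q c by (simp add: powr_mult[symmetric] powr_mono2)
  have gi: "integrable M (\<lambda>t. c powr q * norm (g t) powr q)" using g by (simp add: Lp_space_real)
  have fi: "integrable M (\<lambda>t. norm (f t) powr q)"
    by (rule Bochner_Integration.integrable_bound[OF gi]) (use f le' in \<open>auto intro!: AE_I2\<close>)
  then show "f \<in> Lp_space (ereal q) M" using f by (simp add: Lp_space_real)
  have "(\<integral>t. norm (f t) powr q \<partial>M) \<le> (\<integral>t. c powr q * norm (g t) powr q \<partial>M)"
    using fi gi le' by (intro integral_mono)
  also have "\<dots> = c powr q * (\<integral>t. norm (g t) powr q \<partial>M)" by simp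
  finally have "Lp_norm q M f \<le> (c powr q * (\<integral>t. norm (g t) powr q \<partial>M)) powr (1 / q)"
    unfolding Lp_norm_def using q by (intro powr_mono2) auto
  also have "\<dots> = c * Lp_norm q M g"
    using q c by (simp add: powr_mult powr_powr Lp_norm_def)
  finally show "Lp_norm q M f \<le> c * Lp_norm q M g" .
qed

lemma Lp_space_scaleR:
  fixes f :: "'c \<Rightarrow> 'b::{real_normed_vector,second_countable_topology}"
  assumes q: "q \<ge> 1" and f: "f \<in> Lp_space (ereal q) M" shows "(\<lambda>t. c *\<^sub>R f t) \<in> Lp_space (ereal q) M"
  using f by (intro Lp_space_mono(1)[OF q _ f, of _ "\<bar>c\<bar>"]) (auto simp: Lp_space_real)

lemma Lp_space_diff:
  fixes f g :: "'c \<Rightarrow> 'b::{real_normed_vector,second_countable_topology}"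
  assumes q: "q \<ge> 1" and f: "f \<in> Lp_space (ereal q) M" and g: "g \<in> Lp_space (ereal q) M"
  shows "(\<lambda>t. f t - g t) \<in> Lp_space (ereal q) M"
  using Lp_space_add[OF q f Lp_space_scaleR[OF q g, of "-1"]] by simp

lemma Lp_space_indicator:
  fixes f :: "'c \<Rightarrow> 'b::{real_normed_vector,second_countable_topology}"
  assumes q: "q \<ge> 1" and f: "f \<in> Lp_space (ereal q) M" and E: "E \<in> sets M" shows "(\<lambda>t. indicator E t *\<^sub>R f t) \<in> Lp_space (ereal q) M"
  using f E by (intro Lp_space_mono(1)[OF q _ f, of _ 1]) (auto simp: Lp_space_real indicator_def)

lemma bm_Lp_space:
  fixes f :: "'c \<Rightarrow> 'b::{real_normed_vector,second_countable_topology}"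
  assumes "finite_measure M" "q \<ge> 1" "f \<in> bm M" shows "f \<in> Lp_space (ereal q) M"
proof -
  interpret finite_measure M by fact
  obtain B where B: "f \<in> borel_measurable M" "0 \<le> B" "\<And>t. t \<in> space M \<Longrightarrow> norm (f t) \<le> B" using bmE[OF assms(3)] by metis
  have "integrable M (\<lambda>x. norm (f x) powr q)"
    using B assms(2) by (intro integrable_const_bound[of _ "B powr q"] AE_I2) (auto intro: powr_mono2)
  then show ?thesis using B(1) by (simp add: Lp_space_real)
qed

lemma Lp_norm_cong_AE:
  fixes f g :: "'c \<Rightarrow> 'b::{real_normed_vector,second_countable_topology}"
  assumes "f \<in> borel_measurable M" "g \<in> borel_measurable M" "AE t in M. norm (f t) = norm (g t)"
  shows "Lp_norm q M f = Lp_norm q M g"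
proof -
  have "(\<integral>t. norm (f t) powr q \<partial>M) = (\<integral>t. norm (g t) powr q \<partial>M)"
  proof (rule integral_cong_AE)
    show "AE t in M. norm (f t) powr q = norm (g t) powr q" using assms(3) by eventually_elim simp
  qed (use assms in measurable)
  then show ?thesis by (simp add: Lp_norm_def)
qed

text \<open>Functionals pass between intervals by extending functions by zero; this is the norm
  identity behind it.\<close>

lemma Lp_norm_restrict:
  fixes f :: "real \<Rightarrow> 'b::{real_normed_vector,second_countable_topology}"
  assumes J: "{c..d} \<subseteq> {a..b}"
  shows "Lp_norm q (MI a b) (\<lambda>t. indicator {c..d} t *\<^sub>R f t) = Lp_norm q (MI c d) f"
    and "q > 0 \<Longrightarrow> integrable (MI a b) (\<lambda>t. norm (indicator {c..d} t *\<^sub>R f t) powr q) \<longleftrightarrow> integrable (MI c d) (\<lambda>t. norm (f t) powr q)"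
proof -
  have *: "indicator {a..b} t *\<^sub>R (indicator {c..d} t * norm (f t)) powr q = indicator {c..d} t *\<^sub>R norm (f t) powr q" for t
    using J by (auto simp: indicator_def)
  show "Lp_norm q (MI a b) (\<lambda>t. indicator {c..d} t *\<^sub>R f t) = Lp_norm q (MI c d) f"
    unfolding Lp_norm_def by (simp add: integral_restrict_space * del: real_scaleR_def)
  show "integrable (MI a b) (\<lambda>t. norm (indicator {c..d} t *\<^sub>R f t) powr q) \<longleftrightarrow> integrable (MI c d) (\<lambda>t. norm (f t) powr q)"
    by (simp add: integrable_restrict_space set_integrable_def * del: real_scaleR_def)
qed

text \<open>\<open>M_space\<close> without extensionality and with an explicit bound
  \<open>N\<close>: differences, restrictions and weak-* limits stay in the class without adjusting
  values outside the space, and \<open>N\<close> names the ball in which compactness holds.\<close>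

definition lqf :: "real \<Rightarrow> real \<Rightarrow> real \<Rightarrow> real \<Rightarrow> ((real \<Rightarrow> 'a::euclidean_space L1_real) \<Rightarrow> real) \<Rightarrow> bool" where
  "lqf q a b N W \<longleftrightarrow> 1 \<le> q \<and> 0 \<le> N \<and>
    (\<forall>f\<in>Lp_space (ereal q) (MI a b). \<forall>g\<in>Lp_space (ereal q) (MI a b). \<forall>c d. W (\<lambda>t. c *\<^sub>R f t + d *\<^sub>R g t) = c * W f + d * W g) \<and>
    (\<forall>f\<in>Lp_space (ereal q) (MI a b). \<bar>W f\<bar> \<le> N * Lp_norm q (MI a b) f)"

lemma lqfD:
  assumes "lqf q a b N W"
  shows lqf_q: "1 \<le> q" and lqf_N: "0 \<le> N"
    and lqf_lin: "\<And>f g c d. f \<in> Lp_space (ereal q) (MI a b) \<Longrightarrow> g \<in> Lp_space (ereal q) (MI a b) \<Longrightarrow> W (\<lambda>t. c *\<^sub>R f t + d *\<^sub>R g t) = c * W f + d * W g"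
    and lqf_le: "\<And>f. f \<in> Lp_space (ereal q) (MI a b) \<Longrightarrow> \<bar>W f\<bar> \<le> N * Lp_norm q (MI a b) f"
  using assms by (auto simp: lqf_def)

lemma lqf_mono: "lqf q a b N W \<Longrightarrow> N \<le> N' \<Longrightarrow> lqf q a b N' W"
  unfolding lqf_def by (meson Lp_norm_nonneg mult_right_mono order_trans)

lemma conj_exponent_ge_1: "1 < p \<Longrightarrow> 1 \<le> conj_exponent p"
  by (cases p) (auto simp: conj_exponent_def one_ereal_def field_simps)

lemma M_space_iff:
  assumes "1 < p"
  shows "V \<in> M_space p {a..b} \<longleftrightarrow> V \<in> extensional (Lp_space (ereal (conj_exponent p)) (MI a b)) \<and> (\<exists>N. lqf (conj_exponent p) a b N V)"
proof
  assume V: "V \<in> M_space p {a..b}"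
  then obtain C where C: "\<forall>f\<in>Lp_space (ereal (conj_exponent p)) (MI a b). \<bar>V f\<bar> \<le> C * Lp_norm (conj_exponent p) (MI a b) f"
    by (auto simp: M_space_def Let_def)
  \<comment> \<open>The constant in \<open>M_space\<close> carries no sign, hence the maximum with
    0.\<close>
  have "C * Lp_norm (conj_exponent p) (MI a b) f \<le> max C 0 * Lp_norm (conj_exponent p) (MI a b) f" for f :: "real \<Rightarrow> 'a L1_real"
    by (intro mult_right_mono Lp_norm_nonneg) simp
  then have "lqf (conj_exponent p) a b (max C 0) V"
    using V C conj_exponent_ge_1[OF assms] unfolding lqf_def M_space_def Let_def by (auto intro: order_trans)
  then show "V \<in> extensional (Lp_space (ereal (conj_exponent p)) (MI a b)) \<and> (\<exists>N. lqf (conj_exponent p) a b N V)"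
    using V by (auto simp: M_space_def Let_def)
next
  assume "V \<in> extensional (Lp_space (ereal (conj_exponent p)) (MI a b)) \<and> (\<exists>N. lqf (conj_exponent p) a b N V)"
  then show "V \<in> M_space p {a..b}" unfolding M_space_def Let_def lqf_def by auto
qed

context
  fixes q a b N :: real and W :: "(real \<Rightarrow> 'a::euclidean_space L1_real) \<Rightarrow> real"
  assumes W: "lqf q a b N W"
begin

lemma lqf_diff: "f \<in> Lp_space (ereal q) (MI a b) \<Longrightarrow> g \<in> Lp_space (ereal q) (MI a b) \<Longrightarrow> W (\<lambda>t. f t - g t) = W f - W g"
  using lqf_lin[OF W, of f g 1 "-1"] by simp

lemma lqf_add: "f \<in> Lp_space (ereal q) (MI a b) \<Longrightarrow> g \<in> Lp_space (ereal q) (MI a b) \<Longrightarrow> W (\<lambda>t. f t + g t) = W f + W g"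
  using lqf_lin[OF W, of f g 1 1] by simp

lemma lqf_scaleR: "f \<in> Lp_space (ereal q) (MI a b) \<Longrightarrow> W (\<lambda>t. c *\<^sub>R f t) = c * W f"
  using lqf_lin[OF W, of f f c 0] by simp

lemma lqf_zero: "W (\<lambda>t. 0) = 0"
proof -
  have "(\<lambda>t. 0 :: 'a L1_real) \<in> Lp_space (ereal q) (MI a b)" by (simp add: Lp_space_real)
  from lqf_scaleR[OF this, of 0] show ?thesis by simp
qed

lemma lqf_cong_AE:
  assumes f: "f \<in> Lp_space (ereal q) (MI a b)" and g: "g \<in> Lp_space (ereal q) (MI a b)" and eq: "AE t in MI a b. f t = g t"
  shows "W f = W g"
proof -
  have fg: "(\<lambda>t. f t - g t) \<in> Lp_space (ereal q) (MI a b)" by (rule Lp_space_diff[OF lqf_q[OF W] f g])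
  have "Lp_norm q (MI a b) (\<lambda>t. f t - g t) = Lp_norm q (MI a b) (\<lambda>t. 0 :: 'a L1_real)"
    using fg eq by (intro Lp_norm_cong_AE) (auto simp: Lp_space_real elim!: eventually_mono)
  then show ?thesis using lqf_le[OF W fg] lqf_diff[OF f g] by (simp add: Lp_norm_def)
qed

lemma lqf_cong:
  assumes "f \<in> Lp_space (ereal q) (MI a b)" and eq: "\<And>t. t \<in> {a..b} \<Longrightarrow> f t = g t"
  shows "W f = W g" "g \<in> Lp_space (ereal q) (MI a b)"
proof -
  have "f \<in> borel_measurable (MI a b) \<longleftrightarrow> g \<in> borel_measurable (MI a b)"
    by (rule measurable_cong) (simp add: space_MI eq)
  moreover have "integrable (MI a b) (\<lambda>x. norm (f x) powr q) \<longleftrightarrow> integrable (MI a b) (\<lambda>x. norm (g x) powr q)"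
    by (rule Bochner_Integration.integrable_cong) (simp_all add: space_MI eq)
  ultimately show g: "g \<in> Lp_space (ereal q) (MI a b)" using assms(1) by (simp add: Lp_space_real)
  show "W f = W g" by (rule lqf_cong_AE[OF assms(1) g]) (rule AE_I2, simp add: space_MI eq)
qed

end

lemma bm_rmul:
  assumes f: "f \<in> bm M" and g: "g \<in> bm M" shows "(\<lambda>t. rmul (f t) (g t)) \<in> bm M"
proof -
  obtain A B where f: "f \<in> borel_measurable M" "0 \<le> A" "\<And>t. t \<in> space M \<Longrightarrow> norm (f t) \<le> A"
    and g: "g \<in> borel_measurable M" "0 \<le> B" "\<And>t. t \<in> space M \<Longrightarrow> norm (g t) \<le> B" using bmE[OF f] bmE[OF g] by metis
  show ?thesis
  proof (rule bmI)
    show "(\<lambda>t. rmul (f t) (g t)) \<in> borel_measurable M"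
      by (intro borel_measurable_continuous_Pair[OF f(1) g(1)] bounded_bilinear.continuous_on[OF bounded_bilinear_rmul] continuous_intros)
    show "norm (rmul (f t) (g t)) \<le> A * B" if "t \<in> space M" for t
      by (rule order_trans[OF norm_rmul_le mult_mono[OF f(3)[OF that] g(3)[OF that] f(2) norm_ge_zero]])
  qed
qed

text \<open>Freezing the bounded factor \<open>f\<close> turns a functional on L^1-valued functions
  into one on L^2-valued functions, to which the Hilbert space duality \<open>dual_density\<close>
  applies.\<close>

lemma lq_functional_rmul:
  assumes W: "lqf q a b N W" and f: "f \<in> bm (MI a b)" and B: "0 \<le> B" "\<And>t. t \<in> {a..b} \<Longrightarrow> norm (f t) \<le> B"
  shows "lq_functional (MI a b) (\<lambda>g. W (\<lambda>t. rmul (f t) (g t))) q (N * B)"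
proof -
  interpret rm: bounded_bilinear rmul by (rule bounded_bilinear_rmul)
  note X = bm_Lp_space[OF finite_measure_MI lqf_q[OF W]]
  show ?thesis
  proof (intro lq_functional.intro finite_measure_MI lq_functional_axioms.intro)
    show "1 \<le> q" by (rule lqf_q[OF W])
    show "0 \<le> N * B" using lqf_N[OF W] B by simp
    show "W (\<lambda>t. rmul (f t) (g t + h t)) = W (\<lambda>t. rmul (f t) (g t)) + W (\<lambda>t. rmul (f t) (h t))" if "g \<in> bm (MI a b)" "h \<in> bm (MI a b)" for g h
      unfolding rm.add_right by (intro lqf_add[OF W] X bm_rmul f that)
    show "W (\<lambda>t. rmul (f t) (c *\<^sub>R g t)) = c * W (\<lambda>t. rmul (f t) (g t))" if "g \<in> bm (MI a b)" for g c
      unfolding rm.scaleR_right by (intro lqf_scaleR[OF W] X bm_rmul f that)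
    show "\<bar>W (\<lambda>t. rmul (f t) (g t))\<bar> \<le> N * B * Lp_norm q (MI a b) g" if g: "g \<in> bm (MI a b)" for g
    proof -
      have "Lp_norm q (MI a b) (\<lambda>t. rmul (f t) (g t)) \<le> B * Lp_norm q (MI a b) g"
      proof (rule Lp_space_mono(2)[OF lqf_q[OF W] bm_measurable[OF bm_rmul[OF f g]] X[OF g] B(1)])
        show "norm (rmul (f t) (g t)) \<le> B * norm (g t)" if "t \<in> space (MI a b)" for t
          by (rule order_trans[OF norm_rmul_le mult_right_mono[OF B(2) norm_ge_zero]]) (use that in \<open>simp add: space_MI\<close>)
      qed
      then show ?thesis
        using lqf_le[OF W X[OF bm_rmul[OF f g]]] mult_left_mono[of _ _ N] lqf_N[OF W] by (force simp: mult.assoc)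
    qed
  qed
qed

section \<open>The Duhamel integral in weak form\<close>

text \<open>
  \<open>Gop W f\<close> is the integral of \<open>e\<^bsup>-i\<Delta>s\<^esup> f(s) W(ds)\<close>, tested against \<open>g\<close> by the real inner product. Pulling the
  free evolution back to time 0 avoids the density of \<open>f(s) W(ds)\<close>.
\<close>

definition Gop :: "((real \<Rightarrow> 'a::euclidean_space L1_real) \<Rightarrow> real) \<Rightarrow> (real \<Rightarrow> 'a L2) \<Rightarrow> 'a L2" where
  "Gop W f = (THE u. \<forall>g. inner u g = W (\<lambda>s. rmul (f s) (U s g)))"

lemma Gop_eqI:
  assumes "\<And>g. inner u g = W (\<lambda>s. rmul (f s) (U s g))" shows "Gop W f = u"
  unfolding Gop_def
proof (rule the_equality)
  fix v assume "\<forall>g. inner v g = W (\<lambda>s. rmul (f s) (U s g))"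
  then have "inner (v - u) (v - u) = 0" using assms by (simp add: inner_diff_left)
  then show "v = u" by simp
qed (use assms in simp)

lemma continuous_U: "continuous_on S (\<lambda>s. U (s - c) g)"
  by (intro continuous_on_U continuous_intros)

text \<open>Justifies the description operator: with a density \<phi> of \<open>f(s) W(ds)\<close>,
  the vector sought is the integral of \<open>U (- s) (\<phi> s)\<close>. Estimates of
  \<open>Gop\<close> use this weak identity rather than the density.\<close>

lemma Gop_inner:
  assumes W: "lqf q a b N W" and f: "f \<in> bm (MI a b)"
  shows "inner (Gop W f) g = W (\<lambda>s. rmul (f s) (U s g))"
proof -
  obtain B where B: "0 \<le> B" "\<And>t. t \<in> {a..b} \<Longrightarrow> norm (f t) \<le> B" using bmE[OF f] space_MI by metis
  interpret lq_functional "MI a b" "\<lambda>g. W (\<lambda>t. rmul (f t) (g t))" q "N * B" by (rule lq_functional_rmul[OF W f B])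
  obtain \<phi> where \<phi>: "\<phi> \<in> borel_measurable (MI a b)" "integrable (MI a b) \<phi>"
    "\<And>g. g \<in> bm (MI a b) \<Longrightarrow> W (\<lambda>t. rmul (f t) (g t)) = (\<integral>t. inner (\<phi> t) (g t) \<partial>MI a b)"
    by (rule dual_density) (blast intro: that)
  have Um: "(\<lambda>s. U (- s) (\<phi> s)) \<in> borel_measurable (MI a b)"
    by (intro borel_measurable_continuous_Pair[of "\<lambda>s. s" _ \<phi> "\<lambda>s v. U (- s) v"] \<phi> borel_measurable_MI continuous_on_U continuous_intros) simp
  have Ui: "integrable (MI a b) (\<lambda>s. U (- s) (\<phi> s))"
    by (rule Bochner_Integration.integrable_bound[OF \<phi>(2) Um]) simp
  have "inner (\<integral>s. U (- s) (\<phi> s) \<partial>MI a b) g = W (\<lambda>s. rmul (f s) (U s g))" for g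
  proof -
    have "inner (\<integral>s. U (- s) (\<phi> s) \<partial>MI a b) g = (\<integral>s. inner (U (- s) (\<phi> s)) g \<partial>MI a b)"
      using integral_bounded_linear[OF bounded_linear_inner_left Ui] by simp
    also have "\<dots> = (\<integral>s. inner (\<phi> s) (U s g) \<partial>MI a b)" by (simp add: inner_U)
    also have "\<dots> = W (\<lambda>s. rmul (f s) (U s g))"
      using \<phi>(3)[OF continuous_bm[OF continuous_U[of _ 0 g]]] by simp
    finally show ?thesis .
  qed
  note * = this
  then have "Gop W f = (\<integral>s. U (- s) (\<phi> s) \<partial>MI a b)" by (rule Gop_eqI)
  with * show ?thesis by simp
qed

lemma Lp_space_integrable:
  fixes f :: "'c \<Rightarrow> 'b::{banach,second_countable_topology}"
  assumes "finite_measure M" "1 < p" "f \<in> Lp_space p M" shows "integrable M f"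
proof (cases "p = \<infinity>")
  case True
  then obtain C where "f \<in> borel_measurable M" "AE x in M. norm (f x) \<le> C" using assms(3) by (auto simp: Lp_space_def)
  then show ?thesis using finite_measure.integrable_const_bound[OF assms(1)] by blast
next
  case False
  then obtain r where r: "p = ereal r" "1 < r" using assms(2) by (cases p) auto
  have f: "f \<in> borel_measurable M" "integrable M (\<lambda>x. norm (f x) powr r)" using assms(3) r by (auto simp: Lp_space_real)
  show ?thesis
  proof (rule Bochner_Integration.integrable_bound[OF _ f(1)])
    show "integrable M (\<lambda>x. 1 + norm (f x) powr r)" using f(2) finite_measure.integrable_const[OF assms(1)] by (intro Bochner_Integration.integrable_add)
    show "AE x in M. norm (f x) \<le> norm (1 + norm (f x) powr r)"
    proof (rule AE_I2)
      fix x show "norm (f x) \<le> norm (1 + norm (f x) powr r)"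
      proof (cases "norm (f x) \<le> 1")
        case False
        then have "norm (f x) powr 1 \<le> norm (f x) powr r" using r(2) by (intro powr_mono) auto
        then show ?thesis using False by simp
      next
        case True
        have "0 \<le> norm (f x) powr r" by simp
        then have "norm (1 + norm (f x) powr r) = 1 + norm (f x) powr r" by simp
        then show ?thesis using True \<open>0 \<le> norm (f x) powr r\<close> by linarith
      qed
    qed
  qed
qed

text \<open>\<open>conjL\<close> is an involution, so testing the complex pairing with all
  \<open>g\<close> amounts to testing the real functional with all \<open>h\<close>; the imaginary
  part is the instance in which \<open>h\<close> carries the factor \<i>.\<close>

lemma V_integral_eq:
  "V_integral V E f = (THE u. \<forall>h. inner u h = V (\<lambda>t. indicator E t *\<^sub>R rmul (f t) h))"
proof -
  have "(\<forall>g. (\<integral>x. rep_lp u x * rep_lp g x \<partial>lborel) = pairing V (\<lambda>t. indicator E t *\<^sub>R mult_L2 (f t) g))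
    \<longleftrightarrow> (\<forall>h. inner u h = V (\<lambda>t. indicator E t *\<^sub>R rmul (f t) h))" for u
    unfolding integral_mult_inner pairing_def Re_L1_mult_L2 Im_L1_mult_L2 complex.inject
    by (metis conjL_conjL)
  then show ?thesis unfolding V_integral_def by simp
qed

text \<open>\<open>V_density\<close> is chosen by \<open>SOME\<close>, so only its defining property
  is available. \<open>dual_density\<close> supplies one density, which makes the choice meaningful.
  The chosen one has the same integrals over Borel sets, hence represents the same functional, and
  moving the free evolution to the test vector gives the weak form.\<close>

lemma duhamel_eq:
  assumes p: "1 < p" and V: "V \<in> M_space p {a..b}" and J: "{c..d} \<subseteq> {a..b}" and f: "continuous_on {a..b} f"
  shows "duhamel p V c d s f = U s (Gop V (\<lambda>t. indicator {c..d} t *\<^sub>R f t))"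
proof -
  define q where "q = conj_exponent p"
  obtain N where W: "lqf q a b N V" using V unfolding M_space_iff[OF p] q_def by blast
  note q1 = lqf_q[OF W]
  note X = bm_Lp_space[OF finite_measure_MI q1]
  let ?J = "indicator {c..d} :: real \<Rightarrow> real"
  have Jm: "{c..d} \<in> sets (MI a b)" using J by (intro sets_MI) auto
  have fb: "f \<in> bm (MI a b)" by (rule continuous_bm[OF f])
  have fJ: "(\<lambda>t. ?J t *\<^sub>R f t) \<in> bm (MI a b)" by (rule bm_indicator_scaleR[OF Jm fb])
  have extJ: "(\<lambda>t. ?J t *\<^sub>R g t) \<in> bm (MI a b)" if gb: "g \<in> bm (MI c d)" for g :: "real \<Rightarrow> 'a L2"
  proof -
    obtain B where B: "g \<in> borel_measurable (MI c d)" "0 \<le> B" "\<And>t. t \<in> {c..d} \<Longrightarrow> norm (g t) \<le> B" using bmE[OF gb] space_MI by metis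
    show ?thesis by (rule bmI[OF MI_subset[OF J B(1)], of B]) (use B in \<open>auto simp: indicator_def\<close>)
  qed
  have JJ: "?J t *\<^sub>R rmul u v = rmul (?J t *\<^sub>R u) (?J t *\<^sub>R v)" for t u v
    by (auto simp: indicator_def bounded_bilinear.zero_left[OF bounded_bilinear_rmul])
  obtain B where B: "0 \<le> B" "\<And>t. t \<in> {a..b} \<Longrightarrow> norm (?J t *\<^sub>R f t) \<le> B" using bmE[OF fJ] space_MI by metis
  interpret big: lq_functional "MI a b" "\<lambda>g. V (\<lambda>t. rmul (?J t *\<^sub>R f t) (g t))" q "N * B"
    by (rule lq_functional_rmul[OF W fJ B])
  \<comment> \<open>The functional on the subinterval. With the indicator on both factors, only the
    values of \<open>g\<close> on \<open>{c..d}\<close> count, and the bound is in the norm over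
    \<open>{c..d}\<close>.\<close>
  define \<Lambda> where "\<Lambda> g = V (\<lambda>t. rmul (?J t *\<^sub>R f t) (?J t *\<^sub>R g t))" for g
  interpret lq_functional "MI c d" \<Lambda> q "N * B"
  proof (intro lq_functional.intro finite_measure_MI lq_functional_axioms.intro)
    show "1 \<le> q" by (rule q1)
    show "0 \<le> N * B" by (rule big.C)
    show "\<Lambda> (\<lambda>t. g t + h t) = \<Lambda> g + \<Lambda> h" if "g \<in> bm (MI c d)" "h \<in> bm (MI c d)" for g h
      unfolding \<Lambda>_def scaleR_add_right by (rule big.add[OF extJ[OF that(1)] extJ[OF that(2)]])
    show "\<Lambda> (\<lambda>t. k *\<^sub>R g t) = k * \<Lambda> g" if "g \<in> bm (MI c d)" for g k
      unfolding \<Lambda>_def using big.scale[OF extJ[OF that], of k] by (simp add: mult.commute)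
    show "\<bar>\<Lambda> g\<bar> \<le> N * B * Lp_norm q (MI c d) g" if "g \<in> bm (MI c d)" for g
      unfolding \<Lambda>_def using big.bound[OF extJ[OF that]] by (simp only: Lp_norm_restrict[OF J])
  qed
  obtain \<phi> where \<phi>: "\<phi> \<in> borel_measurable (MI c d)" "integrable (MI c d) \<phi>"
    "\<And>g. g \<in> bm (MI c d) \<Longrightarrow> \<Lambda> g = (\<integral>t. inner (\<phi> t) (g t) \<partial>MI c d)" by (rule dual_density) (blast intro: that)
  have Lp: "\<phi> \<in> Lp_space p (MI c d)" by (rule density_in_Lp[OF \<phi> p q_def])
  have \<Lambda>E: "\<Lambda> (\<lambda>t. indicator E t *\<^sub>R h) = V (\<lambda>t. indicator E t *\<^sub>R rmul (f t) h)" if "E \<subseteq> {c..d}" for E h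
    unfolding \<Lambda>_def
  proof (rule arg_cong[where f = V], rule ext)
    fix t show "rmul (?J t *\<^sub>R f t) (?J t *\<^sub>R indicator E t *\<^sub>R h) = indicator E t *\<^sub>R rmul (f t) h"
      using that by (auto simp: indicator_def bounded_bilinear.zero_right[OF bounded_bilinear_rmul] bounded_bilinear.zero_left[OF bounded_bilinear_rmul])
  qed
  have intE: "(LINT t:E|lborel. \<theta> t) = (\<integral>t. indicator E t *\<^sub>R \<theta> t \<partial>MI c d)" if "E \<subseteq> {c..d}" for E and \<theta> :: "real \<Rightarrow> 'a L2"
  proof -
    have *: "(\<lambda>t. indicator {c..d} t *\<^sub>R indicator E t *\<^sub>R \<theta> t) = (\<lambda>t. indicator E t *\<^sub>R \<theta> t)"
      using that by (auto simp: indicator_def fun_eq_iff)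
    show ?thesis unfolding set_lebesgue_integral_def by (subst integral_restrict_space) (simp_all only: *, simp)
  qed
  have innE: "inner (LINT t:E|lborel. \<theta> t) h = (\<integral>t. indicator E t * inner (\<theta> t) h \<partial>MI c d)"
    if "integrable (MI c d) \<theta>" "E \<in> sets borel" "E \<subseteq> {c..d}" for E h and \<theta> :: "real \<Rightarrow> 'a L2"
  proof -
    have "integrable (MI c d) (\<lambda>t. indicator E t *\<^sub>R \<theta> t)" by (rule integrable_mult_indicator[OF sets_MI[OF that(2,3)] that(1)])
    then show ?thesis unfolding intE[OF that(3)] using integral_bounded_linear[OF bounded_linear_inner_left, of "MI c d" "\<lambda>t. indicator E t *\<^sub>R \<theta> t" h] by simp
  qed
  have VE: "V_integral V E f = u" if u: "\<And>h. inner u h = \<Lambda> (\<lambda>t. indicator E t *\<^sub>R h)" and E: "E \<subseteq> {c..d}" for E u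
    unfolding V_integral_eq
  proof (rule the_equality)
    fix v assume "\<forall>h. inner v h = V (\<lambda>t. indicator E t *\<^sub>R rmul (f t) h)"
    then have "inner (v - u) (v - u) = 0" using u \<Lambda>E[OF E] by (simp add: inner_diff_left)
    then show "v = u" by simp
  qed (use u \<Lambda>E[OF E] in simp)
  have good: "V_integral V E f = (LINT t:E|lborel. \<phi> t)" if E: "E \<in> sets borel" "E \<subseteq> {c..d}" for E
    using \<phi>(3)[OF bm_indicator_scaleR[OF sets_MI[OF E] bm_const]] by (intro VE E) (simp add: innE[OF \<phi>(2) E])
  define \<theta> where "\<theta> = V_density p V {c..d} f"
  have \<theta>: "\<theta> \<in> Lp_space p (MI c d)" "\<And>E. E \<in> sets borel \<Longrightarrow> E \<subseteq> {c..d} \<Longrightarrow> V_integral V E f = (LINT t:E|lborel. \<theta> t)"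
    unfolding \<theta>_def V_density_def
    using someI[where P = "\<lambda>\<phi>. \<phi> \<in> Lp_space p (MI c d) \<and> (\<forall>E. E \<in> sets borel \<and> E \<subseteq> {c..d} \<longrightarrow> V_integral V E f = (LINT t:E|lborel. \<phi> t))", of \<phi>]
      Lp good by blast+
  have \<theta>i: "integrable (MI c d) \<theta>" by (rule Lp_space_integrable[OF finite_measure_MI p \<theta>(1)])
  have \<theta>rep: "\<Lambda> g = (\<integral>t. inner (\<theta> t) (g t) \<partial>MI c d)" if "g \<in> bm (MI c d)" for g
  proof (rule represent_bounded[OF \<theta>i bounded_linear_ident _ that])
    fix E h assume "E \<in> sets (MI c d)"
    then have E: "E \<in> sets borel" "E \<subseteq> {c..d}" using sets_MI_D by auto
    have "\<Lambda> (\<lambda>t. indicator E t *\<^sub>R h) = inner (LINT t:E|lborel. \<phi> t) h"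
      using \<phi>(3)[OF bm_indicator_scaleR[OF sets_MI[OF E] bm_const]] by (simp add: innE[OF \<phi>(2) E])
    also have "\<dots> = (\<integral>t. indicator E t * inner (\<theta> t) h \<partial>MI c d)"
      using good[OF E] \<theta>(2)[OF E] innE[OF \<theta>i E] by simp
    finally show "\<Lambda> (\<lambda>t. indicator E t *\<^sub>R h) = (\<integral>t. indicator E t * inner (\<theta> t) h \<partial>MI c d)" .
  qed
  have id: "(\<lambda>t. t) \<in> borel_measurable (MI c d)" by (rule borel_measurable_MI) simp
  have Um: "(\<lambda>t. U (s - t) (\<theta> t)) \<in> borel_measurable (MI c d)"
    by (rule borel_measurable_continuous_Pair[OF id borel_measurable_integrable[OF \<theta>i]]) (intro continuous_on_U continuous_intros)
  have Ui: "integrable (MI c d) (\<lambda>t. U (s - t) (\<theta> t))"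
    by (rule Bochner_Integration.integrable_bound[OF \<theta>i Um]) simp
  have "inner (duhamel p V c d s f) g = inner (U s (Gop V (\<lambda>t. ?J t *\<^sub>R f t))) g" for g
  proof -
    have "inner (duhamel p V c d s f) g = (\<integral>t. indicator {c..d} t * inner (U (s - t) (\<theta> t)) g \<partial>MI c d)"
      unfolding duhamel_def \<theta>_def[symmetric] by (intro innE Ui) auto
    also have "\<dots> = (\<integral>t. inner (\<theta> t) (U (t - s) g) \<partial>MI c d)"
      by (intro Bochner_Integration.integral_cong refl) (simp add: inner_U space_MI)
    also have "\<dots> = \<Lambda> (\<lambda>t. U (t - s) g)"
      by (rule \<theta>rep[OF continuous_bm[OF continuous_U], symmetric])
    also have "\<dots> = V (\<lambda>t. rmul (?J t *\<^sub>R f t) (U t (U (- s) g)))"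
      unfolding \<Lambda>_def by (rule arg_cong[where f = V], rule ext) (simp add: U_U indicator_def bounded_bilinear.zero_left[OF bounded_bilinear_rmul])
    also have "\<dots> = inner (Gop V (\<lambda>t. ?J t *\<^sub>R f t)) (U (- s) g)"
      by (rule Gop_inner[OF W fJ, symmetric])
    also have "\<dots> = inner (U s (Gop V (\<lambda>t. ?J t *\<^sub>R f t))) g" by (simp add: inner_U)
    finally show ?thesis .
  qed
  then show ?thesis by (rule inner_eqI)
qed

section \<open>Existence, uniqueness and stability of solutions\<close>

lemma Gop_diff:
  fixes f h :: "real \<Rightarrow> 'a::euclidean_space L2"
  assumes W: "lqf q a b N W" and f: "f \<in> bm (MI a b)" and h: "h \<in> bm (MI a b)"
  shows "Gop W (\<lambda>s. f s - h s) = Gop W f - Gop W h"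
proof (rule inner_eqI)
  fix g :: "'a L2"
  interpret rm: bounded_bilinear rmul by (rule bounded_bilinear_rmul)
  note X = bm_Lp_space[OF finite_measure_MI lqf_q[OF W]]
  have g: "(\<lambda>s. U s g) \<in> bm (MI a b)" using continuous_bm[OF continuous_U[of _ 0 g]] by simp
  show "inner (Gop W (\<lambda>s. f s - h s)) g = inner (Gop W f - Gop W h) g"
    unfolding inner_diff_left Gop_inner[OF W f] Gop_inner[OF W h] Gop_inner[OF W bm_diff[OF f h]] rm.diff_left
    by (intro lqf_diff[OF W] X bm_rmul f h g)
qed

lemma norm_Gop_le:
  assumes W: "lqf q a b N W" and f: "f \<in> bm (MI a b)"
  shows "norm (Gop W f) \<le> N * Lp_norm q (MI a b) f"
proof -
  note X = bm_Lp_space[OF finite_measure_MI lqf_q[OF W]]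
  define u where "u = Gop W f"
  have g: "(\<lambda>s. U s u) \<in> bm (MI a b)" using continuous_bm[OF continuous_U[of _ 0 u]] by simp
  have "Lp_norm q (MI a b) (\<lambda>s. rmul (f s) (U s u)) \<le> norm u * Lp_norm q (MI a b) f"
    by (intro Lp_space_mono(2)[OF lqf_q[OF W] bm_measurable[OF bm_rmul[OF f g]] X[OF f]])
      (auto intro: order_trans[OF norm_rmul_le] simp: mult.commute)
  then have "N * Lp_norm q (MI a b) (\<lambda>s. rmul (f s) (U s u)) \<le> N * (norm u * Lp_norm q (MI a b) f)"
    by (intro mult_left_mono lqf_N[OF W])
  moreover have "norm u * norm u = W (\<lambda>s. rmul (f s) (U s u))"
    using Gop_inner[OF W f, of u] by (simp add: u_def[symmetric] dot_square_norm power2_eq_square)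
  ultimately have "norm u * norm u \<le> norm u * (N * Lp_norm q (MI a b) f)"
    using lqf_le[OF W X[OF bm_rmul[OF f g]]] by (simp add: mult_ac)
  then show ?thesis
    using mult_nonneg_nonneg[OF lqf_N[OF W] Lp_norm_nonneg] unfolding u_def[symmetric]
    by (cases "u = 0") auto
qed

text \<open>Signed indicator of the interval between 0 and \<open>t\<close>; it builds the sign
  convention for integrals to negative times into a single formula.\<close>

definition sgj :: "real \<Rightarrow> real \<Rightarrow> real" where
  "sgj t s = (if 0 \<le> t then indicator {0..t} s else - indicator {t..0} s)"

lemma sgj_measurable [measurable]: "sgj t \<in> borel_measurable borel"
  unfolding sgj_def[abs_def] by (cases "0 \<le> t") auto

lemma abs_sgj_le: "\<bar>sgj t s\<bar> \<le> 1" by (auto simp: sgj_def indicator_def)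

lemma sgj_bm:
  fixes f :: "real \<Rightarrow> 'b::{real_normed_vector,second_countable_topology}"
  shows "f \<in> bm (MI a b) \<Longrightarrow> (\<lambda>s. sgj t s *\<^sub>R f s) \<in> bm (MI a b)"
  by (rule bm_scaleR) (auto intro!: bmI[of _ _ 1] borel_measurable_MI simp: abs_sgj_le)

text \<open>The factor 2 comes from \<open>s = 0\<close>: for times of opposite sign both closed
  intervals contain this point, and the contributions add up.\<close>

lemma sgj_diff_le: "\<bar>sgj t s - sgj t' s\<bar> \<le> 2 * indicator {min t t'..max t t'} s"
  by (auto simp: sgj_def indicator_def min_def max_def split: if_splits)

text \<open>A modulus of continuity in \<open>t\<close> that depends on \<open>W\<close> only
  through \<open>N\<close>. It gives continuity of the Duhamel term and, for a sequence of
  functionals, equicontinuity.\<close>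

lemma Gop_sgj_continuous:
  assumes W: "lqf q a b N W" and f: "f \<in> bm (MI a b)" and B: "0 \<le> B" "\<And>t. t \<in> {a..b} \<Longrightarrow> norm (f t) \<le> B"
    and t: "t \<in> {a..b}" "t' \<in> {a..b}"
  shows "norm (Gop W (\<lambda>s. sgj t s *\<^sub>R f s) - Gop W (\<lambda>s. sgj t' s *\<^sub>R f s)) \<le> N * (2 * B * \<bar>t - t'\<bar> powr (1 / q))"
proof -
  let ?E = "{min t t'..max t t'}"
  have E: "?E \<in> sets (MI a b)" using t by (intro sets_MI) auto
  have "measure (MI a b) ?E = \<bar>t - t'\<bar>"
    using t by (subst measure_restrict_space) (auto simp: min_def max_def)
  moreover have "Lp_norm q (MI a b) (\<lambda>s. sgj t s *\<^sub>R f s - sgj t' s *\<^sub>R f s) \<le> 2 * B * measure (MI a b) ?E powr (1 / q)"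
  proof (rule Lp_norm_le[OF finite_measure_MI lqf_q[OF W] _ E bm_measurable[OF bm_diff[OF sgj_bm[OF f] sgj_bm[OF f]]]])
    fix s assume s: "s \<in> space (MI a b)"
    have "norm (sgj t s *\<^sub>R f s - sgj t' s *\<^sub>R f s) = \<bar>sgj t s - sgj t' s\<bar> * norm (f s)"
      by (simp flip: scaleR_left_diff_distrib)
    also have "\<dots> \<le> (2 * indicator ?E s) * B"
      using s B by (intro mult_mono sgj_diff_le) (auto simp: space_MI)
    finally show "norm (sgj t s *\<^sub>R f s - sgj t' s *\<^sub>R f s) \<le> 2 * B * indicator ?E s" by (simp add: mult_ac)
  qed (use B in simp)
  ultimately have "Lp_norm q (MI a b) (\<lambda>s. sgj t s *\<^sub>R f s - sgj t' s *\<^sub>R f s) \<le> 2 * B * \<bar>t - t'\<bar> powr (1 / q)" by simp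
  then have "N * Lp_norm q (MI a b) (\<lambda>s. sgj t s *\<^sub>R f s - sgj t' s *\<^sub>R f s) \<le> N * (2 * B * \<bar>t - t'\<bar> powr (1 / q))"
    by (intro mult_left_mono lqf_N[OF W])
  then show ?thesis
    using norm_Gop_le[OF W bm_diff[OF sgj_bm[OF f, of t] sgj_bm[OF f, of t']]]
    unfolding Gop_diff[OF W sgj_bm[OF f] sgj_bm[OF f]] by linarith
qed

lemma exp_abs_integral:
  assumes c: "c > 0" and t: "t \<in> {a..b}" "a \<le> 0" "0 \<le> b"
  shows "(\<integral>s. \<bar>sgj t s\<bar> * exp (c * \<bar>s\<bar>) \<partial>MI a b) \<le> exp (c * \<bar>t\<bar>) / c"
proof (cases "0 \<le> t")
  case True
  have "(\<integral>s. \<bar>sgj t s\<bar> * exp (c * \<bar>s\<bar>) \<partial>MI a b) = (\<integral>s. exp (c * s) * indicator {0..t} s \<partial>lborel)"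
    using True t by (subst integral_restrict_space) (auto intro!: Bochner_Integration.integral_cong simp: sgj_def indicator_def)
  also have "\<dots> = exp (c * t) / c - exp (c * 0) / c"
    using True c by (intro integral_FTC_Icc_real) (auto intro!: derivative_eq_intros continuous_intros)
  finally show ?thesis using True c by simp
next
  case False
  have "(\<integral>s. \<bar>sgj t s\<bar> * exp (c * \<bar>s\<bar>) \<partial>MI a b) = (\<integral>s. exp (- c * s) * indicator {t..0} s \<partial>lborel)"
    using False t by (subst integral_restrict_space) (auto intro!: Bochner_Integration.integral_cong simp: sgj_def indicator_def)
  also have "\<dots> = - exp (- c * 0) / c - (- exp (- c * t) / c)"
    using False c by (intro integral_FTC_Icc_real) (auto intro!: derivative_eq_intros continuous_intros)
  finally show ?thesis using False c by simp
qed

text \<open>Chosen so that the q-th root of \<open>lam q N * q\<close> is \<open>2 * N + 1\<close>: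
  integrating the exponential weight gains the inverse of this, which beats the operator bound
  \<open>N\<close> by a factor 1/2. The summand 1 keeps the rate positive for
  \<open>N = 0\<close>.\<close>

definition lam :: "real \<Rightarrow> real \<Rightarrow> real" where
  "lam q N = (2 * N + 1) powr q / q"

text \<open>With the weight \<open>exp (- lam q N * \<bar>t\<bar>)\<close> the Duhamel operator is a contraction on the whole interval at once.\<close>

lemma Gop_weighted:
  assumes W: "lqf q a b N W" and f: "f \<in> bm (MI a b)" and t: "t \<in> {a..b}" and ab: "a \<le> 0" "0 \<le> b"
    and D: "0 \<le> D" "\<And>s. s \<in> {a..b} \<Longrightarrow> norm (f s) \<le> D * exp (lam q N * \<bar>s\<bar>)"
  shows "norm (Gop W (\<lambda>s. sgj t s *\<^sub>R f s)) \<le> D / 2 * exp (lam q N * \<bar>t\<bar>)"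
proof -
  note q = lqf_q[OF W] and N = lqf_N[OF W]
  let ?l = "lam q N"
  have l: "?l > 0" using q N by (simp add: lam_def)
  let ?F = "\<lambda>s. (sgj t s * exp (?l * \<bar>s\<bar>)) :: real"
  have Fb: "?F \<in> bm (MI a b)"
    using sgj_bm[OF continuous_bm[of a b "\<lambda>s. exp (?l * \<bar>s\<bar>)"], of t] by (simp add: continuous_intros)
  have "Lp_norm q (MI a b) (\<lambda>s. sgj t s *\<^sub>R f s) \<le> D * Lp_norm q (MI a b) ?F"
  proof (rule Lp_space_mono(2)[OF q bm_measurable[OF sgj_bm[OF f]] bm_Lp_space[OF finite_measure_MI q Fb] D(1)])
    show "norm (sgj t s *\<^sub>R f s) \<le> D * norm (?F s)" if "s \<in> space (MI a b)" for s
    proof -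
      have "\<bar>sgj t s\<bar> * norm (f s) \<le> \<bar>sgj t s\<bar> * (D * exp (?l * \<bar>s\<bar>))"
        using D(2) that by (intro mult_left_mono) (auto simp: space_MI)
      then show ?thesis by (simp add: abs_mult mult_ac)
    qed
  qed
  also have "Lp_norm q (MI a b) ?F = (\<integral>s. \<bar>sgj t s\<bar> * exp ((?l * q) * \<bar>s\<bar>) \<partial>MI a b) powr (1 / q)"
  proof -
    have "norm (?F s) powr q = \<bar>sgj t s\<bar> * exp ((?l * q) * \<bar>s\<bar>)" for s
    proof -
      have "\<bar>sgj t s\<bar> powr q = \<bar>sgj t s\<bar>" using q by (auto simp: sgj_def indicator_def)
      then show ?thesis by (simp add: abs_mult powr_mult exp_powr_real mult_ac)
    qed
    then show ?thesis by (simp only: Lp_norm_def)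
  qed
  also have "(\<integral>s. \<bar>sgj t s\<bar> * exp ((?l * q) * \<bar>s\<bar>) \<partial>MI a b) powr (1 / q) \<le> (exp ((?l * q) * \<bar>t\<bar>) / (?l * q)) powr (1 / q)"
    using l q exp_abs_integral[of "?l * q" t a b] t ab by (intro powr_mono2) (auto intro!: integral_nonneg_AE)
  also have "(exp ((?l * q) * \<bar>t\<bar>) / (?l * q)) powr (1 / q) = exp (?l * \<bar>t\<bar>) / (2 * N + 1)"
  proof -
    have "?l * q = (2 * N + 1) powr q" using q by (simp add: lam_def)
    then have "(?l * q) powr (1 / q) = 2 * N + 1" using q N by (simp add: powr_powr)
    moreover have "exp ((?l * q) * \<bar>t\<bar>) powr (1 / q) = exp (?l * \<bar>t\<bar>)" using q by (simp add: exp_powr_real)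
    ultimately show ?thesis by (simp add: powr_divide)
  qed
  finally have "Lp_norm q (MI a b) (\<lambda>s. sgj t s *\<^sub>R f s) \<le> D * (exp (?l * \<bar>t\<bar>) / (2 * N + 1))"
    using D(1) by (simp add: mult_left_mono)
  then have "norm (Gop W (\<lambda>s. sgj t s *\<^sub>R f s)) \<le> N * (D * (exp (?l * \<bar>t\<bar>) / (2 * N + 1)))"
    using norm_Gop_le[OF W sgj_bm[OF f]] mult_left_mono[OF _ N] by (meson order_trans)
  also have "\<dots> = (N / (2 * N + 1)) * (D * exp (?l * \<bar>t\<bar>))" by simp
  also have "\<dots> \<le> (1 / 2) * (D * exp (?l * \<bar>t\<bar>))"
    using N D(1) by (intro mult_right_mono) (auto simp: field_simps)
  finally show ?thesis by simp
qed

text \<open>The right-hand side of the integral equation for both signs of \<open>t\<close>, by way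
  of \<open>sgj\<close>; solutions are its fixed points.\<close>

definition Gam :: "((real \<Rightarrow> 'a::euclidean_space L1_real) \<Rightarrow> real) \<Rightarrow> 'a L2 \<Rightarrow> (real \<Rightarrow> 'a L2) \<Rightarrow> real \<Rightarrow> 'a L2" where
  "Gam W \<psi>0 f t = U t \<psi>0 - cscale \<i> (U t (Gop W (\<lambda>s. sgj t s *\<^sub>R f s)))"

definition solves :: "((real \<Rightarrow> 'a::euclidean_space L1_real) \<Rightarrow> real) \<Rightarrow> real \<Rightarrow> real \<Rightarrow> 'a L2 \<Rightarrow> (real \<Rightarrow> 'a L2) \<Rightarrow> bool" where
  "solves W a b \<psi>0 \<psi> \<longleftrightarrow> continuous_on {a..b} \<psi> \<and> (\<forall>t\<in>{a..b}. \<psi> t = Gam W \<psi>0 \<psi> t)"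

lemma bounded_linear_cscale: "cmod c \<le> 1 \<Longrightarrow> bounded_linear (cscale c)"
  unfolding cscale_mul by (intro bounded_linear_mul unitb_const)

lemma norm_cscale: "cmod c = 1 \<Longrightarrow> norm (cscale c u) = norm u"
  unfolding cscale_mul by (intro norm_mul_eq unitb_const) auto

lemma cscale_U_diff: "norm (cscale \<i> (U t x) - cscale \<i> (U t y)) = norm (x - y)"
proof -
  have "cscale \<i> (U t x) - cscale \<i> (U t y) = cscale \<i> (U t (x - y))"
    by (simp add: linear_diff[OF bounded_linear.linear[OF bounded_linear_U]] linear_diff[OF bounded_linear.linear[OF bounded_linear_cscale[of \<i>]]])
  then show ?thesis by (simp add: norm_cscale)
qed

lemma continuous_Gam:
  assumes W: "lqf q a b N W" and f: "f \<in> bm (MI a b)"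
  shows "continuous_on {a..b} (Gam W \<psi>0 f)"
proof -
  obtain B where B: "0 \<le> B" "\<And>t. t \<in> {a..b} \<Longrightarrow> norm (f t) \<le> B" using bmE[OF f] space_MI by metis
  have "continuous_on {a..b} (\<lambda>t. Gop W (\<lambda>s. sgj t s *\<^sub>R f s))"
    unfolding continuous_on_def
  proof
    fix t' assume t': "t' \<in> {a..b}"
    have "((\<lambda>t. N * (2 * B * \<bar>t - t'\<bar> powr (1 / q))) \<longlongrightarrow> N * (2 * B * \<bar>t' - t'\<bar> powr (1 / q))) (at t' within {a..b})"
      using lqf_q[OF W] by (intro tendsto_mult_left tendsto_powr2 tendsto_intros) auto
    then have lim: "((\<lambda>t. N * (2 * B * \<bar>t - t'\<bar> powr (1 / q))) \<longlongrightarrow> 0) (at t' within {a..b})" by simp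
    show "((\<lambda>t. Gop W (\<lambda>s. sgj t s *\<^sub>R f s)) \<longlongrightarrow> Gop W (\<lambda>s. sgj t' s *\<^sub>R f s)) (at t' within {a..b})"
    proof (rule LIM_zero_cancel, rule Lim_null_comparison[OF _ lim])
      show "\<forall>\<^sub>F t in at t' within {a..b}. norm (Gop W (\<lambda>s. sgj t s *\<^sub>R f s) - Gop W (\<lambda>s. sgj t' s *\<^sub>R f s)) \<le> N * (2 * B * \<bar>t - t'\<bar> powr (1 / q))"
        unfolding eventually_at_filter using Gop_sgj_continuous[OF W f B _ t'] by (intro always_eventually) auto
    qed
  qed
  then have "continuous_on {a..b} (\<lambda>t. U t \<psi>0 - cscale \<i> (U t (Gop W (\<lambda>s. sgj t s *\<^sub>R f s))))"
    by (intro continuous_on_diff continuous_on_U continuous_on_id continuous_on_const bounded_linear.continuous_on[OF bounded_linear_cscale]) auto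
  then show ?thesis by (simp add: Gam_def[abs_def])
qed

lemma Gam_contraction:
  assumes W: "lqf q a b N W" and f: "f \<in> bm (MI a b)" and g: "g \<in> bm (MI a b)" and t: "t \<in> {a..b}" and ab: "a \<le> 0" "0 \<le> b"
    and D: "0 \<le> D" "\<And>s. s \<in> {a..b} \<Longrightarrow> norm (f s - g s) \<le> D * exp (lam q N * \<bar>s\<bar>)"
  shows "norm (Gam W \<psi>0 f t - Gam W \<psi>0 g t) \<le> D / 2 * exp (lam q N * \<bar>t\<bar>)"
proof -
  have "norm (Gam W \<psi>0 f t - Gam W \<psi>0 g t) = norm (cscale \<i> (U t (Gop W (\<lambda>s. sgj t s *\<^sub>R g s))) - cscale \<i> (U t (Gop W (\<lambda>s. sgj t s *\<^sub>R f s))))"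
    by (simp add: Gam_def)
  also have "\<dots> = norm (Gop W (\<lambda>s. sgj t s *\<^sub>R f s) - Gop W (\<lambda>s. sgj t s *\<^sub>R g s))"
    by (simp add: cscale_U_diff norm_minus_commute)
  also have "\<dots> = norm (Gop W (\<lambda>s. sgj t s *\<^sub>R (f s - g s)))"
    by (simp add: Gop_diff[OF W sgj_bm[OF f] sgj_bm[OF g]] scaleR_diff_right)
  also have "\<dots> \<le> D / 2 * exp (lam q N * \<bar>t\<bar>)"
    by (rule Gop_weighted[OF W bm_diff[OF f g] t ab D])
  finally show ?thesis .
qed

lemma continuous_norm_bound:
  fixes f :: "real \<Rightarrow> 'b::real_normed_vector"
  assumes "continuous_on {a..b} f" obtains D where "0 \<le> D" "\<And>s. s \<in> {a..b} \<Longrightarrow> norm (f s) \<le> D"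
proof -
  have "bounded (f ` {a..b})" by (intro compact_imp_bounded compact_continuous_image assms) simp
  then obtain B where "\<forall>t\<in>{a..b}. norm (f t) \<le> B" by (auto simp: bounded_iff)
  then show thesis by (intro that[of "max B 0"]) (auto simp: le_max_iff_disj)
qed

lemma lam_nonneg: "lqf q a b N W \<Longrightarrow> 0 \<le> lam q N"
  using lqf_q lqf_N by (force simp: lam_def)

text \<open>In the weighted sup norm \<open>Gam\<close> has Lipschitz constant 1/2, so the distance
  \<open>D\<close> between a fixed point and an approximate one satisfies
  \<open>D \<le> D / 2 + e\<close>. Continuity on a compact interval makes the weighted supremum
  attained, at \<open>m\<close>.\<close>

lemma solves_stability:
  assumes W: "lqf q a b N W" and ab: "a \<le> 0" "0 \<le> b" and f: "solves W a b \<psi>0 f" and g: "continuous_on {a..b} g"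
    and e: "\<And>t. t \<in> {a..b} \<Longrightarrow> norm (Gam W \<psi>0 g t - g t) \<le> e" and e0: "0 \<le> e" and t: "t \<in> {a..b}"
  shows "norm (f t - g t) \<le> 2 * e * exp (lam q N * \<bar>t\<bar>)"
proof -
  let ?l = "lam q N"
  have fc: "continuous_on {a..b} f" and fe: "\<And>t. t \<in> {a..b} \<Longrightarrow> f t = Gam W \<psi>0 f t" using f by (auto simp: solves_def)
  have "continuous_on {a..b} (\<lambda>s. norm (f s - g s) * exp (- ?l * \<bar>s\<bar>))" by (intro continuous_intros fc g)
  then obtain m where m: "m \<in> {a..b}" "\<And>s. s \<in> {a..b} \<Longrightarrow> norm (f s - g s) * exp (- ?l * \<bar>s\<bar>) \<le> norm (f m - g m) * exp (- ?l * \<bar>m\<bar>)"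
    using continuous_attains_sup[OF compact_Icc] t by blast
  define D where "D = norm (f m - g m) * exp (- ?l * \<bar>m\<bar>)"
  have D0: "0 \<le> D" by (simp add: D_def)
  have D: "norm (f s - g s) \<le> D * exp (?l * \<bar>s\<bar>)" if "s \<in> {a..b}" for s
    using mult_right_mono[OF m(2)[OF that], of "exp (?l * \<bar>s\<bar>)"] by (simp add: D_def mult.assoc flip: exp_add)
  have "norm (f m - g m) \<le> norm (Gam W \<psi>0 f m - Gam W \<psi>0 g m) + norm (Gam W \<psi>0 g m - g m)"
    using fe[OF m(1)] norm_triangle_ineq[of "Gam W \<psi>0 f m - Gam W \<psi>0 g m" "Gam W \<psi>0 g m - g m"] by simp
  also have "\<dots> \<le> D / 2 * exp (?l * \<bar>m\<bar>) + e"
    by (intro add_mono Gam_contraction[OF W continuous_bm[OF fc] continuous_bm[OF g] m(1) ab D0 D] e m(1))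
  finally have "norm (f m - g m) * exp (- ?l * \<bar>m\<bar>) \<le> (D / 2 * exp (?l * \<bar>m\<bar>) + e) * exp (- ?l * \<bar>m\<bar>)"
    by (rule mult_right_mono) simp
  also have "\<dots> = D / 2 + e * exp (- ?l * \<bar>m\<bar>)" by (simp add: distrib_right exp_minus)
  also have "\<dots> \<le> D / 2 + e * 1" using lam_nonneg[OF W] e0 by (intro add_left_mono mult_left_mono) auto
  finally have "D \<le> 2 * e" by (simp add: D_def)
  then show ?thesis using order_trans[OF D[OF t] mult_right_mono] by simp
qed

lemma solves_unique:
  assumes W: "lqf q a b N W" and ab: "a \<le> 0" "0 \<le> b" and f: "solves W a b \<psi>0 f" and g: "solves W a b \<psi>0 g" and t: "t \<in> {a..b}"
  shows "f t = g t"
  using solves_stability[OF W ab f _ _ order_refl t, of g] g by (simp add: solves_def)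

text \<open>Picard iteration: the weighted increments halve at each step, and the weight is bounded
  on the interval, so the iterates converge uniformly.\<close>

lemma solves_exists:
  assumes W: "lqf q a b N W" and ab: "a \<le> 0" "0 \<le> b"
  obtains \<psi> where "solves W a b \<psi>0 \<psi>"
proof -
  let ?l = "lam q N"
  define f where "f n = (Gam W \<psi>0 ^^ n) (\<lambda>t. 0)" for n
  have f_Suc: "f (Suc n) = Gam W \<psi>0 (f n)" for n by (simp add: f_def)
  have fb: "f n \<in> bm (MI a b)" for n
    by (induction n) (auto simp: f_Suc intro: continuous_bm[OF continuous_Gam[OF W]], simp add: f_def bm_const)
  have fc: "continuous_on {a..b} (f n)" for n
    by (cases n) (auto simp: f_Suc intro: continuous_Gam[OF W fb], simp add: f_def)
  obtain D where D: "0 \<le> D" "\<And>s. s \<in> {a..b} \<Longrightarrow> norm (f 1 s) \<le> D" using continuous_norm_bound[OF fc[of 1]] by metis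
  have step: "norm (f (Suc n) s - f n s) \<le> D / 2 ^ n * exp (?l * \<bar>s\<bar>)" if "s \<in> {a..b}" for n s
    using that
  proof (induction n arbitrary: s)
    case 0
    have "1 \<le> exp (?l * \<bar>s\<bar>)" using lam_nonneg[OF W] by simp
    then have "D * 1 \<le> D * exp (?l * \<bar>s\<bar>)" using D(1) by (rule mult_left_mono)
    then show ?case using D(2)[OF 0] by (simp add: f_def)
  next
    case (Suc n)
    show ?case using Gam_contraction[OF W fb fb Suc.prems ab _ Suc.IH] D(1) by (simp add: f_Suc mult.commute)
  qed
  define E where "E = exp (?l * max \<bar>a\<bar> \<bar>b\<bar>)"
  have E: "exp (?l * \<bar>s\<bar>) \<le> E" if "s \<in> {a..b}" for s
    unfolding E_def using that lam_nonneg[OF W] by (auto intro!: mult_left_mono)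
  have E0: "0 < E" by (simp add: E_def)
  define \<psi> where "\<psi> t = (\<Sum>n. f (Suc n) t - f n t)" for t
  have ul: "uniform_limit {a..b} (\<lambda>n t. \<Sum>i<n. f (Suc i) t - f i t) \<psi> sequentially"
    unfolding \<psi>_def
  proof (rule Weierstrass_m_test)
    show "norm (f (Suc n) t - f n t) \<le> D * E * (1/2) ^ n" if "t \<in> {a..b}" for n t
    proof -
      have "D / 2 ^ n * exp (?l * \<bar>t\<bar>) \<le> D / 2 ^ n * E" using D(1) E[OF that] by (intro mult_left_mono) auto
      then show ?thesis using step[OF that, of n] by (simp add: power_one_over field_simps)
    qed
    show "summable (\<lambda>n. D * E * (1/2) ^ n)" by (intro summable_mult summable_geometric) simp
  qed
  have ts: "(\<Sum>i<n. f (Suc i) t - f i t) = f n t" for n t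
    using sum_lessThan_telescope[of "\<lambda>i. f i t" n] by (simp add: f_def)
  have ulf: "uniform_limit {a..b} f \<psi> sequentially" using ul unfolding ts .
  have \<psi>c: "continuous_on {a..b} \<psi>"
    by (rule uniform_limit_theorem[OF _ ulf]) (auto intro!: always_eventually fc)
  have "\<psi> t = Gam W \<psi>0 \<psi> t" if t: "t \<in> {a..b}" for t
  proof -
    \<comment> \<open>Passage to the limit in the recursion \<open>f_Suc\<close>. The tolerance for
      \<open>f n\<close> is divided by \<open>E\<close> because \<open>Gam_contraction\<close>
      returns a weighted bound.\<close>
    have "norm (\<psi> t - Gam W \<psi>0 \<psi> t) \<le> e" if e: "e > 0" for e
    proof -
      have "e / 2 / E > 0" "e / 2 > 0" using e E0 by auto
      note e2 = this
      have "\<forall>\<^sub>F n in sequentially. \<forall>s\<in>{a..b}. dist (f (Suc n) s) (\<psi> s) < e / 2"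
        using uniform_limitD[OF ulf e2(2)] by (subst eventually_sequentially_Suc)
      from eventually_happens'[OF sequentially_bot eventually_conj[OF uniform_limitD[OF ulf e2(1)] this]]
      obtain n where n: "\<forall>s\<in>{a..b}. dist (f n s) (\<psi> s) < e / 2 / E" "\<forall>s\<in>{a..b}. dist (f (Suc n) s) (\<psi> s) < e / 2"
        by blast
      have "norm (f n s - \<psi> s) \<le> e / 2 / E * exp (?l * \<bar>s\<bar>)" if "s \<in> {a..b}" for s
      proof -
        have "1 \<le> exp (?l * \<bar>s\<bar>)" using lam_nonneg[OF W] by simp
        then have "e / 2 / E * 1 \<le> e / 2 / E * exp (?l * \<bar>s\<bar>)" using \<open>e / 2 / E > 0\<close> by (intro mult_left_mono) auto
        then show ?thesis using n(1) that by (force simp: dist_norm)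
      qed
      from Gam_contraction[OF W fb continuous_bm[OF \<psi>c] t ab _ this]
      have "norm (Gam W \<psi>0 (f n) t - Gam W \<psi>0 \<psi> t) \<le> e / 2 / E / 2 * exp (?l * \<bar>t\<bar>)" using \<open>e / 2 / E > 0\<close> by simp
      also have "\<dots> \<le> e / 2 / E / 2 * E" using E[OF t] \<open>e / 2 / E > 0\<close> by (intro mult_left_mono) auto
      also have "\<dots> \<le> e / 2" using E0 e by simp
      finally have "norm (f (Suc n) t - Gam W \<psi>0 \<psi> t) \<le> e / 2" by (simp add: f_Suc)
      moreover have "norm (\<psi> t - f (Suc n) t) < e / 2" using n(2) t by (auto simp: dist_norm norm_minus_commute)
      ultimately show ?thesis using norm_triangle_ineq[of "\<psi> t - f (Suc n) t" "f (Suc n) t - Gam W \<psi>0 \<psi> t"] by simp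
    qed
    then have "norm (\<psi> t - Gam W \<psi>0 \<psi> t) \<le> 0" by (rule field_le_epsilon[of _ 0, simplified])
    then show ?thesis by simp
  qed
  then show thesis using \<psi>c by (intro that[of \<psi>]) (simp add: solves_def)
qed

section \<open>Sequential weak-* compactness\<close>

lemma diagonal_convergent:
  fixes X :: "nat \<Rightarrow> nat \<Rightarrow> real"
  assumes "\<And>k n. \<bar>X n k\<bar> \<le> B k"
  obtains r where "strict_mono r" "\<And>k. convergent (\<lambda>n. X (r n) k)"
proof -
  let ?P = "\<lambda>k s. convergent (\<lambda>n. X (s n) k)"
  interpret subseqs ?P
  proof
    fix k and s :: "nat \<Rightarrow> nat"
    have "bounded (range (\<lambda>n. X (s n) k))" using assms by (auto simp: bounded_iff)
    then obtain l r where "strict_mono r" "((\<lambda>n. X (s n) k) \<circ> r) \<longlonglongrightarrow> l"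
      using bounded_imp_convergent_subsequence by blast
    then show "\<exists>r. strict_mono r \<and> convergent (\<lambda>n. X ((s \<circ> r) n) k)"
      by (auto simp: comp_def convergent_def)
  qed
  have "convergent (\<lambda>n. X ((diagseq \<circ> (+) (Suc k)) n) k)" for k
  proof (rule diagseq_holds)
    fix r s :: "nat \<Rightarrow> nat" and k assume "strict_mono r" "convergent (\<lambda>n. X (s n) k)"
    then show "convergent (\<lambda>n. X ((s \<circ> r) n) k)"
      using LIMSEQ_subseq_LIMSEQ[of "\<lambda>n. X (s n) k" _ r] by (auto simp: convergent_def comp_def)
  qed
  moreover have "(\<lambda>n. X ((diagseq \<circ> (+) (Suc k)) n) k) = (\<lambda>n. X (diagseq (n + Suc k)) k)" for k
    by (rule ext) (simp add: comp_def add.commute)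
  ultimately have "convergent (\<lambda>n. X (diagseq (n + Suc k)) k)" for k by metis
  then have "convergent (\<lambda>n. X (diagseq n) k)" for k
    using convergent_ignore_initial_segment[of "\<lambda>n. X (diagseq n) k" "Suc k"] by blast
  then show thesis using subseq_diagseq by (rule that[rotated])
qed

text \<open>A sup bound promotes closeness in L^1 to closeness in L^q; this is how separability of
  L^1 serves for every exponent q.\<close>

lemma Lp_norm_interpolation:
  fixes f :: "'c \<Rightarrow> 'b::{banach,second_countable_topology}"
  assumes M: "finite_measure M" and q: "q \<ge> 1" and f: "f \<in> borel_measurable M" and b: "b > 0" "\<And>t. t \<in> space M \<Longrightarrow> norm (f t) \<le> b"
    and d: "(\<integral>t. norm (f t) \<partial>M) \<le> d"
  shows "Lp_norm q M f \<le> (b powr (q - 1) * d) powr (1 / q)"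
proof -
  have fb: "f \<in> bm M" using f b by (intro bmI) auto
  have i1: "integrable M (\<lambda>t. norm (f t) powr q)" using bm_Lp_space[OF M q fb] by (simp add: Lp_space_real)
  have "(\<integral>t. norm (f t) powr q \<partial>M) \<le> (\<integral>t. b powr (q - 1) * norm (f t) \<partial>M)"
  proof (intro integral_mono i1)
    show "integrable M (\<lambda>t. b powr (q - 1) * norm (f t))" using bm_integrable[OF M fb] by simp
    show "norm (f t) powr q \<le> b powr (q - 1) * norm (f t)" if "t \<in> space M" for t
    proof -
      have "norm (f t) powr q = norm (f t) powr (q - 1) * norm (f t)"
        using powr_add[of "norm (f t)" "q - 1" 1] by (cases "f t = 0") auto
      also have "\<dots> \<le> b powr (q - 1) * norm (f t)"
        using b(2)[OF that] q by (intro mult_right_mono powr_mono2) auto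
      finally show ?thesis .
    qed
  qed
  also have "\<dots> \<le> b powr (q - 1) * d" using d by (simp add: mult_left_mono)
  finally show ?thesis unfolding Lp_norm_def using q by (intro powr_mono2) auto
qed

text \<open>Separability is at hand for \<open>lp\<close>, whose exponent is a natural number,
  whereas q is real. So a dense subset of the integrable functions on the line is truncated at
  integer heights, and boundedness transfers the approximation to L^q.\<close>

lemma countable_determining:
  assumes q: "1 \<le> q"
  obtains s :: "nat \<Rightarrow> real \<Rightarrow> 'a::euclidean_space L1_real" where "\<And>k. s k \<in> Lp_space (ereal q) (MI a b)"
    "\<And>f e N. f \<in> Lp_space (ereal q) (MI a b) \<Longrightarrow> 0 < e \<Longrightarrow> \<exists>k. \<forall>W. lqf q a b N W \<longrightarrow> \<bar>W f - W (s k)\<bar> \<le> e"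
proof -
  obtain R :: "(real, 'a L1_real, 1) lp set" where R: "countable R" "closure R = UNIV" using separable_lp by blast
  have R0: "R \<noteq> {}" using R(2) by auto
  define cut :: "nat \<Rightarrow> (real \<Rightarrow> 'a L1_real) \<Rightarrow> real \<Rightarrow> 'a L1_real" where "cut j h t = (if norm (h t) \<le> real j then h t else 0)" for j h t
  have cutm: "cut j h \<in> borel_measurable M" if [measurable]: "h \<in> borel_measurable M" for j h and M :: "real measure"
    unfolding cut_def[abs_def] by measurable
  have cutb: "norm (cut j h t) \<le> real j" for j h t by (simp add: cut_def)
  \<comment> \<open>One index encodes the height of the truncation and the position in the
    enumeration of \<open>R\<close>.\<close>
  define s where "s k = cut (fst (prod_decode k)) (rep_lp (from_nat_into R (snd (prod_decode k))))" for k
  have X: "g \<in> bm (MI a b) \<Longrightarrow> g \<in> Lp_space (ereal q) (MI a b)" for g :: "real \<Rightarrow> 'a L1_real"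
    by (rule bm_Lp_space[OF finite_measure_MI q])
  have sb: "s k \<in> bm (MI a b)" for k
    unfolding s_def by (rule bmI[OF cutm cutb]) (rule borel_measurable_MI, simp)
  have approx: "\<exists>k. \<forall>W. lqf q a b N W \<longrightarrow> \<bar>W f - W (s k)\<bar> \<le> e"
    if f: "f \<in> Lp_space (ereal q) (MI a b)" and e: "0 < e" for f e N
  proof (cases "0 \<le> N")
    case False
    then show ?thesis using lqf_N by blast
  next
    case N: True
    have fm: "f \<in> borel_measurable (MI a b)" using f by (simp add: Lp_space_real)
    have "(\<lambda>j. Lp_norm q (MI a b) (\<lambda>t. f t - cut j f t)) \<longlonglongrightarrow> 0"
    proof (rule Lp_norm_tendsto_0[OF q, where w = "\<lambda>t. norm (f t)"])
      show "integrable (MI a b) (\<lambda>t. norm (f t) powr q)" using f by (simp add: Lp_space_real)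
      show "AE t in MI a b. (\<lambda>j. f t - cut j f t) \<longlonglongrightarrow> 0"
      proof (rule AE_I2)
        fix t obtain J where "norm (f t) \<le> real J" using real_arch_simple by blast
        then have "\<forall>\<^sub>F j in sequentially. f t - cut j f t = 0" by (intro eventually_sequentiallyI[of J]) (simp add: cut_def)
        then show "(\<lambda>j. f t - cut j f t) \<longlonglongrightarrow> 0" by (rule tendsto_eventually)
      qed
      show "AE t in MI a b. norm (f t - cut j f t) \<le> norm (f t)" for j by (rule AE_I2) (simp add: cut_def)
    qed (intro borel_measurable_diff fm cutm)
    from LIMSEQ_D[OF this, of "e / (2 * (N + 1))"] obtain J where J: "Lp_norm q (MI a b) (\<lambda>t. f t - cut J f t) < e / (2 * (N + 1))"
      using e N by (auto simp: Lp_norm_nonneg)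
    define h where "h t = indicator {a..b} t *\<^sub>R cut J f t" for t
    have cf: "cut J f \<in> bm (MI a b)" by (rule bmI[OF cutm[OF fm] cutb])
    have hm [measurable]: "h \<in> borel_measurable borel"
      using cutm[OF fm, of J] unfolding measurable_MI_iff h_def[abs_def] .
    have hb: "norm (h t) \<le> real J" for t using cutb[of J f t] by (auto simp: h_def indicator_def)
    have hl: "lp_fun 1 h"
    proof (rule lp_fun_bound)
      show "integrable lborel (\<lambda>t. (real J * indicator {a..b} t) ^ 1)" by (simp add: emeasure_lborel_Icc_eq)
      show "AE t in lborel. norm (h t) \<le> real J * indicator {a..b} t"
        using cutb[of J f] by (intro AE_I2) (auto simp: h_def indicator_def)
    qed simp
    \<comment> \<open>\<open>h\<close> is bounded by \<open>J\<close> and the truncated approximant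
      by \<open>2 * J\<close>, so their difference stays below \<open>bb\<close>; \<open>d\<close>
      is the L^1 distance that interpolation turns into \<open>e / (2 * (N + 1))\<close>.\<close>
    define bb where "bb = 3 * real J + 1"
    define d where "d = (e / (2 * (N + 1))) powr q / bb powr (q - 1)"
    have bb: "bb > 0" by (simp add: bb_def)
    have d: "d > 0" using e N bb by (simp add: d_def)
    have "abs_lp h \<in> closure R" using R(2) by simp
    then obtain u where u: "u \<in> R" "dist u (abs_lp h) < d" using d unfolding closure_approachable by blast
    obtain i where i: "from_nat_into R i = u" using from_nat_into_surj[OF R(1) u(1)] by auto
    \<comment> \<open>Height \<open>2 * J\<close>: where the approximant exceeds it, its distance
      from \<open>h\<close> is more than \<open>J\<close>, so replacing it by 0 does not increase
      the error.\<close>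
    let ?k = "prod_encode (2 * J, i)"
    have sk: "s ?k = cut (2 * J) (rep_lp u)" by (simp add: s_def i)
    have le: "norm (h t - s ?k t) \<le> norm (h t - rep_lp u t)" for t
    proof (cases "norm (rep_lp u t) \<le> 2 * real J")
      case False
      then show ?thesis using hb[of t] norm_triangle_ineq2[of "rep_lp u t" "h t"] by (simp add: sk cut_def norm_minus_commute)
    qed (simp add: sk cut_def)
    have hs3: "norm (h t - s ?k t) \<le> bb" for t
      using norm_triangle_ineq4[of "h t" "s ?k t"] hb[of t] cutb[of "2 * J" "rep_lp u" t] by (simp add: sk bb_def)
    have dn: "norm (abs_lp h - u) = (\<integral>t. norm (h t - rep_lp u t) \<partial>lborel)" and di: "integrable lborel (\<lambda>t. norm (h t - rep_lp u t))"
    proof -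
      have ul: "lp_fun 1 (rep_lp u)" using lp_fun_rep[of u] by simp
      have "abs_lp h - u = abs_lp (\<lambda>t. h t - rep_lp u t)"
        using minus_lp_abs[of h "rep_lp u", where 'c = 1] hl ul by (simp add: abs_rep_lp)
      then show "norm (abs_lp h - u) = (\<integral>t. norm (h t - rep_lp u t) \<partial>lborel)"
        using norm_L1_abs[OF lp_fun_diff[OF hl ul]] by simp
      show "integrable lborel (\<lambda>t. norm (h t - rep_lp u t))" using lp_fun_integrable[OF lp_fun_diff[OF hl ul]] by simp
    qed
    have hbm: "h \<in> bm (MI a b)" by (rule bmI[OF borel_measurable_MI[OF hm] hb])
    have hsb: "(\<lambda>t. h t - s ?k t) \<in> bm (MI a b)" by (rule bm_diff[OF hbm sb])
    have "(\<integral>t. norm (h t - s ?k t) \<partial>MI a b) \<le> (\<integral>t. norm (h t - rep_lp u t) \<partial>lborel)"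
    proof -
      have [measurable]: "s ?k \<in> borel_measurable borel" unfolding sk by (rule cutm) simp
      have "(\<integral>t. norm (h t - s ?k t) \<partial>MI a b) = (\<integral>t. indicator {a..b} t *\<^sub>R norm (h t - s ?k t) \<partial>lborel)"
        by (rule integral_restrict_space) simp
      also have "\<dots> \<le> (\<integral>t. norm (h t - rep_lp u t) \<partial>lborel)"
        using le by (intro integral_mono' di) (auto simp: indicator_def)
      finally show ?thesis .
    qed
    also have "\<dots> \<le> d" using u(2) by (simp add: dn[symmetric] dist_norm norm_minus_commute less_imp_le)
    finally have "Lp_norm q (MI a b) (\<lambda>t. h t - s ?k t) \<le> (bb powr (q - 1) * d) powr (1 / q)"
      using hs3 bb by (intro Lp_norm_interpolation[OF finite_measure_MI q bm_measurable[OF hsb]])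
    also have "bb powr (q - 1) * d = (e / (2 * (N + 1))) powr q" using bb by (simp add: d_def)
    also have "\<dots> powr (1 / q) = e / (2 * (N + 1))" using q e N by (simp add: powr_powr)
    finally have L2: "Lp_norm q (MI a b) (\<lambda>t. h t - s ?k t) \<le> e / (2 * (N + 1))" .
    have "\<bar>W f - W (s ?k)\<bar> \<le> e" if W: "lqf q a b N W" for W
    proof -
      have c: "W h = W (cut J f)" by (rule lqf_cong(1)[OF W X[OF hbm]]) (simp add: h_def)
      have "\<bar>W f - W (cut J f)\<bar> \<le> N * (e / (2 * (N + 1)))"
        using lqf_le[OF W Lp_space_diff[OF q f X[OF cf]]] mult_left_mono[OF less_imp_le[OF J] N] lqf_diff[OF W f X[OF cf]] by simp
      moreover have "\<bar>W h - W (s ?k)\<bar> \<le> N * (e / (2 * (N + 1)))"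
        using lqf_le[OF W X[OF hsb]] mult_left_mono[OF L2 N] lqf_diff[OF W X[OF hbm] X[OF sb[of ?k]]] by simp
      moreover have "N * (e / (2 * (N + 1))) \<le> e / 2" using N e by (simp add: field_simps)
      ultimately show ?thesis using c by linarith
    qed
    then show ?thesis by blast
  qed
  show thesis by (rule that[OF X[OF sb] approx])
qed

text \<open>The values on the countable family converge along a diagonal subsequence. The
  approximation by that family is uniform over the ball of radius \<open>N\<close>, so the values on
  every other function are Cauchy as well.\<close>

lemma weak_star_compact:
  fixes W :: "nat \<Rightarrow> (real \<Rightarrow> 'a::euclidean_space L1_real) \<Rightarrow> real"
  assumes W: "\<And>n. lqf q a b N (W n)"
  obtains r W' where "strict_mono r" "lqf q a b N W'"
    "\<And>f. f \<in> Lp_space (ereal q) (MI a b) \<Longrightarrow> (\<lambda>n. W (r n) f) \<longlonglongrightarrow> W' f"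
proof -
  note q = lqf_q[OF W[of 0]] and N = lqf_N[OF W[of 0]]
  obtain s :: "nat \<Rightarrow> real \<Rightarrow> 'a L1_real" where s: "\<And>k. s k \<in> Lp_space (ereal q) (MI a b)"
    and approx: "\<And>f e N. f \<in> Lp_space (ereal q) (MI a b) \<Longrightarrow> 0 < e \<Longrightarrow> \<exists>k. \<forall>W. lqf q a b N W \<longrightarrow> \<bar>W f - W (s k)\<bar> \<le> e"
    using countable_determining[OF q] by metis
  obtain r where r: "strict_mono r" "\<And>k. convergent (\<lambda>n. W (r n) (s k))"
  proof (rule diagonal_convergent[of "\<lambda>n k. W n (s k)"])
    show "\<bar>W n (s k)\<bar> \<le> N * Lp_norm q (MI a b) (s k)" for k n by (rule lqf_le[OF W s])
  qed (use that in blast)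
  have conv: "convergent (\<lambda>n. W (r n) f)" if f: "f \<in> Lp_space (ereal q) (MI a b)" for f
  proof (rule Cauchy_convergent, rule metric_CauchyI)
    fix e :: real assume e: "0 < e"
    then obtain k where k: "\<And>W. lqf q a b N W \<Longrightarrow> \<bar>W f - W (s k)\<bar> \<le> e / 4" using approx[OF f, of "e / 4" N] by auto
    have "Cauchy (\<lambda>n. W (r n) (s k))" using r(2) by (rule convergent_Cauchy)
    then obtain M where M: "\<And>m n. m \<ge> M \<Longrightarrow> n \<ge> M \<Longrightarrow> \<bar>W (r m) (s k) - W (r n) (s k)\<bar> < e / 4"
      using metric_CauchyD[of "\<lambda>n. W (r n) (s k)" "e / 4"] e by (auto simp: dist_real_def)
    have "dist (W (r m) f) (W (r n) f) < e" if "m \<ge> M" "n \<ge> M" for m n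
      using M[OF that] k[OF W, of "r m"] k[OF W, of "r n"] e unfolding dist_real_def by linarith
    then show "\<exists>M. \<forall>m\<ge>M. \<forall>n\<ge>M. dist (W (r m) f) (W (r n) f) < e" by blast
  qed
  define W' where "W' f = lim (\<lambda>n. W (r n) f)" for f
  have lim: "(\<lambda>n. W (r n) f) \<longlonglongrightarrow> W' f" if "f \<in> Lp_space (ereal q) (MI a b)" for f
    using conv[OF that] by (simp add: W'_def convergent_LIMSEQ_iff)
  have lq: "lqf q a b N W'"
    unfolding lqf_def
  proof (intro conjI ballI allI q N)
    fix f g :: "real \<Rightarrow> 'a L1_real" and c d :: real
    assume f: "f \<in> Lp_space (ereal q) (MI a b)" and g: "g \<in> Lp_space (ereal q) (MI a b)"
    have fg: "(\<lambda>t. c *\<^sub>R f t + d *\<^sub>R g t) \<in> Lp_space (ereal q) (MI a b)"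
      by (intro Lp_space_add[OF q] Lp_space_scaleR[OF q] f g)
    have "(\<lambda>n. c * W (r n) f + d * W (r n) g) \<longlonglongrightarrow> c * W' f + d * W' g" by (intro tendsto_intros lim f g)
    with lim[OF fg] show "W' (\<lambda>t. c *\<^sub>R f t + d *\<^sub>R g t) = c * W' f + d * W' g"
      unfolding lqf_lin[OF W f g] by (rule LIMSEQ_unique)
  next
    fix f :: "real \<Rightarrow> 'a L1_real" assume f: "f \<in> Lp_space (ereal q) (MI a b)"
    show "\<bar>W' f\<bar> \<le> N * Lp_norm q (MI a b) f"
      by (rule LIMSEQ_le_const2[OF tendsto_rabs[OF lim[OF f]]]) (use lqf_le[OF W f] in auto)
  qed
  show thesis by (rule that[OF r(1) lq lim])
qed

section \<open>Local smoothing\<close>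

text \<open>The point over \<xi> on the paraboloid; a free wave is the Fourier transform of a
  density carried by it, evaluated at a space-time point.\<close>

definition theta :: "'a::euclidean_space \<Rightarrow> 'a \<times> real" where
  "theta \<xi> = (\<xi>, - (norm \<xi>)\<^sup>2)"

text \<open>Up to a constant, the kernel of the quadratic form that a Gaussian weight on space-time
  induces on frequency densities.\<close>

definition smooth_kernel :: "'a::euclidean_space \<Rightarrow> 'a \<Rightarrow> real" where
  "smooth_kernel \<xi> \<eta> = gauss 1 (theta \<xi> - theta \<eta>)"

lemma smooth_kernel_eq:
  "smooth_kernel \<xi> (\<xi> + \<zeta>) = exp (- ((norm \<zeta>)\<^sup>2 + (2 * (\<xi> \<bullet> \<zeta>) + (norm \<zeta>)\<^sup>2)\<^sup>2) / 2)"
proof -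
  have "(norm (\<xi> + \<zeta>))\<^sup>2 - (norm \<xi>)\<^sup>2 = 2 * (\<xi> \<bullet> \<zeta>) + (norm \<zeta>)\<^sup>2"
    unfolding power2_norm_eq_inner by (simp add: inner_add_left inner_add_right inner_commute)
  moreover have "(norm (theta \<xi> - theta (\<xi> + \<zeta>)))\<^sup>2 = (norm \<zeta>)\<^sup>2 + ((norm (\<xi> + \<zeta>))\<^sup>2 - (norm \<xi>)\<^sup>2)\<^sup>2"
    by (simp add: theta_def norm_Pair)
  ultimately show ?thesis by (simp add: smooth_kernel_def gauss_def)
qed

lemma smooth_kernel_commute: "smooth_kernel \<xi> \<eta> = smooth_kernel \<eta> \<xi>"
  by (simp add: smooth_kernel_def gauss_def norm_minus_commute)

lemma theta_continuous: "continuous_on S (theta :: 'a::euclidean_space \<Rightarrow> _)"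
  unfolding theta_def by (intro continuous_intros)

lemma smooth_kernel_measurable: "(\<lambda>z. smooth_kernel (fst z) (snd z)) \<in> borel_measurable borel"
  unfolding smooth_kernel_def gauss_def
  by (intro borel_measurable_continuous_onI continuous_intros continuous_on_compose2[OF theta_continuous[of UNIV]]) auto

text \<open>Row integral of \<open>smooth_kernel\<close> at \<xi> in the variable \<zeta> = \<eta> -
  \<xi>, as \<open>row_nn\<close> confirms; it is the quantity that enters the Schur test.\<close>

definition row :: "'a::euclidean_space \<Rightarrow> real" where
  "row \<xi> = (\<integral>\<zeta>. exp (- ((norm \<zeta>)\<^sup>2 + (2 * (\<xi> \<bullet> \<zeta>) + (norm \<zeta>)\<^sup>2)\<^sup>2) / 2) \<partial>lborel)"

lemma row_integrable: "integrable lborel (\<lambda>\<zeta>::'a::euclidean_space. exp (- ((norm \<zeta>)\<^sup>2 + (2 * (\<xi> \<bullet> \<zeta>) + (norm \<zeta>)\<^sup>2)\<^sup>2) / 2))"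
proof (rule Bochner_Integration.integrable_bound[OF gauss_integrable[of 1]])
  show "AE \<zeta> in lborel. norm (exp (- ((norm \<zeta>)\<^sup>2 + (2 * (\<xi> \<bullet> \<zeta>) + (norm \<zeta>)\<^sup>2)\<^sup>2) / 2)) \<le> norm (gauss 1 \<zeta>)"
    by (intro AE_I2) (simp add: gauss_def)
qed auto

lemma row_nn: "(\<integral>\<^sup>+\<eta>. ennreal (smooth_kernel \<xi> \<eta>) \<partial>lborel) = ennreal (row \<xi>)"
proof -
  have [measurable]: "(\<lambda>\<eta>. smooth_kernel \<xi> \<eta>) \<in> borel_measurable borel"
    unfolding smooth_kernel_def gauss_def
    by (intro borel_measurable_continuous_onI continuous_intros theta_continuous) auto
  have "(\<integral>\<^sup>+\<eta>. ennreal (smooth_kernel \<xi> \<eta>) \<partial>lborel) = (\<integral>\<^sup>+\<eta>. ennreal (smooth_kernel \<xi> \<eta>) \<partial>distr lborel borel ((+) \<xi>))"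
    by (simp add: lborel_distr_plus)
  also have "\<dots> = (\<integral>\<^sup>+\<zeta>. ennreal (smooth_kernel \<xi> (\<xi> + \<zeta>)) \<partial>lborel)" by (subst nn_integral_distr) auto
  also have "\<dots> = ennreal (row \<xi>)"
    unfolding row_def smooth_kernel_eq by (intro nn_integral_eq_integral row_integrable) auto
  finally show ?thesis .
qed

lemma AE_not_orthogonal:
  fixes \<omega> :: "'a::euclidean_space" assumes "\<omega> \<noteq> 0" shows "AE \<zeta> in lborel. \<omega> \<bullet> \<zeta> \<noteq> 0"
proof -
  have "{x. \<omega> \<bullet> x = 0} \<in> null_sets lebesgue"
    using negligible_hyperplane[of \<omega> 0] assms by (simp add: negligible_iff_null_sets)
  moreover have "{x. \<omega> \<bullet> x = 0} \<in> sets lborel" by (simp add: closed_hyperplane)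
  ultimately have "{x. \<omega> \<bullet> x = 0} \<in> null_sets lborel" by (simp add: null_sets_completion_iff)
  from AE_not_in[OF this] show ?thesis by simp
qed

text \<open>Waves of high frequency leave a bounded region quickly: the row integrals vanish at infinity,
  because \<open>2 \<xi> \<cdot> \<zeta> + |\<zeta>|\<^sup>2\<close> is large unless \<open>\<zeta>\<close> is nearly orthogonal to \<open>\<xi>\<close>.\<close>

lemma row_small:
  assumes e: "e > 0"
  obtains R :: nat where "\<And>\<xi>::'a::euclidean_space. real R < norm \<xi> \<Longrightarrow> row \<xi> \<le> e"
proof -
  have "\<exists>R::nat. \<forall>\<xi>::'a. real R < norm \<xi> \<longrightarrow> row \<xi> \<le> e"
  proof (rule ccontr)
    assume "\<not> ?thesis"
    then have "\<forall>n::nat. \<exists>\<xi>::'a. real n < norm \<xi> \<and> row \<xi> > e" by (simp add: not_le)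
    then obtain \<xi> :: "nat \<Rightarrow> 'a" where \<xi>: "\<And>n. real n < norm (\<xi> n)" "\<And>n. row (\<xi> n) > e" by metis
    have nz: "\<xi> n \<noteq> 0" for n using \<xi>(1)[of n] by auto
    \<comment> \<open>By compactness of the sphere the directions of a counterexample sequence
      converge to some \<omega> along a subsequence. Off the null hyperplane orthogonal to \<omega>
      the exponent tends to minus infinity, and dominated convergence contradicts the lower bound
      \<open>e\<close>.\<close>
    have "\<forall>n. sgn (\<xi> n) \<in> sphere 0 1" using nz by (simp add: norm_sgn)
    moreover have "compact (sphere (0::'a) 1)" by simp
    ultimately obtain \<omega> r where \<omega>: "\<omega> \<in> sphere (0::'a) 1" and r: "strict_mono r" and lim: "((\<lambda>n. sgn (\<xi> n)) \<circ> r) \<longlonglongrightarrow> \<omega>"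
      using compact_def[THEN iffD1, of "sphere (0::'a) 1"] by meson
    have \<omega>0: "\<omega> \<noteq> 0" using \<omega> by auto
    let ?a = "\<lambda>n \<zeta>. 2 * (\<xi> (r n) \<bullet> \<zeta>) + (norm \<zeta>)\<^sup>2"
    have "(\<lambda>n. row (\<xi> (r n))) \<longlonglongrightarrow> (\<integral>\<zeta>. 0 \<partial>(lborel :: 'a measure))"
      unfolding row_def
    proof (rule integral_dominated_convergence[where w = "gauss 1"])
      show "integrable lborel (gauss 1 :: 'a \<Rightarrow> real)" by (rule gauss_integrable) simp
      show "AE \<zeta> in lborel. norm (exp (- ((norm \<zeta>)\<^sup>2 + (?a n \<zeta>)\<^sup>2) / 2)) \<le> gauss 1 \<zeta>" for n
        by (intro AE_I2) (simp add: gauss_def)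
      show "AE \<zeta> in lborel. (\<lambda>n. exp (- ((norm \<zeta>)\<^sup>2 + (?a n \<zeta>)\<^sup>2) / 2)) \<longlonglongrightarrow> 0"
        using AE_not_orthogonal[OF \<omega>0]
      proof eventually_elim
        case (elim \<zeta>)
        define c where "c = \<bar>\<omega> \<bullet> \<zeta>\<bar>"
        have c: "c > 0" using elim by (simp add: c_def)
        have "(\<lambda>n. \<bar>sgn (\<xi> (r n)) \<bullet> \<zeta>\<bar>) \<longlonglongrightarrow> c"
          unfolding c_def using lim by (intro tendsto_intros) (simp add: comp_def)
        then have "\<forall>\<^sub>F n in sequentially. \<bar>sgn (\<xi> (r n)) \<bullet> \<zeta>\<bar> > c / 2" using c by (intro order_tendstoD(1)) auto
        then have ev: "\<forall>\<^sub>F n in sequentially. c * real n - (norm \<zeta>)\<^sup>2 \<le> \<bar>?a n \<zeta>\<bar>"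
        proof eventually_elim
          case (elim n)
          have "\<xi> (r n) = norm (\<xi> (r n)) *\<^sub>R sgn (\<xi> (r n))" using nz[of "r n"] by (simp add: sgn_div_norm)
          then have "\<bar>\<xi> (r n) \<bullet> \<zeta>\<bar> = norm (\<xi> (r n)) * \<bar>sgn (\<xi> (r n)) \<bullet> \<zeta>\<bar>"
            by (metis abs_mult abs_norm_cancel inner_scaleR_left)
          moreover have "real n * (c / 2) \<le> norm (\<xi> (r n)) * \<bar>sgn (\<xi> (r n)) \<bullet> \<zeta>\<bar>"
          proof (rule mult_mono)
            have "real n \<le> real (r n)" using seq_suble[OF r] by simp
            then show "real n \<le> norm (\<xi> (r n))" using \<xi>(1)[of "r n"] by simp
          qed (use elim c in auto)
          ultimately have "real n * c \<le> 2 * \<bar>\<xi> (r n) \<bullet> \<zeta>\<bar>" by simp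
          moreover have "2 * \<bar>p\<bar> - z \<le> \<bar>2 * p + z\<bar>" if "0 \<le> z" for p z :: real
            using that by (auto simp: abs_if)
          ultimately show ?case by (smt (verit) mult.commute zero_le_power2)
        qed
        have "filterlim (\<lambda>n. c * real n - (norm \<zeta>)\<^sup>2) at_top sequentially"
          using filterlim_tendsto_add_at_top[OF tendsto_const[of "- (norm \<zeta>)\<^sup>2"] filterlim_tendsto_pos_mult_at_top[OF tendsto_const c filterlim_real_sequentially]]
          by (simp add: algebra_simps)
        then have "filterlim (\<lambda>n. \<bar>?a n \<zeta>\<bar>) at_top sequentially"
          by (rule filterlim_at_top_mono) (rule ev)
        then have "filterlim (\<lambda>n. \<bar>?a n \<zeta>\<bar> * \<bar>?a n \<zeta>\<bar>) at_top sequentially"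
          by (intro filterlim_at_top_mult_at_top)
        then have "filterlim (\<lambda>n. (norm \<zeta>)\<^sup>2 / 2 + (1/2) * (\<bar>?a n \<zeta>\<bar> * \<bar>?a n \<zeta>\<bar>)) at_top sequentially"
          by (intro filterlim_tendsto_add_at_top[OF tendsto_const] filterlim_tendsto_pos_mult_at_top[OF tendsto_const]) auto
        then have "filterlim (\<lambda>n. - ((norm \<zeta>)\<^sup>2 / 2 + (1/2) * (\<bar>?a n \<zeta>\<bar> * \<bar>?a n \<zeta>\<bar>))) at_bot sequentially"
          by (subst filterlim_uminus_at_bot) (simp only: minus_minus)
        from filterlim_compose[OF exp_at_bot this]
        have "(\<lambda>n. exp (- ((norm \<zeta>)\<^sup>2 / 2 + (1/2) * (\<bar>?a n \<zeta>\<bar> * \<bar>?a n \<zeta>\<bar>)))) \<longlonglongrightarrow> 0" .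
        moreover have eq: "- ((norm \<zeta>)\<^sup>2 / 2 + (1/2) * (\<bar>?a n \<zeta>\<bar> * \<bar>?a n \<zeta>\<bar>)) = - ((norm \<zeta>)\<^sup>2 + (?a n \<zeta>)\<^sup>2) / 2" for n
        proof -
          have sq: "\<bar>y\<bar> * \<bar>y\<bar> = y\<^sup>2" for y :: real by (simp add: power2_eq_square flip: abs_mult)
          show ?thesis by (simp only: sq) (simp add: add_divide_distrib)
        qed
        ultimately show ?case by (simp only: eq)
      qed
    qed auto
    then have "(\<lambda>n. row (\<xi> (r n))) \<longlonglongrightarrow> 0" by simp
    from order_tendstoD(2)[OF this e] obtain n where "row (\<xi> (r n)) < e" by (auto simp: eventually_sequentially)
    then show False using \<xi>(2)[of "r n"] by simp
  qed
  then show thesis using that by blast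
qed

definition wave :: "('a::euclidean_space \<Rightarrow> complex) \<Rightarrow> 'a \<times> real \<Rightarrow> complex" where
  "wave g y = (\<integral>\<xi>. cis (y \<bullet> theta \<xi>) * g \<xi> \<partial>lborel)"

lemma wave_kernel_measurable: "(\<lambda>(y, \<xi>). cis (y \<bullet> theta \<xi>)) \<in> borel_measurable borel"
  unfolding case_prod_beta cis_conv_exp
  by (intro borel_measurable_continuous_onI continuous_intros continuous_on_compose2[OF theta_continuous[of UNIV]]) auto

text \<open>Schur test. The kernel is positive and symmetric, a product of two moduli is at most
  half the sum of their squares, and each square integrates against a row, which is at most
  \<open>e\<close> wherever \<open>g\<close> does not vanish.\<close>

lemma wave_gauss:
  fixes g :: "'a::euclidean_space \<Rightarrow> complex"
  assumes g: "integrable lborel g" and R: "\<And>\<xi>. g \<xi> \<noteq> 0 \<Longrightarrow> row \<xi> \<le> e" and e: "0 \<le> e"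
    and g2: "integrable lborel (\<lambda>\<xi>. (cmod (g \<xi>))\<^sup>2)"
  shows "integrable lborel (\<lambda>y. gauss 1 y * (cmod (wave g y))\<^sup>2)"
    and "(\<integral>y. gauss 1 y * (cmod (wave g y))\<^sup>2 \<partial>lborel) \<le> sqrt (2 * pi) ^ DIM('a \<times> real) * e * (\<integral>\<xi>. (cmod (g \<xi>))\<^sup>2 \<partial>lborel)"
proof -
  define \<kappa> where "\<kappa> = sqrt (2 * pi) ^ DIM('a \<times> real)"
  have \<kappa>0: "0 \<le> \<kappa>" by (simp add: \<kappa>_def)
  define hf :: real where "hf = 1 / 2"
  have hf: "0 \<le> hf" "hf * x + hf * x = x" for x by (simp_all add: hf_def)
  have [measurable]: "g \<in> borel_measurable borel" using g by (auto dest: borel_measurable_integrable)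
  have qm [measurable]: "(\<lambda>z::'a \<times> 'a. smooth_kernel (fst z) (snd z)) \<in> borel_measurable (lborel \<Otimes>\<^sub>M lborel)"
    using smooth_kernel_measurable by (simp add: lborel_prod)
  have sq0: "0 \<le> smooth_kernel \<xi> \<eta>" for \<xi> \<eta> :: 'a by (simp add: smooth_kernel_def less_imp_le[OF gauss_pos])
  note sk = integral_square_kernel[OF g gauss_integrable[of 1] wave_kernel_measurable, folded wave_def]
  show i: "integrable lborel (\<lambda>y. gauss 1 y * (cmod (wave g y))\<^sup>2)" using sk(2) by simp
  have K: "(\<integral>y. complex_of_real (gauss 1 y) * (cis (y \<bullet> theta \<xi>) * cnj (cis (y \<bullet> theta \<eta>))) \<partial>lborel) = complex_of_real (\<kappa> * smooth_kernel \<xi> \<eta>)" for \<xi> \<eta> :: 'a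
  proof -
    have "(\<integral>y. complex_of_real (gauss 1 y) * (cis (y \<bullet> theta \<xi>) * cnj (cis (y \<bullet> theta \<eta>))) \<partial>lborel)
      = (\<integral>y. complex_of_real (gauss 1 y) * cis (y \<bullet> (theta \<xi> - theta \<eta>)) \<partial>lborel)"
      by (intro Bochner_Integration.integral_cong refl) (simp add: cis_cnj cis_mult inner_diff_right)
    then show ?thesis using gauss_integral[of 1 "theta \<xi> - theta \<eta>"] by (simp add: smooth_kernel_def \<kappa>_def)
  qed
  have nn1: "(\<integral>\<^sup>+z. ennreal (smooth_kernel (fst z) (snd z) * (cmod (g (fst z)))\<^sup>2) \<partial>(lborel \<Otimes>\<^sub>M lborel)) \<le> ennreal (e * (\<integral>\<xi>. (cmod (g \<xi>))\<^sup>2 \<partial>lborel))" (is "?I1 \<le> ?E")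
  proof -
    have "?I1 = (\<integral>\<^sup>+\<xi>. (\<integral>\<^sup>+\<eta>. ennreal (smooth_kernel \<xi> \<eta> * (cmod (g \<xi>))\<^sup>2) \<partial>lborel) \<partial>lborel)"
      by (subst lborel.nn_integral_fst[symmetric]) auto
    also have "\<dots> \<le> (\<integral>\<^sup>+\<xi>. ennreal (e * (cmod (g \<xi>))\<^sup>2) \<partial>lborel)"
    proof (intro nn_integral_mono)
      fix \<xi> :: 'a
      have [measurable]: "(\<lambda>\<eta>. smooth_kernel \<xi> \<eta>) \<in> borel_measurable lborel"
        using measurable_compose_Pair1[OF _ qm, of \<xi>] by simp
      have "(\<integral>\<^sup>+\<eta>. ennreal (smooth_kernel \<xi> \<eta> * (cmod (g \<xi>))\<^sup>2) \<partial>lborel) = ennreal (row \<xi>) * ennreal ((cmod (g \<xi>))\<^sup>2)"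
        by (simp add: ennreal_mult sq0 nn_integral_multc row_nn)
      also have "\<dots> \<le> ennreal e * ennreal ((cmod (g \<xi>))\<^sup>2)"
        using R[of \<xi>] by (cases "g \<xi> = 0") (auto intro!: mult_right_mono ennreal_leI)
      finally show "(\<integral>\<^sup>+\<eta>. ennreal (smooth_kernel \<xi> \<eta> * (cmod (g \<xi>))\<^sup>2) \<partial>lborel) \<le> ennreal (e * (cmod (g \<xi>))\<^sup>2)"
        using e by (simp add: ennreal_mult)
    qed
    also have "\<dots> = ?E" using g2 e by (subst nn_integral_eq_integral) auto
    finally show ?thesis .
  qed
  have nn2: "(\<integral>\<^sup>+z. ennreal (smooth_kernel (fst z) (snd z) * (cmod (g (snd z)))\<^sup>2) \<partial>(lborel \<Otimes>\<^sub>M lborel)) \<le> ennreal (e * (\<integral>\<xi>. (cmod (g \<xi>))\<^sup>2 \<partial>lborel))"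
  proof -
    have "(\<integral>\<^sup>+z. ennreal (smooth_kernel (fst z) (snd z) * (cmod (g (snd z)))\<^sup>2) \<partial>(lborel \<Otimes>\<^sub>M lborel))
      = (\<integral>\<^sup>+\<eta>. (\<integral>\<^sup>+\<xi>. ennreal (smooth_kernel \<xi> \<eta> * (cmod (g \<eta>))\<^sup>2) \<partial>lborel) \<partial>lborel)"
      by (subst lborel_pair.nn_integral_snd[symmetric]) auto
    also have "\<dots> = (\<integral>\<^sup>+\<eta>. (\<integral>\<^sup>+\<xi>. ennreal (smooth_kernel \<eta> \<xi> * (cmod (g \<eta>))\<^sup>2) \<partial>lborel) \<partial>lborel)"
      by (simp only: smooth_kernel_commute)
    also have "\<dots> = (\<integral>\<^sup>+z. ennreal (smooth_kernel (fst z) (snd z) * (cmod (g (fst z)))\<^sup>2) \<partial>(lborel \<Otimes>\<^sub>M lborel))"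
      by (subst lborel.nn_integral_fst[symmetric]) auto
    finally show ?thesis using nn1 by simp
  qed
  let ?h = "\<lambda>z. smooth_kernel (fst z) (snd z) * (cmod (g (fst z)) * cmod (g (snd z)))"
  have "(\<integral>\<^sup>+z. ennreal (?h z) \<partial>(lborel \<Otimes>\<^sub>M lborel))
    \<le> (\<integral>\<^sup>+z. ennreal hf * ennreal (smooth_kernel (fst z) (snd z) * (cmod (g (fst z)))\<^sup>2) + ennreal hf * ennreal (smooth_kernel (fst z) (snd z) * (cmod (g (snd z)))\<^sup>2) \<partial>(lborel \<Otimes>\<^sub>M lborel))"
  proof (intro nn_integral_mono)
    fix z :: "'a \<times> 'a"
    have "cmod (g (fst z)) * cmod (g (snd z)) \<le> hf * (cmod (g (fst z)))\<^sup>2 + hf * (cmod (g (snd z)))\<^sup>2"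
      using sum_squares_bound[of "cmod (g (fst z))" "cmod (g (snd z))"] by (simp add: hf_def)
    from mult_left_mono[OF this sq0[of "fst z" "snd z"]]
    show "ennreal (?h z) \<le> ennreal hf * ennreal (smooth_kernel (fst z) (snd z) * (cmod (g (fst z)))\<^sup>2) + ennreal hf * ennreal (smooth_kernel (fst z) (snd z) * (cmod (g (snd z)))\<^sup>2)"
      by (simp add: ennreal_mult[symmetric] ennreal_plus[symmetric] sq0 hf(1) algebra_simps ennreal_leI del: ennreal_plus)
  qed
  also have "\<dots> = ennreal hf * ?I1 + ennreal hf * (\<integral>\<^sup>+z. ennreal (smooth_kernel (fst z) (snd z) * (cmod (g (snd z)))\<^sup>2) \<partial>(lborel \<Otimes>\<^sub>M lborel))"
    by (simp add: nn_integral_add nn_integral_cmult)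
  also have "\<dots> \<le> ennreal hf * ?E + ennreal hf * ?E" by (intro add_mono mult_left_mono nn1 nn2) auto
  also have "\<dots> = ?E"
    using e hf by (simp add: ennreal_mult[symmetric] ennreal_plus[symmetric] integral_nonneg_AE del: ennreal_plus)
  finally have le: "(\<integral>\<^sup>+z. ennreal (?h z) \<partial>lborel) \<le> ?E" by (simp add: lborel_prod)
  have "complex_of_real (\<integral>y. gauss 1 y * (cmod (wave g y))\<^sup>2 \<partial>lborel) = (\<integral>z. complex_of_real (\<kappa> * smooth_kernel (fst z) (snd z)) * (g (fst z) * cnj (g (snd z))) \<partial>lborel)"
    using sk(1) unfolding K by simp
  from arg_cong[OF this, of cmod] have "(\<integral>y. gauss 1 y * (cmod (wave g y))\<^sup>2 \<partial>lborel) \<le> cmod (\<integral>z. complex_of_real (\<kappa> * smooth_kernel (fst z) (snd z)) * (g (fst z) * cnj (g (snd z))) \<partial>lborel)"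
    by (simp only: norm_of_real)
  also have "\<dots> \<le> \<kappa> * (e * (\<integral>\<xi>. (cmod (g \<xi>))\<^sup>2 \<partial>lborel))"
  proof -
    have "ennreal (cmod (\<integral>z. complex_of_real (\<kappa> * smooth_kernel (fst z) (snd z)) * (g (fst z) * cnj (g (snd z))) \<partial>lborel))
      \<le> (\<integral>\<^sup>+z. ennreal (cmod (complex_of_real (\<kappa> * smooth_kernel (fst z) (snd z)) * (g (fst z) * cnj (g (snd z))))) \<partial>lborel)"
    proof (cases "integrable lborel (\<lambda>z. complex_of_real (\<kappa> * smooth_kernel (fst z) (snd z)) * (g (fst z) * cnj (g (snd z))))")
      case True
      then show ?thesis by (rule integral_norm_bound_ennreal)
    qed (simp add: not_integrable_integral_eq)
    also have "\<dots> = (\<integral>\<^sup>+z. ennreal \<kappa> * ennreal (?h z) \<partial>lborel)"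
      by (intro nn_integral_cong) (simp add: norm_mult abs_mult sq0 \<kappa>0 ennreal_mult[symmetric] mult_ac)
    also have "\<dots> = ennreal \<kappa> * (\<integral>\<^sup>+z. ennreal (?h z) \<partial>lborel)"
      using smooth_kernel_measurable
      by (intro nn_integral_cmult) (auto intro!: borel_measurable_times measurable_compose[OF measurable_fst] simp flip: borel_prod)
    also have "\<dots> \<le> ennreal \<kappa> * ?E" by (intro mult_left_mono le) auto
    also have "\<dots> = ennreal (\<kappa> * (e * (\<integral>\<xi>. (cmod (g \<xi>))\<^sup>2 \<partial>lborel)))" using e \<kappa>0 by (simp add: ennreal_mult integral_nonneg_AE)
    finally show ?thesis using e \<kappa>0 by (subst (asm) ennreal_le_iff) (auto simp: integral_nonneg_AE)
  qed
  finally show "(\<integral>y. gauss 1 y * (cmod (wave g y))\<^sup>2 \<partial>lborel) \<le> sqrt (2 * pi) ^ DIM('a \<times> real) * e * (\<integral>\<xi>. (cmod (g \<xi>))\<^sup>2 \<partial>lborel)"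
    unfolding \<kappa>_def[symmetric] by (simp add: mult.assoc)
qed

section \<open>Free evolution of frequency-localised vectors as explicit waves\<close>

lemma U_plancherel: "U s (plancherel 1 \<gamma>) = plancherel 1 (mul (phase s) \<gamma>)"
  by (simp add: schroedinger_group_eq plancherel_inverse2)

lemma mul_commute: "unitb h \<Longrightarrow> unitb k \<Longrightarrow> mul h (mul k u) = mul k (mul h u)"
  by (simp add: mul_mul mult.commute)

abbreviation fconst :: "'a::euclidean_space itself \<Rightarrow> real" where
  "fconst _ \<equiv> (2 * pi) powr (- real DIM('a) / 2)"

text \<open>With frequencies in a ball the inversion integral converges absolutely, so the free
  solution has a pointwise formula in space and time.\<close>

lemma U_wave:
  fixes \<gamma> :: "'a::euclidean_space L2"
  shows "U s (plancherel 1 (mul (cb n) \<gamma>)) = abs_lp (\<lambda>x. complex_of_real (fconst TYPE('a)) * wave (\<lambda>\<xi>. cb n \<xi> * rep_lp \<gamma> \<xi>) (x, s))"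
    and "lp_fun 2 (\<lambda>x. complex_of_real (fconst TYPE('a)) * wave (\<lambda>\<xi>. cb n \<xi> * rep_lp \<gamma> \<xi>) (x, s))"
proof -
  let ?f = "\<lambda>x. complex_of_real (fconst TYPE('a)) * wave (\<lambda>\<xi>. cb n \<xi> * rep_lp \<gamma> \<xi>) (x, s)"
  have "cft 1 (\<lambda>\<xi>. cb n \<xi> * rep_lp (mul (phase s) \<gamma>) \<xi>) = cft 1 (\<lambda>\<xi>. phase s \<xi> * (cb n \<xi> * rep_lp \<gamma> \<xi>))"
  proof (rule cft_cong_AE)
    have [measurable]: "phase s \<in> borel_measurable borel" by (rule unitbD(1)[OF unitb_phase])
    show "(\<lambda>\<xi>. phase s \<xi> * (cb n \<xi> * rep_lp \<gamma> \<xi>)) \<in> borel_measurable borel" by measurable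
    show "AE \<xi> in lborel. cb n \<xi> * rep_lp (mul (phase s) \<gamma>) \<xi> = phase s \<xi> * (cb n \<xi> * rep_lp \<gamma> \<xi>)"
      using rep_mul_AE[OF unitb_phase, of s \<gamma>] by eventually_elim simp
  qed measurable
  also have "\<dots> = ?f"
  proof
    have e: "cis (1 * (\<xi> \<bullet> x)) * (phase s \<xi> * z) = cis ((x, s) \<bullet> theta \<xi>) * z" for x \<xi> :: 'a and z
      unfolding mult.assoc[symmetric] cis_mult phase_def theta_def by (simp add: inner_commute)
    show "cft 1 (\<lambda>\<xi>. phase s \<xi> * (cb n \<xi> * rep_lp \<gamma> \<xi>)) x = ?f x" for x
      by (simp only: cft_def ft_def wave_def e)
  qed
  finally have eq: "cft 1 (\<lambda>\<xi>. cb n \<xi> * rep_lp (mul (phase s) \<gamma>) \<xi>) = ?f" .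
  show "U s (plancherel 1 (mul (cb n) \<gamma>)) = abs_lp ?f"
    unfolding U_plancherel mul_commute[OF unitb_phase unitb_cb] by (simp add: plancherel_mul_cb FI_def eq)
  show "lp_fun 2 ?f" using FI_lp[of 1 n "mul (phase s) \<gamma>"] unfolding eq by simp
qed

definition fconst2 :: "'a::euclidean_space itself \<Rightarrow> real" where
  "fconst2 _ = ((2 * pi) powr (- real DIM('a) / 2))\<^sup>2"

lemma cmod_cb: "cmod (cb n x) \<le> 1" by (rule unitbD(2)[OF unitb_cb])

lemma cb_square: "(cmod (cb n x))\<^sup>2 = indicator (cball 0 (real n)) x"
  by (simp add: cb_def indicator_def)

text \<open>On the ball of radius \<rho> and the time interval, the space-time Gaussian is at least
  \<open>m\<close>, so the weighted estimate controls the localised norm. That estimate asks for an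
  integrable density, hence the extra frequency cut-off \<open>cb n\<close>, which Fatou's lemma
  removes.\<close>

lemma local_smoothing:
  assumes e: "e > 0"
  obtains R :: nat where "\<And>\<gamma> :: 'a::euclidean_space L2. mul (cb R) \<gamma> = 0 \<Longrightarrow>
    (\<integral>\<^sup>+s. ennreal ((norm (mul (cb \<rho>) (U s (plancherel 1 \<gamma>))))\<^sup>2) \<partial>MI a b) \<le> ennreal (e * (norm \<gamma>)\<^sup>2)"
proof -
  define T where "T = max \<bar>a\<bar> \<bar>b\<bar>"
  define m where "m = exp (- ((real \<rho>)\<^sup>2 + T\<^sup>2) / 2)"
  have m: "m > 0" by (simp add: m_def)
  let ?c = "complex_of_real (fconst TYPE('a))" and ?c2 = "fconst2 TYPE('a)"
  define \<kappa> where "\<kappa> = sqrt (2 * pi) ^ DIM('a \<times> real)"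
  have \<kappa>: "\<kappa> > 0" by (simp add: \<kappa>_def)
  have c2: "?c2 > 0" by (simp add: fconst2_def)
  \<comment> \<open>Chosen so that the constants of the weighted estimate combine to
    \<open>e\<close>.\<close>
  define d where "d = e * m / (?c2 * \<kappa>)"
  have d: "d > 0" using e m \<kappa> c2 by (simp add: d_def)
  obtain R :: nat where R: "\<And>\<xi>::'a. real R < norm \<xi> \<Longrightarrow> row \<xi> \<le> d" using row_small[OF d] by blast
  have bounded_case: "(\<integral>\<^sup>+s. ennreal ((norm (mul (cb \<rho>) (U s (plancherel 1 (mul (cb n) \<gamma>)))))\<^sup>2) \<partial>MI a b) \<le> ennreal (e * (norm \<gamma>)\<^sup>2)"
    if \<gamma>0: "mul (cb R) \<gamma> = 0" for n and \<gamma> :: "'a L2"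
  proof -
    \<comment> \<open>Equal almost everywhere to the cut-off density, but zero at every frequency up
      to \<open>R\<close>, as the pointwise hypothesis of \<open>wave_gauss\<close> demands.\<close>
    define g where "g \<xi> = (if norm \<xi> \<le> real R then 0 else cb n \<xi> * rep_lp \<gamma> \<xi>)" for \<xi>
    have gAE: "AE \<xi> in lborel. cb n \<xi> * rep_lp \<gamma> \<xi> = g \<xi>"
      using rep_mul_AE[OF unitb_cb, of R \<gamma>] rep_zero_AE[where 'b = complex and 'c = 2] unfolding \<gamma>0
      by eventually_elim (auto simp: g_def cb_def indicator_def)
    have [measurable]: "g \<in> borel_measurable borel" unfolding g_def[abs_def] by measurable
    have gle: "cmod (g \<xi>) \<le> cmod (cb n \<xi> * rep_lp \<gamma> \<xi>)" for \<xi> by (simp add: g_def)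
    have gi: "integrable lborel g"
      by (rule Bochner_Integration.integrable_bound[OF cb_integrable[of n \<gamma>]]) (use gle in auto)
    have gle2: "(cmod (g \<xi>))\<^sup>2 \<le> (cmod (rep_lp \<gamma> \<xi>))\<^sup>2" for \<xi>
    proof (rule power_mono)
      show "cmod (g \<xi>) \<le> cmod (rep_lp \<gamma> \<xi>)"
        using gle[of \<xi>] mult_right_mono[OF cmod_cb[of n \<xi>], of "cmod (rep_lp \<gamma> \<xi>)"] by (simp add: norm_mult)
    qed simp
    have \<gamma>i: "integrable lborel (\<lambda>\<xi>. (cmod (rep_lp \<gamma> \<xi>))\<^sup>2)" using lp2_L2[of \<gamma>] by (simp add: lp_fun_def)
    have g2i: "integrable lborel (\<lambda>\<xi>. (cmod (g \<xi>))\<^sup>2)"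
      by (rule Bochner_Integration.integrable_bound[OF \<gamma>i]) (use gle2 in auto)
    have g2le: "(\<integral>\<xi>. (cmod (g \<xi>))\<^sup>2 \<partial>lborel) \<le> (norm \<gamma>)\<^sup>2"
      unfolding norm_L2_sq by (intro integral_mono g2i \<gamma>i gle2)
    have row_g: "row \<xi> \<le> d" if "g \<xi> \<noteq> 0" for \<xi> using that R by (auto simp: g_def split: if_splits)
    note wg = wave_gauss[OF gi row_g less_imp_le[OF d] g2i]
    have wave_eq: "wave (\<lambda>\<xi>. cb n \<xi> * rep_lp \<gamma> \<xi>) = wave g"
      unfolding wave_def fun_eq_iff
    proof (intro allI integral_cong_AE)
      fix y :: "'a \<times> real"
      have "(\<lambda>\<xi>. cis (y \<bullet> theta \<xi>)) \<in> borel_measurable borel"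
        unfolding cis_conv_exp by (intro borel_measurable_continuous_onI continuous_intros theta_continuous)
      note [measurable] = this
      show "AE \<xi> in lborel. cis (y \<bullet> theta \<xi>) * (cb n \<xi> * rep_lp \<gamma> \<xi>) = cis (y \<bullet> theta \<xi>) * g \<xi>"
        using gAE by eventually_elim simp
      show "(\<lambda>\<xi>. cis (y \<bullet> theta \<xi>) * (cb n \<xi> * rep_lp \<gamma> \<xi>)) \<in> borel_measurable lborel"
        "(\<lambda>\<xi>. cis (y \<bullet> theta \<xi>) * g \<xi>) \<in> borel_measurable lborel" by measurable
    qed
    have wm [measurable]: "wave g \<in> borel_measurable borel"
    proof -
      have [measurable]: "(\<lambda>(y, \<xi>). cis (y \<bullet> theta \<xi>)) \<in> borel_measurable (lborel \<Otimes>\<^sub>M (lborel :: 'a measure))"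
        using wave_kernel_measurable by (simp add: lborel_prod)
      have "(\<lambda>y. \<integral>\<xi>. cis (y \<bullet> theta \<xi>) * g \<xi> \<partial>lborel) \<in> borel_measurable lborel" by measurable
      then show ?thesis by (simp add: wave_def[abs_def])
    qed
    have sq: "ennreal ((norm (mul (cb \<rho>) (U s (plancherel 1 (mul (cb n) \<gamma>)))))\<^sup>2)
      \<le> (\<integral>\<^sup>+x. ennreal (?c2 / m) * ennreal (gauss 1 (x, s) * (cmod (wave g (x, s)))\<^sup>2) \<partial>lborel)" if s: "s \<in> {a..b}" for s
    proof -
      have wms [measurable]: "(\<lambda>x. wave g (x, s)) \<in> borel_measurable lborel"
        using measurable_compose[OF borel_measurable_continuous_onI wm, of "\<lambda>x. (x, s)"] by (simp add: continuous_on_Pair)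
      have l: "lp_fun 2 (\<lambda>x. ?c * wave g (x, s))" using U_wave(2)[of n \<gamma> s] unfolding wave_eq .
      have "mul (cb \<rho>) (U s (plancherel 1 (mul (cb n) \<gamma>))) = abs_lp (\<lambda>x. cb \<rho> x * (?c * wave g (x, s)))"
        unfolding U_wave(1) wave_eq by (rule mul_abs[OF unitb_cb l])
      then have "(norm (mul (cb \<rho>) (U s (plancherel 1 (mul (cb n) \<gamma>)))))\<^sup>2 = (\<integral>x. (cmod (cb \<rho> x * (?c * wave g (x, s))))\<^sup>2 \<partial>lborel)"
        using norm_L2_abs_sq[OF lp_fun_mul[OF unitb_cb l]] by simp
      also have "ennreal \<dots> = (\<integral>\<^sup>+x. ennreal ((cmod (cb \<rho> x * (?c * wave g (x, s))))\<^sup>2) \<partial>lborel)"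
        using lp_fun_integrable[OF lp_fun_mul[OF unitb_cb l]] by (intro nn_integral_eq_integral[symmetric]) auto
      also have "\<dots> \<le> (\<integral>\<^sup>+x. ennreal (?c2 / m) * ennreal (gauss 1 (x, s) * (cmod (wave g (x, s)))\<^sup>2) \<partial>lborel)"
      proof (intro nn_integral_mono)
        fix x :: 'a
        have "indicator (cball 0 (real \<rho>)) x \<le> gauss 1 (x, s) / m"
        proof (cases "x \<in> cball 0 (real \<rho>)")
          case True
          have 1: "(norm x)\<^sup>2 \<le> (real \<rho>)\<^sup>2" using True by (intro power_mono) auto
          have 2: "s\<^sup>2 \<le> T\<^sup>2" using s by (intro power2_le_iff_abs_le[THEN iffD2]) (auto simp: T_def)
          have n: "(1 * norm (x, s))\<^sup>2 = (norm x)\<^sup>2 + s\<^sup>2" by (simp add: norm_Pair)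
          have "m \<le> gauss 1 (x, s)" unfolding m_def gauss_def n exp_le_cancel_iff
            by (rule divide_right_mono[OF le_imp_neg_le[OF add_mono[OF 1 2]]]) simp
          then show ?thesis using m True by simp
        qed (use m gauss_pos[of 1 "(x, s)"] in simp)
        then have "indicator (cball 0 (real \<rho>)) x * (?c2 * (cmod (wave g (x, s)))\<^sup>2) \<le> gauss 1 (x, s) / m * (?c2 * (cmod (wave g (x, s)))\<^sup>2)"
          using c2 by (intro mult_right_mono) auto
        moreover have "(cmod (cb \<rho> x * (?c * wave g (x, s))))\<^sup>2 = indicator (cball 0 (real \<rho>)) x * (?c2 * (cmod (wave g (x, s)))\<^sup>2)"
          by (simp add: norm_mult power_mult_distrib cb_square fconst2_def)
        ultimately show "ennreal ((cmod (cb \<rho> x * (?c * wave g (x, s))))\<^sup>2) \<le> ennreal (?c2 / m) * ennreal (gauss 1 (x, s) * (cmod (wave g (x, s)))\<^sup>2)"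
          using c2 m gauss_pos[of 1 "(x, s)"] by (subst ennreal_mult[symmetric]) (auto intro!: ennreal_leI simp: mult_ac)
      qed
      finally show ?thesis .
    qed
    have "(\<integral>\<^sup>+s. ennreal ((norm (mul (cb \<rho>) (U s (plancherel 1 (mul (cb n) \<gamma>)))))\<^sup>2) \<partial>MI a b)
      \<le> (\<integral>\<^sup>+s. (\<integral>\<^sup>+x. ennreal (?c2 / m) * ennreal (gauss 1 (x, s) * (cmod (wave g (x, s)))\<^sup>2) \<partial>lborel) \<partial>MI a b)"
      by (intro nn_integral_mono sq) (simp add: space_MI)
    also have "\<dots> \<le> (\<integral>\<^sup>+s. (\<integral>\<^sup>+x. ennreal (?c2 / m) * ennreal (gauss 1 (x, s) * (cmod (wave g (x, s)))\<^sup>2) \<partial>lborel) \<partial>lborel)"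
      by (subst nn_integral_restrict_space) (auto intro!: nn_integral_mono simp: indicator_def)
    also have "\<dots> = (\<integral>\<^sup>+y. ennreal (?c2 / m) * ennreal (gauss 1 y * (cmod (wave g y))\<^sup>2) \<partial>(lborel \<Otimes>\<^sub>M lborel))"
    proof (rule lborel_pair.nn_integral_snd)
      show "(\<lambda>y. ennreal (?c2 / m) * ennreal (gauss 1 y * (cmod (wave g y))\<^sup>2)) \<in> borel_measurable (lborel \<Otimes>\<^sub>M lborel)"
        unfolding lborel_prod by measurable
    qed
    also have "\<dots> = ennreal (?c2 / m) * (\<integral>\<^sup>+y. ennreal (gauss 1 y * (cmod (wave g y))\<^sup>2) \<partial>lborel)"
      unfolding lborel_prod by (rule nn_integral_cmult) simp
    also have "(\<integral>\<^sup>+y. ennreal (gauss 1 y * (cmod (wave g y))\<^sup>2) \<partial>lborel) = ennreal (\<integral>y. gauss 1 y * (cmod (wave g y))\<^sup>2 \<partial>lborel)"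
      by (intro nn_integral_eq_integral wg(1) AE_I2 mult_nonneg_nonneg less_imp_le[OF gauss_pos] zero_le_power2)
    also have "ennreal (?c2 / m) * \<dots> = ennreal (?c2 / m * (\<integral>y. gauss 1 y * (cmod (wave g y))\<^sup>2 \<partial>lborel))"
      using c2 m by (intro ennreal_mult[symmetric] integral_nonneg_AE AE_I2) (auto intro!: mult_nonneg_nonneg less_imp_le[OF gauss_pos])
    also have "?c2 / m * (\<integral>y. gauss 1 y * (cmod (wave g y))\<^sup>2 \<partial>lborel) \<le> ?c2 / m * (\<kappa> * d * (norm \<gamma>)\<^sup>2)"
    proof (rule mult_left_mono)
      have "\<kappa> * d * (\<integral>\<xi>. (cmod (g \<xi>))\<^sup>2 \<partial>lborel) \<le> \<kappa> * d * (norm \<gamma>)\<^sup>2" using \<kappa> d by (intro mult_left_mono g2le) auto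
      then show "(\<integral>y. gauss 1 y * (cmod (wave g y))\<^sup>2 \<partial>lborel) \<le> \<kappa> * d * (norm \<gamma>)\<^sup>2" using wg(2) unfolding \<kappa>_def by linarith
    qed (use c2 m in simp)
    also have "?c2 / m * (\<kappa> * d * (norm \<gamma>)\<^sup>2) = e * (norm \<gamma>)\<^sup>2" using c2 m \<kappa> by (simp add: d_def)
    finally show ?thesis by (simp add: ennreal_leI)
  qed
  show thesis
  proof (rule that)
    fix \<gamma> :: "'a L2" assume \<gamma>0: "mul (cb R) \<gamma> = 0"
    have lim: "(\<lambda>n. ennreal ((norm (mul (cb \<rho>) (U s (plancherel 1 (mul (cb n) \<gamma>)))))\<^sup>2)) \<longlonglongrightarrow> ennreal ((norm (mul (cb \<rho>) (U s (plancherel 1 \<gamma>))))\<^sup>2)" for s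
      by (intro tendsto_ennrealI tendsto_power tendsto_norm bounded_linear.tendsto[OF bounded_linear_mul[OF unitb_cb]]
        bounded_linear.tendsto[OF bounded_linear_U] bounded_linear.tendsto[OF bounded_linear_plancherel] mul_cb_tendsto) simp
    have meas: "(\<lambda>s. ennreal ((norm (mul (cb \<rho>) (U s v)))\<^sup>2)) \<in> borel_measurable (MI a b)" for v :: "'a L2"
      by (intro borel_measurable_MI measurable_compose[OF borel_measurable_continuous_onI[of "\<lambda>s. (norm (mul (cb \<rho>) (U s v)))\<^sup>2"] measurable_ennreal]
        continuous_intros bounded_linear.continuous_on[OF bounded_linear_mul[OF unitb_cb]] continuous_on_U)
    have "(\<integral>\<^sup>+s. ennreal ((norm (mul (cb \<rho>) (U s (plancherel 1 \<gamma>))))\<^sup>2) \<partial>MI a b)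
      = (\<integral>\<^sup>+s. liminf (\<lambda>n. ennreal ((norm (mul (cb \<rho>) (U s (plancherel 1 (mul (cb n) \<gamma>)))))\<^sup>2)) \<partial>MI a b)"
      by (intro nn_integral_cong lim_imp_Liminf[OF sequentially_bot, symmetric] lim)
    also have "\<dots> \<le> liminf (\<lambda>n. \<integral>\<^sup>+s. ennreal ((norm (mul (cb \<rho>) (U s (plancherel 1 (mul (cb n) \<gamma>)))))\<^sup>2) \<partial>MI a b)"
      by (intro nn_integral_liminf meas)
    also have "\<dots> \<le> liminf (\<lambda>n::nat. ennreal (e * (norm \<gamma>)\<^sup>2))"
      by (intro Liminf_mono always_eventually allI bounded_case[OF \<gamma>0])
    finally show "(\<integral>\<^sup>+s. ennreal ((norm (mul (cb \<rho>) (U s (plancherel 1 \<gamma>))))\<^sup>2) \<partial>MI a b) \<le> ennreal (e * (norm \<gamma>)\<^sup>2)"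
      by (simp add: Liminf_const)
  qed
qed

section \<open>Uniform convergence of contractions on compact sets\<close>

text \<open>A finite net suffices because all the maps share the Lipschitz constant 1. Used for the
  ball cut-offs and for the finite-rank projections.\<close>

lemma contraction_uniform_compact:
  fixes T :: "nat \<Rightarrow> 'a::real_normed_vector \<Rightarrow> 'a"
  assumes C: "compact C" and lim: "\<And>y. (\<lambda>n. T n y) \<longlonglongrightarrow> y"
    and con: "\<And>n x y. norm (T n x - T n y) \<le> norm (x - y)" and e: "e > 0"
  obtains n where "\<And>y. y \<in> C \<Longrightarrow> norm (T n y - y) \<le> e"
proof -
  obtain k where k: "finite k" "C \<subseteq> (\<Union>x\<in>k. ball x (e/3))"
    using compact_imp_seq_compact[OF C] seq_compact_imp_totally_bounded[of C] e by (meson zero_less_divide_iff zero_less_numeral)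
  have "\<forall>\<^sub>F n in sequentially. \<forall>x\<in>k. norm (T n x - x) < e/3"
  proof (intro eventually_ball_finite k(1) ballI)
    fix x
    have "0 < e / 3" using e by simp
    from tendstoD[OF lim[of x] this] show "\<forall>\<^sub>F n in sequentially. norm (T n x - x) < e/3" unfolding dist_norm .
  qed
  then obtain n where n: "\<forall>x\<in>k. norm (T n x - x) < e/3" using eventually_happens'[OF sequentially_bot] by blast
  have "norm (T n y - y) \<le> e" if yC: "y \<in> C" for y
  proof -
    obtain x where x: "x \<in> k" "y \<in> ball x (e/3)" using k(2) yC by blast
    have xy: "norm (x - y) < e/3" using x(2) unfolding mem_ball dist_norm .
    have "T n y - y = (T n y - T n x) + (T n x - x) + (x - y)" by simp
    then have "norm (T n y - y) \<le> norm (T n y - T n x) + norm (T n x - x) + norm (x - y)"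
      by (metis norm_triangle_ineq norm_triangle_le add_right_mono order_trans)
    then show ?thesis using con[of n y x] n x(1) xy by (force simp: norm_minus_commute)
  qed
  then show thesis by (rule that)
qed

text \<open>The Hoelder bound is common to all \<open>F n\<close>, so smallness on a finite net
  spreads to the whole interval.\<close>

lemma equicontinuous_uniform:
  fixes F :: "nat \<Rightarrow> real \<Rightarrow> 'a::real_normed_vector"
  assumes r: "r > 0" and eq: "\<And>n t t'. t \<in> {a..b} \<Longrightarrow> t' \<in> {a..b} \<Longrightarrow> norm (F n t - F n t') \<le> C * \<bar>t - t'\<bar> powr r"
    and lim: "\<And>t. t \<in> {a..b} \<Longrightarrow> (\<lambda>n. F n t) \<longlonglongrightarrow> 0" and e: "e > 0"
  shows "\<forall>\<^sub>F n in sequentially. \<forall>t\<in>{a..b}. norm (F n t) \<le> e"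
proof -
  have "((\<lambda>x::real. C * \<bar>x\<bar> powr r) \<longlongrightarrow> C * \<bar>0\<bar> powr r) (at 0)"
    using r by (intro tendsto_mult_left tendsto_powr2 tendsto_intros) auto
  then have "\<forall>\<^sub>F x::real in at 0. C * \<bar>x\<bar> powr r < e/2" using e by (intro order_tendstoD(2)) auto
  then obtain d where d: "d > 0" "\<And>x::real. x \<noteq> 0 \<Longrightarrow> \<bar>x\<bar> < d \<Longrightarrow> C * \<bar>x\<bar> powr r < e/2"
    by (auto simp: eventually_at dist_real_def)
  have d': "C * \<bar>x\<bar> powr r \<le> e/2" if "\<bar>x\<bar> < d" for x :: real using d(2)[OF _ that] e by (cases "x = 0") auto
  obtain k where k: "finite k" "k \<subseteq> {a..b}" "{a..b} \<subseteq> (\<Union>x\<in>k. ball x d)"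
    using compact_imp_seq_compact[OF compact_Icc] seq_compact_imp_totally_bounded[of "{a..b}"] d(1) by meson
  have "\<forall>\<^sub>F n in sequentially. \<forall>x\<in>k. norm (F n x) < e/2"
  proof (intro eventually_ball_finite k(1) ballI)
    fix x assume "x \<in> k"
    then have "x \<in> {a..b}" using k(2) by blast
    have "0 < e / 2" using e by simp
    from tendstoD[OF lim[OF \<open>x \<in> {a..b}\<close>] this] show "\<forall>\<^sub>F n in sequentially. norm (F n x) < e/2" unfolding dist_norm by simp
  qed
  then show ?thesis
  proof eventually_elim
    case (elim n)
    show ?case
    proof
      fix t assume t: "t \<in> {a..b}"
      obtain x where x: "x \<in> k" "\<bar>x - t\<bar> < d" using k(3) t by (auto simp: dist_real_def)
      have "norm (F n t - F n x) \<le> e/2"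
        using eq[OF t, of x n] x k(2) d'[of "t - x"] by (force simp: abs_minus_commute)
      then show "norm (F n t) \<le> e" using elim x(1) norm_triangle_ineq[of "F n t - F n x" "F n x"] by force
    qed
  qed
qed

section \<open>Weak-* to strong continuity\<close>

lemma cb_lp_fun: "lp_fun 2 (\<lambda>\<xi>::'a::euclidean_space. cb R \<xi> * h \<xi>)" if h: "unitb h"
proof (rule lp_fun_bound)
  have [measurable]: "h \<in> borel_measurable borel" by (rule unitbD(1)[OF h])
  show "(\<lambda>\<xi>. cb R \<xi> * h \<xi>) \<in> borel_measurable lborel" by measurable
  have "integrable lborel (indicator (cball (0::'a) (real R)) :: 'a \<Rightarrow> real)"
    using emeasure_bounded_finite[of "cball (0::'a) (real R)"] by (intro integrable_real_indicator) auto
  moreover have "(indicator (cball (0::'a) (real R)) x :: real)\<^sup>2 = indicator (cball 0 (real R)) x" for x by (simp add: indicator_def)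
  ultimately show "integrable lborel (\<lambda>x::'a. (indicator (cball 0 (real R)) x :: real)\<^sup>2)" by simp
  show "AE x in lborel. cmod (cb R x * h x) \<le> indicator (cball 0 (real R)) x"
    using unitbD(2)[OF h] by (intro AE_I2) (simp add: cb_def indicator_def)
qed

text \<open>Representing vector of a point evaluation: paired with \<gamma> it gives the real part
  of the low-frequency wave of \<gamma> at the space-time point \<open>y\<close>, and after
  multiplication by \<i> the imaginary part. It depends continuously on \<open>y\<close>, so compact
  regions give compact sets of vectors.\<close>

definition kap :: "nat \<Rightarrow> 'a::euclidean_space \<times> real \<Rightarrow> 'a L2" where
  "kap R y = abs_lp (\<lambda>\<xi>. cb R \<xi> * cis (- (y \<bullet> theta \<xi>)))"

lemma unitb_cis_theta: "unitb (\<lambda>\<xi>. cis (- (y \<bullet> theta \<xi>)))"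
  unfolding unitb_def cis_conv_exp
  by (auto intro!: borel_measurable_continuous_onI continuous_intros theta_continuous simp flip: cis_conv_exp)

lemma kap_lp: "lp_fun 2 (\<lambda>\<xi>. cb R \<xi> * cis (- (y \<bullet> theta \<xi>)))"
  by (rule cb_lp_fun[OF unitb_cis_theta])

lemma kap_continuous: "continuous_on UNIV (kap R :: 'a::euclidean_space \<times> real \<Rightarrow> _)"
  unfolding continuous_on_sequentially comp_def
proof (intro ballI allI impI, elim conjE)
  fix x :: "nat \<Rightarrow> 'a \<times> real" and y assume lim: "x \<longlonglongrightarrow> y"
  show "(\<lambda>n. kap R (x n)) \<longlonglongrightarrow> kap R y"
    unfolding kap_def
  proof (rule abs_lp_tendsto_dominated[where w = "indicator (cball 0 (real R))"])
    show "(\<lambda>\<xi>. cb R \<xi> * cis (- (x i \<bullet> theta \<xi>))) \<in> borel_measurable lborel" for i by (rule lp_fun_measurable[OF kap_lp])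
    show "(\<lambda>\<xi>. cb R \<xi> * cis (- (y \<bullet> theta \<xi>))) \<in> borel_measurable lborel" by (rule lp_fun_measurable[OF kap_lp])
    have "integrable lborel (indicator (cball (0::'a) (real R)) :: 'a \<Rightarrow> real)"
      using emeasure_bounded_finite[of "cball (0::'a) (real R)"] by (intro integrable_real_indicator) auto
    moreover have "(indicator (cball (0::'a) (real R)) x :: real) ^ CARD(2) = indicator (cball 0 (real R)) x" for x by (simp add: indicator_def)
    ultimately show "integrable lborel (\<lambda>x::'a. (indicator (cball 0 (real R)) x :: real) ^ CARD(2))" by simp
    show "cmod (cb R \<xi> * cis (- (x i \<bullet> theta \<xi>))) \<le> indicator (cball 0 (real R)) \<xi>" for i \<xi> by (simp add: cb_def indicator_def norm_mult)
    show "(\<lambda>i. cb R \<xi> * cis (- (x i \<bullet> theta \<xi>))) \<longlonglongrightarrow> cb R \<xi> * cis (- (y \<bullet> theta \<xi>))" for \<xi>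
    proof -
      have "(\<lambda>i. x i \<bullet> theta \<xi>) \<longlonglongrightarrow> y \<bullet> theta \<xi>" by (rule tendsto_inner[OF lim tendsto_const])
      from tendsto_mult[OF tendsto_const tendsto_exp[OF tendsto_mult[OF tendsto_const tendsto_of_real[OF tendsto_minus[OF this]]]]]
      show ?thesis unfolding cis_conv_exp .
    qed
  qed
qed

lemma wave_le_kap:
  fixes \<gamma> :: "'a::euclidean_space L2"
  shows "cmod (wave (\<lambda>\<xi>. cb R \<xi> * rep_lp \<gamma> \<xi>) y) \<le> \<bar>inner (kap R y) \<gamma>\<bar> + \<bar>inner (cscale \<i> (kap R y)) \<gamma>\<bar>"
proof -
  let ?k = "\<lambda>\<xi>. cb R \<xi> * cis (- (y \<bullet> theta \<xi>))" and ?g = "\<lambda>\<xi>. cis (y \<bullet> theta \<xi>) * (cb R \<xi> * rep_lp \<gamma> \<xi>)"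
  have "unitb (\<lambda>\<xi>. cis (y \<bullet> theta \<xi>))" using unitb_cis_theta[of "- y"] by simp
  then have gi: "integrable lborel ?g"
    using unitbD[of "\<lambda>\<xi>. cis (y \<bullet> theta \<xi>)"]
    by (intro Bochner_Integration.integrable_bound[OF cb_integrable[of R \<gamma>]]) (auto simp: norm_mult)
  have i: "unitb (\<lambda>\<xi>::'a. \<i>)" by (simp add: unitb_def)
  have cbr: "cnj (cb R \<xi>) = cb R \<xi>" for \<xi> :: 'a by (simp add: cb_def indicator_def)
  have "inner (kap R y) \<gamma> = (\<integral>\<xi>. inner (?k \<xi>) (rep_lp \<gamma> \<xi>) \<partial>lborel)"
    unfolding kap_def using inner_lp_abs[OF kap_lp[of R y] lp2_L2[of \<gamma>], where 'c = 2] by (simp add: abs_rep_lp)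
  also have "\<dots> = (\<integral>\<xi>. Re (?g \<xi>) \<partial>lborel)"
  proof (intro Bochner_Integration.integral_cong refl)
    fix \<xi> :: 'a
    have "inner (?k \<xi>) (rep_lp \<gamma> \<xi>) = Re (cnj (?k \<xi>) * rep_lp \<gamma> \<xi>)" by (simp add: inner_complex_def algebra_simps)
    also have "cnj (?k \<xi>) * rep_lp \<gamma> \<xi> = ?g \<xi>" by (simp add: cis_cnj cbr)
    finally show "inner (?k \<xi>) (rep_lp \<gamma> \<xi>) = Re (?g \<xi>)" .
  qed
  also have "\<dots> = Re (wave (\<lambda>\<xi>. cb R \<xi> * rep_lp \<gamma> \<xi>) y)" unfolding wave_def by (rule integral_Re[OF gi])
  finally have 1: "Re (wave (\<lambda>\<xi>. cb R \<xi> * rep_lp \<gamma> \<xi>) y) = inner (kap R y) \<gamma>" by simp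
  have "inner (cscale \<i> (kap R y)) \<gamma> = (\<integral>\<xi>. inner (\<i> * ?k \<xi>) (rep_lp \<gamma> \<xi>) \<partial>lborel)"
    unfolding kap_def cscale_mul mul_abs[OF i kap_lp]
    using inner_lp_abs[OF lp_fun_mul[OF i kap_lp[of R y]] lp2_L2[of \<gamma>], where 'c = 2] by (simp add: abs_rep_lp)
  also have "\<dots> = (\<integral>\<xi>. Im (?g \<xi>) \<partial>lborel)"
  proof (intro Bochner_Integration.integral_cong refl)
    fix \<xi> :: 'a
    have "inner (\<i> * ?k \<xi>) (rep_lp \<gamma> \<xi>) = Im (cnj (?k \<xi>) * rep_lp \<gamma> \<xi>)" by (simp add: inner_complex_def)
    also have "cnj (?k \<xi>) * rep_lp \<gamma> \<xi> = ?g \<xi>" by (simp add: cis_cnj cbr)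
    finally show "inner (\<i> * ?k \<xi>) (rep_lp \<gamma> \<xi>) = Im (?g \<xi>)" .
  qed
  also have "\<dots> = Im (wave (\<lambda>\<xi>. cb R \<xi> * rep_lp \<gamma> \<xi>) y)" unfolding wave_def by (rule integral_Im[OF gi])
  finally have 2: "Im (wave (\<lambda>\<xi>. cb R \<xi> * rep_lp \<gamma> \<xi>) y) = inner (cscale \<i> (kap R y)) \<gamma>" by simp
  show ?thesis using cmod_le[of "wave (\<lambda>\<xi>. cb R \<xi> * rep_lp \<gamma> \<xi>) y"] unfolding 1 2 .
qed

text \<open>Compactness enters by duality: the wave of
  \<open>\<gamma> - onb_proj e m \<gamma>\<close> at a point is \<gamma> paired with the projection
  error of \<open>kap\<close>, and this error is uniformly small over the compact set
  \<open>C\<close>.\<close>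

lemma low_frequency_finite_rank:
  fixes e :: "nat \<Rightarrow> 'a::euclidean_space L2"
  assumes os: "orthosys e" and elim: "\<And>y. (\<lambda>n. onb_proj e n y) \<longlonglongrightarrow> y" and \<delta>: "\<delta> > 0"
  obtains m where "\<And>\<gamma> s. s \<in> {a..b} \<Longrightarrow> norm (mul (cb \<rho>) (U s (plancherel 1 (mul (cb R) (\<gamma> - onb_proj e m \<gamma>))))) \<le> \<delta> * norm \<gamma>"
proof -
  let ?c = "complex_of_real (fconst TYPE('a))" and ?c2 = "fconst2 TYPE('a)"
  define v where "v = measure lborel (cball (0::'a) (real \<rho>))"
  \<comment> \<open>The pointwise bound \<open>2 * \<epsilon> * norm \<gamma>\<close> becomes an L^2
    bound over the ball after multiplication by the root of \<open>?c2 * v\<close>. The summand 1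
    keeps the denominator positive.\<close>
  define \<epsilon> where "\<epsilon> = \<delta> / (2 * sqrt (?c2 * v) + 1)"
  have c2v: "0 \<le> ?c2 * v" by (simp add: fconst2_def v_def)
  have den: "2 * sqrt (?c2 * v) + 1 > 0" using c2v by (simp add: add_nonneg_pos)
  have \<epsilon>: "\<epsilon> > 0" using \<delta> den by (simp add: \<epsilon>_def)
  let ?K = "cball (0::'a) (real \<rho>) \<times> {a..b}"
  define C where "C = kap R ` ?K \<union> cscale \<i> ` kap R ` ?K"
  have cK: "compact (kap R ` ?K)"
    by (intro compact_continuous_image compact_Times continuous_on_subset[OF kap_continuous]) auto
  have C: "compact C"
    unfolding C_def
    by (rule compact_Un[OF cK compact_continuous_image[OF bounded_linear.continuous_on[OF bounded_linear_cscale continuous_on_id] cK]]) simp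
  obtain m where m: "\<And>y. y \<in> C \<Longrightarrow> norm (onb_proj e m y - y) \<le> \<epsilon>"
  proof (rule contraction_uniform_compact[OF C elim _ \<epsilon>])
    show "norm (onb_proj e n x - onb_proj e n y) \<le> norm (x - y)" for n x y
      using norm_onb_proj_le[OF os, of n "x - y"] by (simp add: linear_diff[OF bounded_linear.linear[OF bounded_linear_onb_proj]])
  qed blast
  have inC: "\<bar>inner y (\<gamma> - onb_proj e m \<gamma>)\<bar> \<le> \<epsilon> * norm \<gamma>" if "y \<in> C" for y \<gamma>
  proof -
    have "inner y (\<gamma> - onb_proj e m \<gamma>) = inner (y - onb_proj e m y) \<gamma>" by (simp add: inner_diff_left inner_diff_right inner_onb_proj)
    then have "\<bar>inner y (\<gamma> - onb_proj e m \<gamma>)\<bar> \<le> norm (onb_proj e m y - y) * norm \<gamma>"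
      using Cauchy_Schwarz_ineq2[of "y - onb_proj e m y" \<gamma>] by (simp add: norm_minus_commute)
    then show ?thesis using mult_right_mono[OF m[OF that] norm_ge_zero[of \<gamma>]] by linarith
  qed
  show thesis
  proof (rule that)
    fix \<gamma> :: "'a L2" and s assume s: "s \<in> {a..b}"
    let ?\<gamma> = "\<gamma> - onb_proj e m \<gamma>"
    let ?w = "\<lambda>x. wave (\<lambda>\<xi>. cb R \<xi> * rep_lp ?\<gamma> \<xi>) (x, s)"
    have w: "cmod (?w x) \<le> 2 * \<epsilon> * norm \<gamma>" if "x \<in> cball 0 (real \<rho>)" for x
    proof -
      have "kap R (x, s) \<in> C" "cscale \<i> (kap R (x, s)) \<in> C" using that s by (auto simp: C_def)
      from inC[OF this(1), of \<gamma>] inC[OF this(2), of \<gamma>] wave_le_kap[of R ?\<gamma> "(x, s)"] show ?thesis by linarith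
    qed
    have l: "lp_fun 2 (\<lambda>x. ?c * ?w x)" by (rule U_wave(2))
    have ind: "integrable lborel (indicator (cball (0::'a) (real \<rho>)) :: 'a \<Rightarrow> real)"
      using emeasure_bounded_finite[of "cball (0::'a) (real \<rho>)"] by (intro integrable_real_indicator) auto
    have "(norm (mul (cb \<rho>) (U s (plancherel 1 (mul (cb R) ?\<gamma>)))))\<^sup>2 = (\<integral>x. (cmod (cb \<rho> x * (?c * ?w x)))\<^sup>2 \<partial>lborel)"
      unfolding U_wave(1) mul_abs[OF unitb_cb l] by (rule norm_L2_abs_sq[OF lp_fun_mul[OF unitb_cb l]])
    also have "\<dots> \<le> (\<integral>x. indicator (cball (0::'a) (real \<rho>)) x * (?c2 * (2 * \<epsilon> * norm \<gamma>)\<^sup>2) \<partial>lborel)"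
    proof (rule integral_mono)
      show "integrable lborel (\<lambda>x. (cmod (cb \<rho> x * (?c * ?w x)))\<^sup>2)" using lp_fun_integrable[OF lp_fun_mul[OF unitb_cb l]] by simp
      show "integrable lborel (\<lambda>x::'a. indicator (cball 0 (real \<rho>)) x * (?c2 * (2 * \<epsilon> * norm \<gamma>)\<^sup>2))" using ind by simp
      show "(cmod (cb \<rho> x * (?c * ?w x)))\<^sup>2 \<le> indicator (cball 0 (real \<rho>)) x * (?c2 * (2 * \<epsilon> * norm \<gamma>)\<^sup>2)" for x
      proof (cases "x \<in> cball 0 (real \<rho>)")
        case True
        have "(cmod (?w x))\<^sup>2 \<le> (2 * \<epsilon> * norm \<gamma>)\<^sup>2" by (intro power_mono w True) simp
        then have "?c2 * (cmod (?w x))\<^sup>2 \<le> ?c2 * (2 * \<epsilon> * norm \<gamma>)\<^sup>2" by (rule mult_left_mono) (simp add: fconst2_def)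
        then show ?thesis using True by (simp add: norm_mult power_mult_distrib cb_def fconst2_def)
      qed (simp add: cb_def)
    qed
    also have "(\<integral>x. indicator (cball (0::'a) (real \<rho>)) x * (?c2 * (2 * \<epsilon> * norm \<gamma>)\<^sup>2) \<partial>lborel) = v * (?c2 * (2 * \<epsilon> * norm \<gamma>)\<^sup>2)" by (simp add: v_def)
    also have "v * (?c2 * (2 * \<epsilon> * norm \<gamma>)\<^sup>2) = (2 * \<epsilon> * norm \<gamma> * sqrt (?c2 * v))\<^sup>2"
    proof -
      have "(sqrt (?c2 * v))\<^sup>2 = ?c2 * v" using c2v by (rule real_sqrt_pow2)
      then show ?thesis unfolding power_mult_distrib[of "2 * \<epsilon> * norm \<gamma>"] by simp
    qed
    finally have sq: "(norm (mul (cb \<rho>) (U s (plancherel 1 (mul (cb R) ?\<gamma>)))))\<^sup>2 \<le> (2 * \<epsilon> * norm \<gamma> * sqrt (?c2 * v))\<^sup>2" .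
    have "norm (mul (cb \<rho>) (U s (plancherel 1 (mul (cb R) ?\<gamma>)))) \<le> 2 * \<epsilon> * norm \<gamma> * sqrt (?c2 * v)"
      by (rule power2_le_imp_le[OF sq]) (use \<epsilon> c2v in simp)
    also have "\<dots> = (\<epsilon> * (2 * sqrt (?c2 * v))) * norm \<gamma>" by simp
    also have "\<dots> \<le> (\<epsilon> * (2 * sqrt (?c2 * v) + 1)) * norm \<gamma>" using \<epsilon> by (intro mult_right_mono mult_left_mono) auto
    also have "\<dots> = \<delta> * norm \<gamma>" using den by (simp add: \<epsilon>_def)
    finally show "norm (mul (cb \<rho>) (U s (plancherel 1 (mul (cb R) ?\<gamma>)))) \<le> \<delta> * norm \<gamma>" .
  qed
qed

text \<open>Interpolation in time between L^2 and the sup norm. This is where q \<ge> 2 enters: the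
  power q - 2 of the norm of \<open>h\<close> is bounded by that of \<open>D\<close>.\<close>

lemma Lp_norm_square_bound:
  fixes h :: "real \<Rightarrow> 'b::{real_normed_vector,second_countable_topology}"
  assumes q: "2 \<le> q" and h: "h \<in> bm (MI a b)" and D: "0 \<le> D" "\<And>s. s \<in> {a..b} \<Longrightarrow> norm (h s) \<le> D"
    and e: "0 \<le> e" and sq: "(\<integral>\<^sup>+s. ennreal ((norm (h s))\<^sup>2) \<partial>MI a b) \<le> ennreal (e * D\<^sup>2)"
  shows "Lp_norm q (MI a b) h \<le> e powr (1 / q) * D"
proof -
  have hm [measurable]: "h \<in> borel_measurable (MI a b)" by (rule bm_measurable[OF h])
  have i2: "integrable (MI a b) (\<lambda>s. (norm (h s))\<^sup>2)"
    by (rule integrableI_nonneg) (use sq in \<open>auto intro: order.strict_trans1\<close>)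
  have "ennreal (\<integral>s. (norm (h s))\<^sup>2 \<partial>MI a b) \<le> ennreal (e * D\<^sup>2)"
    using sq by (subst (asm) nn_integral_eq_integral[OF i2]) auto
  then have s2: "(\<integral>s. (norm (h s))\<^sup>2 \<partial>MI a b) \<le> e * D\<^sup>2" using e by simp
  have "(\<integral>s. norm (h s) powr q \<partial>MI a b) \<le> (\<integral>s. D powr (q - 2) * (norm (h s))\<^sup>2 \<partial>MI a b)"
  proof (rule integral_mono)
    have "h \<in> Lp_space (ereal q) (MI a b)" using q by (intro bm_Lp_space finite_measure_MI h) auto
    then show "integrable (MI a b) (\<lambda>s. norm (h s) powr q)" by (simp add: Lp_space_real)
    show "norm (h s) powr q \<le> D powr (q - 2) * (norm (h s))\<^sup>2" if "s \<in> space (MI a b)" for s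
    proof -
      have "norm (h s) powr q = norm (h s) powr (q - 2) * (norm (h s))\<^sup>2"
        using powr_add[of "norm (h s)" "q - 2" 2] by (cases "h s = 0") auto
      also have "\<dots> \<le> D powr (q - 2) * (norm (h s))\<^sup>2" using D(2)[of s] that q by (intro mult_right_mono powr_mono2) (auto simp: space_MI)
      finally show ?thesis .
    qed
  qed (use i2 in simp)
  also have "\<dots> \<le> D powr (q - 2) * (e * D\<^sup>2)" using s2 by (simp add: mult_left_mono)
  also have "\<dots> = e * D powr q" using powr_add[of D "q - 2" 2] D(1) by (cases "D = 0") auto
  finally have "Lp_norm q (MI a b) h \<le> (e * D powr q) powr (1 / q)" unfolding Lp_norm_def using q by (intro powr_mono2) auto
  also have "\<dots> = e powr (1 / q) * D" using e D(1) q by (simp add: powr_mult powr_powr)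
  finally show ?thesis .
qed

lemma lqf_rmul_le:
  assumes W: "lqf q a b N W" and f: "f \<in> bm (MI a b)" and B: "0 \<le> B" "\<And>s. s \<in> {a..b} \<Longrightarrow> norm (f s) \<le> B" and h: "h \<in> bm (MI a b)"
  shows "\<bar>W (\<lambda>s. rmul (f s) (h s))\<bar> \<le> N * B * Lp_norm q (MI a b) h"
  using lq_functional.bound[OF lq_functional_rmul[OF W f B] h] .

lemma Lp_norm_le_const:
  fixes h :: "real \<Rightarrow> 'b::{real_normed_vector,second_countable_topology}"
  assumes q: "1 \<le> q" and h: "h \<in> bm (MI a b)" and D: "0 \<le> D" "\<And>s. s \<in> {a..b} \<Longrightarrow> norm (h s) \<le> D"
  shows "Lp_norm q (MI a b) h \<le> D * measure (MI a b) {a..b} powr (1 / q)"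
  by (rule Lp_norm_le[OF finite_measure_MI q D(1) sets_MI bm_measurable[OF h]]) (use D in \<open>auto simp: space_MI\<close>)

text \<open>The vector \<open>u = Gop (W n) ?f\<close> is tested against itself, so its squared norm
  is a value of \<open>W n\<close>. Decomposing the test function leaves three errors of size
  \<open>(\<epsilon> / 4) * norm u\<close> and a finite sum of values \<open>W n (F k)\<close>,
  where \<open>F k\<close> does not depend on n. After division by the norm of \<open>u\<close>,
  weak-* convergence handles the sum.\<close>

lemma Gop_tendsto_0:
  fixes W :: "nat \<Rightarrow> (real \<Rightarrow> 'a::euclidean_space L1_real) \<Rightarrow> real"
  assumes W: "\<And>n. lqf q a b N (W n)" and q: "2 \<le> q" and f: "continuous_on {a..b} f"
    and lim: "\<And>F. F \<in> Lp_space (ereal q) (MI a b) \<Longrightarrow> (\<lambda>n. W n F) \<longlonglongrightarrow> 0"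
  shows "(\<lambda>n. Gop (W n) (\<lambda>s. sgj t s *\<^sub>R f s)) \<longlonglongrightarrow> 0"
proof -
  interpret rm: bounded_bilinear rmul by (rule bounded_bilinear_rmul)
  note q1 = lqf_q[OF W[of 0]] and N = lqf_N[OF W[of 0]]
  note X = bm_Lp_space[OF finite_measure_MI q1]
  define L where "L = measure (MI a b) {a..b} powr (1 / q)"
  have L: "0 \<le> L" by (simp add: L_def)
  obtain B where B: "0 \<le> B" "\<And>s. s \<in> {a..b} \<Longrightarrow> norm (f s) \<le> B" using continuous_norm_bound[OF f] by blast
  let ?f = "\<lambda>s. sgj t s *\<^sub>R f s"
  have fb: "?f \<in> bm (MI a b)" by (rule sgj_bm[OF continuous_bm[OF f]])
  have fB: "norm (?f s) \<le> B" if "s \<in> {a..b}" for s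
    using mult_mono[OF abs_sgj_le[of t s] B(2)[OF that]] by simp
  obtain e :: "nat \<Rightarrow> 'a L2" where os: "orthosys e" and elim: "\<And>y. (\<lambda>n. onb_proj e n y) \<longlonglongrightarrow> y" using ex_onb by blast
  have main: "\<forall>\<^sub>F n in sequentially. norm (Gop (W n) ?f) < \<epsilon>" if \<epsilon>: "\<epsilon> > 0" for \<epsilon>
  proof -
    \<comment> \<open>Tolerances for cutting \<open>f\<close> off in space, for the high frequencies
      and for the projection error at low frequencies; each compensates the constant of its
      estimate. In \<open>e2\<close> the power q undoes the root in
      \<open>Lp_norm_square_bound\<close>, and 8 instead of 4 makes up for
      \<open>norm \<gamma>H \<le> 2 * norm u\<close>.\<close>
    define e1 where "e1 = \<epsilon> / (4 * (N * L + 1))"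
    define e2 where "e2 = (\<epsilon> / (8 * (N * B + 1))) powr q"
    define \<delta> where "\<delta> = \<epsilon> / (4 * (N * B * L + 1))"
    have pos: "N * L + 1 > 0" "N * B + 1 > 0" "N * B * L + 1 > 0" using N B(1) L by (simp_all add: add_nonneg_pos)
    have e1: "e1 > 0" and e2: "e2 > 0" and \<delta>: "\<delta> > 0" using \<epsilon> pos by (simp_all add: e1_def e2_def \<delta>_def)
    have "compact (f ` {a..b})" by (intro compact_continuous_image f) simp
    then obtain \<rho> where \<rho>': "\<And>y. y \<in> f ` {a..b} \<Longrightarrow> norm (mul (cb \<rho>) y - y) \<le> e1"
    proof (rule contraction_uniform_compact[OF _ mul_cb_tendsto _ e1])
      show "norm (mul (cb n) x - mul (cb n) y) \<le> norm (x - y)" for n and x y :: "'a L2"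
        using norm_mul_le[OF unitb_cb, of n "x - y"] by (simp add: linear_diff[OF bounded_linear.linear[OF bounded_linear_mul[OF unitb_cb]]])
    qed blast
    obtain R where R: "\<And>\<gamma> :: 'a L2. mul (cb R) \<gamma> = 0 \<Longrightarrow>
      (\<integral>\<^sup>+s. ennreal ((norm (mul (cb \<rho>) (U s (plancherel 1 \<gamma>))))\<^sup>2) \<partial>MI a b) \<le> ennreal (e2 * (norm \<gamma>)\<^sup>2)"
      using local_smoothing[OF e2] by blast
    obtain m where m: "\<And>\<gamma> s. s \<in> {a..b} \<Longrightarrow> norm (mul (cb \<rho>) (U s (plancherel 1 (mul (cb R) (\<gamma> - onb_proj e m \<gamma>))))) \<le> \<delta> * norm \<gamma>"
      using low_frequency_finite_rank[OF os elim \<delta>] by blast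
    define A where "A s x = mul (cb \<rho>) (U s (plancherel 1 x))" for s and x :: "'a L2"
    have A: "bounded_linear (A s)" for s
      unfolding A_def[abs_def] by (intro bounded_linear_compose[OF bounded_linear_mul[OF unitb_cb]] bounded_linear_compose[OF bounded_linear_U] bounded_linear_plancherel) simp
    have Ab: "(\<lambda>s. A s x) \<in> bm (MI a b)" for x
      unfolding A_def by (intro continuous_bm bounded_linear.continuous_on[OF bounded_linear_mul[OF unitb_cb]] continuous_on_U continuous_intros)
    have nA: "norm (A s x) \<le> norm x" for s x
      unfolding A_def using norm_mul_le[OF unitb_cb, of \<rho> "U s (plancherel 1 x)"] by (simp add: norm_plancherel)
    define F where "F k s = rmul (?f s) (A s (mul (cb R) (e k)))" for k s
    have Fb: "F k \<in> bm (MI a b)" for k unfolding F_def[abs_def] by (rule bm_rmul[OF fb Ab])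
    have bound: "norm (Gop (W n) ?f) \<le> 3 * \<epsilon> / 4 + (\<Sum>k<m. \<bar>W n (F k)\<bar>)" for n
    proof -
      define u where "u = Gop (W n) ?f"
      define \<gamma> where "\<gamma> = plancherel (-1) u"
      have u\<gamma>: "u = plancherel 1 \<gamma>" by (simp add: \<gamma>_def plancherel_inverse1)
      have n\<gamma>: "norm \<gamma> = norm u" by (simp add: \<gamma>_def norm_plancherel)
      \<comment> \<open>High-frequency part of the transform of \<open>u\<close>. The low-frequency
        part splits into the projection error \<open>\<gamma>L\<close> and a combination of the
        fixed vectors \<open>mul (cb R) (e k)\<close>.\<close>
      define \<gamma>H where "\<gamma>H = \<gamma> - mul (cb R) \<gamma>"
      define \<gamma>L where "\<gamma>L = mul (cb R) (\<gamma> - onb_proj e m \<gamma>)"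
      have "(\<lambda>x::'a. cb R x * cb R x) = cb R" by (simp add: cb_def fun_eq_iff indicator_def)
      then have \<gamma>H0: "mul (cb R) \<gamma>H = 0"
        by (simp add: \<gamma>H_def linear_diff[OF bounded_linear.linear[OF bounded_linear_mul[OF unitb_cb]]] mul_mul[OF unitb_cb unitb_cb])
      have n\<gamma>H: "norm \<gamma>H \<le> 2 * norm u"
        using norm_triangle_ineq4[of \<gamma> "mul (cb R) \<gamma>"] norm_mul_le[OF unitb_cb, of R \<gamma>] by (simp add: \<gamma>H_def n\<gamma>)
      have dec: "\<gamma> = \<gamma>H + \<gamma>L + (\<Sum>k<m. inner (e k) \<gamma> *\<^sub>R mul (cb R) (e k))"
      proof -
        interpret M: bounded_linear "mul (cb R) :: 'a L2 \<Rightarrow> _" by (rule bounded_linear_mul[OF unitb_cb])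
        show ?thesis by (simp add: \<gamma>H_def \<gamma>L_def M.diff) (simp add: onb_proj_def M.sum M.scaleR)
      qed
      have cbr: "(\<lambda>x::'a. cnj (cb \<rho> x)) = cb \<rho>" by (simp add: cb_def fun_eq_iff indicator_def)
      let ?f1 = "\<lambda>s. ?f s - mul (cb \<rho>) (?f s)"
      have f1b: "?f1 \<in> bm (MI a b)" by (intro bm_diff fb bm_linear[OF bounded_linear_mul[OF unitb_cb]])
      have f1e: "norm (?f1 s) \<le> e1" if "s \<in> {a..b}" for s
      proof -
        have "?f1 s = sgj t s *\<^sub>R (f s - mul (cb \<rho>) (f s))" by (simp add: mul_scaleR[OF unitb_cb] scaleR_diff_right)
        then have "norm (?f1 s) \<le> 1 * norm (f s - mul (cb \<rho>) (f s))" using mult_right_mono[OF abs_sgj_le[of t s] norm_ge_zero] by simp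
        then show ?thesis using \<rho>'[of "f s"] that by (force simp: norm_minus_commute)
      qed
      have Ub: "(\<lambda>s. U s u) \<in> bm (MI a b)" using continuous_bm[OF continuous_U[of _ 0 u]] by simp
      have split: "rmul (?f s) (U s u) = rmul (?f1 s) (U s u) + (rmul (?f s) (A s \<gamma>H) + (rmul (?f s) (A s \<gamma>L) + (\<Sum>k<m. inner (e k) \<gamma> *\<^sub>R F k s)))" for s
      proof -
        interpret A: bounded_linear "A s" by (rule A)
        have "rmul (?f s) (U s u) = rmul (?f1 s) (U s u) + rmul (mul (cb \<rho>) (?f s)) (U s u)" by (simp only: rm.add_left[symmetric] diff_add_cancel)
        also have "rmul (mul (cb \<rho>) (?f s)) (U s u) = rmul (?f s) (A s \<gamma>)" unfolding rmul_mul[OF unitb_cb] cbr by (simp add: A_def u\<gamma>)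
        also have "A s \<gamma> = A s \<gamma>H + (A s \<gamma>L + (\<Sum>k<m. inner (e k) \<gamma> *\<^sub>R A s (mul (cb R) (e k))))"
          by (subst dec) (simp only: A.add A.sum A.scaleR add.assoc)
        finally show ?thesis unfolding F_def by (simp only: rm.add_right rm.sum_right rm.scaleR_right)
      qed
      have Sb: "(\<lambda>s. \<Sum>k<m. inner (e k) \<gamma> *\<^sub>R F k s) \<in> bm (MI a b)" by (intro bm_sum bm_scaleR[OF Fb bm_const]) auto
      have WS: "W n (\<lambda>s. \<Sum>k<j. inner (e k) \<gamma> *\<^sub>R F k s) = (\<Sum>k<j. inner (e k) \<gamma> * W n (F k))" for j
      proof (induction j)
        case 0
        then show ?case by (simp add: lqf_zero[OF W])
      next
        case (Suc j)
        have "(\<lambda>s. \<Sum>k<j. inner (e k) \<gamma> *\<^sub>R F k s) \<in> bm (MI a b)" by (intro bm_sum bm_scaleR[OF Fb bm_const]) auto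
        then show ?case using Suc lqf_add[OF W X X, of "\<lambda>s. \<Sum>k<j. inner (e k) \<gamma> *\<^sub>R F k s" "\<lambda>s. inner (e j) \<gamma> *\<^sub>R F j s" n]
          bm_scaleR[OF Fb bm_const] lqf_scaleR[OF W X[OF Fb]] by simp
      qed
      have "W n (\<lambda>s. rmul (?f s) (U s u)) = W n (\<lambda>s. rmul (?f1 s) (U s u)) + (W n (\<lambda>s. rmul (?f s) (A s \<gamma>H)) + (W n (\<lambda>s. rmul (?f s) (A s \<gamma>L)) + (\<Sum>k<m. inner (e k) \<gamma> * W n (F k))))"
        unfolding split WS[symmetric]
        by (subst lqf_add[OF W], (intro X bm_add bm_rmul fb f1b Ub Ab Sb)+)+ (rule refl)
      moreover have "W n (\<lambda>s. rmul (?f s) (U s u)) = norm u * norm u"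
        using Gop_inner[OF W fb, of n u] by (simp add: u_def[symmetric] dot_square_norm power2_eq_square)
      moreover have "\<bar>W n (\<lambda>s. rmul (?f1 s) (U s u))\<bar> \<le> (\<epsilon> / 4) * norm u"
      proof -
        have "\<bar>W n (\<lambda>s. rmul (?f1 s) (U s u))\<bar> \<le> N * e1 * Lp_norm q (MI a b) (\<lambda>s. U s u)"
          by (rule lqf_rmul_le[OF W f1b less_imp_le[OF e1] f1e Ub])
        also have "\<dots> \<le> N * e1 * (norm u * L)"
          unfolding L_def using N e1 by (intro mult_left_mono Lp_norm_le_const[OF q1 Ub]) auto
        also have "\<dots> = (N * L * e1) * norm u" by simp
        also have "\<dots> \<le> (\<epsilon> / 4) * norm u"
        proof (rule mult_right_mono)
          have "N * L * e1 \<le> (N * L + 1) * e1" using e1 by (intro mult_right_mono) auto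
          also have "\<dots> = \<epsilon> / 4" using pos(1) by (simp add: e1_def divide_simps)
          finally show "N * L * e1 \<le> \<epsilon> / 4" .
        qed simp
        finally show ?thesis .
      qed
      moreover have "\<bar>W n (\<lambda>s. rmul (?f s) (A s \<gamma>H))\<bar> \<le> (\<epsilon> / 4) * norm u"
      proof -
        have "\<bar>W n (\<lambda>s. rmul (?f s) (A s \<gamma>H))\<bar> \<le> N * B * Lp_norm q (MI a b) (\<lambda>s. A s \<gamma>H)"
          by (rule lqf_rmul_le[OF W fb B(1) fB Ab])
        also have "\<dots> \<le> N * B * (e2 powr (1 / q) * norm \<gamma>H)"
          using N B(1) e2 R[OF \<gamma>H0] by (intro mult_left_mono Lp_norm_square_bound[OF q Ab] nA) (auto simp: A_def)
        also have "e2 powr (1 / q) = \<epsilon> / (8 * (N * B + 1))" using \<epsilon> pos q1 by (simp add: e2_def powr_powr)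
        also have "N * B * (\<epsilon> / (8 * (N * B + 1)) * norm \<gamma>H) \<le> N * B * (\<epsilon> / (8 * (N * B + 1)) * (2 * norm u))"
          using N B(1) \<epsilon> pos n\<gamma>H by (intro mult_left_mono) auto
        also have "\<dots> = (N * B / (N * B + 1)) * ((\<epsilon> / 4) * norm u)" using pos(2) by (simp add: field_simps)
        also have "\<dots> \<le> 1 * ((\<epsilon> / 4) * norm u)" using pos(2) \<epsilon> by (intro mult_right_mono) (auto simp: divide_le_eq_1)
        finally show ?thesis by simp
      qed
      moreover have "\<bar>W n (\<lambda>s. rmul (?f s) (A s \<gamma>L))\<bar> \<le> (\<epsilon> / 4) * norm u"
      proof -
        have "\<bar>W n (\<lambda>s. rmul (?f s) (A s \<gamma>L))\<bar> \<le> N * B * Lp_norm q (MI a b) (\<lambda>s. A s \<gamma>L)"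
          by (rule lqf_rmul_le[OF W fb B(1) fB Ab])
        also have "\<dots> \<le> N * B * ((\<delta> * norm u) * L)"
          unfolding L_def using N B(1) \<delta> m[of _ \<gamma>] n\<gamma> by (intro mult_left_mono Lp_norm_le_const[OF q1 Ab]) (auto simp: A_def \<gamma>L_def)
        also have "\<dots> = (N * B * L * \<delta>) * norm u" by simp
        also have "\<dots> \<le> (\<epsilon> / 4) * norm u"
        proof (rule mult_right_mono)
          have "N * B * L * \<delta> \<le> (N * B * L + 1) * \<delta>" using \<delta> by (intro mult_right_mono) auto
          also have "\<dots> = \<epsilon> / 4" using pos(3) by (simp add: \<delta>_def divide_simps)
          finally show "N * B * L * \<delta> \<le> \<epsilon> / 4" .
        qed simp
        finally show ?thesis .
      qed
      moreover have "\<bar>\<Sum>k<m. inner (e k) \<gamma> * W n (F k)\<bar> \<le> (\<Sum>k<m. \<bar>W n (F k)\<bar>) * norm u"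
      proof -
        have "\<bar>\<Sum>k<m. inner (e k) \<gamma> * W n (F k)\<bar> \<le> (\<Sum>k<m. \<bar>inner (e k) \<gamma> * W n (F k)\<bar>)" by (rule sum_abs)
        also have "\<dots> \<le> (\<Sum>k<m. \<bar>W n (F k)\<bar> * norm u)"
        proof (rule sum_mono)
          fix k
          have "(norm (e k))\<^sup>2 \<le> 1\<^sup>2" using os unfolding orthosys_def power2_norm_eq_inner by simp
          then have "norm (e k) \<le> 1" by (rule power2_le_imp_le) simp
          then have "\<bar>inner (e k) \<gamma>\<bar> \<le> norm u"
            using Cauchy_Schwarz_ineq2[of "e k" \<gamma>] mult_right_mono[of "norm (e k)" 1 "norm \<gamma>"] n\<gamma> by simp
          then show "\<bar>inner (e k) \<gamma> * W n (F k)\<bar> \<le> \<bar>W n (F k)\<bar> * norm u"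
            using mult_right_mono[of "\<bar>inner (e k) \<gamma>\<bar>" "norm u" "\<bar>W n (F k)\<bar>"] by (simp add: abs_mult mult.commute)
        qed
        finally show ?thesis by (simp add: sum_distrib_right)
      qed
      ultimately have "norm u * norm u \<le> (\<epsilon> / 4) * norm u + ((\<epsilon> / 4) * norm u + ((\<epsilon> / 4) * norm u + (\<Sum>k<m. \<bar>W n (F k)\<bar>) * norm u))" by linarith
      also have "\<dots> = (3 * \<epsilon> / 4 + (\<Sum>k<m. \<bar>W n (F k)\<bar>)) * norm u" by (simp add: algebra_simps)
      finally have "norm u \<le> 3 * \<epsilon> / 4 + (\<Sum>k<m. \<bar>W n (F k)\<bar>)"
        using \<epsilon> by (cases "u = 0") (auto intro: sum_nonneg add_nonneg_nonneg)
      then show ?thesis by (simp add: u_def)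
    qed
    have "(\<lambda>n. \<Sum>k<m. \<bar>W n (F k)\<bar>) \<longlonglongrightarrow> (\<Sum>k<m. \<bar>0\<bar>)" by (intro tendsto_sum tendsto_rabs lim X Fb)
    then have "\<forall>\<^sub>F n in sequentially. (\<Sum>k<m. \<bar>W n (F k)\<bar>) < \<epsilon> / 4" using \<epsilon> by (intro order_tendstoD(2)) auto
    then show ?thesis proof eventually_elim
      case (elim n)
      then show ?case using bound[of n] by linarith
    qed
  qed
  show ?thesis by (rule tendstoI) (use main in \<open>simp add: dist_norm\<close>)
qed

lemma lqf_diff_functional:
  assumes W: "lqf q a b N W" and W': "lqf q a b N W'"
  shows "lqf q a b (2 * N) (\<lambda>F. W F - W' F)"
  unfolding lqf_def
proof (intro conjI ballI allI)
  show "1 \<le> q" by (rule lqf_q[OF W])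
  show "0 \<le> 2 * N" using lqf_N[OF W] by simp
  fix f g :: "real \<Rightarrow> 'a L1_real" and c d :: real
  assume f: "f \<in> Lp_space (ereal q) (MI a b)"
  then show "\<bar>W f - W' f\<bar> \<le> 2 * N * Lp_norm q (MI a b) f" using lqf_le[OF W f] lqf_le[OF W' f] by simp
  assume g: "g \<in> Lp_space (ereal q) (MI a b)"
  show "W (\<lambda>t. c *\<^sub>R f t + d *\<^sub>R g t) - W' (\<lambda>t. c *\<^sub>R f t + d *\<^sub>R g t) = c * (W f - W' f) + d * (W g - W' g)"
    by (simp only: lqf_lin[OF W f g] lqf_lin[OF W' f g]) (simp add: right_diff_distrib)
qed

lemma Gop_diff_functional:
  assumes W: "lqf q a b N W" and W': "lqf q a b N W'" and f: "f \<in> bm (MI a b)"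
  shows "Gop (\<lambda>F. W F - W' F) f = Gop W f - Gop W' f"
  by (rule inner_eqI) (simp add: inner_diff_left Gop_inner[OF W f] Gop_inner[OF W' f] Gop_inner[OF lqf_diff_functional[OF W W'] f])

text \<open>The limit solution \<psi>' satisfies the equation for \<open>W n\<close> up to a defect,
  the Duhamel term of \<open>W n - W'\<close> with the fixed function \<psi>'. The defect tends to 0
  at each time and is equicontinuous, hence uniformly small, and \<open>solves_stability\<close>
  converts it into the distance of the solutions.\<close>

lemma solves_tendsto:
  fixes W :: "nat \<Rightarrow> (real \<Rightarrow> 'a::euclidean_space L1_real) \<Rightarrow> real"
  assumes W: "\<And>n. lqf q a b N (W n)" and W': "lqf q a b N W'" and q: "2 \<le> q" and ab: "a \<le> 0" "0 \<le> b"
    and lim: "\<And>F. F \<in> Lp_space (ereal q) (MI a b) \<Longrightarrow> (\<lambda>n. W n F) \<longlonglongrightarrow> W' F"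
    and \<psi>: "\<And>n. solves (W n) a b \<psi>0 (\<psi> n)" and \<psi>': "solves W' a b \<psi>0 \<psi>'" and e: "e > 0"
  shows "\<forall>\<^sub>F n in sequentially. \<forall>t\<in>{a..b}. norm (\<psi> n t - \<psi>' t) \<le> e"
proof -
  have c: "continuous_on {a..b} \<psi>'" and eq: "\<And>t. t \<in> {a..b} \<Longrightarrow> \<psi>' t = Gam W' \<psi>0 \<psi>' t" using \<psi>' by (auto simp: solves_def)
  have bm: "\<psi>' \<in> bm (MI a b)" by (rule continuous_bm[OF c])
  obtain B where B: "0 \<le> B" "\<And>s. s \<in> {a..b} \<Longrightarrow> norm (\<psi>' s) \<le> B" using continuous_norm_bound[OF c] by blast
  let ?D = "\<lambda>n F. W n F - W' F"
  have D: "lqf q a b (2 * N) (?D n)" for n by (rule lqf_diff_functional[OF W W'])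
  define E where "E = exp (lam q N * max \<bar>a\<bar> \<bar>b\<bar>)"
  have E0: "E > 0" by (simp add: E_def)
  have "\<forall>\<^sub>F n in sequentially. \<forall>t\<in>{a..b}. norm (Gop (?D n) (\<lambda>s. sgj t s *\<^sub>R \<psi>' s)) \<le> e / (2 * E)"
  proof (rule equicontinuous_uniform)
    show "1 / q > 0" using q by simp
    show "norm (Gop (?D n) (\<lambda>s. sgj t s *\<^sub>R \<psi>' s) - Gop (?D n) (\<lambda>s. sgj t' s *\<^sub>R \<psi>' s)) \<le> (2 * N * (2 * B)) * \<bar>t - t'\<bar> powr (1 / q)"
      if "t \<in> {a..b}" "t' \<in> {a..b}" for n t t'
      using Gop_sgj_continuous[OF D bm B that] by (simp add: mult_ac)
    show "(\<lambda>n. Gop (?D n) (\<lambda>s. sgj t s *\<^sub>R \<psi>' s)) \<longlonglongrightarrow> 0" for t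
      by (rule Gop_tendsto_0[OF D q c]) (intro LIM_zero lim)
    show "0 < e / (2 * E)" using e E0 by simp
  qed
  then show ?thesis
  proof eventually_elim
    case (elim n)
    show ?case
    proof
      fix t assume t: "t \<in> {a..b}"
      have "norm (Gam (W n) \<psi>0 \<psi>' t - \<psi>' t) \<le> e / (2 * E)" if t: "t \<in> {a..b}" for t
      proof -
        have "norm (Gam (W n) \<psi>0 \<psi>' t - \<psi>' t) = norm (Gam (W n) \<psi>0 \<psi>' t - Gam W' \<psi>0 \<psi>' t)" using eq[OF t] by simp
        also have "\<dots> = norm (cscale \<i> (U t (Gop W' (\<lambda>s. sgj t s *\<^sub>R \<psi>' s))) - cscale \<i> (U t (Gop (W n) (\<lambda>s. sgj t s *\<^sub>R \<psi>' s))))"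
          by (simp add: Gam_def)
        also have "\<dots> = norm (Gop (?D n) (\<lambda>s. sgj t s *\<^sub>R \<psi>' s))"
          by (simp add: cscale_U_diff norm_minus_commute Gop_diff_functional[OF W W' sgj_bm[OF bm]])
        finally show ?thesis using elim t by simp
      qed
      from solves_stability[OF W ab \<psi> c this _ t]
      have "norm (\<psi> n t - \<psi>' t) \<le> 2 * (e / (2 * E)) * exp (lam q N * \<bar>t\<bar>)" using e E0 by simp
      also have "\<dots> \<le> 2 * (e / (2 * E)) * E"
        unfolding E_def using t e lam_nonneg[OF W'] by (intro mult_left_mono) (auto intro!: mult_left_mono)
      also have "\<dots> = e" using E0 by simp
      finally show "norm (\<psi> n t - \<psi>' t) \<le> e" .
    qed
  qed
qed

section \<open>Potentials on different intervals\<close>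

text \<open>An elementary route to the Hoelder embedding:
  \<open>x powr q \<le> 1 + x powr q'\<close>, applied to \<open>f / B\<close> for every
  \<open>B\<close> above the norm with exponent \<open>q'\<close>. Letting \<open>B\<close> decrease
  to the norm also covers the case of norm 0.\<close>

lemma Lp_space_exponent_mono:
  fixes f :: "'c \<Rightarrow> 'b::{real_normed_vector,second_countable_topology}"
  assumes M: "finite_measure M" and q: "1 \<le> q" "q \<le> q'" and f: "f \<in> Lp_space (ereal q') M"
  shows "f \<in> Lp_space (ereal q) M" "Lp_norm q M f \<le> (measure M (space M) + 1) powr (1 / q) * Lp_norm q' M f"
proof -
  interpret finite_measure M by fact
  have fm [measurable]: "f \<in> borel_measurable M" and fi: "integrable M (\<lambda>x. norm (f x) powr q')" using f by (auto simp: Lp_space_real)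
  have le: "norm (f x) powr q \<le> B powr q * (1 + norm (f x) powr q' / B powr q')" if B: "0 < B" for B x
  proof -
    have "(norm (f x) / B) powr q \<le> 1 + (norm (f x) / B) powr q'"
    proof (cases "norm (f x) / B \<le> 1")
      case True
      then have "(norm (f x) / B) powr q \<le> 1 powr q" using B q by (intro powr_mono2) auto
      then show ?thesis by (simp add: add_increasing2)
    next
      case False
      then have "(norm (f x) / B) powr q \<le> (norm (f x) / B) powr q'" using q by (intro powr_mono) auto
      then show ?thesis by simp
    qed
    then have "B powr q * (norm (f x) / B) powr q \<le> B powr q * (1 + (norm (f x) / B) powr q')" by (intro mult_left_mono) auto
    then show ?thesis using B by (simp add: powr_divide)
  qed
  have int: "integrable M (\<lambda>x. B powr q * (1 + norm (f x) powr q' / B powr q'))" for B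
    using fi by simp
  have fq: "integrable M (\<lambda>x. norm (f x) powr q)"
    by (rule Bochner_Integration.integrable_bound[OF int[of 1]]) (use le[of 1] in \<open>auto intro!: AE_I2\<close>)
  then show "f \<in> Lp_space (ereal q) M" by (simp add: Lp_space_real)
  define A where "A = Lp_norm q' M f"
  define c where "c = (measure M (space M) + 1) powr (1 / q)"
  have A0: "0 \<le> A" by (simp add: A_def Lp_norm_nonneg)
  have "measure M (space M) + 1 \<noteq> 0" using measure_nonneg[of M "space M"] by linarith
  then have c0: "0 < c" by (simp add: c_def powr_gt_zero)
  have I: "(\<integral>x. norm (f x) powr q' \<partial>M) = A powr q'"
    unfolding A_def Lp_norm_def using q by (simp add: powr_powr)
  have "Lp_norm q M f / c \<le> B" if "A < B" for B
  proof -
    have B: "0 < B" using that A0 by simp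
    have "(\<integral>x. norm (f x) powr q \<partial>M) \<le> (\<integral>x. B powr q * (1 + norm (f x) powr q' / B powr q') \<partial>M)"
      by (rule integral_mono[OF fq int le[OF B]])
    also have "\<dots> = B powr q * (measure M (space M) + A powr q' / B powr q')" using fi by (simp add: I)
    also have "\<dots> \<le> B powr q * (measure M (space M) + 1)"
      using that A0 B q powr_mono2[of q' A B] by (intro mult_left_mono add_left_mono) (auto simp: divide_le_eq)
    finally have "(\<integral>x. norm (f x) powr q \<partial>M) powr (1 / q) \<le> (B powr q * (measure M (space M) + 1)) powr (1 / q)"
      using q by (intro powr_mono2) (auto intro!: integral_nonneg_AE)
    also have "\<dots> = B * c" using B q by (simp add: powr_mult powr_powr c_def)
    finally show ?thesis using c0 by (simp add: Lp_norm_def divide_le_eq)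
  qed
  then have "Lp_norm q M f / c \<le> A" by (rule dense_ge)
  then show "Lp_norm q M f \<le> (measure M (space M) + 1) powr (1 / q) * Lp_norm q' M f"
    using c0 by (simp add: A_def[symmetric] c_def[symmetric] divide_le_eq mult.commute)
qed

text \<open>Inclusion of the potential spaces on a bounded interval, with the change of the norm
  bound made explicit for the later bookkeeping by integers.\<close>

lemma lqf_exponent_mono:
  assumes W: "lqf q a b N W" and q: "q \<le> q'"
  shows "lqf q' a b (N * (measure (MI a b) {a..b} + 1) powr (1 / q)) W"
  unfolding lqf_def
proof (intro conjI ballI allI)
  note q1 = lqf_q[OF W] and N = lqf_N[OF W]
  note mono = Lp_space_exponent_mono[OF finite_measure_MI q1 q, of _ a b, unfolded space_MI]
  show "1 \<le> q'" using q1 q by simp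
  show "0 \<le> N * (measure (MI a b) {a..b} + 1) powr (1 / q)" using N by simp
  fix f g :: "real \<Rightarrow> 'a L1_real" and c d :: real
  assume f: "f \<in> Lp_space (ereal q') (MI a b)"
  have "\<bar>W f\<bar> \<le> N * Lp_norm q (MI a b) f" by (rule lqf_le[OF W mono(1)[OF f]])
  also have "\<dots> \<le> N * ((measure (MI a b) {a..b} + 1) powr (1 / q) * Lp_norm q' (MI a b) f)"
    by (rule mult_left_mono[OF mono(2)[OF f] N])
  finally show "\<bar>W f\<bar> \<le> N * (measure (MI a b) {a..b} + 1) powr (1 / q) * Lp_norm q' (MI a b) f" by simp
  assume g: "g \<in> Lp_space (ereal q') (MI a b)"
  show "W (\<lambda>t. c *\<^sub>R f t + d *\<^sub>R g t) = c * W f + d * W g" by (rule lqf_lin[OF W mono(1)[OF f] mono(1)[OF g]])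
qed

lemma conj_exponent_real: "conj_exponent (ereal ((real k + 2) / (real k + 1))) = real k + 2"
  by (simp add: conj_exponent_def one_ereal_def divide_ereal_def field_simps)

section \<open>Functionals are determined by their measures\<close>

lemma indicator_const_Lp_space:
  fixes h :: "'b::{real_normed_vector,second_countable_topology}"
  assumes "1 \<le> q" "E \<in> sets borel"
  shows "(\<lambda>t. indicator E t *\<^sub>R h) \<in> Lp_space (ereal q) (MI a b)"
proof (rule bm_Lp_space[OF finite_measure_MI assms(1)])
  show "(\<lambda>t. indicator E t *\<^sub>R h) \<in> bm (MI a b)"
    using assms(2) by (intro bmI[of _ _ "norm h"] borel_measurable_MI) (auto simp: indicator_def)
qed

lemma lqf_sum:
  assumes W: "lqf q a b N W" and I: "finite I" and f: "\<And>i. i \<in> I \<Longrightarrow> f i \<in> Lp_space (ereal q) (MI a b)"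
  shows "(\<lambda>t. \<Sum>i\<in>I. f i t) \<in> Lp_space (ereal q) (MI a b) \<and> W (\<lambda>t. \<Sum>i\<in>I. f i t) = (\<Sum>i\<in>I. W (f i))"
  using I f
proof (induction I)
  case empty
  have "(\<lambda>t. 0) \<in> Lp_space (ereal q) (MI a b)" by (simp add: Lp_space_real)
  then show ?case by (simp add: lqf_zero[OF W])
next
  case (insert i I)
  then show ?case
    using Lp_space_add[OF lqf_q[OF W], of "f i" "MI a b" "\<lambda>t. \<Sum>i\<in>I. f i t"] lqf_add[OF W, of "f i" "\<lambda>t. \<Sum>i\<in>I. f i t"] by simp
qed

text \<open>Simple functions are dense, so the values on \<open>indicator E t *\<^sub>R h\<close>
  decide everything; applied to a difference, this makes the functional in
  \<open>local_functional\<close> unique.\<close>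

lemma lqf_determined:
  fixes W :: "(real \<Rightarrow> 'a::euclidean_space L1_real) \<Rightarrow> real"
  assumes W: "lqf q a b N W" and 0: "\<And>E h. E \<in> sets borel \<Longrightarrow> E \<subseteq> {a..b} \<Longrightarrow> W (\<lambda>t. indicator E t *\<^sub>R h) = 0"
    and F: "F \<in> Lp_space (ereal q) (MI a b)"
  shows "W F = 0"
proof -
  note q1 = lqf_q[OF W] and N = lqf_N[OF W]
  have Fm: "F \<in> borel_measurable (MI a b)" and Fi: "integrable (MI a b) (\<lambda>t. norm (F t) powr q)" using F by (auto simp: Lp_space_real)
  obtain s where s: "\<And>i. simple_function (MI a b) (s i)" and lim: "\<And>t. t \<in> space (MI a b) \<Longrightarrow> (\<lambda>i. s i t) \<longlonglongrightarrow> F t"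
    and b: "\<And>i t. t \<in> space (MI a b) \<Longrightarrow> norm (s i t) \<le> 2 * norm (F t)"
    using borel_measurable_implies_sequence_metric[OF Fm, of 0] unfolding dist_norm diff_0_right diff_zero by metis
  have sm: "s i \<in> borel_measurable (MI a b)" for i by (rule borel_measurable_simple_function[OF s])
  have sX: "s i \<in> Lp_space (ereal q) (MI a b)" for i by (rule Lp_space_mono(1)[OF q1 sm F, of 2]) (use b in auto)
  have s0: "W (s i) = 0" for i
  proof -
    let ?V = "s i ` {a..b}" and ?E = "\<lambda>v. s i -` {v} \<inter> {a..b}"
    have fV: "finite ?V" using simple_functionD(1)[OF s[of i]] by (simp add: space_MI)
    have E: "?E v \<in> sets borel" for v using sets_MI_D[OF simple_functionD(2)[OF s[of i], of "{v}"]] by (simp add: space_MI)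
    have "(\<Sum>v\<in>?V. indicator (?E v) t *\<^sub>R v) = s i t" if t: "t \<in> {a..b}" for t
    proof -
      have "(\<Sum>v\<in>?V. indicator (?E v) t *\<^sub>R v) = (\<Sum>v\<in>?V. if v = s i t then v else 0)"
        using t by (intro sum.cong) (auto simp: indicator_def)
      then show ?thesis using t fV by simp
    qed
    then have "W (s i) = W (\<lambda>t. \<Sum>v\<in>?V. indicator (?E v) t *\<^sub>R v)" by (intro lqf_cong(1)[OF W sX]) simp
    also have "\<dots> = (\<Sum>v\<in>?V. W (\<lambda>t. indicator (?E v) t *\<^sub>R v))"
      by (rule conjunct2[OF lqf_sum[OF W fV]]) (rule indicator_const_Lp_space[OF q1 E])
    also have "\<dots> = 0" by (rule sum.neutral) (use 0[OF E] in simp)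
    finally show ?thesis .
  qed
  have "(\<lambda>i. Lp_norm q (MI a b) (\<lambda>t. F t - s i t)) \<longlonglongrightarrow> 0"
  proof (rule Lp_norm_tendsto_0[OF q1, where w = "\<lambda>t. 3 * norm (F t)"])
    show "integrable (MI a b) (\<lambda>t. (3 * norm (F t)) powr q)" using Fi by (simp add: powr_mult)
    show "AE t in MI a b. (\<lambda>i. F t - s i t) \<longlonglongrightarrow> 0"
      by (rule AE_I2) (rule tendsto_eq_intros lim tendsto_const | simp)+
    show "AE t in MI a b. norm (F t - s i t) \<le> 3 * norm (F t)" for i
    proof (rule AE_I2)
      fix t assume "t \<in> space (MI a b)"
      then show "norm (F t - s i t) \<le> 3 * norm (F t)" using b[of t i] norm_triangle_ineq4[of "F t" "s i t"] by linarith
    qed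
  qed (intro borel_measurable_diff Fm sm)
  then have "(\<lambda>i. N * Lp_norm q (MI a b) (\<lambda>t. F t - s i t)) \<longlonglongrightarrow> N * 0" by (rule tendsto_mult_left)
  moreover have "\<bar>W F\<bar> \<le> N * Lp_norm q (MI a b) (\<lambda>t. F t - s i t)" for i
    using lqf_le[OF W Lp_space_diff[OF q1 F sX[of i]]] lqf_diff[OF W F sX[of i]] s0[of i] by simp
  ultimately have "\<bar>W F\<bar> \<le> N * 0" by (intro LIMSEQ_le_const) auto
  then show ?thesis by simp
qed

lemma Lp_space_local:
  fixes F :: "real \<Rightarrow> 'b::{real_normed_vector,second_countable_topology}"
  assumes q: "1 \<le> q" and mn: "{m..n} \<subseteq> {a..b}" "{m..n} \<subseteq> {c..d}" and F: "F \<in> Lp_space (ereal q) (MI c d)"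
  shows "(\<lambda>t. indicator {m..n} t *\<^sub>R F t) \<in> Lp_space (ereal q) (MI a b)"
    and "Lp_norm q (MI a b) (\<lambda>t. indicator {m..n} t *\<^sub>R F t) \<le> Lp_norm q (MI c d) F"
proof -
  have Fm: "F \<in> borel_measurable (MI c d)" using F by (simp add: Lp_space_real)
  have "indicator {m..n} t *\<^sub>R F t = indicator {m..n} t *\<^sub>R (indicator {c..d} t *\<^sub>R F t)" for t
    using mn(2) by (auto simp: indicator_def)
  moreover have "(\<lambda>t. indicator {m..n} t *\<^sub>R (indicator {c..d} t *\<^sub>R F t)) \<in> borel_measurable borel"
    by (intro borel_measurable_scaleR Fm[unfolded measurable_MI_iff]) simp
  ultimately have Fm': "F \<in> borel_measurable (MI m n)" unfolding measurable_MI_iff by (simp only:)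
  note 1 = Lp_space_indicator[OF q F sets_MI[OF _ mn(2)]]
  have "integrable (MI m n) (\<lambda>t. norm (F t) powr q)"
    using 1 Lp_norm_restrict(2)[OF mn(2), of q F] q by (simp add: Lp_space_real)
  then show "(\<lambda>t. indicator {m..n} t *\<^sub>R F t) \<in> Lp_space (ereal q) (MI a b)"
    unfolding Lp_space_real using MI_subset[OF mn(1) Fm'] Lp_norm_restrict(2)[OF mn(1), of q F] q by simp
  have "Lp_norm q (MI a b) (\<lambda>t. indicator {m..n} t *\<^sub>R F t) = Lp_norm q (MI c d) (\<lambda>t. indicator {m..n} t *\<^sub>R F t)"
    by (simp only: Lp_norm_restrict(1)[OF mn(1)] Lp_norm_restrict(1)[OF mn(2)])
  also have "\<dots> \<le> 1 * Lp_norm q (MI c d) F"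
    using 1 by (intro Lp_space_mono(2)[OF q _ F]) (auto simp: Lp_space_real indicator_def)
  finally show "Lp_norm q (MI a b) (\<lambda>t. indicator {m..n} t *\<^sub>R F t) \<le> Lp_norm q (MI c d) F" by simp
qed

text \<open>Covers restriction to a subinterval and extension by zero to another interval at once,
  through the common part \<open>{m..n}\<close>, which may be empty.\<close>

lemma lqf_local:
  assumes W: "lqf q a b N W" and mn: "{m..n} \<subseteq> {a..b}" "{m..n} \<subseteq> {c..d}"
  shows "lqf q c d N (\<lambda>F. W (\<lambda>t. indicator {m..n} t *\<^sub>R F t))"
  unfolding lqf_def
proof (intro conjI ballI allI)
  note q = lqf_q[OF W] and N = lqf_N[OF W]
  note loc = Lp_space_local[OF q mn]
  show "1 \<le> q" "0 \<le> N" by (fact q, fact N)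
  fix f g :: "real \<Rightarrow> 'a L1_real" and c' d' :: real
  assume f: "f \<in> Lp_space (ereal q) (MI c d)"
  show "\<bar>W (\<lambda>t. indicator {m..n} t *\<^sub>R f t)\<bar> \<le> N * Lp_norm q (MI c d) f"
    using lqf_le[OF W loc(1)[OF f]] mult_left_mono[OF loc(2)[OF f] N] by linarith
  assume g: "g \<in> Lp_space (ereal q) (MI c d)"
  have "indicator {m..n} t *\<^sub>R (c' *\<^sub>R f t + d' *\<^sub>R g t) = c' *\<^sub>R (indicator {m..n} t *\<^sub>R f t) + d' *\<^sub>R (indicator {m..n} t *\<^sub>R g t)" for t
    by (simp add: scaleR_add_right mult.commute)
  then show "W (\<lambda>t. indicator {m..n} t *\<^sub>R (c' *\<^sub>R f t + d' *\<^sub>R g t))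
      = c' * W (\<lambda>t. indicator {m..n} t *\<^sub>R f t) + d' * W (\<lambda>t. indicator {m..n} t *\<^sub>R g t)"
    using lqf_lin[OF W loc(1)[OF f] loc(1)[OF g], of c' d'] by simp
qed

section \<open>Dependence of the Duhamel term and of solutions on functional and interval\<close>

lemma Gop_local: "Gop (\<lambda>F. W (\<lambda>t. c t *\<^sub>R F t)) f = Gop W (\<lambda>t. c t *\<^sub>R f t)"
proof -
  interpret rm: bounded_bilinear rmul by (rule bounded_bilinear_rmul)
  show ?thesis unfolding Gop_def by (simp only: rm.scaleR_left)
qed

lemma U_bm: "(\<lambda>s. U s g) \<in> bm (MI a b)"
  using continuous_bm[OF continuous_U[of _ 0 g]] by simp

lemma Gop_cong:
  assumes q: "1 \<le> q" and eq: "\<And>F. F \<in> Lp_space (ereal q) (MI a b) \<Longrightarrow> W F = W' F" and f: "f \<in> bm (MI a b)"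
  shows "Gop W f = Gop W' f"
proof -
  have "W (\<lambda>s. rmul (f s) (U s g)) = W' (\<lambda>s. rmul (f s) (U s g))" for g
    by (intro eq bm_Lp_space[OF finite_measure_MI q] bm_rmul f U_bm)
  then show ?thesis unfolding Gop_def by simp
qed

lemma Gop_cong_fun:
  assumes W: "lqf q a b N W" and f: "f \<in> bm (MI a b)" and eq: "\<And>t. t \<in> {a..b} \<Longrightarrow> f t = g t"
  shows "Gop W f = Gop W g"
proof -
  have "W (\<lambda>s. rmul (f s) (U s h)) = W (\<lambda>s. rmul (g s) (U s h))" for h
    by (intro lqf_cong(1)[OF W] bm_Lp_space[OF finite_measure_MI lqf_q[OF W]] bm_rmul f U_bm) (simp add: eq)
  then show ?thesis unfolding Gop_def by simp
qed

lemma Gop_minus: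
  fixes f :: "real \<Rightarrow> 'a::euclidean_space L2"
  assumes W: "lqf q a b N W" and f: "f \<in> bm (MI a b)"
  shows "Gop W (\<lambda>t. - f t) = - Gop W f"
proof -
  have z: "(\<lambda>t. 0 :: 'a L2) \<in> bm (MI a b)" by (rule bm_const)
  have "Gop W (\<lambda>t. 0 :: 'a L2) = 0" using Gop_diff[OF W z z] by simp
  then show ?thesis using Gop_diff[OF W z f] by simp
qed

lemma solves_cong_fun:
  assumes W: "lqf q a b N W" and f: "solves W a b \<psi>0 f" and eq: "\<And>t. t \<in> {a..b} \<Longrightarrow> f t = g t"
  shows "solves W a b \<psi>0 g"
proof -
  have c: "continuous_on {a..b} f" using f by (simp add: solves_def)
  have "Gam W \<psi>0 f t = Gam W \<psi>0 g t" for t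
    unfolding Gam_def by (subst Gop_cong_fun[OF W sgj_bm[OF continuous_bm[OF c]], of t "\<lambda>s. sgj t s *\<^sub>R g s"]) (simp_all add: eq)
  moreover have "continuous_on {a..b} g" using c eq continuous_on_cong[OF refl, of "{a..b}" f g] by blast
  ultimately show ?thesis using f eq by (auto simp: solves_def)
qed

lemma solves_cong:
  assumes q: "1 \<le> q" and eq: "\<And>F. F \<in> Lp_space (ereal q) (MI a b) \<Longrightarrow> W F = W' F" and f: "solves W a b \<psi>0 f"
  shows "solves W' a b \<psi>0 f"
proof -
  have c: "continuous_on {a..b} f" using f by (simp add: solves_def)
  have "Gam W \<psi>0 f t = Gam W' \<psi>0 f t" for t
    unfolding Gam_def by (subst Gop_cong[OF q eq sgj_bm[OF continuous_bm[OF c]]]) simp_all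
  then show ?thesis using f by (auto simp: solves_def)
qed

text \<open>For \<open>t\<close> in an interval around 0 the function \<open>sgj t\<close> is
  supported in that interval, so the Duhamel term sees only the restricted functional.\<close>

lemma solves_subinterval:
  assumes W: "lqf q a b N W" and f: "solves W a b \<psi>0 f" and cd: "{c..d} \<subseteq> {a..b}" "c \<le> 0" "0 \<le> d"
  shows "solves (\<lambda>F. W (\<lambda>t. indicator {c..d} t *\<^sub>R F t)) c d \<psi>0 f"
proof -
  have cont: "continuous_on {a..b} f" using f by (simp add: solves_def)
  have "Gam (\<lambda>F. W (\<lambda>t. indicator {c..d} t *\<^sub>R F t)) \<psi>0 f t = f t" if t: "t \<in> {c..d}" for t
  proof -
    have "indicator {c..d} s *\<^sub>R (sgj t s *\<^sub>R f s) = sgj t s *\<^sub>R f s" for s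
      using t cd by (auto simp: sgj_def indicator_def)
    then have "Gam (\<lambda>F. W (\<lambda>t. indicator {c..d} t *\<^sub>R F t)) \<psi>0 f t = Gam W \<psi>0 f t"
      unfolding Gam_def Gop_local by (simp only:)
    then show ?thesis using f t cd by (auto simp: solves_def)
  qed
  then show ?thesis using continuous_on_subset[OF cont cd(1)] by (simp add: solves_def)
qed

section \<open>From measures on the line to functionals on intervals\<close>

lemma M_space_lqf: "1 < p \<Longrightarrow> V \<in> M_space p {a..b} \<Longrightarrow> \<exists>N. lqf (conj_exponent p) a b N V"
  by (simp add: M_space_iff)

lemma represents_unique:
  fixes W :: "(real \<Rightarrow> 'a::euclidean_space L1_real) \<Rightarrow> real"
  assumes p: "1 < p" and W: "W \<in> M_space p {a..b}" "represents {a..b} W V" and W': "W' \<in> M_space p {a..b}" "represents {a..b} W' V"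
  shows "W = W'"
proof (rule extensionalityI)
  let ?q = "conj_exponent p"
  show "W \<in> extensional (Lp_space (ereal ?q) (MI a b))" "W' \<in> extensional (Lp_space (ereal ?q) (MI a b))"
    using W(1) W'(1) by (simp_all add: M_space_iff[OF p])
  obtain N N' where "lqf ?q a b N W" "lqf ?q a b N' W'" using M_space_lqf[OF p W(1)] M_space_lqf[OF p W'(1)] by blast
  then have "lqf ?q a b (max N N') W" "lqf ?q a b (max N N') W'" by (auto elim: lqf_mono)
  note D = lqf_diff_functional[OF this]
  fix F :: "real \<Rightarrow> 'a L1_real" assume F: "F \<in> Lp_space (ereal ?q) (MI a b)"
  have "W F - W' F = 0"
    by (rule lqf_determined[OF D _ F]) (use W(2) W'(2) in \<open>simp add: represents_def\<close>)
  then show "W F = W' F" by simp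
qed

lemma local_functional_eqI:
  assumes "1 < p" "W \<in> M_space p {a..b}" "represents {a..b} W V"
  shows "local_functional p V a b = W"
  unfolding local_functional_def by (rule the_equality) (use assms represents_unique in blast)+

lemma local_functional_props:
  assumes p: "1 < p" and V: "V \<in> M_loc p" and ab: "a \<le> b"
  shows "local_functional p V a b \<in> M_space p {a..b}" "represents {a..b} (local_functional p V a b) V"
proof -
  obtain W where W: "W \<in> M_space p {a..b}" "represents {a..b} W V" using V ab by (auto simp: M_loc_def)
  then show "local_functional p V a b \<in> M_space p {a..b}" "represents {a..b} (local_functional p V a b) V"
    using local_functional_eqI[OF p W] by auto
qed

lemma lqf_restrict:
  assumes W: "lqf q a b N W" shows "lqf q a b N (restrict W (Lp_space (ereal q) (MI a b)))"
  unfolding lqf_def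
proof (intro conjI ballI allI)
  note q = lqf_q[OF W] and N = lqf_N[OF W]
  show "1 \<le> q" "0 \<le> N" by (fact q, fact N)
  fix f g :: "real \<Rightarrow> 'a L1_real" and c d :: real
  assume f: "f \<in> Lp_space (ereal q) (MI a b)"
  show "\<bar>restrict W (Lp_space (ereal q) (MI a b)) f\<bar> \<le> N * Lp_norm q (MI a b) f" using lqf_le[OF W f] f by simp
  assume g: "g \<in> Lp_space (ereal q) (MI a b)"
  have "(\<lambda>t. c *\<^sub>R f t + d *\<^sub>R g t) \<in> Lp_space (ereal q) (MI a b)" by (intro Lp_space_add Lp_space_scaleR q f g)
  then show "restrict W (Lp_space (ereal q) (MI a b)) (\<lambda>t. c *\<^sub>R f t + d *\<^sub>R g t)
      = c * restrict W (Lp_space (ereal q) (MI a b)) f + d * restrict W (Lp_space (ereal q) (MI a b)) g"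
    using f g lqf_lin[OF W f g] by simp
qed

lemma restrict_M_space:
  assumes p: "1 < p" and W: "lqf (conj_exponent p) a b N W"
  shows "restrict W (Lp_space (ereal (conj_exponent p)) (MI a b)) \<in> M_space p {a..b}"
  unfolding M_space_iff[OF p] using lqf_restrict[OF W] by auto

lemma restrict_represents:
  assumes q: "1 \<le> q" and W: "\<And>E h. E \<in> sets borel \<Longrightarrow> E \<subseteq> {a..b} \<Longrightarrow> (\<integral>x. V E x * rep_lp h x \<partial>lborel) = W (\<lambda>t. indicator E t *\<^sub>R h)"
  shows "represents {a..b} (restrict W (Lp_space (ereal q) (MI a b))) V"
  unfolding represents_def by (simp add: W indicator_const_Lp_space[OF q])

text \<open>Compatibility follows from uniqueness: both sides represent \<open>V\<close> on
  \<open>{c..d}\<close>.\<close>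

lemma local_functional_subinterval:
  fixes V :: "real set \<Rightarrow> 'a::euclidean_space \<Rightarrow> real"
  assumes p: "1 < p" and V: "V \<in> M_loc p" and cd: "c \<le> d" "{c..d} \<subseteq> {a..b}"
    and F: "F \<in> Lp_space (ereal (conj_exponent p)) (MI c d)"
  shows "local_functional p V c d F = local_functional p V a b (\<lambda>t. indicator {c..d} t *\<^sub>R F t)"
proof -
  let ?q = "conj_exponent p"
  let ?W = "local_functional p V a b"
  let ?W' = "\<lambda>F. ?W (\<lambda>t. indicator {c..d} t *\<^sub>R F t)"
  have ab: "a \<le> b" using cd by auto
  note W = local_functional_props[OF p V ab]
  obtain N where N: "lqf ?q a b N ?W" using M_space_lqf[OF p W(1)] by blast
  have "represents {c..d} (restrict ?W' (Lp_space (ereal ?q) (MI c d))) V"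
  proof (rule restrict_represents[OF lqf_q[OF N]])
    fix E h assume E: "E \<in> sets borel" "E \<subseteq> {c..d}"
    then have "(\<integral>x. V E x * rep_lp h x \<partial>lborel) = ?W (\<lambda>t. indicator E t *\<^sub>R h)"
      using W(2) cd(2) unfolding represents_def by blast
    moreover have "indicator {c..d} t *\<^sub>R (indicator E t *\<^sub>R h) = indicator E t *\<^sub>R h" for t
      using E(2) by (auto simp: indicator_def)
    ultimately show "(\<integral>x. V E x * rep_lp h x \<partial>lborel) = ?W' (\<lambda>t. indicator E t *\<^sub>R h)" by (simp only:)
  qed
  from local_functional_eqI[OF p restrict_M_space[OF p lqf_local[OF N cd(2) subset_refl]] this]
  show ?thesis using F by simp
qed

text \<open>A global solution is defined with a different functional for each time; this expresses
  them all by the one on a fixed larger interval.\<close>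

lemma duhamel_local:
  fixes V :: "real set \<Rightarrow> 'a::euclidean_space \<Rightarrow> real"
  assumes p: "1 < p" and V: "V \<in> M_loc p" and \<psi>: "continuous_on {a..b} \<psi>" and cd: "c \<le> d" "{c..d} \<subseteq> {a..b}"
  shows "duhamel p (local_functional p V c d) c d s \<psi> = U s (Gop (local_functional p V a b) (\<lambda>t. indicator {c..d} t *\<^sub>R \<psi> t))"
proof -
  let ?f = "\<lambda>t. indicator {c..d} t *\<^sub>R \<psi> t"
  have q: "1 \<le> conj_exponent p" by (rule conj_exponent_ge_1[OF p])
  have \<psi>': "continuous_on {c..d} \<psi>" by (rule continuous_on_subset[OF \<psi> cd(2)])
  have fb: "?f \<in> bm (MI c d)" by (intro bm_indicator_scaleR continuous_bm[OF \<psi>'] sets_MI) auto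
  have "duhamel p (local_functional p V c d) c d s \<psi> = U s (Gop (local_functional p V c d) ?f)"
    by (rule duhamel_eq[OF p local_functional_props(1)[OF p V cd(1)] subset_refl \<psi>'])
  also have "Gop (local_functional p V c d) ?f = Gop (\<lambda>F. local_functional p V a b (\<lambda>t. indicator {c..d} t *\<^sub>R F t)) ?f"
    by (rule Gop_cong[OF q local_functional_subinterval[OF p V cd] fb])
  also have "\<dots> = Gop (local_functional p V a b) (\<lambda>t. indicator {c..d} t *\<^sub>R ?f t)" by (rule Gop_local)
  also have "(\<lambda>t. indicator {c..d} t *\<^sub>R ?f t) = ?f" by (auto simp: indicator_def)
  finally show ?thesis .
qed

lemma continuous_on_UNIV_intervals:
  "continuous_on UNIV (\<psi> :: real \<Rightarrow> 'b::topological_space) \<longleftrightarrow> (\<forall>n::nat. continuous_on {- real n..real n} \<psi>)"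
proof
  assume c: "\<forall>n::nat. continuous_on {- real n..real n} \<psi>"
  have "isCont \<psi> t" for t
  proof -
    obtain n :: nat where n: "\<bar>t\<bar> < real n" using reals_Archimedean2 by blast
    have "continuous_on {- real n<..<real n} \<psi>" by (rule continuous_on_subset[OF c[rule_format, of n]]) auto
    moreover have "t \<in> {- real n<..<real n}" using n by auto
    ultimately show ?thesis by (simp add: continuous_on_eq_continuous_at)
  qed
  then show "continuous_on UNIV \<psi>" by (simp add: continuous_on_eq_continuous_at)
qed (auto intro: continuous_on_subset)

text \<open>Replaces intervals of integration that vary with the time by an exhaustion with fixed
  functionals, to which the existence and uniqueness results apply.\<close>

lemma global_solution_iff:
  fixes V :: "real set \<Rightarrow> 'a::euclidean_space \<Rightarrow> real"
  assumes p: "1 < p" and V: "V \<in> M_loc p"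
  shows "global_solution p V \<psi>0 \<psi> \<longleftrightarrow> (\<forall>n::nat. solves (local_functional p V (- real n) (real n)) (- real n) (real n) \<psi>0 \<psi>)"
proof -
  let ?W = "\<lambda>n::nat. local_functional p V (- real n) (real n)"
  let ?D = "\<lambda>t. if 0 \<le> t then duhamel p (local_functional p V 0 t) 0 t t \<psi> else - duhamel p (local_functional p V t 0) t 0 t \<psi>"
  have eq: "?D t = U t (Gop (?W n) (\<lambda>s. sgj t s *\<^sub>R \<psi> s))" if t: "t \<in> {- real n..real n}" and c: "continuous_on {- real n..real n} \<psi>" for t n
  proof (cases "0 \<le> t")
    case True
    have "sgj t s = indicator {0..t} s" for s using True by (simp add: sgj_def)
    then show ?thesis using True t duhamel_local[OF p V c, of 0 t t] by simp
  next
    case False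
    let ?f = "\<lambda>s. indicator {t..0} s *\<^sub>R \<psi> s"
    obtain N where N: "lqf (conj_exponent p) (- real n) (real n) N (?W n)"
      using M_space_lqf[OF p local_functional_props(1)[OF p V, of "- real n" "real n"]] by auto
    have fb: "?f \<in> bm (MI (- real n) (real n))" using t by (intro bm_indicator_scaleR continuous_bm[OF c] sets_MI) auto
    have "?D t = - U t (Gop (?W n) ?f)" using False t duhamel_local[OF p V c, of t 0 t] by simp
    also have "\<dots> = U t (Gop (?W n) (\<lambda>s. - ?f s))"
      unfolding Gop_minus[OF N fb] by (simp add: linear_neg[OF bounded_linear.linear[OF bounded_linear_U]])
    also have "(\<lambda>s. - ?f s) = (\<lambda>s. sgj t s *\<^sub>R \<psi> s)" using False by (simp add: sgj_def)
    finally show ?thesis .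
  qed
  have ex: "\<exists>n::nat. t \<in> {- real n..real n}" for t :: real
  proof -
    obtain n :: nat where "\<bar>t\<bar> \<le> real n" using real_arch_simple by blast
    then show ?thesis by (intro exI[of _ n]) auto
  qed
  have "(\<forall>t. \<psi> t = U t \<psi>0 - cscale \<i> (?D t)) \<longleftrightarrow> (\<forall>n::nat. \<forall>t\<in>{- real n..real n}. \<psi> t = Gam (?W n) \<psi>0 \<psi> t)"
    if c: "\<forall>n::nat. continuous_on {- real n..real n} \<psi>"
  proof
    assume h: "\<forall>t. \<psi> t = U t \<psi>0 - cscale \<i> (?D t)"
    show "\<forall>n::nat. \<forall>t\<in>{- real n..real n}. \<psi> t = Gam (?W n) \<psi>0 \<psi> t"
    proof (intro allI ballI)
      fix n :: nat and t assume t: "t \<in> {- real n..real n}"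
      show "\<psi> t = Gam (?W n) \<psi>0 \<psi> t" unfolding Gam_def eq[OF t c[rule_format], symmetric] by (rule h[rule_format])
    qed
  next
    assume h: "\<forall>n::nat. \<forall>t\<in>{- real n..real n}. \<psi> t = Gam (?W n) \<psi>0 \<psi> t"
    show "\<forall>t. \<psi> t = U t \<psi>0 - cscale \<i> (?D t)"
    proof
      fix t obtain n where t: "t \<in> {- real n..real n}" using ex by blast
      show "\<psi> t = U t \<psi>0 - cscale \<i> (?D t)" unfolding eq[OF t c[rule_format]] by (rule h[rule_format, OF t, unfolded Gam_def])
    qed
  qed
  then show ?thesis unfolding global_solution_def solves_def continuous_on_UNIV_intervals by blast
qed

lemma psi_global_solves:
  fixes V :: "real set \<Rightarrow> 'a::euclidean_space \<Rightarrow> real"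
  assumes p: "1 < p" and V: "V \<in> M_loc p"
  shows "solves (local_functional p V (- real n) (real n)) (- real n) (real n) \<psi>0 (psi_global p V \<psi>0)"
proof -
  let ?W = "\<lambda>n::nat. local_functional p V (- real n) (real n)" and ?q = "conj_exponent p"
  have q: "1 \<le> ?q" by (rule conj_exponent_ge_1[OF p])
  have "\<exists>N. lqf ?q (- real n) (real n) N (?W n)" for n :: nat
    using M_space_lqf[OF p local_functional_props(1)[OF p V, of "- real n" "real n"]] by auto
  then obtain N where N: "\<And>n. lqf ?q (- real n) (real n) (N n) (?W n)" by metis
  have "\<exists>\<psi>. solves (?W n) (- real n) (real n) \<psi>0 \<psi>" for n using solves_exists[OF N] by (metis neg_le_0_iff_le of_nat_0_le_iff)
  then obtain \<psi> where \<psi>: "\<And>n. solves (?W n) (- real n) (real n) \<psi>0 (\<psi> n)" by metis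
  have cons: "\<psi> m t = \<psi> n t" if "n \<le> m" "t \<in> {- real n..real n}" for m n t
  proof -
    have sub: "{- real n..real n} \<subseteq> {- real m..real m}" using that by auto
    have "solves (?W n) (- real n) (real n) \<psi>0 (\<psi> m)"
    proof (rule solves_cong[OF q _ solves_subinterval[OF N \<psi> sub]])
      show "?W m (\<lambda>t. indicator {- real n..real n} t *\<^sub>R F t) = ?W n F"
        if "F \<in> Lp_space (ereal ?q) (MI (- real n) (real n))" for F
        using local_functional_subinterval[OF p V _ sub that] by simp
    qed simp_all
    from solves_unique[OF N _ _ this \<psi> that(2)] show ?thesis by simp
  qed
  \<comment> \<open>By \<open>cons\<close> every interval that contains \<open>t\<close> gives the
    same value; rounding up the modulus of \<open>t\<close> selects one.\<close>
  define \<Psi> where "\<Psi> t = \<psi> (nat \<lceil>\<bar>t\<bar>\<rceil>) t" for t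
  have \<Psi>: "\<psi> n t = \<Psi> t" if t: "t \<in> {- real n..real n}" for n t
  proof -
    have "\<bar>t\<bar> \<le> real n" using t by auto
    then have "nat \<lceil>\<bar>t\<bar>\<rceil> \<le> n" by (simp add: nat_le_iff ceiling_le_iff)
    moreover have "\<bar>t\<bar> \<le> real (nat \<lceil>\<bar>t\<bar>\<rceil>)" by (rule real_nat_ceiling_ge)
    then have "t \<in> {- real (nat \<lceil>\<bar>t\<bar>\<rceil>)..real (nat \<lceil>\<bar>t\<bar>\<rceil>)}" unfolding abs_le_iff atLeastAtMost_iff by linarith
    ultimately show ?thesis unfolding \<Psi>_def by (intro cons)
  qed
  have "global_solution p V \<psi>0 \<Psi>"
    unfolding global_solution_iff[OF p V] by (intro allI solves_cong_fun[OF N \<psi> \<Psi>])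
  moreover have "\<phi> = \<Psi>" if "global_solution p V \<psi>0 \<phi>" for \<phi>
  proof
    fix t
    obtain n :: nat where n: "\<bar>t\<bar> \<le> real n" using real_arch_simple by blast
    then have t: "t \<in> {- real n..real n}" by auto
    have "solves (?W n) (- real n) (real n) \<psi>0 \<phi>" using that unfolding global_solution_iff[OF p V] by blast
    from solves_unique[OF N _ _ this \<psi> t] show "\<phi> t = \<Psi> t" using \<Psi>[OF t] by simp
  qed
  ultimately have "psi_global p V \<psi>0 = \<Psi>" unfolding psi_global_def by (rule the_equality)
  then show ?thesis using \<open>global_solution p V \<psi>0 \<Psi>\<close> unfolding global_solution_iff[OF p V] by blast
qed

lemma psi_on_solves:
  fixes V :: "(real \<Rightarrow> 'a::euclidean_space L1_real) \<Rightarrow> real"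
  assumes p: "1 < p" and V: "V \<in> M_space p {0..T}" and T: "0 \<le> T"
  shows "solves V 0 T \<psi>0 (psi_on p T V \<psi>0)"
proof -
  obtain N where N: "lqf (conj_exponent p) 0 T N V" using M_space_lqf[OF p V] by blast
  have iff: "solution_on p T V \<psi>0 \<psi> \<longleftrightarrow> solves V 0 T \<psi>0 \<psi>" for \<psi>
  proof (cases "continuous_on {0..T} \<psi>")
    case True
    have "duhamel p V 0 t t \<psi> = U t (Gop V (\<lambda>s. sgj t s *\<^sub>R \<psi> s))" if "t \<in> {0..T}" for t
      using that duhamel_eq[OF p V _ True, of 0 t t] by (simp add: sgj_def)
    then show ?thesis by (simp add: solution_on_def solves_def Gam_def)
  qed (simp add: solution_on_def solves_def)
  obtain \<psi> where \<psi>: "solves V 0 T \<psi>0 \<psi>" using solves_exists[OF N _ T] by blast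
  have r: "solves V 0 T \<psi>0 (restrict \<psi> {0..T})" by (rule solves_cong_fun[OF N \<psi>]) simp
  have "psi_on p T V \<psi>0 = restrict \<psi> {0..T}"
    unfolding psi_on_def iff
  proof (rule the_equality)
    fix \<phi> assume \<phi>: "\<phi> \<in> extensional {0..T} \<and> solves V 0 T \<psi>0 \<phi>"
    show "\<phi> = restrict \<psi> {0..T}"
      by (rule extensionalityI[of _ "{0..T}"]) (use \<phi> solves_unique[OF N _ T _ r] in auto)
  qed (use r in auto)
  then show ?thesis using r by simp
qed

section \<open>Functionals as measures with values in \<open>L\<^sup>\<infinity>\<close>\<close>

lemma integrable_lp_fun: "integrable lborel (f :: 'a::euclidean_space \<Rightarrow> 'b::{banach,second_countable_topology}) \<Longrightarrow> lp_fun 1 f"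
  by (simp add: lp_fun_def integrable_norm borel_measurable_integrable)

lemma indicator_gauss_integrable:
  "E \<in> sets borel \<Longrightarrow> integrable lborel (\<lambda>x::'a::euclidean_space. indicator E x * gauss 1 x)"
  using integrable_mult_indicator[of E lborel "gauss 1 :: 'a \<Rightarrow> real"] gauss_integrable[of 1] by simp

text \<open>The Gaussian factor puts indicators of sets of infinite measure into L^1, so that every
  Borel set can be tested.\<close>

definition gvec :: "'a::euclidean_space set \<Rightarrow> 'a L1_real" where
  "gvec E = abs_lp (\<lambda>x. indicator E x * gauss 1 x)"

lemma gvec_lp: "E \<in> sets borel \<Longrightarrow> lp_fun 1 (\<lambda>x::'a::euclidean_space. indicator E x * gauss 1 x)"
  by (rule integrable_lp_fun[OF indicator_gauss_integrable])

lemma norm_gvec: "E \<in> sets borel \<Longrightarrow> norm (gvec E) = (\<integral>x. indicator E x * gauss 1 x \<partial>lborel)"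
  unfolding gvec_def using norm_L1_abs[OF gvec_lp[of E]] by (simp add: abs_mult gauss_pos less_imp_le)

lemma integral_gvec:
  assumes E [measurable]: "E \<in> sets borel" and g [measurable]: "g \<in> borel_measurable borel"
  shows "(\<integral>x. g x * rep_lp (gvec E) x \<partial>lborel) = (\<integral>x. indicator E x * (g x * gauss 1 x) \<partial>lborel)"
proof (rule integral_cong_AE)
  show "AE x in lborel. g x * rep_lp (gvec E) x = indicator E x * (g x * gauss 1 x)"
    using rep_abs_L1[OF gvec_lp[OF E]] unfolding gvec_def by eventually_elim simp
qed measurable

text \<open>Tested on the exceptional set where \<open>g\<close> exceeds \<open>C\<close>; since the
  Gaussian is positive, that set is null.\<close>

lemma AE_le_of_integrals:
  fixes g :: "'a::euclidean_space \<Rightarrow> real"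
  assumes [measurable]: "g \<in> borel_measurable borel" and gi: "integrable lborel (\<lambda>x. g x * gauss 1 x)"
    and le: "\<And>E. E \<in> sets borel \<Longrightarrow> (\<integral>x. indicator E x * (g x * gauss 1 x) \<partial>lborel) \<le> C * (\<integral>x. indicator E x * gauss 1 x \<partial>lborel)"
  shows "AE x in lborel. g x \<le> C"
proof -
  define A where "A = {x. C < g x}"
  have A [measurable]: "A \<in> sets borel" unfolding A_def by measurable
  let ?f = "\<lambda>x. indicator A x * (g x * gauss 1 x) - C * (indicator A x * gauss 1 x)"
  have i1: "integrable lborel (\<lambda>x. indicator A x * (g x * gauss 1 x))"
    using integrable_mult_indicator[OF _ gi, of A] A by simp
  have fi: "integrable lborel ?f" by (intro Bochner_Integration.integrable_diff i1 integrable_mult_right indicator_gauss_integrable A)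
  have f0: "0 \<le> ?f x" for x
  proof -
    have "?f x = indicator A x * ((g x - C) * gauss 1 x)" by (simp add: algebra_simps)
    also have "\<dots> \<ge> 0" using gauss_pos[of 1 x] by (auto simp: A_def indicator_def)
    finally show ?thesis .
  qed
  have "integral\<^sup>L lborel ?f \<le> 0"
    using le[OF A] i1 indicator_gauss_integrable[OF A] by simp
  then have "integral\<^sup>L lborel ?f = 0" using f0 by (intro antisym integral_nonneg) auto
  then have "AE x in lborel. ?f x = 0" using integral_nonneg_eq_0_iff_AE[OF fi AE_I2[OF f0]] by simp
  then show ?thesis
  proof eventually_elim
    case (elim x)
    then have "indicator A x * ((g x - C) * gauss 1 x) = 0" by (simp add: algebra_simps)
    then show ?case using gauss_pos[of 1 x] by (auto simp: A_def indicator_def split: if_splits)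
  qed
qed

lemma AE_abs_le_of_integrals:
  fixes g :: "'a::euclidean_space \<Rightarrow> real"
  assumes g: "g \<in> borel_measurable borel" and gi: "integrable lborel (\<lambda>x. g x * gauss 1 x)"
    and le: "\<And>E. E \<in> sets borel \<Longrightarrow> \<bar>\<integral>x. indicator E x * (g x * gauss 1 x) \<partial>lborel\<bar> \<le> C * (\<integral>x. indicator E x * gauss 1 x \<partial>lborel)"
  shows "AE x in lborel. \<bar>g x\<bar> \<le> C"
proof -
  have "AE x in lborel. g x \<le> C" by (rule AE_le_of_integrals[OF g gi]) (use le abs_le_D1 in blast)
  moreover have "AE x in lborel. - g x \<le> C"
  proof (rule AE_le_of_integrals)
    fix E :: "'a set" assume "E \<in> sets borel"
    from le[OF this] show "(\<integral>x. indicator E x * (- g x * gauss 1 x) \<partial>lborel) \<le> C * (\<integral>x. indicator E x * gauss 1 x \<partial>lborel)" by simp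
  qed (use g gi in auto)
  ultimately show ?thesis by eventually_elim simp
qed

lemma bounded_mult_L1:
  fixes g :: "'a::euclidean_space \<Rightarrow> real"
  assumes [measurable]: "g \<in> borel_measurable borel" and b: "\<And>x. \<bar>g x\<bar> \<le> K" and f: "integrable lborel f"
  shows "integrable lborel (\<lambda>x. g x * f x)"
proof (rule Bochner_Integration.integrable_bound)
  show "integrable lborel (\<lambda>x. K * f x)" using f by simp
  have [measurable]: "f \<in> borel_measurable borel" using borel_measurable_integrable[OF f] by simp
  show "(\<lambda>x. g x * f x) \<in> borel_measurable lborel" by measurable
  show "AE x in lborel. norm (g x * f x) \<le> norm (K * f x)"
  proof (rule AE_I2)
    fix x
    have "\<bar>g x\<bar> * \<bar>f x\<bar> \<le> \<bar>K\<bar> * \<bar>f x\<bar>" by (rule mult_right_mono) (use b[of x] in auto)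
    then show "norm (g x * f x) \<le> norm (K * f x)" by (simp add: abs_mult)
  qed
qed

lemma rep_L1_integrable: "integrable lborel (rep_lp (h :: 'a::euclidean_space L1_real))"
  using lp_fun1_integrable[of "rep_lp h"] lp_fun_rep[of h] by simp

text \<open>The vectors \<open>gvec E\<close> alone recover the pointwise bound from the bound of
  the induced functional.\<close>

lemma Linf_AE_bound:
  fixes g :: "'a::euclidean_space \<Rightarrow> real"
  assumes g: "g \<in> borel_measurable borel" and b: "\<And>x. \<bar>g x\<bar> \<le> K"
    and le: "\<And>h :: 'a L1_real. \<bar>\<integral>x. g x * rep_lp h x \<partial>lborel\<bar> \<le> C * norm h"
  shows "AE x in lborel. \<bar>g x\<bar> \<le> C"
proof (rule AE_abs_le_of_integrals[OF g])
  show "integrable lborel (\<lambda>x. g x * gauss 1 x)" by (rule bounded_mult_L1[OF g b gauss_integrable]) simp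
  fix E :: "'a set" assume "E \<in> sets borel"
  then show "\<bar>\<integral>x. indicator E x * (g x * gauss 1 x) \<partial>lborel\<bar> \<le> C * (\<integral>x. indicator E x * gauss 1 x \<partial>lborel)"
    using le[of "gvec E"] by (simp add: integral_gvec[OF _ g] norm_gvec)
qed

text \<open>Duality of L^1 and L^infinity. Lebesgue measure is exchanged for the finite Gaussian
  measure \<open>M\<close>, where Radon-Nikodym applies with exponent 1. The representative obeys
  the bound at every point, which \<open>lqf_Linf_measure\<close> uses.\<close>

lemma L1_dual:
  fixes \<phi> :: "'a::euclidean_space L1_real \<Rightarrow> real"
  assumes \<phi>: "bounded_linear \<phi>" and C: "0 \<le> C" "\<And>h. \<bar>\<phi> h\<bar> \<le> C * norm h"
  obtains g where "g \<in> borel_measurable borel" "\<And>x. \<bar>g x\<bar> \<le> C" "\<And>h. (\<integral>x. g x * rep_lp h x \<partial>lborel) = \<phi> h"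
proof -
  interpret \<phi>: bounded_linear \<phi> by fact
  define M where "M = density lborel (\<lambda>x::'a. ennreal (gauss 1 x))"
  have sM: "sets M = sets borel" and spM: "space M = UNIV" by (simp_all add: M_def)
  have Mi: "integrable M f \<longleftrightarrow> integrable lborel (\<lambda>x. f x * gauss 1 x)" if "f \<in> borel_measurable borel" for f :: "'a \<Rightarrow> real"
    unfolding M_def using that by (subst integrable_density) (auto simp: gauss_pos less_imp_le mult.commute)
  have MI: "(\<integral>x. f x \<partial>M) = (\<integral>x. f x * gauss 1 x \<partial>lborel)" if "f \<in> borel_measurable borel" for f :: "'a \<Rightarrow> real"
    unfolding M_def using that by (subst integral_density) (auto simp: gauss_pos less_imp_le mult.commute)
  have gi: "integrable lborel (gauss 1 :: 'a \<Rightarrow> real)" by (rule gauss_integrable) simp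
  have "(\<integral>\<^sup>+x. ennreal (gauss 1 (x :: 'a)) \<partial>lborel) < \<infinity>"
    using gi unfolding integrable_iff_bounded by (simp add: gauss_pos less_imp_le)
  then have fM: "finite_measure M" by (intro finite_measureI) (simp add: M_def emeasure_density less_top)
  interpret finite_measure M by fact
  have mM: "measure M E = (\<integral>x. indicator E x * gauss 1 x \<partial>lborel)" if "E \<in> sets borel" for E
    using MI[of "indicator E"] that by (simp add: sM)
  have gadd: "gvec (E \<union> F) = gvec E + gvec F" if E: "E \<in> sets borel" and F: "F \<in> sets borel" and "E \<inter> F = {}" for E F :: "'a set"
  proof -
    have "(\<lambda>x. indicator (E \<union> F) x * gauss 1 x) = (\<lambda>x. indicator E x * gauss 1 x + indicator F x * gauss 1 x)"
      using that(3) by (auto simp: indicator_def fun_eq_iff)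
    then show ?thesis unfolding gvec_def using plus_lp_abs[where 'c = 1, of "\<lambda>x. indicator E x * gauss 1 x" "\<lambda>x. indicator F x * gauss 1 x"] gvec_lp[OF E] gvec_lp[OF F] by simp
  qed
  have \<phi>g: "\<bar>\<phi> (gvec E)\<bar> \<le> C * measure M E" if "E \<in> sets borel" for E using C(2)[of "gvec E"] that by (simp add: mM norm_gvec)
  obtain m where m: "m \<in> borel_measurable M" "integrable M m"
    and mE: "\<And>E. E \<in> sets M \<Longrightarrow> \<phi> (gvec E) + C * measure M E = (\<integral>x. indicator E x * m x \<partial>M)"
  \<comment> \<open>Adding \<open>C * measure M E\<close> makes the set function nonnegative;
    \<open>g0\<close> subtracts \<open>C\<close> again.\<close>
  proof (rule Radon_Nikodym_real[OF fM, of "\<lambda>E. \<phi> (gvec E) + C * measure M E" 1 "2 * C"])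
    fix E assume E: "E \<in> sets M"
    show "0 \<le> \<phi> (gvec E) + C * measure M E" "\<phi> (gvec E) + C * measure M E \<le> 2 * C * measure M E powr 1"
      using \<phi>g[of E] E by (auto simp: sM abs_le_iff)
    fix F assume "F \<in> sets M" "E \<inter> F = {}"
    then show "\<phi> (gvec (E \<union> F)) + C * measure M (E \<union> F) = \<phi> (gvec E) + C * measure M E + (\<phi> (gvec F) + C * measure M F)"
      using E by (simp add: gadd sM \<phi>.add finite_measure_Union algebra_simps)
  qed (use that in auto)
  define g0 where "g0 x = m x - C" for x
  have mm [measurable]: "m \<in> borel_measurable borel" using m(1) measurable_cong_sets[OF sM refl] by blast
  have g0m [measurable]: "g0 \<in> borel_measurable borel" unfolding g0_def[abs_def] by measurable
  have g0i: "integrable lborel (\<lambda>x. g0 x * gauss 1 x)"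
  proof -
    have "integrable M g0" unfolding g0_def[abs_def] using m(2) by simp
    then show ?thesis using Mi[OF g0m] by simp
  qed
  have g0E: "(\<integral>x. indicator E x * (g0 x * gauss 1 x) \<partial>lborel) = \<phi> (gvec E)" if E: "E \<in> sets borel" for E
  proof -
    have [measurable]: "E \<in> sets borel" by fact
    have "(\<integral>x. indicator E x * (g0 x * gauss 1 x) \<partial>lborel) = (\<integral>x. indicator E x * g0 x \<partial>M)"
      using MI[of "\<lambda>x. indicator E x * g0 x"] by (simp add: mult.assoc)
    also have "\<dots> = (\<integral>x. indicator E x * m x - C * indicator E x \<partial>M)" by (simp add: g0_def algebra_simps)
    also have "\<dots> = (\<integral>x. indicator E x * m x \<partial>M) - C * measure M E"
      using integrable_mult_indicator[OF _ m(2), of E] E sM by (subst Bochner_Integration.integral_diff) (auto simp: less_top[symmetric] emeasure_finite)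
    also have "\<dots> = \<phi> (gvec E)" using mE[of E] E by (simp add: sM)
    finally show ?thesis .
  qed
  have AEg0: "AE x in lborel. \<bar>g0 x\<bar> \<le> C"
    by (rule AE_abs_le_of_integrals[OF g0m g0i]) (use \<phi>g in \<open>simp add: g0E mM\<close>)
  \<comment> \<open>Clamping changes \<open>g0\<close> only on a null set and makes the bound hold
    everywhere.\<close>
  define g where "g x = max (- C) (min C (g0 x))" for x
  have gm [measurable]: "g \<in> borel_measurable borel" unfolding g_def[abs_def] by measurable
  have gb: "\<bar>g x\<bar> \<le> C" for x using C(1) by (auto simp: g_def)
  have AEg: "AE x in lborel. g x = g0 x" using AEg0 by eventually_elim (auto simp: g_def)
  \<comment> \<open>Multiplication by the Gaussian carries functions integrable for \<open>M\<close>
    to L^1, and every \<open>h\<close> arises in this way, so the induction runs over integrable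
    functions for \<open>M\<close>.\<close>
  have main: "(\<integral>x. g x * (f x * gauss 1 x) \<partial>lborel) = \<phi> (abs_lp (\<lambda>x. f x * gauss 1 x))" if "integrable M f" for f
    using that
  proof (induction f rule: integrable_induct)
    case (base A c)
    then have A [measurable]: "A \<in> sets borel" by (simp add: sM)
    have "(\<integral>x. g x * (indicator A x *\<^sub>R c * gauss 1 x) \<partial>lborel) = (\<integral>x. c * (indicator A x * (g0 x * gauss 1 x)) \<partial>lborel)"
    proof (rule integral_cong_AE)
      show "AE x in lborel. g x * (indicator A x *\<^sub>R c * gauss 1 x) = c * (indicator A x * (g0 x * gauss 1 x))" using AEg by eventually_elim simp
    qed measurable
    also have "\<dots> = c * \<phi> (gvec A)" by (simp only: integral_mult_right_zero g0E[OF A])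
    also have "\<dots> = \<phi> (c *\<^sub>R gvec A)" by (simp add: \<phi>.scaleR)
    also have "c *\<^sub>R gvec A = abs_lp (\<lambda>x. c *\<^sub>R (indicator A x * gauss 1 x))"
      unfolding gvec_def using scaleR_lp_abs[where 'c = 1, of "\<lambda>x::'a. indicator A x * gauss 1 x"] gvec_lp[OF A] by simp
    finally show ?case by (simp add: mult_ac)
  next
    case (add f1 f2)
    have meas: "f1 \<in> borel_measurable borel" "f2 \<in> borel_measurable borel"
      using add.hyps[THEN borel_measurable_integrable] measurable_cong_sets[OF sM refl] by blast+
    have i: "integrable lborel (\<lambda>x. f1 x * gauss 1 x)" "integrable lborel (\<lambda>x. f2 x * gauss 1 x)"
      using add.hyps Mi meas by auto
    have "abs_lp (\<lambda>x. (f1 x + f2 x) * gauss 1 x) = (abs_lp (\<lambda>x. f1 x * gauss 1 x) + abs_lp (\<lambda>x. f2 x * gauss 1 x) :: 'a L1_real)"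
      using plus_lp_abs[where 'c = 1, of "\<lambda>x. f1 x * gauss 1 x" "\<lambda>x. f2 x * gauss 1 x"] i[THEN integrable_lp_fun] by (simp add: distrib_right)
    then show ?case
      using add.IH i[THEN bounded_mult_L1[OF gm gb]] by (simp add: \<phi>.add distrib_right distrib_left)
  next
    case (lim f s)
    have fm: "f \<in> borel_measurable borel" and sm: "\<And>i. s i \<in> borel_measurable borel"
      using lim.hyps(1,4)[THEN borel_measurable_integrable] measurable_cong_sets[OF sM refl] by blast+
    note [measurable] = fm sm
    have fi: "integrable lborel (\<lambda>x. f x * gauss 1 x)" using lim.hyps(4) Mi[OF fm] by simp
    then have w: "integrable lborel (\<lambda>x. 2 * norm (f x * gauss 1 x))" by simp
    have sb: "norm (s i x * gauss 1 x) \<le> 2 * norm (f x * gauss 1 x)" for i x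
      using mult_right_mono[OF lim.hyps(3)[of x i] abs_ge_zero[of "gauss 1 x"]] by (simp add: spM abs_mult)
    have sl: "(\<lambda>i. s i x * gauss 1 x) \<longlonglongrightarrow> f x * gauss 1 x" for x using lim.hyps(2)[of x] by (intro tendsto_mult_right) (simp add: spM)
    have "(\<lambda>i. abs_lp (\<lambda>x. s i x * gauss 1 x) :: 'a L1_real) \<longlonglongrightarrow> abs_lp (\<lambda>x. f x * gauss 1 x)"
      by (rule abs_lp_tendsto_dominated[where w = "\<lambda>x. 2 * norm (f x * gauss 1 x)"]) (use w sb sl in simp_all)
    from \<phi>.tendsto[OF this] have 1: "(\<lambda>i. \<phi> (abs_lp (\<lambda>x. s i x * gauss 1 x))) \<longlonglongrightarrow> \<phi> (abs_lp (\<lambda>x. f x * gauss 1 x))" .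
    have "(\<lambda>i. \<integral>x. g x * (s i x * gauss 1 x) \<partial>lborel) \<longlonglongrightarrow> (\<integral>x. g x * (f x * gauss 1 x) \<partial>lborel)"
    proof (rule integral_dominated_convergence[where w = "\<lambda>x. C * (2 * norm (f x * gauss 1 x))"])
      show "integrable lborel (\<lambda>x. C * (2 * norm (f x * gauss 1 x)))" using w by (rule integrable_mult_right)
      show "AE x in lborel. (\<lambda>i. g x * (s i x * gauss 1 x)) \<longlonglongrightarrow> g x * (f x * gauss 1 x)" by (intro AE_I2 tendsto_mult_left sl)
      show "AE x in lborel. norm (g x * (s i x * gauss 1 x)) \<le> C * (2 * norm (f x * gauss 1 x))" for i
      proof (rule AE_I2)
        fix x
        show "norm (g x * (s i x * gauss 1 x)) \<le> C * (2 * norm (f x * gauss 1 x))"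
          using mult_mono[OF gb[of x] sb[of i x] C(1) norm_ge_zero] unfolding norm_mult[of "g x"] by simp
      qed
    qed measurable
    with 1 show ?case unfolding lim.IH by (intro LIMSEQ_unique)
  qed
  show thesis
  proof (rule that[OF gm gb])
    fix h :: "'a L1_real"
    let ?f = "\<lambda>x. rep_lp h x / gauss 1 x"
    have eq: "?f x * gauss 1 x = rep_lp h x" for x using gauss_pos[of 1 x] by simp
    have "?f \<in> borel_measurable borel" by measurable
    then have "integrable M ?f" using Mi[of ?f] rep_L1_integrable[of h] by (simp only: eq)
    from main[OF this] show "(\<integral>x. g x * rep_lp h x \<partial>lborel) = \<phi> h" by (simp only: eq abs_rep_lp)
  qed
qed


text \<open>The values come from \<open>L1_dual\<close> with bound \<open>c E\<close>, a power of
  the measure of \<open>E\<close> inside the interval. What remains of a disjoint union after n sets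
  is the value on the tail \<open>T n\<close>, whose bound tends to 0 because 1/q is positive: this
  is the uniform countable additivity asked for in \<open>Linf_measure\<close>.\<close>

lemma lqf_Linf_measure:
  fixes W :: "(real \<Rightarrow> 'a::euclidean_space L1_real) \<Rightarrow> real"
  assumes W: "lqf q a b N W"
  obtains V :: "real set \<Rightarrow> 'a \<Rightarrow> real" where "Linf_measure V"
    "\<And>E h. E \<in> sets borel \<Longrightarrow> (\<integral>x. V E x * rep_lp h x \<partial>lborel) = W (\<lambda>t. indicator (E \<inter> {a..b}) t *\<^sub>R h)"
proof -
  note q = lqf_q[OF W] and N = lqf_N[OF W]
  interpret M: finite_measure "MI a b" by (rule finite_measure_MI)
  let ?I = "{a..b}"
  define w where "w E h = W (\<lambda>t. indicator (E \<inter> ?I) t *\<^sub>R h)" for E :: "real set" and h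
  define c where "c E = N * measure (MI a b) (E \<inter> ?I) powr (1 / q)" for E
  have X: "(\<lambda>t. indicator (E \<inter> ?I) t *\<^sub>R h) \<in> Lp_space (ereal q) (MI a b)" if "E \<in> sets borel" for E and h :: "'a L1_real"
    using that by (intro indicator_const_Lp_space q) auto
  have c0: "0 \<le> c E" for E using N by (simp add: c_def)
  have wc: "\<bar>w E h\<bar> \<le> c E * norm h" if E: "E \<in> sets borel" for E h
  proof -
    have "Lp_norm q (MI a b) (\<lambda>t. indicator (E \<inter> ?I) t *\<^sub>R h) \<le> norm h * measure (MI a b) (E \<inter> ?I) powr (1 / q)"
    proof (rule Lp_norm_le[OF finite_measure_MI q norm_ge_zero])
      show "E \<inter> ?I \<in> sets (MI a b)" using E by (intro sets_MI) auto
      show "(\<lambda>t. indicator (E \<inter> ?I) t *\<^sub>R h) \<in> borel_measurable (MI a b)" using X[OF E, of h] by (simp add: Lp_space_real)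
    qed simp
    from mult_left_mono[OF this N] lqf_le[OF W X[OF E, of h]] show ?thesis by (simp add: w_def c_def mult_ac)
  qed
  have lin: "bounded_linear (w E)" if E: "E \<in> sets borel" for E
  proof (rule bounded_linear_intro[where K = "c E"])
    show "w E (h + k) = w E h + w E k" for h k
      using lqf_add[OF W X[OF E, of h] X[OF E, of k]] by (simp add: w_def scaleR_add_right)
    show "w E (r *\<^sub>R h) = r *\<^sub>R w E h" for r h
      using lqf_scaleR[OF W X[OF E, of h], of r] by (simp add: w_def mult.commute)
    show "norm (w E h) \<le> norm h * c E" for h using wc[OF E, of h] by (simp add: mult.commute)
  qed
  have "\<exists>g. g \<in> borel_measurable borel \<and> (\<forall>x. \<bar>g x\<bar> \<le> c E) \<and> (\<forall>h. (\<integral>x. g x * rep_lp h x \<partial>lborel) = w E h)" if E: "E \<in> sets borel" for E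
    by (rule L1_dual[OF lin[OF E] c0 wc[OF E]]) blast
  then obtain V where V: "\<And>E. E \<in> sets borel \<Longrightarrow> V E \<in> borel_measurable borel" "\<And>E x. E \<in> sets borel \<Longrightarrow> \<bar>V E x\<bar> \<le> c E"
    "\<And>E h. E \<in> sets borel \<Longrightarrow> (\<integral>x. V E x * rep_lp h x \<partial>lborel) = w E h" by metis
  have wadd: "w (E \<union> F) h = w E h + w F h" if E: "E \<in> sets borel" and F: "F \<in> sets borel" and "E \<inter> F = {}" for E F h
  proof -
    have "indicator ((E \<union> F) \<inter> ?I) t *\<^sub>R h = indicator (E \<inter> ?I) t *\<^sub>R h + indicator (F \<inter> ?I) t *\<^sub>R h" for t
      using that(3) by (auto simp: indicator_def)
    then show ?thesis unfolding w_def using lqf_add[OF W X[OF E, of h] X[OF F, of h]] by (simp only:)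
  qed
  have "Linf_measure V"
    unfolding Linf_measure_def
  proof (intro conjI allI impI; elim conjE)
    fix E :: "real set" assume "E \<in> sets borel"
    then show "V E \<in> Lp_space \<infinity> lborel" using V(1,2) by (auto simp: Lp_space_def intro!: exI[of _ "c E"])
  next
    fix E :: "nat \<Rightarrow> real set" and e :: real
    assume E: "range E \<subseteq> sets borel" "disjoint_family E" "bounded (\<Union>i. E i)" and e: "e > 0"
    have Ei: "E i \<in> sets borel" for i using E(1) by auto
    define T where "T n = (\<Union>i\<in>{n..}. E i)" for n
    have T: "T n \<in> sets borel" for n unfolding T_def by (intro sets.countable_UN') (use Ei in auto)
    have T0: "T 0 = (\<Union>i. E i)" by (auto simp: T_def)
    have TS: "T n = E n \<union> T (Suc n)" "E n \<inter> T (Suc n) = {}" for n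
    proof -
      have "{n..} = insert n {Suc n..}" by auto
      then show "T n = E n \<union> T (Suc n)" by (simp add: T_def)
      show "E n \<inter> T (Suc n) = {}"
      proof -
        have "E n \<inter> E i = {}" if "Suc n \<le> i" for i using disjoint_family_onD[OF E(2), of n i] that by simp
        then show ?thesis by (auto simp: T_def)
      qed
    qed
    have tele: "w (T 0) h = (\<Sum>i<n. w (E i) h) + w (T n) h" for n h
    proof (induction n)
      case (Suc n)
      then show ?case using wadd[OF Ei T TS(2), of n h] TS(1)[of n] by simp
    qed simp
    \<comment> \<open>Representatives are chosen set by set, so additivity can hold only almost
      everywhere; it is read off from the integrals against all \<open>h\<close>.\<close>
    have AE: "AE x in lborel. \<bar>V (\<Union>i. E i) x - (\<Sum>i<n. V (E i) x)\<bar> \<le> c (T n)" for n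
    proof (rule Linf_AE_bound)
      show "(\<lambda>x. V (\<Union>i. E i) x - (\<Sum>i<n. V (E i) x)) \<in> borel_measurable borel"
        using V(1)[OF T[of 0]] V(1)[OF Ei] by (simp add: T0)
      show "\<bar>V (\<Union>i. E i) x - (\<Sum>i<n. V (E i) x)\<bar> \<le> c (T 0) + (\<Sum>i<n. c (E i))" for x
      proof -
        have "\<bar>\<Sum>i<n. V (E i) x\<bar> \<le> (\<Sum>i<n. c (E i))" by (intro order_trans[OF sum_abs] sum_mono V(2) Ei)
        then show ?thesis using V(2)[OF T[of 0], of x] unfolding T0 by linarith
      qed
      fix h :: "'a L1_real"
      have i: "integrable lborel (\<lambda>x. V F x * rep_lp h x)" if "F \<in> sets borel" for F
        by (rule bounded_mult_L1[OF V(1)[OF that] V(2)[OF that] rep_L1_integrable])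
      have "(\<integral>x. (V (\<Union>i. E i) x - (\<Sum>i<n. V (E i) x)) * rep_lp h x \<partial>lborel)
          = (\<integral>x. V (T 0) x * rep_lp h x - (\<Sum>i<n. V (E i) x * rep_lp h x) \<partial>lborel)"
        by (simp add: T0 left_diff_distrib sum_distrib_right)
      also have "\<dots> = w (T 0) h - (\<Sum>i<n. w (E i) h)"
        using i[OF T] i[OF Ei] by (simp add: V(3)[OF T] V(3)[OF Ei])
      also have "\<dots> = w (T n) h" using tele[of h n] by simp
      finally show "\<bar>\<integral>x. (V (\<Union>i. E i) x - (\<Sum>i<n. V (E i) x)) * rep_lp h x \<partial>lborel\<bar> \<le> c (T n) * norm h"
        using wc[OF T[of n], of h] by simp
    qed
    have Tlim: "(\<lambda>n. measure (MI a b) (T n \<inter> ?I)) \<longlonglongrightarrow> measure (MI a b) (\<Inter>n. T n \<inter> ?I)"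
    proof (rule M.finite_Lim_measure_decseq)
      show "range (\<lambda>n. T n \<inter> ?I) \<subseteq> sets (MI a b)" using T by (auto intro!: sets_MI)
      show "decseq (\<lambda>n. T n \<inter> ?I)" by (rule decseq_SucI) (subst (2) TS(1), blast)
    qed
    have "(\<Inter>n. T n \<inter> ?I) = {}"
    proof (rule ccontr)
      assume "(\<Inter>n. T n \<inter> ?I) \<noteq> {}"
      then obtain t where t: "\<And>n. t \<in> T n" by auto
      then obtain i where "t \<in> E i" unfolding T_def by blast
      moreover obtain j where "j \<ge> Suc i" "t \<in> E j" using t[of "Suc i"] unfolding T_def by auto
      ultimately show False using disjoint_family_onD[OF E(2), of i j] by auto
    qed
    then have "(\<lambda>n. measure (MI a b) (T n \<inter> ?I) powr (1 / q)) \<longlonglongrightarrow> 0"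
      using Tlim q by (intro tendsto_zero_powrI[where b = "1 / q"]) auto
    from tendsto_mult_left[OF this, of N] have "(\<lambda>n. c (T n)) \<longlonglongrightarrow> 0" by (simp add: c_def)
    then have "\<forall>\<^sub>F n in sequentially. c (T n) < e" using e by (rule order_tendstoD)
    then show "\<forall>\<^sub>F n in sequentially. AE x in lborel. \<bar>V (\<Union>i. E i) x - (\<Sum>i<n. V (E i) x)\<bar> \<le> e"
    proof eventually_elim
      case (elim n)
      show ?case using AE[of n] by eventually_elim (use elim in linarith)
    qed
  qed
  then show thesis by (rule that) (simp add: V(3) w_def)
qed

text \<open>Extension by zero outside \<open>{a..b}\<close> produces a measure on the whole line, so
  every functional of the compact family is realised by a potential in \<open>M_loc\<close>.\<close>

lemma lqf_M_loc:
  fixes W :: "(real \<Rightarrow> 'a::euclidean_space L1_real) \<Rightarrow> real"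
  assumes p: "1 < p" and W: "lqf (conj_exponent p) a b N W"
  obtains V where "V \<in> M_loc p" "\<And>F. F \<in> Lp_space (ereal (conj_exponent p)) (MI a b) \<Longrightarrow> local_functional p V a b F = W F"
proof -
  let ?q = "conj_exponent p"
  note q = lqf_q[OF W]
  obtain V where V: "Linf_measure V" and VW: "\<And>E h. E \<in> sets borel \<Longrightarrow> (\<integral>x. V E x * rep_lp h x \<partial>lborel) = W (\<lambda>t. indicator (E \<inter> {a..b}) t *\<^sub>R h)"
    using lqf_Linf_measure[OF W] by blast
  have "\<exists>W'\<in>M_space p {c..d}. represents {c..d} W' V" for c d
  proof
    \<comment> \<open>The overlap of the two intervals; when they are disjoint it is empty and
      \<open>?W'\<close> is the zero functional.\<close>
    let ?m = "max a c" and ?n = "min b d"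
    let ?W' = "\<lambda>F. W (\<lambda>t. indicator {?m..?n} t *\<^sub>R F t)"
    have "lqf ?q c d N ?W'" by (rule lqf_local[OF W]) auto
    then show "restrict ?W' (Lp_space (ereal ?q) (MI c d)) \<in> M_space p {c..d}" by (rule restrict_M_space[OF p])
    show "represents {c..d} (restrict ?W' (Lp_space (ereal ?q) (MI c d))) V"
    proof (rule restrict_represents[OF q])
      fix E and h :: "'a L1_real" assume E: "E \<in> sets borel" "E \<subseteq> {c..d}"
      have "indicator (E \<inter> {a..b}) t *\<^sub>R h = indicator {?m..?n} t *\<^sub>R (indicator E t *\<^sub>R h)" for t
        using E(2) by (auto simp: indicator_def)
      then show "(\<integral>x. V E x * rep_lp h x \<partial>lborel) = ?W' (\<lambda>t. indicator E t *\<^sub>R h)" by (simp only: VW[OF E(1)])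
    qed
  qed
  then have Vloc: "V \<in> M_loc p" using V by (simp add: M_loc_def)
  have "represents {a..b} (restrict W (Lp_space (ereal ?q) (MI a b))) V"
    by (rule restrict_represents[OF q]) (simp add: VW Int_absorb2)
  from local_functional_eqI[OF p restrict_M_space[OF p W] this] show thesis
    by (intro that[OF Vloc]) simp
qed

section \<open>Compactness\<close>

text \<open>Phrased with functionals on a bounded interval instead of measures, since those with a
  fixed bound are stable under weak-* limits; \<open>attainable_eq\<close> returns to
  measures.\<close>

definition states :: "'a::euclidean_space L2 \<Rightarrow> nat \<Rightarrow> nat \<Rightarrow> nat \<Rightarrow> 'a L2 set" where
  "states \<psi>0 k n N = {\<psi> t | \<psi> t W. t \<in> {- real n..real n} \<and> lqf (real k + 2) (- real n) (real n) (real N) W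
    \<and> solves W (- real n) (real n) \<psi>0 \<psi>}"

definition densities :: "'a::euclidean_space L2 \<Rightarrow> real \<Rightarrow> nat \<Rightarrow> nat \<Rightarrow> (real \<Rightarrow> 'a L1) set" where
  "densities \<psi>0 T k N = {(\<lambda>t\<in>{0..T}. abs_square (\<psi> t)) | \<psi> W. lqf (real k + 2) 0 T (real N) W \<and> solves W 0 T \<psi>0 \<psi>}"

text \<open>The subsequence is selected for the functionals alone; the solutions follow by
  continuous dependence.\<close>

lemma solutions_compact:
  fixes W :: "nat \<Rightarrow> (real \<Rightarrow> 'a::euclidean_space L1_real) \<Rightarrow> real"
  assumes W: "\<And>n. lqf q a b N (W n)" and q: "2 \<le> q" and ab: "a \<le> 0" "0 \<le> b" and \<psi>: "\<And>n. solves (W n) a b \<psi>0 (\<psi> n)"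
  obtains r W' \<psi>' where "strict_mono r" "lqf q a b N W'" "solves W' a b \<psi>0 \<psi>'"
    "\<And>e. e > 0 \<Longrightarrow> \<forall>\<^sub>F n in sequentially. \<forall>t\<in>{a..b}. norm (\<psi> (r n) t - \<psi>' t) \<le> e"
proof -
  obtain r W' where r: "strict_mono r" and W': "lqf q a b N W'"
    and lim: "\<And>f. f \<in> Lp_space (ereal q) (MI a b) \<Longrightarrow> (\<lambda>n. W (r n) f) \<longlonglongrightarrow> W' f"
    by (rule weak_star_compact[where W = W, OF W]) blast
  obtain \<psi>' where \<psi>': "solves W' a b \<psi>0 \<psi>'" by (rule solves_exists[OF W' ab])
  show thesis by (rule that[OF r W' \<psi>']) (rule solves_tendsto[OF W W' q ab lim \<psi> \<psi>'])
qed

text \<open>Potential and time vary together along a sequence, so uniform convergence of the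
  solutions is combined with convergence of the times and continuity of the limit solution.\<close>

lemma compact_states: "compact (states \<psi>0 k n N)"
  unfolding compact_def
proof (intro allI impI)
  let ?a = "- real n" and ?b = "real n"
  fix f :: "nat \<Rightarrow> 'a L2" assume "\<forall>i. f i \<in> states \<psi>0 k n N"
  then have "\<forall>i. \<exists>\<psi> t W. f i = \<psi> t \<and> t \<in> {?a..?b} \<and> lqf (real k + 2) ?a ?b (real N) W \<and> solves W ?a ?b \<psi>0 \<psi>"
    by (auto simp: states_def)
  then obtain \<psi> t W where f: "\<And>i. f i = \<psi> i (t i)" and t: "\<And>i. t i \<in> {?a..?b}"
    and W: "\<And>i. lqf (real k + 2) ?a ?b (real N) (W i)" and \<psi>: "\<And>i. solves (W i) ?a ?b \<psi>0 (\<psi> i)" by metis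
  obtain r W' \<psi>' where r: "strict_mono r" and W': "lqf (real k + 2) ?a ?b (real N) W'" and \<psi>': "solves W' ?a ?b \<psi>0 \<psi>'"
    and unif: "\<And>e. e > 0 \<Longrightarrow> \<forall>\<^sub>F i in sequentially. \<forall>t\<in>{?a..?b}. norm (\<psi> (r i) t - \<psi>' t) \<le> e"
    by (rule solutions_compact[where W = W and \<psi> = \<psi>, OF W _ _ _ \<psi>]) auto
  have sc: "seq_compact {?a..?b}" by (rule compact_imp_seq_compact) simp
  from sc[unfolded seq_compact_def, rule_format, of "\<lambda>i. t (r i)", OF t]
  obtain t' r' where t': "t' \<in> {?a..?b}" and r': "strict_mono r'" and lim: "((\<lambda>i. t (r i)) \<circ> r') \<longlonglongrightarrow> t'" by blast
  have cont: "continuous_on {?a..?b} \<psi>'" using \<psi>' by (simp add: solves_def)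
  have 1: "(\<lambda>i. \<psi>' (t (r (r' i)))) \<longlonglongrightarrow> \<psi>' t'"
    using continuous_on_tendsto_compose[OF cont lim t'] t by (simp add: comp_def)
  have "(\<lambda>i. \<psi> (r (r' i)) (t (r (r' i))) - \<psi>' (t (r (r' i)))) \<longlonglongrightarrow> 0"
  proof (rule tendstoI)
    fix e :: real assume "e > 0"
    then have "\<forall>\<^sub>F i in sequentially. \<forall>t\<in>{?a..?b}. norm (\<psi> (r i) t - \<psi>' t) \<le> e / 2" by (intro unif) simp
    from eventually_subseq[OF r' this]
    show "\<forall>\<^sub>F i in sequentially. dist (\<psi> (r (r' i)) (t (r (r' i))) - \<psi>' (t (r (r' i)))) 0 < e"
    proof eventually_elim
      case (elim i)
      then have "norm (\<psi> (r (r' i)) (t (r (r' i))) - \<psi>' (t (r (r' i)))) \<le> e / 2" using t by blast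
      then show ?case using \<open>e > 0\<close> by simp
    qed
  qed
  from tendsto_add[OF this 1] have "(f \<circ> (r \<circ> r')) \<longlonglongrightarrow> \<psi>' t'" by (simp add: comp_def f)
  moreover have "\<psi>' t' \<in> states \<psi>0 k n N" using t' W' \<psi>' by (auto simp: states_def)
  ultimately show "\<exists>l\<in>states \<psi>0 k n N. \<exists>r. strict_mono r \<and> (f \<circ> r) \<longlonglongrightarrow> l"
    using strict_mono_o[OF r r'] by blast
qed

text \<open>The difference of squared moduli factors pointwise, and Cauchy-Schwarz applies to each
  product; the density thus depends on the state in a locally Lipschitz way.\<close>

lemma norm_abs_square_diff: "norm (abs_square u - abs_square v) \<le> norm (u - v) * (norm u + norm v)"
proof -
  have au: "lp_fun 1 (\<lambda>x. complex_of_real ((cmod (rep_lp u x))\<^sup>2))" for u :: "'a L2" by (rule lp_fun_abs_square[OF lp2_L2])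
  have "abs_square u - abs_square v = abs_lp (\<lambda>x. complex_of_real ((cmod (rep_lp u x))\<^sup>2) - complex_of_real ((cmod (rep_lp v x))\<^sup>2))"
    unfolding abs_square_def by (rule minus_lp_abs) (use au in simp_all)
  then have "norm (abs_square u - abs_square v) = (\<integral>x. cmod (complex_of_real ((cmod (rep_lp u x))\<^sup>2) - complex_of_real ((cmod (rep_lp v x))\<^sup>2)) \<partial>lborel)"
    using norm_L1_abs[OF lp_fun_diff[OF au au]] by simp
  also have "\<dots> \<le> (\<integral>x. cmod (rep_lp (u - v) x) * cmod (rep_lp u x) + cmod (rep_lp (u - v) x) * cmod (rep_lp v x) \<partial>lborel)"
  proof (rule integral_mono_AE)
    show "integrable lborel (\<lambda>x. cmod (complex_of_real ((cmod (rep_lp u x))\<^sup>2) - complex_of_real ((cmod (rep_lp v x))\<^sup>2)))"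
      by (intro integrable_norm lp_fun1_integrable lp_fun_diff au)
    show "integrable lborel (\<lambda>x. cmod (rep_lp (u - v) x) * cmod (rep_lp u x) + cmod (rep_lp (u - v) x) * cmod (rep_lp v x))"
      by (intro Bochner_Integration.integrable_add lp_fun_inner(2) lp2_L2)
    show "AE x in lborel. cmod (complex_of_real ((cmod (rep_lp u x))\<^sup>2) - complex_of_real ((cmod (rep_lp v x))\<^sup>2))
        \<le> cmod (rep_lp (u - v) x) * cmod (rep_lp u x) + cmod (rep_lp (u - v) x) * cmod (rep_lp v x)"
      using rep_minus_AE[of u v]
    proof eventually_elim
      case (elim x)
      let ?a = "cmod (rep_lp u x)" and ?b = "cmod (rep_lp v x)"
      have "cmod (complex_of_real (?a\<^sup>2) - complex_of_real (?b\<^sup>2)) = \<bar>?a\<^sup>2 - ?b\<^sup>2\<bar>"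
        unfolding of_real_diff[symmetric] norm_of_real ..
      also have "?a\<^sup>2 - ?b\<^sup>2 = (?a - ?b) * (?a + ?b)" by (simp add: power2_eq_square algebra_simps)
      also have "\<bar>(?a - ?b) * (?a + ?b)\<bar> = \<bar>?a - ?b\<bar> * (?a + ?b)" by (simp add: abs_mult)
      also have "\<dots> \<le> cmod (rep_lp u x - rep_lp v x) * (?a + ?b)" by (intro mult_right_mono norm_triangle_ineq3) auto
      finally show ?case unfolding elim by (simp add: distrib_left)
    qed
  qed
  also have "\<dots> = (\<integral>x. cmod (rep_lp (u - v) x) * cmod (rep_lp u x) \<partial>lborel) + (\<integral>x. cmod (rep_lp (u - v) x) * cmod (rep_lp v x) \<partial>lborel)"
    by (intro Bochner_Integration.integral_add lp_fun_inner(2) lp2_L2)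
  also have "\<dots> \<le> norm (u - v) * norm u + norm (u - v) * norm v" by (intro add_mono norm_inner_L2)
  finally show ?thesis by (simp add: distrib_left)
qed

lemma continuous_abs_square: "continuous_on S (abs_square :: 'a::euclidean_space L2 \<Rightarrow> _)"
proof (rule continuous_at_imp_continuous_on, intro ballI)
  fix v :: "'a L2"
  have "((\<lambda>u. norm (u - v) * (norm u + norm v)) \<longlongrightarrow> norm (v - v) * (norm v + norm v)) (at v)" by (intro tendsto_intros)
  then have lim: "((\<lambda>u. norm (u - v) * (norm u + norm v)) \<longlongrightarrow> 0) (at v)" by simp
  have "((\<lambda>u. abs_square u - abs_square v) \<longlongrightarrow> 0) (at v)"
    by (rule Lim_null_comparison[OF always_eventually lim]) (intro allI norm_abs_square_diff)
  then show "isCont abs_square v" unfolding isCont_def by (rule LIM_zero_cancel)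
qed

lemma compact_densities:
  assumes T: "0 \<le> T"
  shows "compactin (C0_space T) (densities \<psi>0 T k N)"
proof -
  let ?m = "cfunspace (top_of_set {0..T}) (euclidean_metric :: 'a L1 metric)"
  interpret C: Metric_space "mspace ?m" "mdist ?m" by (rule Metric_space_mspace_mdist)
  have ms: "mspace ?m = {f. f \<in> extensional {0..T} \<and> continuous_on {0..T} f}"
    using compactin_mspace_cfunspace[of "top_of_set {0..T}" euclidean_metric] by (simp add: compactin_subtopology)
  have rho: "(\<lambda>t\<in>{0..T}. abs_square (\<psi> t)) \<in> mspace ?m" if "continuous_on {0..T} \<psi>" for \<psi> :: "real \<Rightarrow> 'a L2"
  proof -
    have "continuous_on {0..T} (\<lambda>t. abs_square (\<psi> t))"
      by (rule continuous_on_compose2[OF continuous_abs_square that subset_UNIV])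
    then have "continuous_on {0..T} (\<lambda>t\<in>{0..T}. abs_square (\<psi> t))" by (rule continuous_on_eq) simp
    then show ?thesis unfolding ms mem_Collect_eq by (intro conjI restrict_extensional)
  qed
  have "compactin C.mtopology (densities \<psi>0 T k N)"
    unfolding C.compactin_sequentially
  proof (intro conjI allI impI)
    show "densities \<psi>0 T k N \<subseteq> mspace ?m" unfolding densities_def using rho by (auto simp: solves_def)
    fix f :: "nat \<Rightarrow> real \<Rightarrow> 'a L1" assume "range f \<subseteq> densities \<psi>0 T k N"
    then have "\<forall>i. \<exists>\<psi> W. f i = (\<lambda>t\<in>{0..T}. abs_square (\<psi> t)) \<and> lqf (real k + 2) 0 T (real N) W \<and> solves W 0 T \<psi>0 \<psi>"
      by (auto simp: densities_def subset_iff)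
    then obtain \<psi> W where f: "\<And>i. f i = (\<lambda>t\<in>{0..T}. abs_square (\<psi> i t))"
      and W: "\<And>i. lqf (real k + 2) 0 T (real N) (W i)" and \<psi>: "\<And>i. solves (W i) 0 T \<psi>0 (\<psi> i)" by metis
    obtain r W' \<psi>' where r: "strict_mono r" and W': "lqf (real k + 2) 0 T (real N) W'" and \<psi>': "solves W' 0 T \<psi>0 \<psi>'"
      and unif: "\<And>e. e > 0 \<Longrightarrow> \<forall>\<^sub>F i in sequentially. \<forall>t\<in>{0..T}. norm (\<psi> (r i) t - \<psi>' t) \<le> e"
      by (rule solutions_compact[where W = W and \<psi> = \<psi>, OF W _ _ T \<psi>]) auto
    define l where "l = (\<lambda>t\<in>{0..T}. abs_square (\<psi>' t))"
    have cont: "continuous_on {0..T} \<psi>'" "\<And>i. continuous_on {0..T} (\<psi> i)" using \<psi>' \<psi> by (auto simp: solves_def)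
    obtain B where B: "0 \<le> B" "\<And>t. t \<in> {0..T} \<Longrightarrow> norm (\<psi>' t) \<le> B" by (rule continuous_norm_bound[OF cont(1)]) blast
    have "limitin C.mtopology (f \<circ> r) l sequentially"
      unfolding C.limitin_metric
    proof (intro conjI allI impI)
      show "l \<in> mspace ?m" unfolding l_def by (rule rho[OF cont(1)])
      fix e :: real assume e: "e > 0"
      \<comment> \<open>The bound 1 keeps nearby solutions below \<open>B + 1\<close>, so that the
        second factor in \<open>norm_abs_square_diff\<close> is at most
        \<open>2 * B + 1\<close>.\<close>
      define d where "d = min 1 (e / (2 * (2 * B + 1)))"
      have d: "0 < d" "d \<le> 1" "d * (2 * B + 1) \<le> e / 2"
      proof -
        have p: "0 < 2 * B + 1" using B(1) by simp
        then show "0 < d" "d \<le> 1" using e by (auto simp: d_def)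
        have "d * (2 * B + 1) \<le> e / (2 * (2 * B + 1)) * (2 * B + 1)" using p by (intro mult_right_mono) (auto simp: d_def)
        also have "\<dots> = e / 2"
        proof -
          have "e / (2 * x) * x = e / 2" if "0 < x" for x :: real using that by simp
          from this[OF p] show ?thesis .
        qed
        finally show "d * (2 * B + 1) \<le> e / 2" .
      qed
      from unif[OF d(1)] show "\<forall>\<^sub>F i in sequentially. (f \<circ> r) i \<in> mspace ?m \<and> mdist ?m ((f \<circ> r) i) l < e"
      proof eventually_elim
        case (elim i)
        have "mdist ?m (f (r i)) l \<le> e / 2"
        proof (rule mdist_cfunspace_le)
          fix t assume "t \<in> topspace (top_of_set {0..T})"
          then have t: "t \<in> {0..T}" by simp
          have \<delta>: "norm (\<psi> (r i) t - \<psi>' t) \<le> d" using elim t by blast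
          have "norm (\<psi> (r i) t) + norm (\<psi>' t) \<le> 2 * B + 1"
            using norm_triangle_sub[of "\<psi> (r i) t" "\<psi>' t"] B(2)[OF t] \<delta> d(2) by linarith
          then have "norm (\<psi> (r i) t - \<psi>' t) * (norm (\<psi> (r i) t) + norm (\<psi>' t)) \<le> d * (2 * B + 1)"
            using \<delta> d(1) by (intro mult_mono) auto
          then have "norm (abs_square (\<psi> (r i) t) - abs_square (\<psi>' t)) \<le> e / 2"
            using norm_abs_square_diff[of "\<psi> (r i) t" "\<psi>' t"] d(3) by linarith
          then show "mdist euclidean_metric (f (r i) t) (l t) \<le> e / 2" using t by (simp add: f l_def dist_norm)
        qed (use e in simp)
        then show ?case using rho[OF cont(2)] e by (simp add: f)
      qed
    qed
    moreover have "l \<in> densities \<psi>0 T k N" unfolding l_def densities_def using W' \<psi>' by blast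
    ultimately show "\<exists>l r. l \<in> densities \<psi>0 T k N \<and> strict_mono r \<and> limitin C.mtopology (f \<circ> r) l sequentially"
      using r by blast
  qed
  then show ?thesis by (simp add: C0_space_def mtopology_of_def)
qed

text \<open>Lowers p until the conjugate exponent is an integer of at least 2 and rounds the norm
  bound up, so that countably many parameter values suffice.\<close>

lemma lqf_exponent_nat:
  assumes p: "1 < p" and W: "lqf (conj_exponent p) a b N W"
  obtains k M :: nat where "lqf (real k + 2) a b (real M) W"
proof -
  obtain k :: nat where k: "conj_exponent p \<le> real k" using real_arch_simple by blast
  have "lqf (real k + 2) a b (N * (measure (MI a b) {a..b} + 1) powr (1 / conj_exponent p)) W"
    by (rule lqf_exponent_mono[OF W]) (use k in simp)
  moreover obtain M :: nat where "N * (measure (MI a b) {a..b} + 1) powr (1 / conj_exponent p) \<le> real M"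
    using real_arch_simple by blast
  ultimately show thesis by (blast intro: that lqf_mono)
qed

lemma exponent_gt_1: "1 < ereal ((real k + 2) / (real k + 1))"
  by (simp add: one_ereal_def)

text \<open>Uniqueness links the two descriptions: on its interval, a solution for a functional
  agrees with the global solution for the measure extended by zero.\<close>

lemma attainable_eq:
  fixes \<psi>0 :: "'a::euclidean_space L2"
  shows "attainable \<psi>0 = (\<Union>k n N. states \<psi>0 k n N)"
proof (intro equalityI subsetI)
  fix u assume "u \<in> attainable \<psi>0"
  then obtain p V t where p: "1 < p" and V: "V \<in> M_loc p" and u: "u = psi_global p V \<psi>0 t" by (auto simp: attainable_def)
  obtain n :: nat where "\<bar>t\<bar> \<le> real n" using real_arch_simple by blast
  then have t: "t \<in> {- real n..real n}" by auto
  let ?W = "local_functional p V (- real n) (real n)"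
  have "?W \<in> M_space p {- real n..real n}" by (rule local_functional_props(1)[OF p V]) simp
  from M_space_lqf[OF p this] obtain N' where "lqf (conj_exponent p) (- real n) (real n) N' ?W" by blast
  then obtain k N where "lqf (real k + 2) (- real n) (real n) (real N) ?W" by (rule lqf_exponent_nat[OF p])
  then have "u \<in> states \<psi>0 k n N" unfolding states_def u using t psi_global_solves[OF p V] by blast
  then show "u \<in> (\<Union>k n N. states \<psi>0 k n N)" by blast
next
  fix u assume "u \<in> (\<Union>k n N. states \<psi>0 k n N)"
  then obtain k n N \<psi> t W where u: "u = \<psi> t" and t: "t \<in> {- real n..real n}"
    and W: "lqf (real k + 2) (- real n) (real n) (real N) W" and \<psi>: "solves W (- real n) (real n) \<psi>0 \<psi>"
    unfolding states_def by blast
  let ?p = "ereal ((real k + 2) / (real k + 1))"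
  note p = exponent_gt_1[of k] and q = conj_exponent_real[of k]
  obtain V where V: "V \<in> M_loc ?p"
    and eq: "\<And>F. F \<in> Lp_space (ereal (conj_exponent ?p)) (MI (- real n) (real n)) \<Longrightarrow> local_functional ?p V (- real n) (real n) F = W F"
    by (rule lqf_M_loc[OF p]) (use W q in auto)
  have "solves W (- real n) (real n) \<psi>0 (psi_global ?p V \<psi>0)"
    by (rule solves_cong[where q = "real k + 2", OF _ _ psi_global_solves[OF p V]]) (use eq q in auto)
  from solves_unique[OF W _ _ \<psi> this t] have "u = psi_global ?p V \<psi>0 t" by (simp add: u)
  then show "u \<in> attainable \<psi>0" unfolding attainable_def using p V by blast
qed

text \<open>A functional becomes an element of \<open>M_space\<close> once its values outside L^q
  are reset by \<open>restrict\<close>, and this leaves its solutions unchanged.\<close>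

lemma representable_densities_eq:
  fixes \<psi>0 :: "'a::euclidean_space L2"
  assumes T: "0 \<le> T"
  shows "representable_densities \<psi>0 T = (\<Union>k N. densities \<psi>0 T k N)"
proof (intro equalityI subsetI)
  fix \<rho> assume "\<rho> \<in> representable_densities \<psi>0 T"
  then obtain p V where p: "1 < p" and V: "V \<in> M_space p {0..T}" and \<rho>: "\<rho> = (\<lambda>t\<in>{0..T}. abs_square (psi_on p T V \<psi>0 t))"
    by (auto simp: representable_densities_def)
  from M_space_lqf[OF p V] obtain N' where "lqf (conj_exponent p) 0 T N' V" by blast
  then obtain k N where "lqf (real k + 2) 0 T (real N) V" by (rule lqf_exponent_nat[OF p])
  then have "\<rho> \<in> densities \<psi>0 T k N" unfolding densities_def \<rho> using psi_on_solves[OF p V T] by blast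
  then show "\<rho> \<in> (\<Union>k N. densities \<psi>0 T k N)" by blast
next
  fix \<rho> assume "\<rho> \<in> (\<Union>k N. densities \<psi>0 T k N)"
  then obtain k N \<psi> W where \<rho>: "\<rho> = (\<lambda>t\<in>{0..T}. abs_square (\<psi> t))" and W: "lqf (real k + 2) 0 T (real N) W" and \<psi>: "solves W 0 T \<psi>0 \<psi>"
    unfolding densities_def by blast
  let ?p = "ereal ((real k + 2) / (real k + 1))"
  note p = exponent_gt_1[of k] and q = conj_exponent_real[of k]
  define V where "V = restrict W (Lp_space (ereal (conj_exponent ?p)) (MI 0 T))"
  have V: "V \<in> M_space ?p {0..T}" unfolding V_def by (rule restrict_M_space[OF p]) (use W q in simp)
  have "solves W 0 T \<psi>0 (psi_on ?p T V \<psi>0)"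
    by (rule solves_cong[where q = "real k + 2", OF _ _ psi_on_solves[OF p V T]]) (use q in \<open>auto simp: V_def\<close>)
  then have "\<psi> t = psi_on ?p T V \<psi>0 t" if "t \<in> {0..T}" for t using solves_unique[OF W _ T \<psi> _ that] by simp
  then have "\<rho> = (\<lambda>t\<in>{0..T}. abs_square (psi_on ?p T V \<psi>0 t))" unfolding \<rho> by (intro restrict_ext) simp
  then show "\<rho> \<in> representable_densities \<psi>0 T" unfolding representable_densities_def using p V by blast
qed

theorem theorem2:
  fixes \<psi>0 :: "(real ^ 'n) L2" and T :: real
  assumes "T > 0"
  shows "(\<exists>K :: nat \<Rightarrow> (real ^ 'n) L2 set.
           (\<forall>n. compact (K n)) \<and> attainable \<psi>0 = (\<Union>n. K n)) \<and>
         (\<exists>K :: nat \<Rightarrow> (real \<Rightarrow> (real ^ 'n) L1) set.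
           (\<forall>n. compactin (C0_space T) (K n)) \<and> representable_densities \<psi>0 T = (\<Union>n. K n))"
proof (intro conjI exI allI)
  \<comment> \<open>Triples of naturals form a countable type, so \<open>from_nat\<close> enumerates
    all pieces.\<close>
  let ?K = "\<lambda>(k, n, N). states \<psi>0 k n N"
  show "compact (?K (from_nat i))" for i by (simp add: compact_states split: prod.split)
  have "attainable \<psi>0 = \<Union>(?K ` range from_nat)" by (auto simp: attainable_eq surj_from_nat)
  then show "attainable \<psi>0 = (\<Union>i. ?K (from_nat i))" by (simp only: image_image)
  let ?D = "\<lambda>(k, N). densities \<psi>0 T k N"
  show "compactin (C0_space T) (?D (from_nat i))" for i using assms by (simp add: compact_densities split: prod.split)
  have "representable_densities \<psi>0 T = \<Union>(?D ` range from_nat)" using assms by (auto simp: representable_densities_eq surj_from_nat)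
  then show "representable_densities \<psi>0 T = (\<Union>i. ?D (from_nat i))" by (simp only: image_image)
qed

end
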